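(* (1) Let $\Omega$ be an open domain of $\mathbb{R}^n$ and $\tau\in C^2(\Omega)$. Let $\iota:\mathbb{R}^n\to\mathbb{R}^{n+1}$, $\iota(x)=(x,0)$, be the canonical totally geodesic embedding and $\nu_0=(0,\dots,0,1)\in\mathbb{R}^{n+1}$ its constant unit normal vector. Then the immersion $\bar\varphi:\Omega\to\mathbb{R}^{n+2}_1$ defined by $$\bar\varphi(x)=(\iota(x),0)+\tau(x)(\nu_0,1)$$ is flat and its second fundamental form is given by $$\bar h(X,Y)=\mathrm{Hess}_\tau(X,Y)\,(\nu_0,1).$$ In particular $\bar\varphi$ has null second fundamental form and is therefore marginally trapped. Conversely, any $n$-dimensional spacelike submanifold of $\mathbb{R}^{n+2}_1$ with null second fundamental form is locally congruent to the image of such an immersion. (2) Let $\varphi$ be an immersion of class $C^4$ of an $n$-dimensional manifold $\mathcal{M}$ into $\mathbb{R}^{n+1}$ and denote by $\nu$ the ($\mathbb{S}^n$-valued) Gauss map of $\varphi$. Assume that $\varphi$ admits $p$ distinct, non-vanishing principal curvatures $\kappa_1,\dots,\kappa_p$, $p\ge 2$, with multiplicities $m_i$, and denote by $\tau_i$ the $p-1$ roots of the polynomial $$P(\tau):=\sum_{i=1}^p m_i\prod_{j\ne i}^{p}(\kappa_j^{-1}-\tau).$$ Then the $p-1$ immersions $\bar\varphi_i:\mathcal{M}\to\mathbb{R}^{n+2}_1$ defined by $$\bar\varphi_i=(\varphi+\tau_i\nu,\tau_i)$$ are marginally trapped. Conversely, any $n$-dimensional spacelike marginally trapped submanifold of $\mathbb{R}^{n+2}_1$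 whose second fundamental form is not null is locally congruent to the image of such an immersion. (3) In particular, in the case $n=2$, let $\varphi$ be a non-flat $C^4$-immersion of a surface $\mathcal{M}$ into $\mathbb{R}^3$ which is free of umbilic points. Denote by $\nu$ its Gauss map, and by $H$ and $K$ the mean curvature with respect to $\nu$ and the Gaussian curvature of $\varphi$. Then the immersion $\bar\varphi:\mathcal{M}\to\mathbb{R}^4_1$ defined by $$\bar\varphi:=\left(\varphi+\frac{H}{K}\nu,\ \frac{H}{K}\right)$$ is marginally trapped. As a corollary, an immersed surface which is contained in a time slice $\{x_4=\mathrm{const.}\}$ is marginally trapped if and only if $\frac{H}{K}$ is constant, i.e. $\varphi$ is linear Weingarten.
   Context: $\langle\cdot,\cdot\rangle_0=dx_1^2+\dots+dx_{n+1}^2$ is the Euclidean metric of $\mathbb{R}^{n+1}$, and $\mathbb{R}^{n+2}_1=\mathbb{R}^{n+1}\times\mathbb{R}$ is Minkowski space with the flat Lorentzian metric $\langle\cdot,\cdot\rangle_1=\langle\cdot,\cdot\rangle_0-dx_{n+2}^2$. An immersion is spacelike if its induced metric is positive definite. For an immersion with non-degenerate induced metric, the second fundamental form is $h(X,Y)=(D_XY)^\perp$, where $D$ is the Levi-Civita connection of the ambient metric and $(\cdot)^\perp$ the projection onto the normal space; the mean curvature vector $\vec H$ is its trace with respect to the induced metric (possibly normalized by $1/n$). A submanifold with non-degenerate induced metric of a pseudo-Riemannian manifold with metric $g$ is marginally trapped if $g(\vec H,\vec H)$ vanishes identically (so $\vec H=0$ is allowed). A second fundamental form is null if it takes values in a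 null line of the normal bundle, i.e. locally $h(X,Y)$ is collinear to a fixed nowhere vanishing null normal field. "Flat" means that the induced metric is flat. $\mathrm{Hess}_\tau$ is the Hessian of $\tau$. Principal curvatures of $\varphi$ are the eigenvalues of the shape operator $A=-d\nu$. The roots $\tau_i$ are functions on $\mathcal{M}$, since the coefficients of $P$ depend on the point. In (3), with $\kappa_1,\kappa_2$ the principal curvatures, $H=\frac{1}{2}(\kappa_1+\kappa_2)$, $K=\kappa_1\kappa_2$, and non-flat is understood as $K$ not vanishing, so that $H/K$ is defined. Two submanifolds are congruent if one is mapped onto the other by an isometry of the ambient space.
   Formalization: Converse of (2): C^5, second fundamental form null at no point; holds on an open dense set (H in one null line, constant number of eigenvalues) if n=2 or the null shape operator is invertible; else a curvature may vanish. Corollary of (3): the slice surface (φ+cν,c) is trapped iff H/K=c. *)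

theory Defs
  imports "HOL-Analysis.Analysis" "HOL-Computational_Algebra.Polynomial"
begin

section \<open>Calculus on open subsets of Euclidean space\<close>

primrec Ck_on :: "nat \<Rightarrow> ('a::euclidean_space \<Rightarrow> 'b::real_normed_vector) \<Rightarrow> 'a set \<Rightarrow> bool" where
  "Ck_on 0 f S \<longleftrightarrow> continuous_on S f"
| "Ck_on (Suc k) f S \<longleftrightarrow>
     (\<forall>x\<in>S. f differentiable (at x)) \<and> (\<forall>v. Ck_on k (\<lambda>x. frechet_derivative f (at x) v) S)"

abbreviation D1 :: "('a::euclidean_space \<Rightarrow> 'b::real_normed_vector) \<Rightarrow> 'a \<Rightarrow> 'a \<Rightarrow> 'b" where
  "D1 f x u \<equiv> frechet_derivative f (at x) u"

text \<open>The second derivative. For real-valued functions on an open subset of Euclidean space this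
  is the Hessian; for maps into a flat ambient space it is \<open>D\<^sub>X Y\<close> with \<open>X\<close>, \<open>Y\<close> the images of the
  constant fields \<open>u\<close>, \<open>v\<close>.\<close>

definition D2 :: "('a::euclidean_space \<Rightarrow> 'b::real_normed_vector) \<Rightarrow> 'a \<Rightarrow> 'a \<Rightarrow> 'a \<Rightarrow> 'b" where
  "D2 f x u v = D1 (\<lambda>y. D1 f y v) x u"

definition Hess :: "('a::euclidean_space \<Rightarrow> real) \<Rightarrow> 'a \<Rightarrow> 'a \<Rightarrow> 'a \<Rightarrow> real" where
  "Hess \<tau> = D2 \<tau>"

definition immersion :: "nat \<Rightarrow> 'a::euclidean_space set \<Rightarrow> ('a \<Rightarrow> 'b::real_normed_vector) \<Rightarrow> bool" where
  "immersion k \<Omega> f \<longleftrightarrow> Ck_on k f \<Omega> \<and> (\<forall>x\<in>\<Omega>. inj (frechet_derivative f (at x)))"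


section \<open>Manifolds\<close>

text \<open>An \<open>n\<close>-dimensional manifold of class \<open>C\<^sup>k\<close>, with \<open>n = CARD('n)\<close>: a topological space with
  an atlas, given as a set of pairs of a chart domain and a chart.\<close>

type_synonym ('m, 'n) atlas = "('m set \<times> ('m \<Rightarrow> real ^ 'n)) set"

definition manifold :: "nat \<Rightarrow> 'm topology \<Rightarrow> ('m, 'n::finite) atlas \<Rightarrow> bool" where
  "manifold k X A \<longleftrightarrow>
     Hausdorff_space X \<and> second_countable X \<and> (\<Union>(U, c)\<in>A. U) = topspace X \<and>
     (\<forall>(U, c)\<in>A. openin X U \<and> open (c ` U) \<and>
        homeomorphic_map (subtopology X U) (top_of_set (c ` U)) c) \<and>
     (\<forall>(U, c)\<in>A. \<forall>(V, d)\<in>A. Ck_on k (d \<circ> inv_into U c) (c ` (U \<inter> V)))"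

text \<open>\<open>P \<Omega> r\<close> holds for every local parametrization \<open>r : \<Omega> \<rightarrow> M\<close> inverse to a chart. All properties
  used below are invariant under changes of coordinates.\<close>

definition on_charts ::
  "('m, 'n::finite) atlas \<Rightarrow> ((real ^ 'n) set \<Rightarrow> (real ^ 'n \<Rightarrow> 'm) \<Rightarrow> bool) \<Rightarrow> bool" where
  "on_charts A P \<longleftrightarrow> (\<forall>(U, c)\<in>A. P (c ` U) (inv_into U c))"

definition in_chart_at ::
  "('m, 'n::finite) atlas \<Rightarrow> 'm \<Rightarrow>
    ((real ^ 'n) set \<Rightarrow> (real ^ 'n \<Rightarrow> 'm) \<Rightarrow> real ^ 'n \<Rightarrow> bool) \<Rightarrow> bool" where
  "in_chart_at A x P \<longleftrightarrow> (\<exists>(U, c)\<in>A. x \<in> U \<and> P (c ` U) (inv_into U c) (c x))"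


section \<open>Minkowski space and its submanifolds of codimension two\<close>

text \<open>With \<open>n = CARD('n)\<close>, \<open>real ^ 'n \<times> real\<close> is \<open>\<real>\<^sup>n\<^sup>+\<^sup>1\<close> with its Euclidean inner product.\<close>

type_synonym 'n mink = "((real ^ 'n) \<times> real) \<times> real"

definition mink :: "'n::finite mink \<Rightarrow> 'n mink \<Rightarrow> real" where
  "mink a b = fst a \<bullet> fst b - snd a * snd b"

definition mink_isometry :: "('n::finite mink \<Rightarrow> 'n mink) \<Rightarrow> bool" where
  "mink_isometry F \<longleftrightarrow> bij F \<and> (\<forall>k. Ck_on k F UNIV \<and> Ck_on k (inv F) UNIV) \<and>
     (\<forall>x a b. mink (D1 F x a) (D1 F x b) = mink a b)"

definition time_slice :: "real \<Rightarrow> 'n::finite mink set" where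
  "time_slice c = {w. snd w = c}"

definition ind_metric :: "(real ^ 'n \<Rightarrow> 'n::finite mink) \<Rightarrow> real ^ 'n \<Rightarrow> real ^ 'n \<Rightarrow> real ^ 'n \<Rightarrow> real"
  where "ind_metric \<psi> x u v = mink (D1 \<psi> x u) (D1 \<psi> x v)"

definition nondegenerate_metric :: "(real ^ 'n) set \<Rightarrow> (real ^ 'n \<Rightarrow> 'n::finite mink) \<Rightarrow> bool" where
  "nondegenerate_metric \<Omega> \<psi> \<longleftrightarrow> (\<forall>x\<in>\<Omega>. \<forall>u. u \<noteq> 0 \<longrightarrow> (\<exists>v. ind_metric \<psi> x u v \<noteq> 0))"

definition spacelike :: "(real ^ 'n) set \<Rightarrow> (real ^ 'n \<Rightarrow> 'n::finite mink) \<Rightarrow> bool" where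
  "spacelike \<Omega> \<psi> \<longleftrightarrow> (\<forall>x\<in>\<Omega>. \<forall>u. u \<noteq> 0 \<longrightarrow> ind_metric \<psi> x u u > 0)"

text \<open>Flatness as local isometry with Euclidean space, which is meaningful for the merely \<open>C\<^sup>1\<close>
  metric induced by a \<open>C\<^sup>2\<close> immersion.\<close>

definition flat :: "(real ^ 'n) set \<Rightarrow> (real ^ 'n \<Rightarrow> 'n::finite mink) \<Rightarrow> bool" where
  "flat \<Omega> \<psi> \<longleftrightarrow> (\<forall>x\<in>\<Omega>. \<exists>V (f :: real ^ 'n \<Rightarrow> real ^ 'n). open V \<and> x \<in> V \<and> V \<subseteq> \<Omega> \<and>
     inj_on f V \<and> Ck_on 1 f V \<and>
     (\<forall>y\<in>V. \<forall>u v. ind_metric \<psi> y u v = D1 f y u \<bullet> D1 f y v))"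

definition normal_space :: "(real ^ 'n \<Rightarrow> 'n::finite mink) \<Rightarrow> real ^ 'n \<Rightarrow> 'n mink set" where
  "normal_space \<psi> x = {w. \<forall>u. mink w (D1 \<psi> x u) = 0}"

definition normal_proj :: "(real ^ 'n \<Rightarrow> 'n::finite mink) \<Rightarrow> real ^ 'n \<Rightarrow> 'n mink \<Rightarrow> 'n mink" where
  "normal_proj \<psi> x w = (THE z. z \<in> normal_space \<psi> x \<and> w - z \<in> range (frechet_derivative \<psi> (at x)))"

definition sff :: "(real ^ 'n \<Rightarrow> 'n::finite mink) \<Rightarrow> real ^ 'n \<Rightarrow> real ^ 'n \<Rightarrow> real ^ 'n \<Rightarrow> 'n mink" where
  "sff \<psi> x u v = normal_proj \<psi> x (D2 \<psi> x u v)"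

definition gram :: "(real ^ 'n \<Rightarrow> 'n::finite mink) \<Rightarrow> real ^ 'n \<Rightarrow> real ^ 'n ^ 'n" where
  "gram \<psi> x = (\<chi> i j. ind_metric \<psi> x (axis i 1) (axis j 1))"

definition mean_curv_vec :: "(real ^ 'n \<Rightarrow> 'n::finite mink) \<Rightarrow> real ^ 'n \<Rightarrow> 'n mink" where
  "mean_curv_vec \<psi> x = (1 / real CARD('n)) *\<^sub>R
     (\<Sum>i\<in>UNIV. \<Sum>j\<in>UNIV. (matrix_inv (gram \<psi> x) $ i $ j) *\<^sub>R sff \<psi> x (axis i 1) (axis j 1))"

definition marginally_trapped :: "(real ^ 'n) set \<Rightarrow> (real ^ 'n \<Rightarrow> 'n::finite mink) \<Rightarrow> bool" where
  "marginally_trapped \<Omega> \<psi> \<longleftrightarrow> nondegenerate_metric \<Omega> \<psi> \<and>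
     (\<forall>x\<in>\<Omega>. mink (mean_curv_vec \<psi> x) (mean_curv_vec \<psi> x) = 0)"

definition null_normal :: "(real ^ 'n \<Rightarrow> 'n::finite mink) \<Rightarrow> real ^ 'n \<Rightarrow> 'n mink \<Rightarrow> bool" where
  "null_normal \<psi> x w \<longleftrightarrow> w \<in> normal_space \<psi> x \<and> w \<noteq> 0 \<and> mink w w = 0"

definition null_normal_field ::
  "(real ^ 'n) set \<Rightarrow> (real ^ 'n \<Rightarrow> 'n::finite mink) \<Rightarrow> (real ^ 'n \<Rightarrow> 'n mink) \<Rightarrow> bool" where
  "null_normal_field V \<psi> \<xi> \<longleftrightarrow> continuous_on V \<xi> \<and> (\<forall>x\<in>V. null_normal \<psi> x (\<xi> x))"

definition null_sff :: "(real ^ 'n) set \<Rightarrow> (real ^ 'n \<Rightarrow> 'n::finite mink) \<Rightarrow> bool" where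
  "null_sff \<Omega> \<psi> \<longleftrightarrow> (\<forall>x\<in>\<Omega>. \<exists>V \<xi>. open V \<and> x \<in> V \<and> V \<subseteq> \<Omega> \<and> null_normal_field V \<psi> \<xi> \<and>
     (\<forall>y\<in>V. \<forall>u v. \<exists>b. sff \<psi> y u v = b *\<^sub>R \<xi> y))"

definition null_sff_at :: "(real ^ 'n \<Rightarrow> 'n::finite mink) \<Rightarrow> real ^ 'n \<Rightarrow> bool" where
  "null_sff_at \<psi> x \<longleftrightarrow> (\<exists>w. null_normal \<psi> x w \<and> (\<forall>u v. \<exists>b. sff \<psi> x u v = b *\<^sub>R w))"

text \<open>A submanifold is \<open>\<psi> : M \<rightarrow> \<real>\<^sup>n\<^sup>+\<^sup>2\<close> up to the choice of the immersion; the set \<open>\<S>\<close> lists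
  the model images.\<close>

definition locally_congruent_at ::
  "'m topology \<Rightarrow> ('m \<Rightarrow> 'n::finite mink) \<Rightarrow> 'm \<Rightarrow> 'n mink set set \<Rightarrow> bool" where
  "locally_congruent_at X \<psi> x \<S> \<longleftrightarrow>
     (\<exists>V F. openin X V \<and> x \<in> V \<and> mink_isometry F \<and> F ` \<psi> ` V \<in> \<S>)"


section \<open>Flat immersions with null second fundamental form\<close>

definition canon_emb :: "real ^ 'n::finite \<Rightarrow> (real ^ 'n) \<times> real" where
  "canon_emb x = (x, 0)"

definition normal0 :: "(real ^ 'n::finite) \<times> real" where
  "normal0 = (0, 1)"

definition null_graph :: "(real ^ 'n \<Rightarrow> real) \<Rightarrow> real ^ 'n::finite \<Rightarrow> 'n mink" where
  "null_graph \<tau> x = (canon_emb x, 0) + \<tau> x *\<^sub>R (normal0, 1)"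

definition null_graph_images :: "'n::finite mink set set" where
  "null_graph_images = {null_graph \<tau> ` \<Omega> | \<tau> \<Omega>. open \<Omega> \<and> connected \<Omega> \<and> Ck_on 2 \<tau> \<Omega>}"


section \<open>Hypersurfaces of Euclidean space\<close>

definition gauss_map ::
  "(real ^ 'n) set \<Rightarrow> (real ^ 'n \<Rightarrow> (real ^ 'n::finite) \<times> real) \<Rightarrow> (real ^ 'n \<Rightarrow> (real ^ 'n) \<times> real) \<Rightarrow> bool"
  where
  "gauss_map \<Omega> \<phi> \<nu> \<longleftrightarrow> continuous_on \<Omega> \<nu> \<and> (\<forall>x\<in>\<Omega>. norm (\<nu> x) = 1 \<and> (\<forall>u. \<nu> x \<bullet> D1 \<phi> x u = 0))"

text \<open>\<open>A = -d\<nu>\<close>, as an endomorphism of the tangent space of the parameter domain.\<close>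

definition shape_op ::
  "(real ^ 'n \<Rightarrow> (real ^ 'n::finite) \<times> real) \<Rightarrow> (real ^ 'n \<Rightarrow> (real ^ 'n) \<times> real) \<Rightarrow>
    real ^ 'n \<Rightarrow> real ^ 'n \<Rightarrow> real ^ 'n" where
  "shape_op \<phi> \<nu> x u = (THE w. D1 \<phi> x w = - D1 \<nu> x u)"

definition principal_curvatures ::
  "(real ^ 'n \<Rightarrow> (real ^ 'n::finite) \<times> real) \<Rightarrow> (real ^ 'n \<Rightarrow> (real ^ 'n) \<times> real) \<Rightarrow>
    real ^ 'n \<Rightarrow> real set" where
  "principal_curvatures \<phi> \<nu> x = {k. \<exists>u. u \<noteq> 0 \<and> shape_op \<phi> \<nu> x u = k *\<^sub>R u}"

definition umbilic ::
  "(real ^ 'n \<Rightarrow> (real ^ 'n::finite) \<times> real) \<Rightarrow> (real ^ 'n \<Rightarrow> (real ^ 'n) \<times> real) \<Rightarrow>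
    real ^ 'n \<Rightarrow> bool" where
  "umbilic \<phi> \<nu> x \<longleftrightarrow> (\<exists>k. \<forall>u. shape_op \<phi> \<nu> x u = k *\<^sub>R u)"

text \<open>The distinct principal curvatures at each point are \<open>\<kappa> 1, \<dots>, \<kappa> p\<close>, with constant
  multiplicities \<open>m 1, \<dots>, m p\<close>.\<close>

definition has_principal_curvatures ::
  "(real ^ 'n) set \<Rightarrow> (real ^ 'n \<Rightarrow> (real ^ 'n::finite) \<times> real) \<Rightarrow> (real ^ 'n \<Rightarrow> (real ^ 'n) \<times> real) \<Rightarrow>
    nat \<Rightarrow> (nat \<Rightarrow> real ^ 'n \<Rightarrow> real) \<Rightarrow> (nat \<Rightarrow> nat) \<Rightarrow> bool" where
  "has_principal_curvatures \<Omega> \<phi> \<nu> p \<kappa> m \<longleftrightarrow> (\<forall>x\<in>\<Omega>.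
     inj_on (\<lambda>i. \<kappa> i x) {1..p} \<and>
     principal_curvatures \<phi> \<nu> x = (\<lambda>i. \<kappa> i x) ` {1..p} \<and>
     (\<forall>i\<in>{1..p}. dim {u. shape_op \<phi> \<nu> x u = \<kappa> i x *\<^sub>R u} = m i))"

definition curv_poly :: "nat \<Rightarrow> (nat \<Rightarrow> real) \<Rightarrow> (nat \<Rightarrow> nat) \<Rightarrow> real poly" where
  "curv_poly p k m =
     (\<Sum>i\<in>{1..p}. smult (real (m i)) (\<Prod>j\<in>{1..p} - {i}. [:inverse (k j), -1:]))"

text \<open>Listing the roots in increasing order makes each \<open>\<tau> i\<close> a well-defined function of the
  point (an arbitrary pointwise labelling need not even be continuous).\<close>

definition root_functions ::
  "'m set \<Rightarrow> nat \<Rightarrow> (nat \<Rightarrow> 'm \<Rightarrow> real) \<Rightarrow> (nat \<Rightarrow> nat) \<Rightarrow> (nat \<Rightarrow> 'm \<Rightarrow> real) \<Rightarrow> bool" where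
  "root_functions M p \<kappa> m \<tau> \<longleftrightarrow> (\<forall>x\<in>M.
     strict_mono_on {1..p - 1} (\<lambda>i. \<tau> i x) \<and>
     (\<lambda>i. \<tau> i x) ` {1..p - 1} = {t. poly (curv_poly p (\<lambda>i. \<kappa> i x) m) t = 0})"

definition lift :: "('m \<Rightarrow> (real ^ 'n::finite) \<times> real) \<Rightarrow> ('m \<Rightarrow> (real ^ 'n) \<times> real) \<Rightarrow>
    ('m \<Rightarrow> real) \<Rightarrow> 'm \<Rightarrow> 'n mink" where
  "lift \<phi> \<nu> \<tau> x = (\<phi> x + \<tau> x *\<^sub>R \<nu> x, \<tau> x)"

definition trapped_images :: "'n::finite mink set set" where
  "trapped_images = {lift \<phi> \<nu> (\<tau> i) ` \<Omega> | \<phi> \<nu> \<tau> i \<Omega>. open \<Omega> \<and> immersion 4 \<Omega> \<phi> \<and> gauss_map \<Omega> \<phi> \<nu> \<and>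
     (\<exists>p \<kappa> m. 2 \<le> p \<and> has_principal_curvatures \<Omega> \<phi> \<nu> p \<kappa> m \<and> (\<forall>j\<in>{1..p}. \<forall>x\<in>\<Omega>. \<kappa> j x \<noteq> 0) \<and>
        root_functions \<Omega> p \<kappa> m \<tau> \<and> i \<in> {1..p - 1})}"

text \<open>The same family with the principal curvatures allowed to vanish (at each point at most one of
  them does, as they are distinct). The condition on \<open>\<tau>\<close> is
  that of being a root of \<open>P\<close> with denominators cleared: for non-vanishing \<open>\<kappa>\<^sub>j\<close> the sum equals
  \<open>(\<Prod>\<^sub>j \<kappa>\<^sub>j) P(\<tau>)\<close>.\<close>

definition trapped_images_ext :: "'n::finite mink set set" where
  "trapped_images_ext = {lift \<phi> \<nu> \<tau> ` \<Omega> | \<phi> \<nu> \<tau> \<Omega>. open \<Omega> \<and> immersion 4 \<Omega> \<phi> \<and> gauss_map \<Omega> \<phi> \<nu> \<and>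
     Ck_on 2 \<tau> \<Omega> \<and>
     (\<exists>p \<kappa> m. 2 \<le> p \<and> has_principal_curvatures \<Omega> \<phi> \<nu> p \<kappa> m \<and>
        (\<forall>x\<in>\<Omega>. (\<Sum>i\<in>{1..p}. real (m i) * \<kappa> i x * (\<Prod>j\<in>{1..p} - {i}. 1 - \<kappa> j x * \<tau> x)) = 0))}"


section \<open>Regular points of a marginally trapped submanifold\<close>

text \<open>Let \<open>\<psi>\<close> be spacelike and marginally trapped. Near most points the mean curvature vector stays
  in one of the two null lines of the normal bundle, spanned by \<open>\<xi>\<close>, but it may change from one to
  the other where it vanishes. Likewise the number of eigenvalues of the shape operator of \<open>\<xi>\<close> is
  only locally constant on an open dense set. Non-degeneracy of the shape operator of \<open>\<xi>\<close> is
  automatic for surfaces whose second fundamental form is not null, since it is then trace-free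
  and non-zero.\<close>

definition null_eigenvalues ::
  "(real ^ 'n \<Rightarrow> 'n::finite mink) \<Rightarrow> (real ^ 'n \<Rightarrow> 'n mink) \<Rightarrow> real ^ 'n \<Rightarrow> real set" where
  "null_eigenvalues \<psi> \<xi> x =
     {l. \<exists>u. u \<noteq> 0 \<and> (\<forall>v. mink (sff \<psi> x u v) (\<xi> x) = l * ind_metric \<psi> x u v)}"

definition trapping_field ::
  "(real ^ 'n) set \<Rightarrow> (real ^ 'n \<Rightarrow> 'n::finite mink) \<Rightarrow> (real ^ 'n \<Rightarrow> 'n mink) \<Rightarrow> bool" where
  "trapping_field V \<psi> \<xi> \<longleftrightarrow> null_normal_field V \<psi> \<xi> \<and>
     (\<forall>x\<in>V. \<exists>b. mean_curv_vec \<psi> x = b *\<^sub>R \<xi> x) \<and>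
     (\<exists>q. \<forall>x\<in>V. card (null_eigenvalues \<psi> \<xi> x) = q)"

definition regular_at :: "(real ^ 'n) set \<Rightarrow> (real ^ 'n \<Rightarrow> 'n::finite mink) \<Rightarrow> real ^ 'n \<Rightarrow> bool" where
  "regular_at \<Omega> \<psi> x \<longleftrightarrow> (\<exists>V \<xi>. open V \<and> x \<in> V \<and> V \<subseteq> \<Omega> \<and> trapping_field V \<psi> \<xi>)"

definition nondegenerate_at :: "(real ^ 'n) set \<Rightarrow> (real ^ 'n \<Rightarrow> 'n::finite mink) \<Rightarrow> real ^ 'n \<Rightarrow> bool" where
  "nondegenerate_at \<Omega> \<psi> x \<longleftrightarrow> (\<exists>V \<xi>. open V \<and> x \<in> V \<and> V \<subseteq> \<Omega> \<and> trapping_field V \<psi> \<xi> \<and>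
     0 \<notin> null_eigenvalues \<psi> \<xi> x)"

end

theory Submission
  imports Defs
begin

text \<open>Everything rests on one remark about codimension two. The normal plane of a spacelike
  submanifold of Minkowski space is Lorentzian, so the orthogonal complement in it of a null
  normal \<open>n\<close> is the line of \<open>n\<close> (\<open>normal_orthogonal_null\<close>). A null normal can be scaled to
  \<open>(N, 1)\<close> with \<open>N\<close> a unit vector of Euclidean space. The mean curvature vector is a multiple
  of \<open>(N, 1)\<close> exactly if it is orthogonal to \<open>(N, 1)\<close>, that is, if the shape operator \<open>S\<close> of
  \<open>(N, 1)\<close> is trace-free (\<open>mean_curv_null_iff_trace\<close>).

  If the whole second fundamental form is a multiple of \<open>(N, 1)\<close>, then \<open>S = 0\<close>, so the
  derivative of \<open>N\<close> is normal and orthogonal to \<open>(N, 1)\<close>, hence zero. With \<open>N\<close> constant the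
  submanifold lies in a degenerate hyperplane and is a graph over Euclidean space after a
  congruence (\<open>null_sff_locally_null_graph\<close>).

  For a hypersurface \<open>\<phi>\<close> with Gauss map \<open>\<nu>\<close> and shape operator \<open>A\<close>, the derivative of
  \<open>(\<phi> + \<tau> \<nu>, \<tau>)\<close> is that of \<open>\<phi>\<close> composed with \<open>1 - \<tau> A\<close>, up to multiples of the null normal
  \<open>(\<nu>, 1)\<close>. Hence its shape operator along \<open>(\<nu>, 1)\<close> is \<open>(1 - \<tau> A)\<^sup>-\<^sup>1 A\<close>, with eigenvalues
  \<open>\<kappa> / (1 - \<tau> \<kappa>) = 1 / (\<kappa>\<^sup>-\<^sup>1 - \<tau>)\<close>, and \<open>P(\<tau>)\<close> is the trace of this operator with its
  denominators cleared (\<open>curv_poly_root_iff\<close>). There is one root between any two consecutive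
  radii of curvature (\<open>card_curv_poly_roots\<close>). Unlike its individual eigenvalues, whose
  regularity would have to be established separately, the trace is visibly as smooth as \<open>A\<close>, and
  its derivative in \<open>\<tau>\<close> is a sum of squares; so the implicit function theorem makes the roots
  \<open>C\<^sup>2\<close> functions (\<open>Ck_on_root_function\<close>).

  Conversely, a marginally trapped submanifold is moved along \<open>(N, 1)\<close> to a time slice. Near a
  given point this gives a hypersurface with unit normal \<open>N\<close>, whose lift by the height function
  is the given submanifold; an eigenvalue \<open>d\<close> of \<open>S\<close> becomes the principal curvature
  \<open>d / (1 + \<tau> d)\<close> (\<open>trapping_field_local_lift\<close>). Constancy of the multiplicities comes from a
  perturbation argument for eigenvalues (\<open>eigenvalue_clusters\<close>), which also shows that regular
  points are dense (\<open>regular_points_dense\<close>).\<close>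

section \<open>Calculus of maps of class \<open>C\<^sup>k\<close>\<close>

lemma has_derivative_D1: "f differentiable (at x) \<Longrightarrow> (f has_derivative D1 f x) (at x)"
  by (simp add: frechet_derivative_works)

lemma D1_eq: "(f has_derivative f') (at x) \<Longrightarrow> D1 f x = f'"
  using frechet_derivative_at by metis

lemma D1_cong:
  assumes "open S" "x \<in> S" "\<And>y. y \<in> S \<Longrightarrow> f y = g y"
  shows "D1 f x = D1 g x"
proof (cases "f differentiable (at x)")
  case True
  then have "(g has_derivative D1 f x) (at x)"
    using has_derivative_transform_within_open[OF has_derivative_D1] assms by blast
  then show ?thesis using D1_eq by metis
next
  case False
  have "\<not> (f has_derivative h) (at x)" for h
    using False by (auto simp: differentiable_def)
  moreover have "\<not> (g has_derivative h) (at x)" for h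
    using False has_derivative_transform_within_open[of g h x UNIV S f] assms
    by (auto simp: differentiable_def)
  ultimately show ?thesis unfolding frechet_derivative_def by simp
qed

lemma Ck_on_cong:
  assumes "open S" "\<And>x. x \<in> S \<Longrightarrow> f x = g x"
  shows "Ck_on k f S \<longleftrightarrow> Ck_on k g S"
  using assms(2)
proof (induction k arbitrary: f g)
  case 0
  then show ?case by (simp cong: continuous_on_cong)
next
  case (Suc k)
  have "D1 f x = D1 g x" if "x \<in> S" for x
    using D1_cong[OF assms(1) that] Suc.prems by blast
  then have "Ck_on k (\<lambda>x. D1 f x v) S \<longleftrightarrow> Ck_on k (\<lambda>x. D1 g x v) S" for v
    by (intro Suc.IH) simp
  moreover have "f differentiable (at x) \<longleftrightarrow> g differentiable (at x)" if "x \<in> S" for x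
  proof -
    have "\<And>h. (f has_derivative h) (at x) \<Longrightarrow> (g has_derivative h) (at x)"
         "\<And>h. (g has_derivative h) (at x) \<Longrightarrow> (f has_derivative h) (at x)"
      using has_derivative_transform_within_open[of f _ x UNIV S g]
            has_derivative_transform_within_open[of g _ x UNIV S f] assms(1) that Suc.prems
      by simp_all
    then show ?thesis unfolding differentiable_def by blast
  qed
  ultimately show ?case unfolding Ck_on.simps by blast
qed

lemma Ck_on_SucI:
  assumes "open S" "\<And>x. x \<in> S \<Longrightarrow> (f has_derivative f' x) (at x)"
    and "\<And>v. Ck_on k (\<lambda>x. f' x v) S"
  shows "Ck_on (Suc k) f S"
proof -
  have "Ck_on k (\<lambda>x. D1 f x v) S" for v
    using assms(3)[of v] Ck_on_cong[OF assms(1), of "\<lambda>x. D1 f x v" "\<lambda>x. f' x v"] D1_eq[OF assms(2)]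
    by simp
  then show ?thesis using assms(2) by (auto simp: differentiable_def)
qed

lemma Ck_on_subset: "Ck_on k f S \<Longrightarrow> T \<subseteq> S \<Longrightarrow> Ck_on k f T"
proof (induction k arbitrary: f)
  case 0
  then show ?case using continuous_on_subset by auto
next
  case (Suc k)
  have "Ck_on k (\<lambda>x. D1 f x v) T" for v
    using Suc.prems by (intro Suc.IH) auto
  then show ?case using Suc.prems by auto
qed

lemma Ck_on_Suc_D: "Ck_on (Suc k) f S \<Longrightarrow> Ck_on k f S"
proof (induction k arbitrary: f)
  case 0
  then show ?case
    by (auto intro!: continuous_at_imp_continuous_on differentiable_imp_continuous_within)
next
  case (Suc k)
  have "Ck_on k (\<lambda>x. D1 f x v) S" for v
    using Suc.prems by (intro Suc.IH) simp
  then show ?case using Suc.prems by simp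
qed

lemma Ck_on_le: "Ck_on k f S \<Longrightarrow> j \<le> k \<Longrightarrow> Ck_on j f S"
  by (induction k) (auto simp del: Ck_on.simps simp: le_Suc_eq dest: Ck_on_Suc_D)

lemma Ck_on_continuous: "Ck_on k f S \<Longrightarrow> continuous_on S f"
  using Ck_on_le[of k f S 0] by simp

lemma Ck_on_differentiable: "Ck_on k f S \<Longrightarrow> 0 < k \<Longrightarrow> x \<in> S \<Longrightarrow> f differentiable (at x)"
  by (cases k) auto

lemma Ck_on_has_derivative:
  "Ck_on k f S \<Longrightarrow> 0 < k \<Longrightarrow> x \<in> S \<Longrightarrow> (f has_derivative D1 f x) (at x)"
  using Ck_on_differentiable has_derivative_D1 by metis

lemma Ck_on_D1: "Ck_on (Suc k) f S \<Longrightarrow> Ck_on k (\<lambda>x. D1 f x v) S"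
  by simp

lemma Ck_on_const: "Ck_on k (\<lambda>x. c) S"
  by (induction k arbitrary: c) auto

lemma Ck_on_bounded_linear:
  fixes f :: "'a::euclidean_space \<Rightarrow> 'b::real_normed_vector"
  assumes "bounded_linear f"
  shows "Ck_on k f S"
proof (cases k)
  case 0
  then show ?thesis using linear_continuous_on[OF assms] by simp
next
  case (Suc j)
  have f: "(f has_derivative f) (at x)" for x
    by (rule bounded_linear_imp_has_derivative[OF assms])
  have "D1 f x = f" for x by (rule D1_eq[OF f])
  then show ?thesis using f unfolding Suc by (auto simp: differentiable_def Ck_on_const)
qed

lemma Ck_on_id: "Ck_on k (\<lambda>x. x) S"
  by (rule Ck_on_bounded_linear) simp

lemma Ck_on_add:
  assumes "open S" "Ck_on k f S" "Ck_on k g S"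
  shows "Ck_on k (\<lambda>x. f x + g x) S"
  using assms(2,3)
proof (induction k arbitrary: f g)
  case 0
  then show ?case by (auto intro: continuous_intros)
next
  case (Suc k)
  show ?case
  proof (rule Ck_on_SucI[OF assms(1)])
    show "((\<lambda>x. f x + g x) has_derivative (\<lambda>v. D1 f x v + D1 g x v)) (at x)" if "x \<in> S" for x
      using Suc.prems that by (intro has_derivative_add has_derivative_D1) auto
    show "Ck_on k (\<lambda>x. D1 f x v + D1 g x v) S" for v
      using Suc by auto
  qed
qed

lemma Ck_on_sum:
  assumes "open S" "\<And>i. i \<in> I \<Longrightarrow> Ck_on k (f i) S"
  shows "Ck_on k (\<lambda>x. \<Sum>i\<in>I. f i x) S"
proof (cases "finite I")
  case True
  then show ?thesis using assms(2)
    by (induction I) (auto intro: Ck_on_const Ck_on_add[OF assms(1)])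
next
  case False
  then show ?thesis by (simp add: Ck_on_const)
qed

text \<open>Induction on \<open>k\<close> by the product rule; both summands of the derivative are bilinear in maps
  of class one lower.\<close>

lemma Ck_on_bilinear:
  assumes "open S" "bounded_bilinear pr" "Ck_on k f S" "Ck_on k g S"
  shows "Ck_on k (\<lambda>x. pr (f x) (g x)) S"
  using assms(3,4)
proof (induction k arbitrary: f g)
  case 0
  then show ?case using bounded_bilinear.continuous_on[OF assms(2)] by auto
next
  case (Suc k)
  show ?case
  proof (rule Ck_on_SucI[OF assms(1)])
    show "((\<lambda>x. pr (f x) (g x)) has_derivative
        (\<lambda>v. pr (f x) (D1 g x v) + pr (D1 f x v) (g x))) (at x)" if "x \<in> S" for x
      using Suc.prems that by (intro bounded_bilinear.FDERIV[OF assms(2)] has_derivative_D1) auto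
    show "Ck_on k (\<lambda>x. pr (f x) (D1 g x v) + pr (D1 f x v) (g x)) S" for v
      using Suc.prems by (intro Ck_on_add[OF assms(1)] Suc.IH Ck_on_Suc_D[of k f] Ck_on_Suc_D[of k g]) auto
  qed
qed

lemma Ck_on_compose_bounded_linear:
  assumes "open S" "bounded_linear L" "Ck_on k f S"
  shows "Ck_on k (\<lambda>x. L (f x)) S"
  using assms(3)
proof (induction k arbitrary: f)
  case 0
  then show ?case using bounded_linear.continuous_on[OF assms(2)] by auto
next
  case (Suc k)
  show ?case
  proof (rule Ck_on_SucI[OF assms(1)])
    show "((\<lambda>x. L (f x)) has_derivative (\<lambda>v. L (D1 f x v))) (at x)" if "x \<in> S" for x
      using Suc.prems that by (intro bounded_linear.has_derivative[OF assms(2)] has_derivative_D1) auto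
    show "Ck_on k (\<lambda>x. L (D1 f x v)) S" for v
      by (rule Suc.IH[OF Ck_on_D1[OF Suc.prems]])
  qed
qed

lemma Ck_on_minus: "open S \<Longrightarrow> Ck_on k f S \<Longrightarrow> Ck_on k (\<lambda>x. - f x) S"
  by (rule Ck_on_compose_bounded_linear[of S uminus]) (auto intro: bounded_linear_minus)

lemma Ck_on_diff: "open S \<Longrightarrow> Ck_on k f S \<Longrightarrow> Ck_on k g S \<Longrightarrow> Ck_on k (\<lambda>x. f x - g x) S"
  using Ck_on_add[of S k f "\<lambda>x. - g x"] Ck_on_minus[of S k g] by simp

lemma Ck_on_scaleR:
  "open S \<Longrightarrow> Ck_on k f S \<Longrightarrow> Ck_on k g S \<Longrightarrow> Ck_on k (\<lambda>x. f x *\<^sub>R g x) S"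
  by (rule Ck_on_bilinear[OF _ bounded_bilinear_scaleR])

lemma Ck_on_inner:
  "open S \<Longrightarrow> Ck_on k f S \<Longrightarrow> Ck_on k g S \<Longrightarrow> Ck_on k (\<lambda>x. f x \<bullet> g x) S"
  by (rule Ck_on_bilinear[OF _ bounded_bilinear_inner])

lemma Ck_on_Pair:
  assumes "open S" "Ck_on k f S" "Ck_on k g S"
  shows "Ck_on k (\<lambda>x. (f x, g x)) S"
proof -
  have "Ck_on k (\<lambda>x. (f x, 0) + (0, g x)) S"
    using assms
    by (intro Ck_on_add Ck_on_compose_bounded_linear[of S "\<lambda>a. (a, 0)"]
        Ck_on_compose_bounded_linear[of S "\<lambda>a. (0, a)"])
      (auto intro: bounded_linear_Pair bounded_linear_ident bounded_linear_zero)
  then show ?thesis by simp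
qed

lemma Ck_on_fst: "open S \<Longrightarrow> Ck_on k f S \<Longrightarrow> Ck_on k (\<lambda>x. fst (f x)) S"
  by (rule Ck_on_compose_bounded_linear[OF _ bounded_linear_fst])

lemma Ck_on_snd: "open S \<Longrightarrow> Ck_on k f S \<Longrightarrow> Ck_on k (\<lambda>x. snd (f x)) S"
  by (rule Ck_on_compose_bounded_linear[OF _ bounded_linear_snd])

lemma Ck_on_vec_lambda:
  fixes f :: "'n::finite \<Rightarrow> _ \<Rightarrow> 'b::euclidean_space"
  assumes "open S" "\<And>i. Ck_on k (f i) S"
  shows "Ck_on k (\<lambda>x. \<chi> i. f i x) S"
proof -
  have lin: "bounded_linear (\<lambda>a. (\<chi> j. if j = i then a else 0) :: 'b ^ 'n)" for i
    by (rule linear_conv_bounded_linear[THEN iffD1]) (auto intro!: linearI simp: vec_eq_iff)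
  have "Ck_on k (\<lambda>x. \<Sum>i\<in>UNIV. (\<chi> j. if j = i then f i x else 0)) S"
    by (intro Ck_on_sum Ck_on_compose_bounded_linear[OF assms(1) lin] assms)
  moreover have "(\<Sum>i\<in>UNIV. (\<chi> j. if j = i then f i x else 0)) = (\<chi> i. f i x)" for x
    by (simp add: vec_eq_iff)
  ultimately show ?thesis by simp
qed

lemma linear_eq_sum_Basis:
  fixes L :: "'a::euclidean_space \<Rightarrow> 'b::real_vector"
  assumes "linear L"
  shows "L w = (\<Sum>b\<in>Basis. (w \<bullet> b) *\<^sub>R L b)"
proof -
  have "L w = L (\<Sum>b\<in>Basis. (w \<bullet> b) *\<^sub>R b)" by (simp add: euclidean_representation)
  then show ?thesis by (simp add: linear_sum[OF assms] linear_scale[OF assms])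
qed

text \<open>A family of linear maps is smooth as soon as its values on the standard basis are.\<close>

lemma Ck_on_linear_apply:
  fixes w :: "'a::euclidean_space \<Rightarrow> 'c::euclidean_space"
  assumes "open S" "\<And>x. x \<in> S \<Longrightarrow> linear (L x)" "\<And>e. Ck_on k (\<lambda>x. L x e) S" "Ck_on k w S"
  shows "Ck_on k (\<lambda>x. L x (w x)) S"
proof -
  have "Ck_on k (\<lambda>x. \<Sum>b\<in>Basis. (w x \<bullet> b) *\<^sub>R L x b) S"
    using assms by (intro Ck_on_sum Ck_on_scaleR Ck_on_inner Ck_on_const) auto
  moreover have "L x (w x) = (\<Sum>b\<in>Basis. (w x \<bullet> b) *\<^sub>R L x b)" if "x \<in> S" for x
    by (rule linear_eq_sum_Basis[OF assms(2)[OF that]])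
  ultimately show ?thesis
    using Ck_on_cong[OF assms(1), of "\<lambda>x. L x (w x)" "\<lambda>x. \<Sum>b\<in>Basis. (w x \<bullet> b) *\<^sub>R L x b"]
    by blast
qed

lemma Ck_on_D1_apply:
  assumes "open S" "Ck_on (Suc k) f S" "Ck_on k w S"
  shows "Ck_on k (\<lambda>x. D1 f x (w x)) S"
proof (rule Ck_on_linear_apply[OF assms(1) _ Ck_on_D1[OF assms(2)] assms(3)])
  show "linear (D1 f x)" if "x \<in> S" for x
    using assms(2) that by (intro linear_frechet_derivative) simp
qed

text \<open>By the chain rule the derivative of the composition applies a smooth family of linear maps
  to a smooth vector.\<close>

lemma Ck_on_comp:
  fixes g :: "'b::euclidean_space \<Rightarrow> 'c::real_normed_vector"
  assumes "open S" "open T" "Ck_on k f S" "Ck_on k g T" "f ` S \<subseteq> T"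
  shows "Ck_on k (\<lambda>x. g (f x)) S"
  using assms(3,4)
proof (induction k arbitrary: g)
  case 0
  then show ?case using assms(5) continuous_on_compose2 by auto
next
  case (Suc k)
  show ?case
  proof (rule Ck_on_SucI[OF assms(1)])
    show "((\<lambda>x. g (f x)) has_derivative (\<lambda>v. D1 g (f x) (D1 f x v))) (at x)" if "x \<in> S" for x
    proof -
      have "f x \<in> T" using that assms(5) by auto
      then show ?thesis
        using Suc.prems that by (intro has_derivative_compose[OF has_derivative_D1 has_derivative_D1]) auto
    qed
    show "Ck_on k (\<lambda>x. D1 g (f x) (D1 f x v)) S" for v
    proof (rule Ck_on_linear_apply[OF assms(1)])
      show "linear (D1 g (f x))" if "x \<in> S" for x
        using that assms(5) Suc.prems by (auto intro!: linear_frechet_derivative)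
      show "Ck_on k (\<lambda>x. D1 g (f x) e) S" for e
        by (rule Suc.IH[OF Ck_on_Suc_D[OF Suc.prems(1)] Ck_on_D1[OF Suc.prems(2)]])
      show "Ck_on k (\<lambda>x. D1 f x v) S" using Suc.prems by simp
    qed
  qed
qed

section \<open>Regularity of solutions of equations\<close>

lemma isCont_nhds: "isCont f x \<Longrightarrow> (f \<longlongrightarrow> f x) (nhds x)"
  unfolding isCont_def tendsto_at_iff_tendsto_nhds .

text \<open>A perturbation by at most half of the lower bound of an injective linear map leaves the
  other half.\<close>

lemma linear_inj_bounded_below_near:
  fixes L :: "'p::euclidean_space \<Rightarrow> 'e::euclidean_space \<Rightarrow> 'f::euclidean_space"
  assumes lin: "\<forall>\<^sub>F x in nhds x0. linear (L x)" and inj: "inj (L x0)"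
    and cont: "\<And>e. isCont (\<lambda>x. L x e) x0"
  shows "\<exists>c>0. \<forall>\<^sub>F x in nhds x0. \<forall>e. c * norm e \<le> norm (L x e)"
proof -
  have l0: "linear (L x0)" using lin eventually_nhds_x_imp_x by blast
  obtain M where "linear M" "M \<circ> L x0 = id" using linear_injective_left_inverse[OF l0 inj] by auto
  then obtain B where B: "B > 0" "\<And>e. B * norm e \<le> norm (L x0 e)"
    using linear_invertible_bounded_below_pos[OF l0] by blast
  have "((\<lambda>x. \<Sum>b\<in>Basis. norm (L x b - L x0 b)) \<longlongrightarrow> (\<Sum>b\<in>(Basis::'e set). norm (L x0 b - L x0 b))) (nhds x0)"
    by (intro tendsto_sum tendsto_norm tendsto_diff tendsto_const isCont_nhds[OF cont])
  then have "\<forall>\<^sub>F x in nhds x0. (\<Sum>b\<in>(Basis::'e set). norm (L x b - L x0 b)) < B / 2"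
    using B(1) by (intro order_tendstoD(2)[where a="B/2"]) auto
  with lin have "\<forall>\<^sub>F x in nhds x0. \<forall>e. B / 2 * norm e \<le> norm (L x e)"
  proof eventually_elim
    case (elim x)
    show ?case
    proof
      fix e
      have "L x e - L x0 e = (\<Sum>b\<in>Basis. (e \<bullet> b) *\<^sub>R (L x b - L x0 b))"
        using linear_eq_sum_Basis[OF elim(1), of e] linear_eq_sum_Basis[OF l0, of e]
        by (simp add: scaleR_diff_right sum_subtractf)
      also have "norm \<dots> \<le> (\<Sum>b\<in>Basis. norm e * norm (L x b - L x0 b))"
        by (rule sum_norm_le) (auto intro!: mult_right_mono simp: Basis_le_norm)
      also have "\<dots> \<le> norm e * (B / 2)"
        unfolding sum_distrib_left[symmetric] using elim(2) by (intro mult_left_mono) auto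
      finally have "norm (L x e - L x0 e) \<le> norm e * (B / 2)" .
      moreover have "norm (L x0 e) \<le> norm (L x e) + norm (L x e - L x0 e)"
        by (metis norm_minus_commute norm_triangle_sub)
      ultimately show "B / 2 * norm e \<le> norm (L x e)" using B(2)[of e] by (simp add: field_simps)
    qed
  qed
  then show ?thesis using B(1) by (intro exI[of _ "B/2"]) auto
qed

lemma eventually_linear_inj:
  fixes L :: "'p::euclidean_space \<Rightarrow> 'e::euclidean_space \<Rightarrow> 'f::euclidean_space"
  assumes lin: "\<forall>\<^sub>F x in nhds x0. linear (L x)" and "inj (L x0)" "\<And>e. isCont (\<lambda>x. L x e) x0"
  shows "\<forall>\<^sub>F x in nhds x0. inj (L x)"
proof -
  obtain c where c: "c > 0" "\<forall>\<^sub>F x in nhds x0. \<forall>e. c * norm e \<le> norm (L x e)"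
    using linear_inj_bounded_below_near[OF assms] by auto
  show ?thesis using lin c(2)
  proof eventually_elim
    case (elim x)
    show ?case unfolding linear_injective_0[OF elim(1)]
    proof (intro allI impI)
      fix e assume "L x e = 0"
      then have "c * norm e \<le> 0" using elim(2) by (metis norm_zero)
      then show "e = 0" using c(1) by (simp add: mult_le_0_iff)
    qed
  qed
qed

lemma isCont_linear_solution:
  fixes L :: "'p::euclidean_space \<Rightarrow> 'e::euclidean_space \<Rightarrow> 'f::euclidean_space"
  assumes lin: "\<forall>\<^sub>F x in nhds x0. linear (L x)" and inj: "inj (L x0)"
    and cont: "\<And>e. isCont (\<lambda>x. L x e) x0" "isCont b x0"
    and eq: "\<forall>\<^sub>F x in nhds x0. L x (y x) = b x"
  shows "isCont y x0"
proof -
  obtain c where c: "c > 0" "\<forall>\<^sub>F x in nhds x0. \<forall>e. c * norm e \<le> norm (L x e)"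
    using linear_inj_bounded_below_near[OF lin inj cont(1)] by auto
  have "\<forall>\<^sub>F x in nhds x0. norm (y x - y x0) \<le> norm (b x - L x (y x0)) / c"
    using lin c(2) eq
  proof eventually_elim
    case (elim x)
    have "c * norm (y x - y x0) \<le> norm (L x (y x - y x0))" using elim(2) by blast
    also have "L x (y x - y x0) = b x - L x (y x0)" using linear_diff[OF elim(1)] elim(3) by simp
    finally show ?case using c(1) by (simp add: field_simps)
  qed
  moreover have "((\<lambda>x. norm (b x - L x (y x0)) / c) \<longlongrightarrow> norm (b x0 - L x0 (y x0)) / c) (nhds x0)"
    using c(1)
    by (intro tendsto_divide tendsto_norm tendsto_diff tendsto_const isCont_nhds[OF cont(1)] isCont_nhds[OF cont(2)])
      auto
  moreover have "b x0 - L x0 (y x0) = 0" using eq eventually_nhds_x_imp_x[of _ x0] by fastforce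
  ultimately have "((\<lambda>x. y x - y x0) \<longlongrightarrow> 0) (nhds x0)"
    using Lim_null_comparison[of "\<lambda>x. y x - y x0" "\<lambda>x. norm (b x - L x (y x0)) / c" "nhds x0"] by simp
  then show ?thesis unfolding isCont_def tendsto_at_iff_tendsto_nhds by (simp add: Lim_null[symmetric])
qed

text \<open>Differentiability in the implicit function theorem once continuity is known: the Taylor
  remainder of \<open>F\<close> along the graph bounds the increment of \<open>y\<close> by that of \<open>x\<close>, and then is
  itself negligible.\<close>

lemma implicit_differentiable:
  fixes F :: "'p::euclidean_space \<times> 'e::euclidean_space \<Rightarrow> 'f::euclidean_space"
  assumes F: "(F has_derivative F') (at (x0, y x0))" and y: "isCont y x0"
    and eq: "\<forall>\<^sub>F x in nhds x0. F (x, y x) = 0" and inj: "inj (\<lambda>e. F' (0, e))"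
  shows "y differentiable (at x0)" "\<And>u. F' (u, D1 y x0 u) = 0"
proof -
  have F'lin: "linear F'" using F has_derivative_linear by blast
  have split: "F' (h, k) = F' (h, 0) + F' (0, k)" for h k
    using linear_add[OF F'lin, of "(h, 0)" "(0, k)"] by simp
  have lk: "linear (\<lambda>e. F' (0, e))"
    using linear_compose[OF _ F'lin, of "\<lambda>e. (0, e)"] by (simp add: o_def bounded_linear.linear bounded_linear_Pair bounded_linear_ident bounded_linear_zero)
  obtain M where M: "linear M" "\<And>e. M (F' (0, e)) = e"
    using linear_injective_left_inverse[OF lk inj] by (auto simp: fun_eq_iff)
  obtain m where m: "m > 0" "\<And>a. norm (M a) \<le> m * norm a" using linear_bounded_pos[OF M(1)] by blast
  have lh: "linear (\<lambda>h. M (F' (h, 0)))"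
    using M(1) F'lin
    by (intro linearI)
       (metis (no_types, lifting) add_Pair add_0 linear_add,
        metis (no_types, lifting) scaleR_Pair scaleR_zero_right linear_scale)
  obtain C where C: "C > 0" "\<And>h. norm (M (F' (h, 0))) \<le> C * norm h"
    using linear_bounded_pos[OF lh] by blast
  have F0: "F (x0, y x0) = 0" using eq eventually_nhds_x_imp_x by fastforce
  have bl: "bounded_linear (\<lambda>h. - M (F' (h, 0)))"
    using lh by (simp add: linear_conv_bounded_linear[symmetric] linear_compose_neg)
  have der: "(y has_derivative (\<lambda>h. - M (F' (h, 0)))) (at x0)"
    unfolding has_derivative_at_alt
  proof (intro conjI allI impI)
    show "bounded_linear (\<lambda>h. - M (F' (h, 0)))" by fact
    fix e :: real assume "e > 0"
    \<comment> \<open>The first bound absorbs the increment of \<open>y\<close>, which is then at most \<open>2 C + 1\<close> times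
      that of \<open>x\<close>; the second one gives the final estimate.\<close>
    define \<epsilon> where "\<epsilon> = min (1 / (2 * m)) (e / (m * (2 * C + 2)))"
    have \<epsilon>: "\<epsilon> > 0" using \<open>e > 0\<close> m(1) C(1) by (simp add: \<epsilon>_def)
    have \<epsilon>1: "m * \<epsilon> \<le> 1 / 2" using m(1) by (simp add: \<epsilon>_def min_def field_simps)
    have \<epsilon>2: "m * \<epsilon> * (2 * C + 2) \<le> e"
    proof -
      have "m * (2 * C + 2) * \<epsilon> \<le> m * (2 * C + 2) * (e / (m * (2 * C + 2)))"
        using m(1) C(1) by (intro mult_left_mono) (auto simp: \<epsilon>_def)
      also have "\<dots> = e"
      proof -
        have "m * (2 * C + 2) \<noteq> 0" using m(1) C(1) by simp
        then show ?thesis by (metis nonzero_mult_div_cancel_left times_divide_eq_right)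
      qed
      finally show ?thesis by (simp add: algebra_simps)
    qed
    obtain d where d: "d > 0" "\<And>z. norm (z - (x0, y x0)) < d \<Longrightarrow>
        norm (F z - F (x0, y x0) - F' (z - (x0, y x0))) \<le> \<epsilon> * norm (z - (x0, y x0))"
      using F \<epsilon> unfolding has_derivative_at_alt by blast
    have ev1: "\<forall>\<^sub>F x in nhds x0. norm (y x - y x0) < d / 2"
      using tendstoD[OF isCont_nhds[OF y], of "d / 2"] d(1) by (simp add: dist_norm)
    have ev2: "\<forall>\<^sub>F x in nhds x0. norm (x - x0) < d / 2"
      using eventually_nhds_in_open[of "ball x0 (d / 2)" x0] d(1) by (simp add: dist_norm norm_minus_commute)
    have "\<forall>\<^sub>F x in nhds x0. norm (y x - y x0 - (- M (F' (x - x0, 0)))) \<le> e * norm (x - x0)"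
      using ev1 ev2 eq
    proof eventually_elim
      case (elim x)
      define h where "h = x - x0"
      define k where "k = y x - y x0"
      have hk: "norm (h, k) \<le> norm h + norm k" by (simp add: norm_Pair sqrt_sum_squares_le_sum)
      have eqhk: "(x, y x) - (x0, y x0) = (h, k)" by (simp add: h_def k_def)
      have "norm (h, k) < d" using hk elim(1,2) unfolding h_def k_def by linarith
      then have "norm (F (x, y x) - F (x0, y x0) - F' (h, k)) \<le> \<epsilon> * norm (h, k)"
        using d(2)[of "(x, y x)"] unfolding eqhk by blast
      then have "norm (F' (h, k)) \<le> \<epsilon> * norm (h, k)"
        unfolding elim(3) F0 by simp
      also have "\<dots> \<le> \<epsilon> * (norm h + norm k)" using hk \<epsilon> by (intro mult_left_mono) auto
      finally have a: "norm (F' (h, k)) \<le> \<epsilon> * (norm h + norm k)" .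
      have "M (F' (h, k)) = M (F' (h, 0)) + k"
        by (simp add: split[of h k] linear_add[OF M(1)] M(2))
      moreover have "norm (M (F' (h, k))) \<le> m * \<epsilon> * (norm h + norm k)"
        using order_trans[OF m(2)[of "F' (h, k)"] mult_left_mono[OF a, of m]] m(1) by (simp add: mult.assoc)
      ultimately have b: "norm (M (F' (h, 0)) + k) \<le> m * \<epsilon> * (norm h + norm k)" by simp
      have "m * \<epsilon> * (norm h + norm k) \<le> 1 / 2 * (norm h + norm k)"
        using \<epsilon>1 by (intro mult_right_mono) auto
      moreover have "norm k \<le> norm (M (F' (h, 0)) + k) + norm (M (F' (h, 0)))"
        by (metis add_diff_cancel_left' norm_triangle_ineq4)
      ultimately have "norm k \<le> (2 * C + 1) * norm h" using b C(2)[of h] by (simp add: field_simps)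
      then have "m * \<epsilon> * (norm h + norm k) \<le> m * \<epsilon> * ((2 * C + 2) * norm h)"
        using m(1) \<epsilon> by (intro mult_left_mono) (auto simp: algebra_simps)
      also have "\<dots> \<le> e * norm h" using mult_right_mono[OF \<epsilon>2, of "norm h"] by (simp add: mult.assoc)
      finally show ?case using b by (simp add: h_def k_def add.commute)
    qed
    then obtain d' where "d' > 0" "\<And>x. dist x x0 < d' \<Longrightarrow>
        norm (y x - y x0 - (- M (F' (x - x0, 0)))) \<le> e * norm (x - x0)"
      unfolding eventually_nhds_metric by blast
    then show "\<exists>d>0. \<forall>x. norm (x - x0) < d \<longrightarrow>
        norm (y x - y x0 - (- M (F' (x - x0, 0)))) \<le> e * norm (x - x0)"
      by (intro exI[of _ d']) (auto simp: dist_norm)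
  qed
  then show diff: "y differentiable (at x0)" by (auto simp: differentiable_def)
  fix u
  have "((\<lambda>x. F (x, y x)) has_derivative (\<lambda>u. F' (u, D1 y x0 u))) (at x0)"
    by (rule has_derivative_compose[where f = "\<lambda>x. (x, y x)", OF _ F])
       (intro has_derivative_Pair has_derivative_ident has_derivative_D1 diff)
  moreover have "((\<lambda>x. F (x, y x)) has_derivative (\<lambda>u. 0)) (at x0)"
    using eq by (intro has_derivative_transform_eventually[OF has_derivative_const[of 0]])
      (auto simp: F0 eventually_at_filter elim: eventually_mono)
  ultimately have "(\<lambda>u. F' (u, D1 y x0 u)) = (\<lambda>u. 0)" by (rule has_derivative_unique)
  then show "F' (u, D1 y x0 u) = 0" by meson
qed

text \<open>The solution of a linear system with coefficients of class \<open>C\<^sup>k\<close> is of class \<open>C\<^sup>k\<close>: its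
  derivative solves a system with the same matrix.\<close>

lemma Ck_on_linear_solution:
  fixes L :: "'p::euclidean_space \<Rightarrow> 'e::euclidean_space \<Rightarrow> 'f::euclidean_space"
  assumes S: "open S" and lin: "\<And>x. x \<in> S \<Longrightarrow> linear (L x)" and inj: "\<And>x. x \<in> S \<Longrightarrow> inj (L x)"
    and "\<And>e. Ck_on k (\<lambda>x. L x e) S" "Ck_on k b S" "\<And>x. x \<in> S \<Longrightarrow> L x (y x) = b x"
  shows "Ck_on k y S"
  using assms(4-6)
proof (induction k arbitrary: b y)
  case 0
  have "isCont y x" if "x \<in> S" for x
  proof (rule isCont_linear_solution[of L _ b])
    show "\<forall>\<^sub>F x in nhds x. linear (L x)" "\<forall>\<^sub>F x in nhds x. L x (y x) = b x"
      using S that lin 0(3) eventually_nhds by blast+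
    show "inj (L x)" "isCont (\<lambda>x. L x e) x" "isCont b x" for e
      using inj 0 that S by (auto simp: continuous_on_eq_continuous_at)
  qed
  then show ?case by (simp add: continuous_at_imp_continuous_on)
next
  case (Suc k)
  note Ck_on.simps(2)[simp del]
  have y: "Ck_on k y S" using Suc by (meson Ck_on_Suc_D)
  have L1: "((\<lambda>x. L x e) has_derivative D1 (\<lambda>x. L x e) x) (at x)" if "x \<in> S" for x e
    using Suc.prems(1) that by (intro Ck_on_has_derivative) auto
  have b1: "(b has_derivative D1 b x) (at x)" if "x \<in> S" for x
    using Suc.prems(2) that by (intro Ck_on_has_derivative) auto
  define b' where "b' = (\<lambda>u x. D1 b x u - (\<Sum>c\<in>Basis. (y x \<bullet> c) *\<^sub>R D1 (\<lambda>x. L x c) x u))"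
  have *: "y differentiable (at x) \<and> (\<forall>u. L x (D1 y x u) = b' u x)" if x: "x \<in> S" for x
  proof -
    define F where "F = (\<lambda>(x, v). (\<Sum>c\<in>Basis. (v \<bullet> c) *\<^sub>R L x c) - b x)"
    define F' where "F' = (\<lambda>(u, v). (\<Sum>c\<in>Basis. (y x \<bullet> c) *\<^sub>R D1 (\<lambda>x. L x c) x u + (v \<bullet> c) *\<^sub>R L x c) - D1 b x u)"
    have "F = (\<lambda>z. (\<Sum>c\<in>Basis. (snd z \<bullet> c) *\<^sub>R L (fst z) c) - b (fst z))"
      by (auto simp: F_def)
    moreover have "((\<lambda>z. (\<Sum>c\<in>Basis. (snd z \<bullet> c) *\<^sub>R L (fst z) c) - b (fst z)) has_derivative
      (\<lambda>z. (\<Sum>c\<in>Basis. (snd (x, y x) \<bullet> c) *\<^sub>R D1 (\<lambda>x. L x c) x (fst z) + (snd z \<bullet> c) *\<^sub>R L (fst (x, y x)) c)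
          - D1 b x (fst z))) (at (x, y x))"
      using L1[OF x] b1[OF x]
      by (intro has_derivative_diff has_derivative_sum has_derivative_scaleR has_derivative_inner_left
         has_derivative_snd has_derivative_ident has_derivative_compose[where f = fst and g = "\<lambda>x. L x _"]
         has_derivative_compose[where f = fst and g = b] has_derivative_fst) auto
    ultimately have F: "(F has_derivative F') (at (x, y x))" by (simp add: F'_def case_prod_unfold)
    have eqF: "F (z, y z) = 0" if "z \<in> S" for z
      using that Suc.prems(3) linear_eq_sum_Basis[OF lin[OF that], of "y z"] by (simp add: F_def)
    have lin0: "D1 (\<lambda>x. L x c) x 0 = 0" "D1 b x 0 = 0" for c
      using linear_0[OF has_derivative_linear[OF L1[OF x]]] linear_0[OF has_derivative_linear[OF b1[OF x]]] .
    then have F'0: "F' (0, v) = L x v" for v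
      using linear_eq_sum_Basis[OF lin[OF x], of v] by (simp add: F'_def)
    have y0: "isCont y x" using y x S Ck_on_continuous continuous_on_eq_continuous_at by blast
    have ev: "\<forall>\<^sub>F x in nhds x. F (x, y x) = 0" using eqF S x eventually_nhds by blast
    have "inj (\<lambda>e. F' (0, e))" using inj[OF x] F'0 by simp
    note imp = implicit_differentiable[OF F y0 ev this]
    have "F' (u, v) = L x v - b' u x" for u v
      using linear_eq_sum_Basis[OF lin[OF x], of v] by (simp add: F'_def b'_def sum.distrib)
    then show ?thesis using imp by auto
  qed
  have "Ck_on k (\<lambda>x. D1 y x u) S" for u
  proof (rule Suc.IH[of "b' u"])
    show "Ck_on k (\<lambda>x. L x e) S" for e using Suc.prems(1) Ck_on_Suc_D by blast
    show "Ck_on k (b' u) S" unfolding b'_def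
      using Suc.prems y S by (intro Ck_on_diff Ck_on_sum Ck_on_scaleR Ck_on_inner Ck_on_const Ck_on_D1)
  qed (use * in auto)
  then show ?case using * by (simp add: Ck_on.simps)
qed

text \<open>The derivative of \<open>y\<close> solves a linear system whose coefficients are derivatives of \<open>F\<close>
  along the graph of \<open>y\<close>, hence as smooth as \<open>y\<close> itself up to order \<open>k - 1\<close>. So each order
  of differentiability of \<open>y\<close> yields the next one.\<close>

theorem Ck_on_implicit:
  fixes F :: "'p::euclidean_space \<times> 'e::euclidean_space \<Rightarrow> 'f::euclidean_space"
  assumes S: "open S" and W: "open W" and F: "Ck_on k F W" "0 < k" and y: "continuous_on S y"
    and W': "\<And>x. x \<in> S \<Longrightarrow> (x, y x) \<in> W" and eq: "\<And>x. x \<in> S \<Longrightarrow> F (x, y x) = 0"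
    and inj: "\<And>x. x \<in> S \<Longrightarrow> inj (\<lambda>e. D1 F (x, y x) (0, e))"
  shows "Ck_on k y S"
proof -
  note Ck_on.simps(2)[simp del]
  have F1: "(F has_derivative D1 F (x, y x)) (at (x, y x))" if "x \<in> S" for x
    using F W'[OF that] by (intro Ck_on_has_derivative)
  have y1: "y differentiable (at x)" and y2: "D1 F (x, y x) (u, D1 y x u) = 0" if "x \<in> S" for x u
  proof -
    have ev: "\<forall>\<^sub>F x in nhds x. F (x, y x) = 0" using eq S that eventually_nhds by blast
    have "isCont y x" using y that S continuous_on_eq_continuous_at by blast
    note implicit_differentiable[OF F1[OF that] this ev inj[OF that]]
    then show "y differentiable (at x)" "D1 F (x, y x) (u, D1 y x u) = 0" by auto
  qed
  have "j \<le> k \<Longrightarrow> Ck_on j y S" for j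
  proof (induction j)
    case 0
    then show ?case using y by simp
  next
    case (Suc j)
    then obtain k' where k': "k = Suc k'" "j \<le> k'" by (cases k) auto
    have yj: "Ck_on j y S" using Suc by simp
    have coef: "Ck_on j (\<lambda>x. D1 F (x, y x) z) S" for z
    proof (rule Ck_on_comp[OF S W, where g = "\<lambda>q. D1 F q z"])
      show "Ck_on j (\<lambda>x. (x, y x)) S" using S yj by (intro Ck_on_Pair Ck_on_id)
      show "Ck_on j (\<lambda>q. D1 F q z) W" using F k' by (intro Ck_on_le[OF Ck_on_D1]) auto
    qed (use W' in auto)
    have "Ck_on j (\<lambda>x. D1 y x u) S" for u
    proof (rule Ck_on_linear_solution[OF S, where L = "\<lambda>x e. D1 F (x, y x) (0, e)" and b = "\<lambda>x. - D1 F (x, y x) (u, 0)"])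
      fix x assume x: "x \<in> S"
      have l: "linear (D1 F (x, y x))" using F1[OF x] has_derivative_linear by blast
      show "linear (\<lambda>e. D1 F (x, y x) (0, e))"
        using linear_compose[OF _ l, of "\<lambda>e. (0, e)"] by (simp add: o_def bounded_linear.linear bounded_linear_Pair bounded_linear_ident bounded_linear_zero)
      show "inj (\<lambda>e. D1 F (x, y x) (0, e))" using inj[OF x] .
      have "D1 F (x, y x) (u, D1 y x u) = D1 F (x, y x) (u, 0) + D1 F (x, y x) (0, D1 y x u)"
        using linear_add[OF l, of "(u, 0)" "(0, D1 y x u)"] by simp
      then show "D1 F (x, y x) (0, D1 y x u) = - D1 F (x, y x) (u, 0)"
        using y2[OF x, of u] by (simp add: eq_neg_iff_add_eq_0 add.commute)
    next
      show "Ck_on j (\<lambda>x. D1 F (x, y x) (0, e)) S" for e by (rule coef)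
      show "Ck_on j (\<lambda>x. - D1 F (x, y x) (u, 0)) S" using S coef by (intro Ck_on_minus)
    qed
    then show ?case using y1 by (simp add: Ck_on.simps)
  qed
  then show ?thesis by simp
qed

text \<open>A continuous local inverse is provided by the inverse function theorem; it is the implicit
  solution \<open>g\<close> of \<open>f (g y) - y = 0\<close>, which gives its regularity.\<close>

theorem Ck_inverse_function:
  fixes f :: "'a::euclidean_space \<Rightarrow> 'a"
  assumes S: "open S" "x0 \<in> S" and f: "Ck_on k f S" "0 < k" and inj: "inj (D1 f x0)"
  obtains U V g where "open U" "x0 \<in> U" "U \<subseteq> S" "open V" "f x0 \<in> V" "homeomorphism U V f g" "Ck_on k g V"
proof -
  have der: "(f has_derivative D1 f x) (at x)" if "x \<in> S" for x
    using f that by (intro Ck_on_has_derivative)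
  define f' where "f' = (\<lambda>x. Blinfun (D1 f x))"
  have f': "blinfun_apply (f' x) = D1 f x" if "x \<in> S" for x
    using der[OF that] has_derivative_bounded_linear bounded_linear_Blinfun_apply by (auto simp: f'_def)
  have l0: "linear (D1 f x0)" using der[OF S(2)] has_derivative_linear by blast
  obtain M where M: "linear M" "M \<circ> D1 f x0 = id" using linear_injective_left_inverse[OF l0 inj] by auto
  have "bounded_linear M" using M(1) by (simp add: linear_conv_bounded_linear)
  then have inv: "Blinfun M o\<^sub>L f' x0 = id_blinfun"
    using M(2) f'[OF S(2)] by (intro blinfun_eqI) (auto simp: bounded_linear_Blinfun_apply fun_eq_iff)
  have cont: "continuous_on S f'"
  proof (rule continuous_on_blinfun_componentwise)
    fix i
    obtain k' where "k = Suc k'" using f(2) by (cases k) auto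
    then have "Ck_on k' (\<lambda>x. D1 f x i) S" using f(1) by simp
    then have "continuous_on S (\<lambda>x. D1 f x i)" by (rule Ck_on_continuous)
    then show "continuous_on S (\<lambda>x. blinfun_apply (f' x) i)" using f' by (simp cong: continuous_on_cong)
  qed
  obtain U V g g' where g: "open U" "U \<subseteq> S" "x0 \<in> U" "open V" "f x0 \<in> V" "homeomorphism U V f g"
    "\<And>y. y \<in> V \<Longrightarrow> bij (blinfun_apply (f' (g y)))"
    using inverse_function_theorem[of S f f', OF S(1) _ cont S(2) inv] der f' by (metis (no_types, lifting))
  have gU: "g y \<in> U" "f (g y) = y" if "y \<in> V" for y
    using g(6) that by (auto simp: homeomorphism_def)
  have "Ck_on k g V"
  proof (rule Ck_on_implicit[where F = "\<lambda>z. f (snd z) - fst z" and W = "UNIV \<times> S"])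
    show "open (UNIV \<times> S :: ('a \<times> 'a) set)" using S by (simp add: open_Times)
    then show "Ck_on k (\<lambda>z. f (snd z) - fst z) (UNIV \<times> S)"
      using S(1) f(1)
      by (intro Ck_on_diff Ck_on_fst Ck_on_id Ck_on_comp[where f = snd and g = f and T = S] Ck_on_snd) auto
    fix y assume y: "y \<in> V"
    show "(y, g y) \<in> UNIV \<times> S" using gU(1)[OF y] g(2) by auto
    show "f (snd (y, g y)) - fst (y, g y) = 0" using gU(2)[OF y] by simp
    have gyS: "g y \<in> S" using gU(1)[OF y] g(2) by auto
    have "((\<lambda>z. f (snd z) - fst z) has_derivative (\<lambda>z. D1 f (g y) (snd z) - fst z)) (at (y, g y))"
      using der[OF gyS]
      by (intro has_derivative_diff has_derivative_compose[where f = snd and g = f] has_derivative_snd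
          has_derivative_fst has_derivative_ident) auto
    then have "D1 (\<lambda>z. f (snd z) - fst z) (y, g y) = (\<lambda>z. D1 f (g y) (snd z) - fst z)"
      by (rule D1_eq)
    moreover have "inj (D1 f (g y))" using g(7)[OF y] f'[OF gyS] by (simp add: bij_is_inj)
    ultimately show "inj (\<lambda>e. D1 (\<lambda>z. f (snd z) - fst z) (y, g y) (0, e))" by simp
  qed (use g f in \<open>auto simp: homeomorphism_def\<close>)
  then show thesis using that g by blast
qed

section \<open>Symmetry of second derivatives\<close>

lemma DERIV_along_line:
  fixes F :: "'a::real_normed_vector \<Rightarrow> real"
  assumes "(F has_derivative F') (at (p + a *\<^sub>R w))"
  shows "((\<lambda>a. F (p + a *\<^sub>R w)) has_real_derivative F' w) (at a)"
proof -
  have "((\<lambda>a. F (p + a *\<^sub>R w)) has_derivative (\<lambda>c. F' (c *\<^sub>R w))) (at a)"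
    by (rule has_derivative_compose[where f = "\<lambda>a. p + a *\<^sub>R w", OF _ assms]) (auto intro!: derivative_eq_intros)
  moreover have "(*) (F' w) = (\<lambda>c. F' (c *\<^sub>R w))"
    using linear_scale[OF has_derivative_linear[OF assms]] by (intro ext) simp
  ultimately show ?thesis unfolding has_field_derivative_def by simp
qed

text \<open>The mean value theorem, along \<open>u\<close> and then along \<open>v\<close>, turns the second difference
  quotient into a value of the second derivative.\<close>

lemma second_difference:
  fixes f :: "'a::euclidean_space \<Rightarrow> real"
  assumes S: "convex S" and f: "Ck_on 2 f S" and h: "h > 0"
    and pts: "x \<in> S" "x + h *\<^sub>R u \<in> S" "x + h *\<^sub>R v \<in> S" "x + h *\<^sub>R u + h *\<^sub>R v \<in> S"
  shows "\<exists>s\<in>{0..h}. \<exists>r\<in>{0..h}.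
     f (x + h *\<^sub>R u + h *\<^sub>R v) - f (x + h *\<^sub>R u) - f (x + h *\<^sub>R v) + f x = h * (h * D2 f (x + s *\<^sub>R u + r *\<^sub>R v) v u)"
proof -
  have in_S: "x + a *\<^sub>R u + b *\<^sub>R v \<in> S" if ab: "a \<in> {0..h}" "b \<in> {0..h}" for a b
  proof -
    have seg: "p + c *\<^sub>R w \<in> S" if "c \<in> {0..h}" "p \<in> S" "p + h *\<^sub>R w \<in> S" for p w c
    proof -
      have "(1 - c / h) *\<^sub>R p + (c / h) *\<^sub>R (p + h *\<^sub>R w) \<in> S"
        using that h by (intro convexD[OF S]) (auto simp: field_simps)
      moreover have "(1 - c / h) *\<^sub>R p + (c / h) *\<^sub>R (p + h *\<^sub>R w) = p + c *\<^sub>R w"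
        using h by (simp add: algebra_simps)
      ultimately show ?thesis by simp
    qed
    have "x + a *\<^sub>R u \<in> S" using seg pts ab by blast
    moreover have "(x + h *\<^sub>R v) + a *\<^sub>R u \<in> S" by (rule seg) (use pts ab in \<open>auto simp: algebra_simps\<close>)
    ultimately show ?thesis using ab seg[of b "x + a *\<^sub>R u" v] by (simp add: algebra_simps)
  qed
  have f1: "(f has_derivative D1 f z) (at z)" if "z \<in> S" for z
    using f that by (intro Ck_on_has_derivative) auto
  have f2: "((\<lambda>z. D1 f z u) has_derivative D1 (\<lambda>z. D1 f z u) z) (at z)" if "z \<in> S" for z
    using f that by (intro has_derivative_D1) (auto simp: numeral_2_eq_2)
  define g where "g = (\<lambda>a. f (x + a *\<^sub>R u + h *\<^sub>R v) - f (x + a *\<^sub>R u))"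
  define g' where "g' = (\<lambda>a. D1 f (x + a *\<^sub>R u + h *\<^sub>R v) u - D1 f (x + a *\<^sub>R u) u)"
  have gd: "(g has_real_derivative g' a) (at a)" if a: "0 \<le> a" "a \<le> h" for a
  proof -
    have "x + h *\<^sub>R v + a *\<^sub>R u \<in> S" "x + a *\<^sub>R u \<in> S"
      using in_S[of a h] in_S[of a 0] a h by (auto simp: algebra_simps)
    then have "((\<lambda>a. f (x + h *\<^sub>R v + a *\<^sub>R u) - f (x + a *\<^sub>R u)) has_real_derivative
       D1 f (x + h *\<^sub>R v + a *\<^sub>R u) u - D1 f (x + a *\<^sub>R u) u) (at a)"
      by (intro DERIV_diff DERIV_along_line f1)
    moreover have "x + h *\<^sub>R v + b *\<^sub>R u = x + b *\<^sub>R u + h *\<^sub>R v" for b by simp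
    ultimately show ?thesis unfolding g_def g'_def by simp
  qed
  obtain s where s: "0 < s" "s < h" "g h - g 0 = (h - 0) * g' s"
    using MVT2[OF h gd] by blast
  have kd: "((\<lambda>b. D1 f (x + s *\<^sub>R u + b *\<^sub>R v) u) has_real_derivative D2 f (x + s *\<^sub>R u + b *\<^sub>R v) v u) (at b)"
    if b: "0 \<le> b" "b \<le> h" for b
  proof -
    have "x + s *\<^sub>R u + b *\<^sub>R v \<in> S" using in_S[of s b] s b by simp
    then show ?thesis unfolding D2_def by (intro DERIV_along_line f2)
  qed
  obtain r where r: "0 < r" "r < h" "D1 f (x + s *\<^sub>R u + h *\<^sub>R v) u - D1 f (x + s *\<^sub>R u + 0 *\<^sub>R v) u
     = (h - 0) * D2 f (x + s *\<^sub>R u + r *\<^sub>R v) v u"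
    using MVT2[OF h kd] by blast
  have "g h - g 0 = h * (h * D2 f (x + s *\<^sub>R u + r *\<^sub>R v) v u)" using s r by (simp add: g'_def)
  then have "f (x + h *\<^sub>R u + h *\<^sub>R v) - f (x + h *\<^sub>R u) - f (x + h *\<^sub>R v) + f x
      = h * (h * D2 f (x + s *\<^sub>R u + r *\<^sub>R v) v u)"
    unfolding g_def by simp
  then show ?thesis using s(1,2) r(1,2) by (intro bexI[of _ s] bexI[of _ r]) auto
qed

text \<open>The second difference is symmetric in \<open>u\<close> and \<open>v\<close>, so it is a value of the second
  derivative at a nearby point in either order of the arguments. As the points approach \<open>x\<close>,
  continuity gives the claim.\<close>

lemma D2_symmetric_real:
  fixes f :: "'a::euclidean_space \<Rightarrow> real"
  assumes S: "open S" "x \<in> S" and f: "Ck_on 2 f S"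
  shows "D2 f x u v = D2 f x v u"
proof -
  have cont: "continuous_on S (\<lambda>z. D2 f z a b)" for a b
    using f by (simp add: numeral_2_eq_2 D2_def)
  have close: "\<bar>D2 f x v u - D2 f x u v\<bar> \<le> e" if "e > 0" for e
  proof -
    have "\<forall>\<^sub>F z in nhds x. \<bar>D2 f z a b - D2 f x a b\<bar> < e / 2" for a b
    proof -
      have "isCont (\<lambda>z. D2 f z a b) x" using cont S continuous_on_eq_continuous_at by blast
      from tendstoD[OF isCont_nhds[OF this], of "e / 2"] \<open>e > 0\<close> show ?thesis
        by (simp add: dist_real_def)
    qed
    then have "\<forall>\<^sub>F z in nhds x. \<bar>D2 f z v u - D2 f x v u\<bar> < e / 2 \<and> \<bar>D2 f z u v - D2 f x u v\<bar> < e / 2 \<and> z \<in> S"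
      using S by (intro eventually_conj eventually_nhds_in_open)
    then obtain d where d: "d > 0" "\<And>z. dist z x < d \<Longrightarrow>
        \<bar>D2 f z v u - D2 f x v u\<bar> < e / 2 \<and> \<bar>D2 f z u v - D2 f x u v\<bar> < e / 2 \<and> z \<in> S"
      unfolding eventually_nhds_metric by blast
    define h where "h = d / (2 * (norm u + norm v + 1))"
    have h: "h > 0" using d(1) by (simp add: h_def add_nonneg_pos)
    have near: "dist (x + a *\<^sub>R u + b *\<^sub>R v) x < d" if "a \<in> {0..h}" "b \<in> {0..h}" for a b
    proof -
      have "norm (a *\<^sub>R u + b *\<^sub>R v) \<le> a * norm u + b * norm v"
        using that by (metis abs_of_nonneg atLeastAtMost_iff norm_scaleR norm_triangle_ineq)
      also have "\<dots> \<le> h * norm u + h * norm v" using that by (intro add_mono mult_right_mono) auto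
      also have "\<dots> \<le> h * (norm u + norm v + 1)" using h by (simp add: algebra_simps)
      also have "\<dots> = d / 2"
      proof -
        have "norm u + norm v + 1 > 0" by (simp add: add_nonneg_pos)
        then show ?thesis by (simp add: h_def field_simps)
      qed
      also have "\<dots> < d" using d(1) by simp
      finally show ?thesis by (simp add: dist_norm algebra_simps)
    qed
    have C2: "Ck_on 2 f (ball x d)" using f by (rule Ck_on_subset) (use d in \<open>auto simp: dist_commute\<close>)
    have in_b: "x + a *\<^sub>R u + b *\<^sub>R v \<in> ball x d" if "a \<in> {0..h}" "b \<in> {0..h}" for a b
      using near[OF that] by (simp add: dist_commute)
    have pts: "x \<in> ball x d" "x + h *\<^sub>R u \<in> ball x d" "x + h *\<^sub>R v \<in> ball x d"
       "x + h *\<^sub>R u + h *\<^sub>R v \<in> ball x d" "x + h *\<^sub>R v + h *\<^sub>R u \<in> ball x d"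
      using in_b[of 0 0] in_b[of h 0] in_b[of 0 h] in_b[of h h] h by (auto simp: algebra_simps)
    obtain s r where sr: "s \<in> {0..h}" "r \<in> {0..h}" "f (x + h *\<^sub>R u + h *\<^sub>R v) - f (x + h *\<^sub>R u) - f (x + h *\<^sub>R v) + f x
         = h * (h * D2 f (x + s *\<^sub>R u + r *\<^sub>R v) v u)"
      using second_difference[OF convex_ball C2 h pts(1,2,3,4)] by auto
    obtain s' r' where sr': "s' \<in> {0..h}" "r' \<in> {0..h}" "f (x + h *\<^sub>R v + h *\<^sub>R u) - f (x + h *\<^sub>R v) - f (x + h *\<^sub>R u) + f x
         = h * (h * D2 f (x + s' *\<^sub>R v + r' *\<^sub>R u) u v)"
      using second_difference[OF convex_ball C2 h pts(1,3,2,5)] by auto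
    have swap: "x + h *\<^sub>R v + h *\<^sub>R u = x + h *\<^sub>R u + h *\<^sub>R v" by (simp add: algebra_simps)
    have "h * (h * D2 f (x + s *\<^sub>R u + r *\<^sub>R v) v u) = h * (h * D2 f (x + s' *\<^sub>R v + r' *\<^sub>R u) u v)"
      using sr(3) sr'(3)[unfolded swap] by linarith
    then have "D2 f (x + s *\<^sub>R u + r *\<^sub>R v) v u = D2 f (x + r' *\<^sub>R u + s' *\<^sub>R v) u v"
      using h by (simp add: algebra_simps)
    moreover have "\<bar>D2 f (x + s *\<^sub>R u + r *\<^sub>R v) v u - D2 f x v u\<bar> < e / 2"
      using d(2)[OF near[OF sr(1,2)]] by blast
    moreover have "\<bar>D2 f (x + r' *\<^sub>R u + s' *\<^sub>R v) u v - D2 f x u v\<bar> < e / 2"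
      using d(2)[OF near[OF sr'(2,1)]] by blast
    ultimately show ?thesis by linarith
  qed
  show ?thesis using field_le_epsilon[of "\<bar>D2 f x v u - D2 f x u v\<bar>" 0] close by auto
qed

lemma D1_compose_bounded_linear:
  assumes "bounded_linear L" "f differentiable (at x)"
  shows "D1 (\<lambda>y. L (f y)) x v = L (D1 f x v)"
  by (simp add: D1_eq[OF bounded_linear.has_derivative[OF assms(1) has_derivative_D1[OF assms(2)]]])

lemma D2_compose_bounded_linear:
  assumes "bounded_linear L" "open S" "x \<in> S" "Ck_on 2 f S"
  shows "D2 (\<lambda>y. L (f y)) x u v = L (D2 f x u v)"
proof -
  have d: "f differentiable (at y)" "(\<lambda>z. D1 f z v) differentiable (at y)" if "y \<in> S" for y
    using assms(4) that by (auto simp: numeral_2_eq_2)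
  have "D1 (\<lambda>y. D1 (\<lambda>y. L (f y)) y v) x = D1 (\<lambda>y. L (D1 f y v)) x"
    using D1_compose_bounded_linear[OF assms(1)] d(1) by (intro D1_cong[OF assms(2,3)]) auto
  then show ?thesis
    using D1_compose_bounded_linear[OF assms(1) d(2)[OF assms(3)]] by (simp add: D2_def)
qed

theorem D2_symmetric:
  fixes f :: "'a::euclidean_space \<Rightarrow> 'b::euclidean_space"
  assumes "open S" "x \<in> S" "Ck_on 2 f S"
  shows "D2 f x u v = D2 f x v u"
proof (rule euclidean_eqI)
  fix b :: 'b assume "b \<in> Basis"
  have "D2 f x u v \<bullet> b = D2 (\<lambda>y. f y \<bullet> b) x u v" for u v
    using D2_compose_bounded_linear[OF bounded_linear_inner_left assms, of b u v] by simp
  moreover have "D2 (\<lambda>y. f y \<bullet> b) x u v = D2 (\<lambda>y. f y \<bullet> b) x v u"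
    using assms by (intro D2_symmetric_real[of S]) (auto intro!: Ck_on_compose_bounded_linear[OF _ bounded_linear_inner_left])
  ultimately show "D2 f x u v \<bullet> b = D2 f x v u \<bullet> b" by simp
qed

section \<open>Self-adjoint operators for a varying inner product\<close>

definition inner_product :: "('a::euclidean_space \<Rightarrow> 'a \<Rightarrow> real) \<Rightarrow> bool" where
  "inner_product g \<longleftrightarrow> (\<forall>u. linear (g u)) \<and> (\<forall>u v. g u v = g v u) \<and> (\<forall>u. u \<noteq> 0 \<longrightarrow> 0 < g u u)"

lemma inner_product_simps:
  assumes "inner_product g"
  shows "g (u + u') v = g u v + g u' v" "g v (u + u') = g v u + g v u'"
    "g (u - u') v = g u v - g u' v" "g v (u - u') = g v u - g v u'"
    "g (c *\<^sub>R u) v = c * g u v" "g v (c *\<^sub>R u) = c * g v u" "g 0 v = 0" "g v 0 = 0"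
    "g (\<Sum>i\<in>I. w i) v = (\<Sum>i\<in>I. g (w i) v)" "g v (\<Sum>i\<in>I. w i) = (\<Sum>i\<in>I. g v (w i))"
proof -
  have l: "linear (g a)" and s: "g a b = g b a" for a b
    using assms by (auto simp: inner_product_def)
  show "g v (u + u') = g v u + g v u'" "g v (u - u') = g v u - g v u'" "g v (c *\<^sub>R u) = c * g v u"
     "g v 0 = 0" "g v (\<Sum>i\<in>I. w i) = (\<Sum>i\<in>I. g v (w i))"
    by (simp_all add: linear_add[OF l] linear_diff[OF l] linear_scale[OF l] linear_0[OF l] linear_sum[OF l])
  then show "g (u + u') v = g u v + g u' v" "g (u - u') v = g u v - g u' v" "g (c *\<^sub>R u) v = c * g u v"
     "g 0 v = 0" "g (\<Sum>i\<in>I. w i) v = (\<Sum>i\<in>I. g (w i) v)"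
    by (simp_all add: s[of _ v])
qed

lemma inner_product_commute: "inner_product g \<Longrightarrow> g u v = g v u"
  by (simp add: inner_product_def)

lemma inner_product_pos: "inner_product g \<Longrightarrow> u \<noteq> 0 \<Longrightarrow> 0 < g u u"
  by (simp add: inner_product_def)

lemma inner_product_nonneg: "inner_product g \<Longrightarrow> 0 \<le> g u u"
  using inner_product_pos[of g u] inner_product_simps(7)[of g 0] by (cases "u = 0") auto

lemma inner_product_linear: "inner_product g \<Longrightarrow> linear (g u)"
  by (simp add: inner_product_def)

definition riesz :: "('a::euclidean_space \<Rightarrow> 'a \<Rightarrow> real) \<Rightarrow> ('a \<Rightarrow> real) \<Rightarrow> 'a" where
  "riesz g \<phi> = (THE w. \<forall>v. g w v = \<phi> v)"

text \<open>The vector representing \<open>g w\<close> in the standard inner product. In terms of this injective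
  linear map, \<open>riesz\<close> is the solution of a linear system, and so inherits the regularity of its
  data.\<close>

definition lowering :: "('a::euclidean_space \<Rightarrow> 'a \<Rightarrow> real) \<Rightarrow> 'a \<Rightarrow> 'a" where
  "lowering g w = (\<Sum>b\<in>Basis. g w b *\<^sub>R b)"

lemma lowering_inner: "b \<in> Basis \<Longrightarrow> lowering g w \<bullet> b = g w b"
  by (simp add: lowering_def inner_sum_left inner_Basis if_distrib cong: if_cong)

lemma linear_lowering: "inner_product g \<Longrightarrow> linear (lowering g)"
  by (intro linearI) (simp_all add: lowering_def inner_product_simps scaleR_sum_right sum.distrib algebra_simps)

lemma inj_lowering:
  assumes "inner_product g"
  shows "inj (lowering g)"
  unfolding linear_injective_0[OF linear_lowering[OF assms]]
proof (intro allI impI)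
  fix w assume "lowering g w = 0"
  then have "g w b = 0" if "b \<in> Basis" for b using lowering_inner[OF that, of g w] by simp
  then have "g w w = 0"
    using linear_eq_sum_Basis[OF inner_product_linear[OF assms, of w], of w] by simp
  then show "w = 0" using inner_product_pos[OF assms, of w] by force
qed

lemma riesz_works:
  assumes "inner_product g" "linear \<phi>"
  shows "g (riesz g \<phi>) v = \<phi> v"
proof -
  have eq: "(\<forall>v. g w v = \<phi> v) \<longleftrightarrow> lowering g w = (\<Sum>b\<in>Basis. \<phi> b *\<^sub>R b)" for w
  proof
    assume "\<forall>v. g w v = \<phi> v"
    then show "lowering g w = (\<Sum>b\<in>Basis. \<phi> b *\<^sub>R b)" by (simp add: lowering_def)
  next
    assume a: "lowering g w = (\<Sum>b\<in>Basis. \<phi> b *\<^sub>R b)"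
    have "g w b = \<phi> b" if "b \<in> Basis" for b
      using lowering_inner[OF that, of g w] inner_sum_left_Basis[OF that, of \<phi>] unfolding a by simp
    then show "\<forall>v. g w v = \<phi> v"
      using linear_eq_stdbasis[OF inner_product_linear[OF assms(1)] assms(2)] by metis
  qed
  have "surj (lowering g)"
    using linear_injective_imp_surjective[OF linear_lowering inj_lowering] assms by blast
  then have "\<exists>!w. lowering g w = (\<Sum>b\<in>Basis. \<phi> b *\<^sub>R b)"
    using inj_lowering[OF assms(1)] bij_iff[of "lowering g"] unfolding bij_def by blast
  then have "\<exists>!w. \<forall>v. g w v = \<phi> v" by (simp add: eq)
  from theI'[OF this] show ?thesis unfolding riesz_def by blast
qed

lemma inner_product_eqI:
  assumes "inner_product g" "\<And>v. g w v = g w' v"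
  shows "w = w'"
proof (rule ccontr)
  assume "w \<noteq> w'"
  then have "0 < g (w - w') (w - w')" using inner_product_pos[OF assms(1)] by simp
  then show False using assms(2)[of "w - w'"] by (simp add: inner_product_simps(3)[OF assms(1)])
qed

lemma Ck_on_riesz:
  assumes S: "open S" and g: "\<And>x. x \<in> S \<Longrightarrow> inner_product (g x)" "\<And>u v. Ck_on k (\<lambda>x. g x u v) S"
    and \<phi>: "\<And>x. x \<in> S \<Longrightarrow> linear (\<phi> x)" "\<And>v. Ck_on k (\<lambda>x. \<phi> x v) S"
  shows "Ck_on k (\<lambda>x. riesz (g x) (\<phi> x)) S"
proof (rule Ck_on_linear_solution[OF S, where L = "\<lambda>x. lowering (g x)" and b = "\<lambda>x. \<Sum>b\<in>Basis. \<phi> x b *\<^sub>R b"])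
  show "Ck_on k (\<lambda>x. lowering (g x) e) S" for e
    unfolding lowering_def by (intro Ck_on_sum Ck_on_scaleR Ck_on_const S g)
  show "Ck_on k (\<lambda>x. \<Sum>b\<in>Basis. \<phi> x b *\<^sub>R b) S"
    by (intro Ck_on_sum Ck_on_scaleR Ck_on_const S \<phi>)
  show "lowering (g x) (riesz (g x) (\<phi> x)) = (\<Sum>b\<in>Basis. \<phi> x b *\<^sub>R b)" if "x \<in> S" for x
    using riesz_works[OF g(1) \<phi>(1)] that by (simp add: lowering_def)
qed (use g linear_lowering inj_lowering in blast)+

text \<open>A \<open>g\<close>-orthonormal basis of eigenvectors; the second condition says that it spans.\<close>

definition eigenframe ::
  "(real ^ 'n \<Rightarrow> real ^ 'n \<Rightarrow> real) \<Rightarrow> (real ^ 'n \<Rightarrow> real ^ 'n) \<Rightarrow> ('n::finite \<Rightarrow> real ^ 'n) \<Rightarrow> ('n \<Rightarrow> real) \<Rightarrow> bool"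
  where
  "eigenframe g S f d \<longleftrightarrow> (\<forall>i j. g (f i) (f j) = (if i = j then 1 else 0)) \<and>
     (\<forall>u. (\<Sum>i\<in>UNIV. g (f i) u *\<^sub>R f i) = u) \<and> (\<forall>i. S (f i) = d i *\<^sub>R f i)"

text \<open>A maximiser of the Rayleigh quotient on an invariant subspace is an eigenvector: the form
  \<open>\<lambda> g(v, w) - g(S v, w)\<close> is positive semidefinite and vanishes at the maximiser.\<close>

lemma exists_eigenvector:
  fixes g :: "'a::euclidean_space \<Rightarrow> 'a \<Rightarrow> real"
  assumes g: "inner_product g" and S: "linear S" and sa: "\<And>u v. g (S u) v = g u (S v)"
    and U: "subspace U" "U \<noteq> {0}" and inv: "\<And>u. u \<in> U \<Longrightarrow> S u \<in> U"
  shows "\<exists>u\<in>U. \<exists>l. g u u = 1 \<and> S u = l *\<^sub>R u"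
proof -
  note gs = inner_product_simps[OF g]
  have cont_g: "continuous_on A (\<lambda>u. g (L u) u)" if "linear L" for A L
  proof -
    have "continuous_on A (\<lambda>u. \<Sum>b\<in>Basis. (u \<bullet> b) * g (L u) b)"
    proof (intro continuous_intros)
      fix b :: 'a
      have "linear (\<lambda>u. g (L u) b)"
        using linear_add[OF that] linear_scale[OF that] by (intro linearI) (simp_all add: gs)
      then show "continuous_on A (\<lambda>u. g (L u) b)" by (intro linear_continuous_on) (simp add: linear_conv_bounded_linear)
    qed
    moreover have "g (L u) u = (\<Sum>b\<in>Basis. (u \<bullet> b) * g (L u) b)" for u
      using linear_eq_sum_Basis[OF inner_product_linear[OF g, of "L u"], of u] by simp
    ultimately show ?thesis by simp
  qed
  have cS: "continuous_on A (\<lambda>u. g (S u) u)" for A using cont_g[OF S] .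
  have cg: "continuous_on A (\<lambda>u. g u u)" for A using cont_g[OF linear_id] by simp
  define K where "K = U \<inter> {u. g u u = 1}"
  obtain w0 where w0: "w0 \<in> U" "w0 \<noteq> 0" using U subspace_0 by blast
  then have pos: "g w0 w0 > 0" using inner_product_pos[OF g] by simp
  have normalise: "(1 / sqrt (g w w)) *\<^sub>R w \<in> K" if "w \<in> U" "w \<noteq> 0" for w
    using inner_product_pos[OF g that(2)] subspace_scale[OF U(1) that(1)]
    by (simp add: K_def gs field_simps)
  have Kne: "K \<noteq> {}" using normalise[OF w0] by auto
  \<comment> \<open>The minimum of \<open>g\<close> on the Euclidean unit sphere makes the \<open>g\<close>-unit sphere bounded.\<close>
  obtain c where c: "c > 0" "\<And>u. g u u \<ge> c * (norm u)\<^sup>2"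
  proof -
    have sph: "compact (sphere (0::'a) 1)" by simp
    have ne: "sphere (0::'a) 1 \<noteq> {}" using w0(2) by (auto simp: sphere_eq_empty)
    obtain s where s: "s \<in> sphere 0 1" "\<And>u. u \<in> sphere 0 1 \<Longrightarrow> g s s \<le> g u u"
      using continuous_attains_inf[OF sph ne cg] by blast
    show thesis
    proof
      show "g s s > 0" using s(1) inner_product_pos[OF g, of s] by fastforce
      show "g u u \<ge> g s s * (norm u)\<^sup>2" for u
      proof (cases "u = 0")
        case False
        then have "g s s \<le> g ((1 / norm u) *\<^sub>R u) ((1 / norm u) *\<^sub>R u)" by (intro s(2)) simp
        then show ?thesis using False by (simp add: gs field_simps power2_eq_square)
      qed (simp add: gs)
    qed
  qed
  have "bounded K"
    unfolding bounded_iff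
  proof (intro exI ballI)
    fix u assume "u \<in> K"
    then have "c * (norm u)\<^sup>2 \<le> 1" using c(2)[of u] by (simp add: K_def)
    then have "(norm u)\<^sup>2 \<le> 1 / c" using c(1) by (simp add: field_simps)
    then show "norm u \<le> sqrt (1 / c)" using real_le_rsqrt by blast
  qed
  moreover have "closed K"
    unfolding K_def using closed_subspace[OF U(1)] continuous_closed_preimage_constant[OF cg[of UNIV] closed_UNIV, of 1]
    by (intro closed_Int) (auto simp: vimage_def)
  ultimately have "compact K" by (simp add: compact_eq_bounded_closed)
  then obtain u where u: "u \<in> K" "\<And>w. w \<in> K \<Longrightarrow> g (S w) w \<le> g (S u) u"
    using continuous_attains_sup[OF _ Kne cS] by blast
  define l where "l = g (S u) u"
  define b where "b = (\<lambda>v w. l * g v w - g (S v) w)"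
  have uU: "u \<in> U" "g u u = 1" using u by (auto simp: K_def)
  have b_nonneg: "b v v \<ge> 0" if v: "v \<in> U" for v
  proof (cases "v = 0")
    case False
    have "g (S ((1 / sqrt (g v v)) *\<^sub>R v)) ((1 / sqrt (g v v)) *\<^sub>R v) \<le> l"
      unfolding l_def by (rule u(2)[OF normalise[OF v False]])
    then show ?thesis using inner_product_pos[OF g False]
      by (simp add: b_def linear_scale[OF S] gs field_simps)
  qed (simp add: b_def gs linear_0[OF S])
  have b0: "b u v = 0" if v: "v \<in> U" for v
  proof (rule ccontr)
    assume ne: "b u v \<noteq> 0"
    have q: "0 \<le> 2 * t * b u v + t\<^sup>2 * b v v" for t
    proof -
      have "u + t *\<^sub>R v \<in> U" using uU v U(1) by (simp add: subspace_add subspace_scale)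
      from b_nonneg[OF this] have "0 \<le> b u u + t * (b u v + b v u) + t\<^sup>2 * b v v"
        by (simp add: b_def gs linear_add[OF S] linear_scale[OF S] algebra_simps power2_eq_square)
      moreover have "b u u = 0" using uU by (simp add: b_def l_def)
      moreover have "b v u = b u v"
        using inner_product_commute[OF g] sa by (simp add: b_def)
      ultimately show ?thesis by (simp add: algebra_simps)
    qed
    define c where "c = b v v + 1"
    have c: "c > 0" using b_nonneg[OF v] by (simp add: c_def)
    \<comment> \<open>At this \<open>t\<close> the nonnegative quadratic polynomial \<open>q\<close>
      would be negative.\<close>
    define t where "t = - b u v / c"
    have tc: "t * c = - b u v" using c by (simp add: t_def)
    have "c\<^sup>2 * (2 * t * b u v + t\<^sup>2 * b v v) = 2 * (t * c) * c * b u v + (t * c)\<^sup>2 * b v v"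
      by (simp add: power2_eq_square algebra_simps)
    also have "\<dots> = - ((b u v)\<^sup>2 * (b v v + 2))"
      unfolding tc by (simp add: c_def power2_eq_square algebra_simps)
    also have "\<dots> < 0"
      using ne b_nonneg[OF v] by (simp add: add_nonneg_pos)
    finally show False using mult_nonneg_nonneg[OF zero_le_power2[of c] q[of t]] by linarith
  qed
  have "S u = l *\<^sub>R u"
  proof -
    define v where "v = l *\<^sub>R u - S u"
    have "v \<in> U" unfolding v_def using uU inv U(1) by (simp add: subspace_diff subspace_scale)
    then have "b u v = 0" by (rule b0)
    moreover have "g (l *\<^sub>R u - S u) v = b u v" by (simp add: b_def gs)
    ultimately have "g v v = 0" unfolding v_def[symmetric] by simp
    then have "v = 0" using inner_product_pos[OF g, of v] by force
    then show ?thesis by (simp add: v_def)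
  qed
  then show ?thesis using uU by blast
qed

text \<open>A maximal orthonormal set of eigenvectors spans: its orthogonal complement is invariant and
  would contain a further eigenvector.\<close>

theorem spectral_theorem:
  fixes g :: "real ^ 'n \<Rightarrow> real ^ 'n::finite \<Rightarrow> real"
  assumes g: "inner_product g" and S: "linear S" and sa: "\<And>u v. g (S u) v = g u (S v)"
  shows "\<exists>f d. eigenframe g S f d"
proof -
  note gs = inner_product_simps[OF g]
  define good where "good = (\<lambda>B. finite B \<and> (\<forall>b\<in>B. g b b = 1 \<and> (\<exists>l. S b = l *\<^sub>R b)) \<and>
     (\<forall>b\<in>B. \<forall>c\<in>B. b \<noteq> c \<longrightarrow> g b c = 0))"
  have coord: "g b (\<Sum>c\<in>B. a c *\<^sub>R c) = a b" if "good B" "b \<in> B" for B a b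
  proof -
    have "g b (\<Sum>c\<in>B. a c *\<^sub>R c) = (\<Sum>c\<in>B. if c = b then a c else 0)"
      unfolding gs using that by (intro sum.cong refl) (auto simp: good_def gs)
    also have "\<dots> = a b" using that by (simp add: good_def)
    finally show ?thesis .
  qed
  have indep: "independent B" if "good B" for B
  proof -
    have fin: "finite B" using that by (simp add: good_def)
    show ?thesis
      unfolding independent_explicit_finite_subsets
    proof (intro allI impI ballI)
      fix A u v assume "A \<subseteq> B" "finite A" "(\<Sum>v\<in>A. u v *\<^sub>R v) = 0" "v \<in> A"
      moreover from this have "good A" using that by (auto simp: good_def)
      ultimately show "u v = 0" using coord[of A v u] by (simp add: gs)
    qed
  qed
  have card: "card B \<le> CARD('n)" if "good B" for B
    using independent_card_le_dim[OF subset_UNIV indep[OF that]] by simp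
  have "good {}" by (simp add: good_def)
  then obtain B where B: "good B" "\<And>C. good C \<Longrightarrow> card C \<le> card B"
    using ex_has_greatest_nat[of good "{}" card "Suc CARD('n)"] card less_Suc_eq_le by blast
  have fB: "finite B" using B(1) by (simp add: good_def)
  define U where "U = {v. \<forall>b\<in>B. g b v = 0}"
  have "U = {0}"
  proof (rule ccontr)
    assume ne: "U \<noteq> {0}"
    have sub: "subspace U" by (auto simp: U_def subspace_def gs)
    have inv: "S u \<in> U" if "u \<in> U" for u
    proof -
      have "g b (S u) = 0" if b: "b \<in> B" for b
      proof -
        obtain l where l: "S b = l *\<^sub>R b" using B(1) b unfolding good_def by blast
        have "g b (S u) = g (S b) u" by (simp add: sa)
        also have "\<dots> = 0" using \<open>u \<in> U\<close> b by (simp add: U_def l gs)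
        finally show ?thesis .
      qed
      then show ?thesis by (simp add: U_def)
    qed
    obtain u l where u: "u \<in> U" "g u u = 1" "S u = l *\<^sub>R u"
      using exists_eigenvector[OF g S sa sub ne inv] by blast
    have nu: "u \<notin> B" using u(1,2) by (auto simp: U_def)
    have "good (insert u B)"
      using B(1) u inner_product_commute[OF g] by (auto simp: good_def U_def)
    then show False using B(2) nu fB by fastforce
  qed
  have expand: "(\<Sum>b\<in>B. g b v *\<^sub>R b) = v" for v
  proof -
    have "v - (\<Sum>b\<in>B. g b v *\<^sub>R b) \<in> U"
      unfolding U_def using coord[OF B(1), of _ "\<lambda>b. g b v"] by (simp add: gs(4))
    then show ?thesis using \<open>U = {0}\<close> by simp
  qed
  have "span B = UNIV"
  proof -
    have "(\<Sum>b\<in>B. g b v *\<^sub>R b) \<in> span B" for v by (intro span_sum span_scale span_base)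
    then show ?thesis unfolding expand by auto
  qed
  then have "card B = CARD('n)"
    using dim_eq_card[OF _ indep[OF B(1)], of UNIV] by simp
  then obtain f where f: "bij_betw f (UNIV :: 'n set) B"
    using finite_same_card_bij[of "UNIV :: 'n set" B] fB by auto
  have fin: "f i \<in> B" for i using f by (auto simp: bij_betw_def)
  have finj: "f i = f j \<longleftrightarrow> i = j" for i j using f by (auto simp: bij_betw_def inj_on_def)
  have "\<forall>i. \<exists>l. S (f i) = l *\<^sub>R f i" using fin B(1) unfolding good_def by blast
  then obtain d where d: "\<And>i. S (f i) = d i *\<^sub>R f i" by metis
  have "(\<Sum>i\<in>UNIV. g (f i) u *\<^sub>R f i) = u" for u
    using sum.reindex_bij_betw[OF f, of "\<lambda>b. g b u *\<^sub>R b"] expand by simp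
  then have "eigenframe g S f d"
    using d fin finj B(1) by (auto simp: eigenframe_def good_def)
  then show ?thesis by blast
qed

context
  fixes g :: "real ^ 'n \<Rightarrow> real ^ 'n::finite \<Rightarrow> real" and S f d
  assumes g: "inner_product g" and S: "linear S" and ef: "eigenframe g S f d"
begin

lemma eigenframe_ortho: "g (f i) (f j) = (if i = j then 1 else 0)"
  using ef by (simp add: eigenframe_def)

lemma eigenframe_expand: "(\<Sum>i\<in>UNIV. g (f i) u *\<^sub>R f i) = u"
  using ef by (simp add: eigenframe_def)

lemma eigenframe_eigen: "S (f i) = d i *\<^sub>R f i"
  using ef by (simp add: eigenframe_def)

lemma eigenframe_nonzero: "f i \<noteq> 0"
  using eigenframe_ortho[of i i] inner_product_simps(7)[OF g] by fastforce

lemma eigenframe_inj: "inj f"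
proof (rule injI)
  show "i = j" if "f i = f j" for i j
    using eigenframe_ortho[of i j] eigenframe_ortho[of i i] that by (simp split: if_splits)
qed

lemma eigenframe_coord: "g (f i) (\<Sum>j\<in>I. a j *\<^sub>R f j) = (if i \<in> I then a i else 0)"
proof -
  have "g (f i) (\<Sum>j\<in>I. a j *\<^sub>R f j) = (\<Sum>j\<in>I. if j = i then a j else 0)"
    unfolding inner_product_simps[OF g] by (intro sum.cong refl) (auto simp: eigenframe_ortho)
  then show ?thesis by simp
qed

lemma eigenframe_eqI: "(\<And>i. g (f i) u = g (f i) v) \<Longrightarrow> u = v"
proof -
  assume "\<And>i. g (f i) u = g (f i) v"
  then have "(\<Sum>i\<in>UNIV. g (f i) u *\<^sub>R f i) = (\<Sum>i\<in>UNIV. g (f i) v *\<^sub>R f i)" by simp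
  then show ?thesis by (simp only: eigenframe_expand)
qed

lemma eigenframe_operator: "g (f i) (S u) = d i * g (f i) u"
proof -
  have "S u = S (\<Sum>j\<in>UNIV. g (f j) u *\<^sub>R f j)" by (simp add: eigenframe_expand)
  also have "\<dots> = (\<Sum>j\<in>UNIV. (g (f j) u * d j) *\<^sub>R f j)"
    by (simp add: linear_sum[OF S] linear_scale[OF S] eigenframe_eigen)
  finally show ?thesis by (simp add: eigenframe_coord mult.commute)
qed

lemma eigenframe_norm: "g u u = (\<Sum>i\<in>UNIV. (g (f i) u)\<^sup>2)"
proof -
  have "g u u = g (\<Sum>i\<in>UNIV. g (f i) u *\<^sub>R f i) u" by (simp add: eigenframe_expand)
  also have "\<dots> = (\<Sum>i\<in>UNIV. g (f i) u * g (f i) u)"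
    by (simp only: inner_product_simps(5,9)[OF g])
  finally show ?thesis by (simp only: power2_eq_square)
qed

lemma eigenframe_independent: "independent (f ` I)"
  unfolding independent_explicit_finite_subsets
proof (intro allI impI ballI)
  fix A u v assume A: "A \<subseteq> f ` I" "finite A" "(\<Sum>v\<in>A. u v *\<^sub>R v) = 0" "v \<in> A"
  then obtain J where J': "A = f ` J" by (auto simp: subset_image_iff)
  with A obtain i where J: "A = f ` J" "v = f i" "i \<in> J" by blast
  have "(\<Sum>v\<in>A. u v *\<^sub>R v) = (\<Sum>j\<in>J. u (f j) *\<^sub>R f j)"
    using eigenframe_inj unfolding J by (subst sum.reindex) (auto intro: inj_on_subset)
  then have "g (f i) 0 = u (f i)" using eigenframe_coord[of i "\<lambda>j. u (f j)" J] A J by simp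
  then show "u v = 0" using J inner_product_simps(8)[OF g] by simp
qed

lemma eigenframe_span: "span (f ` I) = {u. \<forall>i. i \<notin> I \<longrightarrow> g (f i) u = 0}"
proof
  have "subspace {u. \<forall>i. i \<notin> I \<longrightarrow> g (f i) u = 0}"
    by (auto simp: subspace_def inner_product_simps[OF g])
  moreover have "f ` I \<subseteq> {u. \<forall>i. i \<notin> I \<longrightarrow> g (f i) u = 0}" by (auto simp: eigenframe_ortho)
  ultimately show "span (f ` I) \<subseteq> {u. \<forall>i. i \<notin> I \<longrightarrow> g (f i) u = 0}" by (rule span_minimal[rotated])
next
  show "{u. \<forall>i. i \<notin> I \<longrightarrow> g (f i) u = 0} \<subseteq> span (f ` I)"
  proof
    fix u assume u: "u \<in> {u. \<forall>i. i \<notin> I \<longrightarrow> g (f i) u = 0}"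
    have "(\<Sum>i\<in>UNIV. g (f i) u *\<^sub>R f i) \<in> span (f ` I)"
    proof (rule span_sum)
      fix i show "g (f i) u *\<^sub>R f i \<in> span (f ` I)"
        using u by (cases "i \<in> I") (auto intro: span_scale span_base span_zero)
    qed
    then show "u \<in> span (f ` I)" by (simp add: eigenframe_expand)
  qed
qed

lemma eigenframe_dim_span: "dim (span (f ` I)) = card I"
  using dim_span_eq_card_independent[OF eigenframe_independent[of I]] card_image[of f I] eigenframe_inj
  by (simp add: inj_on_subset)

lemma eigenframe_eigenspace: "{u. S u = k *\<^sub>R u} = span (f ` {i. d i = k})"
proof -
  have "S u = k *\<^sub>R u \<longleftrightarrow> (\<forall>i. d i * g (f i) u = k * g (f i) u)" for u
  proof
    assume a: "S u = k *\<^sub>R u"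
    show "\<forall>i. d i * g (f i) u = k * g (f i) u"
      unfolding eigenframe_operator[symmetric] a by (simp add: inner_product_simps[OF g])
  next
    assume "\<forall>i. d i * g (f i) u = k * g (f i) u"
    then show "S u = k *\<^sub>R u" by (intro eigenframe_eqI) (simp add: eigenframe_operator inner_product_simps[OF g])
  qed
  then show ?thesis unfolding eigenframe_span by auto
qed

lemma eigenframe_dim_eigenspace: "dim {u. S u = k *\<^sub>R u} = card {i. d i = k}"
  unfolding eigenframe_eigenspace by (rule eigenframe_dim_span)

lemma eigenframe_eigenvalues: "{k. \<exists>u. u \<noteq> 0 \<and> S u = k *\<^sub>R u} = range d"
proof
  show "range d \<subseteq> {k. \<exists>u. u \<noteq> 0 \<and> S u = k *\<^sub>R u}"
    using eigenframe_eigen eigenframe_nonzero by blast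
  show "{k. \<exists>u. u \<noteq> 0 \<and> S u = k *\<^sub>R u} \<subseteq> range d"
  proof clarify
    fix k u assume u: "u \<noteq> 0" "S u = k *\<^sub>R u"
    show "k \<in> range d"
    proof (rule ccontr)
      assume "k \<notin> range d"
      then have "{i. d i = k} = {}" by auto
      then have "{u. S u = k *\<^sub>R u} = span {}" unfolding eigenframe_eigenspace by simp
      then show False using u by auto
    qed
  qed
qed

lemma eigenframe_resolvent_inj: "inj (\<lambda>u. u - t *\<^sub>R S u) \<longleftrightarrow> (\<forall>i. 1 - t * d i \<noteq> 0)"
proof -
  have l: "linear (\<lambda>u. u - t *\<^sub>R S u)"
    by (intro linearI) (simp_all add: linear_add[OF S] linear_scale[OF S] algebra_simps)
  show ?thesis
    unfolding linear_injective_0[OF l]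
  proof
    assume a: "\<forall>u. u - t *\<^sub>R S u = 0 \<longrightarrow> u = 0"
    show "\<forall>i. 1 - t * d i \<noteq> 0"
    proof (intro allI notI)
      fix i assume "1 - t * d i = 0"
      moreover have "f i - t *\<^sub>R S (f i) = (1 - t * d i) *\<^sub>R f i"
        by (simp add: eigenframe_eigen algebra_simps)
      ultimately have "f i - t *\<^sub>R S (f i) = 0" by simp
      then show False using a eigenframe_nonzero by blast
    qed
  next
    assume a: "\<forall>i. 1 - t * d i \<noteq> 0"
    show "\<forall>u. u - t *\<^sub>R S u = 0 \<longrightarrow> u = 0"
    proof (intro allI impI)
      fix u assume u: "u - t *\<^sub>R S u = 0"
      show "u = 0"
      proof (rule eigenframe_eqI)
        fix i
        have "g (f i) (u - t *\<^sub>R S u) = (1 - t * d i) * g (f i) u"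
          by (simp add: inner_product_simps[OF g] eigenframe_operator algebra_simps)
        then show "g (f i) u = g (f i) 0"
          using a u by (simp add: inner_product_simps[OF g])
      qed
    qed
  qed
qed

text \<open>The trace of the coordinate matrix does not see \<open>g\<close>; the vectors \<open>f i\<close> and the forms
  \<open>g (f i)\<close> are dual bases.\<close>

lemma eigenframe_trace: "trace (matrix S) = (\<Sum>i\<in>UNIV. d i)"
proof -
  have e: "S (axis k 1) $ k = (\<Sum>i\<in>UNIV. d i * (f i $ k * g (f i) (axis k 1)))" for k
  proof -
    have "S (axis k 1) = (\<Sum>i\<in>UNIV. g (f i) (S (axis k 1)) *\<^sub>R f i)" by (simp only: eigenframe_expand)
    also have "\<dots> $ k = (\<Sum>i\<in>UNIV. d i * (f i $ k * g (f i) (axis k 1)))"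
      by (simp add: eigenframe_operator sum_component algebra_simps)
    finally show ?thesis .
  qed
  have c: "(\<Sum>k\<in>UNIV. f i $ k * g (f i) (axis k 1)) = 1" for i
  proof -
    have "(\<Sum>k\<in>UNIV. f i $ k * g (f i) (axis k 1)) = g (f i) (\<Sum>k\<in>UNIV. f i $ k *\<^sub>R axis k 1)"
      by (simp add: inner_product_simps[OF g])
    also have "(\<Sum>k\<in>UNIV. f i $ k *\<^sub>R axis k 1) = f i"
      using basis_expansion[of "f i"] by (simp add: scalar_mult_eq_scaleR)
    finally show ?thesis by (simp add: eigenframe_ortho)
  qed
  have "trace (matrix S) = (\<Sum>k\<in>UNIV. \<Sum>i\<in>UNIV. d i * (f i $ k * g (f i) (axis k 1)))"
    by (simp add: trace_def matrix_def e)
  also have "\<dots> = (\<Sum>i\<in>UNIV. d i * (\<Sum>k\<in>UNIV. f i $ k * g (f i) (axis k 1)))"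
    by (subst sum.swap) (simp add: sum_distrib_left)
  finally show ?thesis by (simp add: c)
qed

end

lemma matrix_inv_left:
  fixes A :: "real ^ 'n ^ 'n"
  assumes "inj ((*v) A)"
  shows "matrix_inv A ** A = mat 1"
proof -
  obtain B where "B ** A = mat 1" using assms matrix_left_invertible_injective[of A] by auto
  then have "\<exists>B. A ** B = mat 1 \<and> B ** A = mat 1" using matrix_left_right_inverse by blast
  from someI_ex[OF this] show ?thesis unfolding matrix_inv_def by blast
qed

lemma gram_vector:
  fixes g :: "real ^ 'n \<Rightarrow> real ^ 'n::finite \<Rightarrow> real"
  assumes g: "inner_product g"
  shows "((\<chi> i j. g (axis i 1) (axis j 1)) *v u) $ i = g (axis i 1) u"
proof -
  have "g (axis i 1) u = g (axis i 1) (\<Sum>k\<in>UNIV. u $ k *\<^sub>R axis k 1)"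
    using basis_expansion[of u] by (simp add: scalar_mult_eq_scaleR)
  also have "\<dots> = (\<Sum>k\<in>UNIV. g (axis i 1) (axis k 1) * u $ k)"
    by (simp add: inner_product_simps(6,10)[OF g] mult.commute)
  finally show ?thesis by (simp add: matrix_vector_mult_def)
qed

lemma gram_inj:
  fixes g :: "real ^ 'n \<Rightarrow> real ^ 'n::finite \<Rightarrow> real"
  assumes g: "inner_product g"
  shows "inj ((*v) (\<chi> i j. g (axis i 1) (axis j 1)))"
  unfolding linear_injective_0[OF matrix_vector_mul_linear]
proof (intro allI impI)
  fix u assume "(\<chi> i j. g (axis i 1) (axis j 1)) *v u = 0"
  then have z: "g (axis i 1) u = 0" for i using gram_vector[OF g, of u i] by simp
  have "u = (\<Sum>k\<in>UNIV. u $ k *\<^sub>R axis k 1)"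
    using basis_expansion[of u] by (simp add: scalar_mult_eq_scaleR)
  then have "g u u = (\<Sum>k\<in>UNIV. u $ k * g (axis k 1) u)"
    by (metis (no_types, lifting) inner_product_simps(5,9)[OF g] sum.cong)
  then show "u = 0" using z inner_product_pos[OF g, of u] by force
qed

text \<open>The metric trace of a bilinear form is the trace of the operator that represents it.\<close>

lemma metric_trace:
  fixes g h :: "real ^ 'n \<Rightarrow> real ^ 'n::finite \<Rightarrow> real"
  assumes g: "inner_product g" and S: "\<And>u v. g (S u) v = h u v"
  defines "G \<equiv> \<chi> i j. g (axis i 1) (axis j 1)"
  shows "(\<Sum>i\<in>UNIV. \<Sum>j\<in>UNIV. matrix_inv G $ i $ j * h (axis i 1) (axis j 1)) = trace (matrix S)"
proof -
  have expand: "g (axis i 1) u = (\<Sum>k\<in>UNIV. G $ i $ k * u $ k)" for i u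
    using gram_vector[OF g, of u i] by (simp add: G_def matrix_vector_mult_def)
  have "inj ((*v) G)" unfolding G_def by (rule gram_inj[OF g])
  then have inv: "matrix_inv G ** G = mat 1" by (rule matrix_inv_left)
  have h: "h (axis i 1) (axis j 1) = (\<Sum>k\<in>UNIV. G $ j $ k * S (axis i 1) $ k)" for i j
    using expand[of j "S (axis i 1)"] S[of "axis i 1" "axis j 1"] inner_product_commute[OF g] by metis
  have "(\<Sum>i\<in>UNIV. \<Sum>j\<in>UNIV. matrix_inv G $ i $ j * h (axis i 1) (axis j 1))
      = (\<Sum>i\<in>UNIV. \<Sum>k\<in>UNIV. (\<Sum>j\<in>UNIV. matrix_inv G $ i $ j * G $ j $ k) * S (axis i 1) $ k)"
    unfolding h sum_distrib_left sum_distrib_right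
    by (rule sum.cong[OF refl], subst sum.swap) (simp add: mult.assoc)
  also have "\<dots> = (\<Sum>i\<in>UNIV. \<Sum>k\<in>UNIV. (matrix_inv G ** G) $ i $ k * S (axis i 1) $ k)"
    by (simp add: matrix_matrix_mult_def)
  also have "\<dots> = (\<Sum>i\<in>UNIV. S (axis i 1) $ i)"
    unfolding inv by (simp add: mat_def if_distrib[of "\<lambda>a. a * _"] cong: if_cong)
  also have "\<dots> = trace (matrix S)" by (simp add: trace_def matrix_def)
  finally show ?thesis .
qed

lemma eventually_nhds_all_finite:
  fixes P :: "'i::finite \<Rightarrow> 'a::topological_space \<Rightarrow> bool"
  assumes "\<And>i. \<forall>\<^sub>F x in nhds x0. P i x"
  shows "\<forall>\<^sub>F x in nhds x0. \<forall>i. P i x"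
  using assms by (simp add: eventually_all_finite)

lemma sum_abs_squared_le:
  fixes c :: "'n::finite \<Rightarrow> real"
  shows "(\<Sum>j\<in>UNIV. \<bar>c j\<bar>)\<^sup>2 \<le> real CARD('n) * (\<Sum>j\<in>UNIV. (c j)\<^sup>2)"
  using Cauchy_Schwarz_ineq_sum[of "\<lambda>_. 1" "\<lambda>j. \<bar>c j\<bar>" "UNIV :: 'n set"] by simp

lemma quadratic_form_bound:
  fixes c :: "'n::finite \<Rightarrow> real"
  assumes q: "\<And>j k. \<bar>q j k\<bar> \<le> \<eta>"
  shows "\<bar>\<Sum>j\<in>UNIV. \<Sum>k\<in>UNIV. c j * c k * q j k\<bar> \<le> \<eta> * (real CARD('n) * (\<Sum>j\<in>UNIV. (c j)\<^sup>2))"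
proof -
  have e: "\<eta> \<ge> 0" using q abs_ge_zero order_trans by blast
  have "\<bar>\<Sum>j\<in>UNIV. \<Sum>k\<in>UNIV. c j * c k * q j k\<bar> \<le> (\<Sum>j\<in>UNIV. \<Sum>k\<in>UNIV. \<bar>c j * c k * q j k\<bar>)"
    by (rule order_trans[OF sum_abs], rule sum_mono, rule sum_abs)
  also have "\<dots> \<le> (\<Sum>j\<in>UNIV. \<Sum>k\<in>UNIV. \<bar>c j\<bar> * \<bar>c k\<bar> * \<eta>)"
    by (intro sum_mono) (simp add: abs_mult mult_left_mono q)
  also have "\<dots> = \<eta> * (\<Sum>j\<in>UNIV. \<bar>c j\<bar>)\<^sup>2"
    by (simp add: power2_eq_square sum_product sum_distrib_left mult.commute mult.left_commute)
  also have "\<dots> \<le> \<eta> * (real CARD('n) * (\<Sum>j\<in>UNIV. (c j)\<^sup>2))"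
    by (intro mult_left_mono sum_abs_squared_le e)
  finally show ?thesis .
qed

text \<open>Eigenvalues cannot escape: on the eigenspace of \<open>S x0\<close> for \<open>l\<close>, the operator \<open>S x - l\<close>
  has norm below \<open>\<epsilon>\<close> for \<open>x\<close> near \<open>x0\<close>, while its norm is at least \<open>\<epsilon>\<close> on the span of the
  eigenvectors of \<open>S x\<close> with eigenvalues at distance at least \<open>\<epsilon>\<close> from \<open>l\<close>. So these two
  subspaces meet only in 0, and their dimensions add up to at most the total dimension.\<close>

theorem eigenvalues_near:
  fixes g :: "'p::euclidean_space \<Rightarrow> real ^ 'n \<Rightarrow> real ^ 'n::finite \<Rightarrow> real"
  assumes g: "\<forall>\<^sub>F x in nhds x0. inner_product (g x)" and S: "\<forall>\<^sub>F x in nhds x0. linear (S x)"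
    and cg: "\<And>u v. isCont (\<lambda>x. g x u v) x0" and cS: "\<And>u v. isCont (\<lambda>x. g x (S x u) v) x0"
    and cSS: "\<And>u v. isCont (\<lambda>x. g x (S x u) (S x v)) x0"
    and ef0: "eigenframe (g x0) (S x0) f0 d0" and e: "\<epsilon> > 0"
  shows "\<forall>\<^sub>F x in nhds x0. \<forall>f d. eigenframe (g x) (S x) f d \<longrightarrow>
     card {i. d0 i = l} \<le> card {i. \<bar>d i - l\<bar> < \<epsilon>}"
proof -
  define n where "n = real CARD('n)"
  have n: "n > 0" by (simp add: n_def)
  have g0: "inner_product (g x0)" and S0: "linear (S x0)" using g S eventually_nhds_x_imp_x by blast+
  define q where "q = (\<lambda>x j k. g x (S x (f0 j)) (S x (f0 k)) - l * g x (S x (f0 j)) (f0 k)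
      - l * g x (S x (f0 k)) (f0 j) + l * l * g x (f0 j) (f0 k))"
  \<comment> \<open>For \<open>u\<close> in the eigenspace, of squared norm \<open>C\<close> at \<open>x0\<close>, these bounds give at \<open>x\<close> a
    squared norm of at least \<open>C / 2\<close> for \<open>u\<close> and of at most \<open>\<epsilon>\<^sup>2 C / 4\<close> for \<open>(S x - l) u\<close>.\<close>
  have ev1: "\<forall>\<^sub>F x in nhds x0. \<forall>j k. \<bar>g x (f0 j) (f0 k) - g x0 (f0 j) (f0 k)\<bar> < 1 / (2 * n)"
    using tendstoD[OF isCont_nhds[OF cg], of "1 / (2 * n)"] n
    by (intro eventually_nhds_all_finite) (simp add: dist_real_def)
  have ev2: "\<forall>\<^sub>F x in nhds x0. \<forall>j k. \<bar>q x j k - q x0 j k\<bar> < \<epsilon>\<^sup>2 / (4 * n)"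
  proof (intro eventually_nhds_all_finite)
    fix j k
    have "isCont (\<lambda>x. q x j k) x0"
      unfolding q_def by (intro continuous_intros cg cS cSS)
    from tendstoD[OF isCont_nhds[OF this], of "\<epsilon>\<^sup>2 / (4 * n)"] n e
    show "\<forall>\<^sub>F x in nhds x0. \<bar>q x j k - q x0 j k\<bar> < \<epsilon>\<^sup>2 / (4 * n)" by (simp add: dist_real_def)
  qed
  have q0: "q x0 j k = 0" if "d0 j = l" "d0 k = l" for j k
    using that by (simp add: q_def eigenframe_eigen[OF g0 S0 ef0] inner_product_simps[OF g0]
        inner_product_commute[OF g0, of "f0 k" "f0 j"])
  show ?thesis using g S ev1 ev2
  proof eventually_elim
    case (elim x)
    show ?case
    proof (intro allI impI)
      fix f d assume ef: "eigenframe (g x) (S x) f d"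
      define J where "J = {i. d0 i = l}"
      define I where "I = {i. \<bar>d i - l\<bar> < \<epsilon>}"
      have "span (f0 ` J) \<inter> span (f ` (- I)) \<subseteq> {0}"
      proof
        fix u assume u: "u \<in> span (f0 ` J) \<inter> span (f ` (- I))"
        define c where "c = (\<lambda>j. g x0 (f0 j) u)"
        have cJ: "c j = 0" if "j \<notin> J" for j
          using u that unfolding eigenframe_span[OF g0 S0 ef0] c_def by auto
        have u_eq: "u = (\<Sum>j\<in>UNIV. c j *\<^sub>R f0 j)"
          unfolding c_def by (simp only: eigenframe_expand[OF g0 S0 ef0])
        define C where "C = (\<Sum>j\<in>UNIV. (c j)\<^sup>2)"
        note gs = inner_product_simps[OF elim(1)]
        define w where "w = S x u - l *\<^sub>R u"
        have Su: "S x u = (\<Sum>j\<in>UNIV. c j *\<^sub>R S x (f0 j))"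
          unfolding u_eq by (simp add: linear_sum[OF elim(2)] linear_scale[OF elim(2)])
        have w_eq: "w = (\<Sum>j\<in>UNIV. c j *\<^sub>R (S x (f0 j) - l *\<^sub>R f0 j))"
          unfolding w_def Su by (subst u_eq) (simp add: scaleR_diff_right sum_subtractf scaleR_sum_right mult.commute)
        have qx: "g x (S x (f0 j) - l *\<^sub>R f0 j) (S x (f0 k) - l *\<^sub>R f0 k) = q x j k" for j k
          unfolding q_def gs using inner_product_commute[OF elim(1), of "f0 j" "S x (f0 k)"]
          by (simp add: algebra_simps)
        have ww: "g x w w = (\<Sum>j\<in>UNIV. \<Sum>k\<in>UNIV. c j * c k * q x j k)"
          unfolding w_eq gs(9,10) gs(5,6) qx
          by (subst sum.swap) (simp add: sum_distrib_left mult.assoc mult.left_commute)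
        also have "\<dots> = (\<Sum>j\<in>UNIV. \<Sum>k\<in>UNIV. c j * c k * (q x j k - q x0 j k))"
        proof (intro sum.cong refl)
          fix j k show "c j * c k * q x j k = c j * c k * (q x j k - q x0 j k)"
            using cJ[of j] cJ[of k] q0[of j k] by (cases "j \<in> J"; cases "k \<in> J") (auto simp: J_def)
        qed
        also have "\<dots> \<le> \<epsilon>\<^sup>2 / (4 * n) * (n * C)"
          using quadratic_form_bound[of "\<lambda>j k. q x j k - q x0 j k" "\<epsilon>\<^sup>2 / (4 * n)" c] elim(4)
          unfolding n_def[symmetric] C_def[symmetric] by (meson abs_le_D1 less_imp_le)
        finally have up: "g x w w \<le> \<epsilon>\<^sup>2 * C / 4" using n by simp
        have "\<bar>\<Sum>j\<in>UNIV. \<Sum>k\<in>UNIV. c j * c k * (g x (f0 j) (f0 k) - g x0 (f0 j) (f0 k))\<bar> \<le> 1 / (2 * n) * (n * C)"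
          using quadratic_form_bound[of "\<lambda>j k. g x (f0 j) (f0 k) - g x0 (f0 j) (f0 k)" "1 / (2 * n)" c] elim(3)
          unfolding n_def[symmetric] C_def[symmetric] by (meson less_imp_le)
        moreover have "g y u u = (\<Sum>j\<in>UNIV. \<Sum>k\<in>UNIV. c j * c k * g y (f0 j) (f0 k))" if "inner_product (g y)" for y
          unfolding u_eq inner_product_simps(9,10)[OF that] inner_product_simps(5,6)[OF that]
          by (subst sum.swap) (simp add: sum_distrib_left mult.assoc mult.left_commute)
        moreover have "g x0 u u = C" unfolding C_def c_def by (rule eigenframe_norm[OF g0 S0 ef0])
        ultimately have "\<bar>g x u u - C\<bar> \<le> 1 / (2 * n) * (n * C)"
          using elim(1) g0 by (simp add: right_diff_distrib sum_subtractf)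
        then have "2 * \<bar>g x u u - C\<bar> \<le> C" using n by simp
        then have low: "g x u u \<ge> C / 2" by (simp add: abs_if split: if_splits)
        have gf: "g x (f i) w = (d i - l) * g x (f i) u" for i
          unfolding w_def gs eigenframe_operator[OF elim(1,2) ef] by (simp add: algebra_simps)
        have "\<epsilon>\<^sup>2 * g x u u \<le> g x w w"
          unfolding eigenframe_norm[OF elim(1,2) ef] gf sum_distrib_left
        proof (intro sum_mono)
          fix i show "\<epsilon>\<^sup>2 * (g x (f i) u)\<^sup>2 \<le> ((d i - l) * g x (f i) u)\<^sup>2"
          proof (cases "i \<in> I")
            case True
            then have "g x (f i) u = 0" using u unfolding eigenframe_span[OF elim(1,2) ef] by auto
            then show ?thesis by simp
          next
            case False
            then have "\<epsilon>\<^sup>2 \<le> (d i - l)\<^sup>2" using e abs_le_square_iff[of \<epsilon> "d i - l"] by (simp add: I_def)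
            then show ?thesis by (simp add: power_mult_distrib mult_right_mono)
          qed
        qed
        then have "\<epsilon>\<^sup>2 * (C / 2) \<le> \<epsilon>\<^sup>2 * C / 4"
          using up mult_left_mono[OF low zero_le_power2[of \<epsilon>]] by linarith
        then have "C \<le> 0" using e by (simp add: field_simps mult_le_0_iff)
        then have "g x0 u u \<le> 0" using \<open>g x0 u u = C\<close> by simp
        then show "u \<in> {0}" using inner_product_pos[OF g0, of u] by force
      qed
      then have z: "dim (span (f0 ` J) \<inter> span (f ` (- I))) = 0" using dim_subset[of _ "{0::real^'n}"] by force
      have "dim (span (f0 ` J)) + dim (span (f ` (- I))) \<le> CARD('n)"
        using dim_sums_Int[OF subspace_span subspace_span, of "f0 ` J" "f ` (- I)"] z
          dim_subset_UNIV_cart[of "{x + y |x y. x \<in> span (f0 ` J) \<and> y \<in> span (f ` (- I))}"] by linarith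
      then have "card J + card (- I) \<le> CARD('n)"
        by (simp only: eigenframe_dim_span[OF g0 S0 ef0] eigenframe_dim_span[OF elim(1,2) ef])
      moreover have "card (- I) = CARD('n) - card I" by (simp add: Compl_eq_Diff_UNIV card_Diff_subset)
      moreover have "card I \<le> CARD('n)" by (simp add: card_mono)
      ultimately show "card {i. d0 i = l} \<le> card {i. \<bar>d i - l\<bar> < \<epsilon>}" unfolding J_def I_def by linarith
    qed
  qed
qed

text \<open>The spectrum near \<open>x0\<close> splits into clusters around the eigenvalues at \<open>x0\<close>, each with at
  least the original multiplicity and hence with exactly that multiplicity. If the number of
  distinct eigenvalues does not grow, each cluster is a single eigenvalue.\<close>

theorem eigenvalue_clusters:
  fixes g :: "'p::euclidean_space \<Rightarrow> real ^ 'n \<Rightarrow> real ^ 'n::finite \<Rightarrow> real"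
  assumes g: "\<forall>\<^sub>F x in nhds x0. inner_product (g x)" and S: "\<forall>\<^sub>F x in nhds x0. linear (S x)"
    and cg: "\<And>u v. isCont (\<lambda>x. g x u v) x0" and cS: "\<And>u v. isCont (\<lambda>x. g x (S x u) v) x0"
    and cSS: "\<And>u v. isCont (\<lambda>x. g x (S x u) (S x v)) x0"
    and ef0: "eigenframe (g x0) (S x0) f0 d0"
  shows "\<forall>\<^sub>F x in nhds x0. \<forall>f d. eigenframe (g x) (S x) f d \<longrightarrow>
     card (range d0) \<le> card (range d) \<and>
     (card (range d) = card (range d0) \<longrightarrow>
        (\<exists>\<kappa>. inj_on \<kappa> (range d0) \<and> range d = \<kappa> ` range d0 \<and>
           (\<forall>l\<in>range d0. card {i. d i = \<kappa> l} = card {i. d0 i = l})))"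
proof -
  define R where "R = range d0"
  have R: "finite R" "R \<noteq> {}" by (auto simp: R_def)
  obtain \<epsilon> where e: "\<epsilon> > 0" "\<And>l l'. l \<in> R \<Longrightarrow> l' \<in> R \<Longrightarrow> l \<noteq> l' \<Longrightarrow> 2 * \<epsilon> \<le> \<bar>l - l'\<bar>"
  proof -
    define D where "D = insert 1 ((\<lambda>(l, l'). \<bar>l - l'\<bar>) ` {(l, l'). l \<in> R \<and> l' \<in> R \<and> l \<noteq> l'})"
    have "finite {(l, l'). l \<in> R \<and> l' \<in> R \<and> l \<noteq> l'}"
      by (rule finite_subset[of _ "R \<times> R"]) (auto simp: R)
    then have D: "finite D" "D \<noteq> {}" by (auto simp: D_def)
    show thesis
    proof
      show "Min D / 2 > 0" using Min_in[OF D] by (auto simp: D_def)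
      show "2 * (Min D / 2) \<le> \<bar>l - l'\<bar>" if "l \<in> R" "l' \<in> R" "l \<noteq> l'" for l l'
        using that by (simp, intro Min_le D) (auto simp: D_def)
    qed
  qed
  have "\<forall>\<^sub>F x in nhds x0. \<forall>l\<in>R. \<forall>f d. eigenframe (g x) (S x) f d \<longrightarrow>
     card {i. d0 i = l} \<le> card {i. \<bar>d i - l\<bar> < \<epsilon>}"
    using eigenvalues_near[OF g S cg cS cSS ef0 e(1)] by (intro eventually_ball_finite R) auto
  then show ?thesis
  proof eventually_elim
    case (elim x)
    show ?case
    proof (intro allI impI)
      fix f d assume ef: "eigenframe (g x) (S x) f d"
      define I where "I = (\<lambda>l. {i. \<bar>d i - l\<bar> < \<epsilon>})"
      have le: "card {i. d0 i = l} \<le> card (I l)" if "l \<in> R" for l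
        using elim ef that by (auto simp: I_def)
      have disj_d: "d i \<noteq> d j" if "l \<in> R" "l' \<in> R" "l \<noteq> l'" "i \<in> I l" "j \<in> I l'" for l l' i j
        using e(2)[OF that(1-3)] that(4,5) unfolding I_def by (auto simp: abs_if split: if_splits)
      have disj: "I l \<inter> I l' = {}" if "l \<in> R" "l' \<in> R" "l \<noteq> l'" for l l'
        using disj_d[OF that] by blast
      have cU: "card (\<Union>l\<in>R. I l) = (\<Sum>l\<in>R. card (I l))"
        using R disj by (intro card_UN_disjoint) auto
      have c0: "(\<Sum>l\<in>R. card {i. d0 i = l}) = CARD('n)"
      proof -
        have "(\<Sum>l\<in>R. card {i. d0 i = l}) = card (\<Union>l\<in>R. {i. d0 i = l})"
          using R by (intro card_UN_disjoint[symmetric]) auto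
        also have "(\<Union>l\<in>R. {i. d0 i = l}) = UNIV" by (auto simp: R_def)
        finally show ?thesis .
      qed
      have cn: "card (\<Union>l\<in>R. I l) \<le> CARD('n)" by (simp add: card_mono)
      have eq: "card (I l) = card {i. d0 i = l}" if "l \<in> R" for l
      proof (rule ccontr)
        assume "card (I l) \<noteq> card {i. d0 i = l}"
        then have "(\<Sum>l\<in>R. card {i. d0 i = l}) < (\<Sum>l\<in>R. card (I l))"
          using le that R by (intro sum_strict_mono_ex1) force+
        then show False using cU c0 cn by simp
      qed
      have "card (\<Union>l\<in>R. I l) = CARD('n)" using cU c0 eq by simp
      then have cover: "(\<Union>l\<in>R. I l) = UNIV" by (simp add: card_eq_UNIV_imp_eq_UNIV)
      have ne: "I l \<noteq> {}" if "l \<in> R" for l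
      proof -
        have "{i. d0 i = l} \<noteq> {}" using that by (auto simp: R_def)
        then have "0 < card {i. d0 i = l}" by (simp add: card_gt_0_iff)
        then show ?thesis using eq[OF that] by auto
      qed
      have rd: "range d = (\<Union>l\<in>R. d ` I l)" by (simp only: image_UN[symmetric] cover)
      have cd: "card (range d) = (\<Sum>l\<in>R. card (d ` I l))"
        unfolding rd
      proof (intro card_UN_disjoint ballI impI)
        show "d ` I l \<inter> d ` I l' = {}" if "l \<in> R" "l' \<in> R" "l \<noteq> l'" for l l'
          using disj_d[OF that] by blast
      qed (use R in auto)
      have ge1: "1 \<le> card (d ` I l)" if "l \<in> R" for l
        using ne[OF that] by (simp add: Suc_le_eq card_gt_0_iff)
      have "card R = (\<Sum>l\<in>R. 1)" by simp
      also have "\<dots> \<le> card (range d)" unfolding cd by (intro sum_mono ge1)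
      finally have A: "card R \<le> card (range d)" .
      have B: "\<exists>\<kappa>. inj_on \<kappa> R \<and> range d = \<kappa> ` R \<and> (\<forall>l\<in>R. card {i. d i = \<kappa> l} = card {i. d0 i = l})"
        if cr: "card (range d) = card R"
      proof -
        have one: "card (d ` I l) = 1" if "l \<in> R" for l
        proof (rule ccontr)
          assume "card (d ` I l) \<noteq> 1"
          then have "(\<Sum>l\<in>R. 1) < (\<Sum>l\<in>R. card (d ` I l))"
            using ge1 that R by (intro sum_strict_mono_ex1) force+
          then show False using cd cr by simp
        qed
        then have "\<forall>l\<in>R. \<exists>k. d ` I l = {k}" by (auto simp: card_1_singleton_iff)
        then obtain \<kappa> where k: "\<And>l. l \<in> R \<Longrightarrow> d ` I l = {\<kappa> l}" by metis
        have kI: "{i. d i = \<kappa> l} = I l" if l: "l \<in> R" for l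
        proof
          show "I l \<subseteq> {i. d i = \<kappa> l}" using k[OF l] by auto
          show "{i. d i = \<kappa> l} \<subseteq> I l"
          proof
            fix i assume i: "i \<in> {i. d i = \<kappa> l}"
            obtain l' where l': "l' \<in> R" "i \<in> I l'" using cover by auto
            obtain j where j: "j \<in> I l" "d j = \<kappa> l" using k[OF l] by (metis imageE singletonI)
            have "l' = l" using disj_d[OF l l'(1) _ j(1) l'(2)] i j by auto
            then show "i \<in> I l" using l' by simp
          qed
        qed
        have "inj_on \<kappa> R"
        proof (rule inj_onI, rule ccontr)
          fix l l' assume l: "l \<in> R" "l' \<in> R" "\<kappa> l = \<kappa> l'" "l \<noteq> l'"
          then have "I l = I l'" using kI by metis
          then show False using disj[of l l'] ne[of l] l by auto
        qed
        moreover have "range d = \<kappa> ` R" unfolding rd using k by auto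
        ultimately show ?thesis using kI eq by auto
      qed
      show "card (range d0) \<le> card (range d) \<and> (card (range d) = card (range d0) \<longrightarrow>
        (\<exists>\<kappa>. inj_on \<kappa> (range d0) \<and> range d = \<kappa> ` range d0 \<and>
           (\<forall>l\<in>range d0. card {i. d i = \<kappa> l} = card {i. d0 i = l})))"
        using A B unfolding R_def by blast
    qed
  qed
qed

section \<open>Spacelike submanifolds of codimension two in Minkowski space\<close>

lemma bounded_bilinear_mink: "bounded_bilinear (mink :: 'n::finite mink \<Rightarrow> 'n mink \<Rightarrow> real)"
  unfolding bilinear_conv_bounded_bilinear[symmetric] bilinear_def
  by (auto intro!: linearI simp: mink_def inner_add_left inner_add_right algebra_simps)

interpretation mk: bounded_bilinear "mink :: 'n::finite mink \<Rightarrow> 'n mink \<Rightarrow> real"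
  by (rule bounded_bilinear_mink)

lemma mink_commute: "mink a b = mink b a"
  by (simp add: mink_def inner_commute mult.commute)

lemma Ck_on_mink: "open S \<Longrightarrow> Ck_on k f S \<Longrightarrow> Ck_on k g S \<Longrightarrow> Ck_on k (\<lambda>x. mink (f x) (g x)) S"
  by (rule Ck_on_bilinear[OF _ bounded_bilinear_mink])

lemma ind_metric_inner_product:
  assumes "\<psi> differentiable (at x)" "\<And>u. u \<noteq> 0 \<Longrightarrow> 0 < ind_metric \<psi> x u u"
  shows "inner_product (ind_metric \<psi> x)"
proof -
  have l: "linear (D1 \<psi> x)" by (rule linear_frechet_derivative[OF assms(1)])
  show ?thesis using assms(2)
    by (auto simp: inner_product_def ind_metric_def linear_add[OF l] linear_scale[OF l] mk.add_right
        mk.scaleR_right intro!: linearI intro: mink_commute)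
qed

lemma spacelike_inner_product:
  "spacelike \<Omega> \<psi> \<Longrightarrow> x \<in> \<Omega> \<Longrightarrow> \<psi> differentiable (at x) \<Longrightarrow> inner_product (ind_metric \<psi> x)"
  by (rule ind_metric_inner_product) (auto simp: spacelike_def)

lemma spacelike_nondegenerate: "spacelike \<Omega> \<psi> \<Longrightarrow> nondegenerate_metric \<Omega> \<psi>"
  unfolding spacelike_def nondegenerate_metric_def by (metis less_irrefl)

lemma Ck_on_ind_metric:
  assumes "open S" "Ck_on (Suc k) \<psi> S"
  shows "Ck_on k (\<lambda>x. ind_metric \<psi> x u v) S"
  unfolding ind_metric_def by (intro Ck_on_mink assms(1) Ck_on_D1[OF assms(2)])

lemma D2_linear_left:
  assumes "open S" "x \<in> S" "Ck_on 2 f S"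
  shows "linear (\<lambda>u. D2 f x u v)"
  unfolding D2_def using assms by (intro linear_frechet_derivative) (auto simp: numeral_2_eq_2)

lemma D2_linear_right:
  fixes f :: "'a::euclidean_space \<Rightarrow> 'b::euclidean_space"
  assumes "open S" "x \<in> S" "Ck_on 2 f S"
  shows "linear (\<lambda>v. D2 f x u v)"
  using D2_linear_left[OF assms, of u] D2_symmetric[OF assms] by simp

lemma Ck_on_D2:
  assumes "Ck_on (Suc (Suc k)) f S"
  shows "Ck_on k (\<lambda>x. D2 f x u v) S"
  unfolding D2_def by (rule Ck_on_D1[OF Ck_on_D1[OF assms]])

subsection \<open>The normal space at a point\<close>

context
  fixes \<psi> :: "real ^ 'n \<Rightarrow> 'n::finite mink" and x :: "real ^ 'n"
  assumes lin: "linear (D1 \<psi> x)" and ip: "inner_product (ind_metric \<psi> x)"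
begin

definition tangent_part :: "'n mink \<Rightarrow> real ^ 'n" where
  "tangent_part w = riesz (ind_metric \<psi> x) (\<lambda>v. mink w (D1 \<psi> x v))"

lemma tangent_part: "mink (D1 \<psi> x (tangent_part w)) (D1 \<psi> x v) = mink w (D1 \<psi> x v)"
proof -
  have "linear (\<lambda>v. mink w (D1 \<psi> x v))"
    by (intro linearI) (simp_all add: linear_add[OF lin] linear_scale[OF lin] mk.add_right mk.scaleR_right)
  from riesz_works[OF ip this, of v] show ?thesis by (simp add: tangent_part_def ind_metric_def)
qed

lemma normal_tangent_zero:
  assumes "z \<in> normal_space \<psi> x" "z = D1 \<psi> x u"
  shows "z = 0"
proof -
  have "ind_metric \<psi> x u u = 0" using assms by (simp add: normal_space_def ind_metric_def)
  then have "u = 0" using inner_product_pos[OF ip, of u] by force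
  then show ?thesis using assms(2) linear_0[OF lin] by simp
qed

lemma subspace_normal_space: "subspace (normal_space \<psi> x)"
  by (auto simp: subspace_def normal_space_def mk.add_left mk.scaleR_left mk.zero_left)

lemma normal_proj_eq: "normal_proj \<psi> x w = w - D1 \<psi> x (tangent_part w)"
  unfolding normal_proj_def
proof (rule the_equality)
  show "w - D1 \<psi> x (tangent_part w) \<in> normal_space \<psi> x \<and>
     w - (w - D1 \<psi> x (tangent_part w)) \<in> range (D1 \<psi> x)"
    by (auto simp: normal_space_def mk.diff_left tangent_part)
  fix z assume z: "z \<in> normal_space \<psi> x \<and> w - z \<in> range (D1 \<psi> x)"
  then obtain u where u: "w - z = D1 \<psi> x u" by auto
  define y where "y = w - D1 \<psi> x (tangent_part w) - z"
  have "y = D1 \<psi> x (u - tangent_part w)" using u by (simp add: y_def linear_diff[OF lin] algebra_simps)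
  moreover have "y \<in> normal_space \<psi> x"
    using z by (simp add: y_def normal_space_def mk.diff_left tangent_part)
  ultimately have "y = 0" using normal_tangent_zero by blast
  then show "z = w - D1 \<psi> x (tangent_part w)" by (simp add: y_def)
qed

lemma normal_proj_normal: "normal_proj \<psi> x w \<in> normal_space \<psi> x"
  by (simp add: normal_proj_eq normal_space_def mk.diff_left tangent_part)

lemma mink_normal_proj: "n \<in> normal_space \<psi> x \<Longrightarrow> mink (normal_proj \<psi> x w) n = mink w n"
  by (simp add: normal_proj_eq mk.diff_right normal_space_def mink_commute[of _ n])

lemma normal_proj_ident:
  assumes "w \<in> normal_space \<psi> x"
  shows "normal_proj \<psi> x w = w"
proof -
  have "D1 \<psi> x (tangent_part w) = w - normal_proj \<psi> x w" by (simp add: normal_proj_eq)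
  then have "D1 \<psi> x (tangent_part w) \<in> normal_space \<psi> x"
    using assms normal_proj_normal subspace_diff[OF subspace_normal_space] by simp
  then have "D1 \<psi> x (tangent_part w) = 0" using normal_tangent_zero by blast
  then show ?thesis by (simp add: normal_proj_eq)
qed

lemma sff_normal: "sff \<psi> x u v \<in> normal_space \<psi> x"
  unfolding sff_def by (rule normal_proj_normal)

lemma mink_sff: "n \<in> normal_space \<psi> x \<Longrightarrow> mink (sff \<psi> x u v) n = mink (D2 \<psi> x u v) n"
  unfolding sff_def by (rule mink_normal_proj)

lemma mean_curv_normal: "mean_curv_vec \<psi> x \<in> normal_space \<psi> x"
  unfolding mean_curv_vec_def
  by (intro subspace_scale[OF subspace_normal_space] subspace_sum[OF subspace_normal_space] sff_normal)

text \<open>With \<open>W u\<close> the part of the tangent vector orthogonal to \<open>N\<close> in Euclidean space, the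
  vectors \<open>W u\<close> and \<open>N\<close> span the Euclidean factor; so a normal vector orthogonal to the null
  normal \<open>(N, 1)\<close> has no component besides the one along it.\<close>

lemma normal_orthogonal_null:
  assumes N: "(N, 1) \<in> normal_space \<psi> x" "norm N = 1"
    and w: "w \<in> normal_space \<psi> x" "mink w (N, 1) = 0"
  shows "w = snd w *\<^sub>R (N, 1)"
proof -
  define W where "W = (\<lambda>u. fst (D1 \<psi> x u) - snd (D1 \<psi> x u) *\<^sub>R N)"
  have NN: "N \<bullet> N = 1" using N(2) by (simp add: dot_square_norm)
  have ND: "N \<bullet> fst (D1 \<psi> x u) = snd (D1 \<psi> x u)" for u
    using N(1) by (simp add: normal_space_def mink_def)
  have WN: "W u \<bullet> N = 0" for u 
    using ND[of u] inner_commute[of N "fst (D1 \<psi> x u)"] by (simp add: W_def inner_diff_left NN)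
  have WW: "W u \<bullet> W u = ind_metric \<psi> x u u" for u
  proof -
    have "W u \<bullet> W u = fst (D1 \<psi> x u) \<bullet> fst (D1 \<psi> x u) - 2 * snd (D1 \<psi> x u) * (N \<bullet> fst (D1 \<psi> x u))
        + snd (D1 \<psi> x u) * snd (D1 \<psi> x u) * (N \<bullet> N)"
      using inner_commute[of N "fst (D1 \<psi> x u)"]
      by (simp add: W_def inner_diff_left inner_diff_right algebra_simps)
    then show ?thesis by (simp add: NN ND ind_metric_def mink_def)
  qed
  have linW: "linear W"
    by (intro linearI) (simp_all add: W_def linear_add[OF lin] linear_scale[OF lin] algebra_simps)
  define L where "L = (\<lambda>p :: (real ^ 'n) \<times> real. W (fst p) + snd p *\<^sub>R N)"
  have linL: "linear L"
    by (intro linearI) (simp_all add: L_def linear_add[OF linW] linear_scale[OF linW] algebra_simps)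
  have "inj L"
    unfolding linear_injective_0[OF linL]
  proof (intro allI impI)
    fix p assume p: "L p = 0"
    then have "L p \<bullet> N = 0" by simp
    then have s: "snd p = 0" by (simp add: L_def inner_add_left WN NN)
    then have "W (fst p) \<bullet> W (fst p) = 0" using p by (simp add: L_def)
    then have "fst p = 0" using inner_product_pos[OF ip, of "fst p"] WW by force
    then show "p = 0" using s by (simp add: prod_eq_iff)
  qed
  then have "surj L" using linear_injective_imp_surjective[OF linL] by blast
  define y where "y = fst w - snd w *\<^sub>R N"
  have yN: "y \<bullet> N = 0" using w(2) by (simp add: y_def inner_diff_left NN mink_def)
  have yD: "y \<bullet> fst (D1 \<psi> x u) = 0" for u
    using w(1) ND[of u] by (simp add: y_def inner_diff_left normal_space_def mink_def)
  have "y \<bullet> L p = 0" for p by (simp add: L_def W_def inner_add_right inner_diff_right yN yD)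
  then have "y \<bullet> y = 0" using \<open>surj L\<close> by (metis surjD)
  then show ?thesis by (simp add: y_def prod_eq_iff)
qed

end

lemma null_normal_snd_nonzero:
  assumes "null_normal \<psi> x w"
  shows "snd w \<noteq> 0"
proof
  assume "snd w = 0"
  moreover from this have "fst w \<bullet> fst w = 0" using assms by (simp add: null_normal_def mink_def)
  ultimately show False using assms by (simp add: null_normal_def prod_eq_iff)
qed

lemma null_normal_normalise:
  assumes "null_normal \<psi> x w"
  defines "N \<equiv> (1 / snd w) *\<^sub>R fst w"
  shows "(N, 1) \<in> normal_space \<psi> x" "norm N = 1" "w = snd w *\<^sub>R (N, 1)"
proof -
  have s: "snd w \<noteq> 0" by (rule null_normal_snd_nonzero[OF assms(1)])
  then show w: "w = snd w *\<^sub>R (N, 1)" by (simp add: N_def prod_eq_iff)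
  have "fst w \<bullet> fst w = snd w * snd w" using assms(1) by (simp add: null_normal_def mink_def)
  then have "N \<bullet> N = 1" using s by (simp add: N_def)
  then show "norm N = 1" by (simp add: norm_eq_sqrt_inner)
  have "snd w * mink (N, 1) (D1 \<psi> x u) = 0" for u
  proof -
    have "snd w * mink (N, 1) (D1 \<psi> x u) = mink (snd w *\<^sub>R (N, 1)) (D1 \<psi> x u)" by (simp only: mk.scaleR_left, simp)
    also have "\<dots> = 0" using assms(1) unfolding w[symmetric] by (simp add: null_normal_def normal_space_def)
    finally show ?thesis .
  qed
  then show "(N, 1) \<in> normal_space \<psi> x" using s by (simp add: normal_space_def)
qed

lemma null_normal_unit:
  assumes "(N, 1) \<in> normal_space \<psi> x" "norm N = 1"
  shows "null_normal \<psi> x (N, 1)"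
  using assms by (simp add: null_normal_def mink_def dot_square_norm zero_prod_def)

subsection \<open>The shape operator of a normal field\<close>

definition null_shape :: "(real ^ 'n \<Rightarrow> 'n::finite mink) \<Rightarrow> real ^ 'n \<Rightarrow> 'n mink \<Rightarrow> real ^ 'n \<Rightarrow> real ^ 'n" where
  "null_shape \<psi> x n u = riesz (ind_metric \<psi> x) (\<lambda>v. mink (D2 \<psi> x u v) n)"

context
  fixes \<psi> :: "real ^ 'n \<Rightarrow> 'n::finite mink" and \<Omega> x
  assumes \<Omega>: "open \<Omega>" "x \<in> \<Omega>" and C2: "Ck_on 2 \<psi> \<Omega>" and ip: "inner_product (ind_metric \<psi> x)"
begin

lemma null_shape: "ind_metric \<psi> x (null_shape \<psi> x n u) v = mink (D2 \<psi> x u v) n"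
proof -
  have "linear (\<lambda>v. mink (D2 \<psi> x u v) n)"
    using linear_add[OF D2_linear_right[OF \<Omega> C2]] linear_scale[OF D2_linear_right[OF \<Omega> C2]]
    by (intro linearI) (simp_all add: mk.add_left mk.scaleR_left)
  from riesz_works[OF ip this] show ?thesis by (simp add: null_shape_def)
qed

lemma null_shape_unique:
  assumes "\<And>v. ind_metric \<psi> x w v = mink (D2 \<psi> x u v) n"
  shows "null_shape \<psi> x n u = w"
  by (rule inner_product_eqI[OF ip]) (simp add: null_shape assms)

lemma null_shape_linear: "linear (null_shape \<psi> x n)"
  by (intro linearI; rule null_shape_unique)
    (simp_all add: null_shape inner_product_simps[OF ip] linear_add[OF D2_linear_left[OF \<Omega> C2]]
       linear_scale[OF D2_linear_left[OF \<Omega> C2]] mk.add_left mk.scaleR_left)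

lemma null_shape_self_adjoint:
  "ind_metric \<psi> x (null_shape \<psi> x n u) v = ind_metric \<psi> x u (null_shape \<psi> x n v)"
  using null_shape[of n u v] null_shape[of n v u] inner_product_commute[OF ip] D2_symmetric[OF \<Omega> C2, of u v]
  by simp

lemma null_shape_eigenframe: "\<exists>f d. eigenframe (ind_metric \<psi> x) (null_shape \<psi> x n) f d"
proof (rule spectral_theorem[OF ip null_shape_linear])
  show "ind_metric \<psi> x (null_shape \<psi> x n u) v = ind_metric \<psi> x u (null_shape \<psi> x n v)" for u v
    by (rule null_shape_self_adjoint)
qed

text \<open>Pairing with \<open>n\<close> turns the second fundamental form into the bilinear form represented by
  the shape operator.\<close>

lemma mean_curv_trace:
  assumes "n \<in> normal_space \<psi> x"
  shows "mink (mean_curv_vec \<psi> x) n = trace (matrix (null_shape \<psi> x n)) / real CARD('n)"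
proof -
  have lin: "linear (D1 \<psi> x)"
    by (rule linear_frechet_derivative[OF Ck_on_differentiable[OF C2 _ \<Omega>(2)]]) simp
  have "(\<Sum>i\<in>UNIV. \<Sum>j\<in>UNIV. matrix_inv (gram \<psi> x) $ i $ j * mink (D2 \<psi> x (axis i 1) (axis j 1)) n)
     = trace (matrix (null_shape \<psi> x n))"
    unfolding gram_def by (rule metric_trace[OF ip null_shape])
  then show ?thesis
    by (simp add: mean_curv_vec_def mk.scaleR_left mk.sum_left mink_sff[OF lin ip assms])
qed

text \<open>In the Lorentzian normal plane, being a multiple of a null vector is the same as being
  orthogonal to it.\<close>

lemma mean_curv_null_iff_trace:
  assumes N: "(N, 1) \<in> normal_space \<psi> x" "norm N = 1"
  shows "trace (matrix (null_shape \<psi> x (N, 1))) = 0 \<longleftrightarrow> (\<exists>b. mean_curv_vec \<psi> x = b *\<^sub>R (N, 1))"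
proof
  have lin: "linear (D1 \<psi> x)"
    by (rule linear_frechet_derivative[OF Ck_on_differentiable[OF C2 _ \<Omega>(2)]]) simp
  assume "trace (matrix (null_shape \<psi> x (N, 1))) = 0"
  then have "mink (mean_curv_vec \<psi> x) (N, 1) = 0" by (simp add: mean_curv_trace[OF N(1)])
  then show "\<exists>b. mean_curv_vec \<psi> x = b *\<^sub>R (N, 1)"
    using normal_orthogonal_null[OF lin ip N mean_curv_normal[OF lin ip]] by blast
next
  have "mink (N, 1) (N, 1) = 0" using N(2) by (simp add: mink_def dot_square_norm)
  moreover assume "\<exists>b. mean_curv_vec \<psi> x = b *\<^sub>R (N, 1)"
  ultimately have "mink (mean_curv_vec \<psi> x) (N, 1) = 0" by (auto simp only: mk.scaleR_left) simp
  then show "trace (matrix (null_shape \<psi> x (N, 1))) = 0" by (simp add: mean_curv_trace[OF N(1)])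
qed

end

subsection \<open>Regularity and derivative of a null normal field\<close>

text \<open>The field \<open>N\<close> is an implicit solution: \<open>(N, 1)\<close> is orthogonal to the tangent vectors,
  and \<open>N\<close> has norm 1. A solution \<open>e\<close> of the linearised equations gives a normal vector
  \<open>(e, 0)\<close> orthogonal to \<open>(N, 1)\<close>, hence a multiple of \<open>(N, 1)\<close>, hence 0.\<close>

lemma Ck_on_null_normal:
  fixes \<psi> :: "real ^ 'n \<Rightarrow> 'n::finite mink"
  assumes V: "open V" and \<psi>: "Ck_on (Suc k) \<psi> V" and ip: "\<And>x. x \<in> V \<Longrightarrow> inner_product (ind_metric \<psi> x)"
    and N: "continuous_on V N" "\<And>x. x \<in> V \<Longrightarrow> norm (N x) = 1"
    and n: "\<And>x. x \<in> V \<Longrightarrow> (N x, 1) \<in> normal_space \<psi> x"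
  shows "Ck_on k N V"
proof (cases "k = 0")
  case True
  then show ?thesis using N(1) by simp
next
  case False
  define a where "a = (\<lambda>i x. D1 \<psi> x (axis i 1))"
  have a: "Ck_on k (a i) V" for i unfolding a_def by (rule Ck_on_D1[OF \<psi>])
  define W where "W = V \<times> (UNIV :: ((real ^ 'n) \<times> real) set)"
  have W: "open W" using V by (simp add: W_def open_Times)
  define F where "F = (\<lambda>p. (\<chi> i. snd p \<bullet> fst (a i (fst p)) - snd (a i (fst p)), snd p \<bullet> snd p - 1))"
  have aW: "Ck_on k (\<lambda>p. a i (fst p)) W" for i
    by (rule Ck_on_comp[where f = fst and g = "a i", OF W V _ a]) (auto simp: W_def intro: Ck_on_fst W[unfolded W_def] Ck_on_id)
  have F: "Ck_on k F W"
    unfolding F_def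
    by (intro Ck_on_Pair Ck_on_vec_lambda Ck_on_diff Ck_on_inner Ck_on_const Ck_on_fst[OF W aW] Ck_on_snd[OF W aW]
        Ck_on_snd[OF W Ck_on_id] W)
  show ?thesis
  proof (rule Ck_on_implicit[OF V W F _ N(1)])
    show "0 < k" using False by simp
    fix x assume x: "x \<in> V"
    have lin: "linear (D1 \<psi> x)"
      by (rule linear_frechet_derivative[OF Ck_on_differentiable[OF \<psi> _ x]]) simp
    show xW: "(x, N x) \<in> W" using x by (simp add: W_def)
    show "F (x, N x) = 0"
      using n[OF x] N(2)[OF x]
      by (simp add: F_def normal_space_def mink_def a_def zero_prod_def dot_square_norm vec_eq_iff)
    have dF: "(F has_derivative D1 F (x, N x)) (at (x, N x))"
      by (rule Ck_on_has_derivative[OF F _ xW]) (use False in simp)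
    have "((\<lambda>z. F (x, z)) has_derivative (\<lambda>e. D1 F (x, N x) (0, e))) (at (N x))"
      by (rule has_derivative_compose[where f = "\<lambda>z. (x, z)", OF _ dF])
        (intro has_derivative_Pair has_derivative_const has_derivative_ident)
    moreover have "((\<lambda>z. F (x, z)) has_derivative (\<lambda>e. (\<chi> i. e \<bullet> fst (a i x), 2 * (N x \<bullet> e)))) (at (N x))"
    proof -
      have "((\<lambda>z. \<chi> i. z \<bullet> fst (a i x) - snd (a i x)) has_derivative (\<lambda>e. \<chi> i. e \<bullet> fst (a i x))) (at (N x))"
      proof -
        have "linear (\<lambda>e. \<chi> i. e \<bullet> fst (a i x))"
          by (intro linearI) (simp_all add: vec_eq_iff inner_add_left)
        then have "((\<lambda>e. \<chi> i. e \<bullet> fst (a i x)) has_derivative (\<lambda>e. \<chi> i. e \<bullet> fst (a i x))) (at (N x))"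
          by (simp add: bounded_linear_imp_has_derivative linear_conv_bounded_linear)
        from has_derivative_diff[OF this has_derivative_const[of "\<chi> i. snd (a i x)"]]
        show ?thesis by (simp add: minus_vec_def)
      qed
      moreover have "((\<lambda>z. z \<bullet> z - 1) has_derivative (\<lambda>e. 2 * (N x \<bullet> e))) (at (N x))"
        by (auto intro!: derivative_eq_intros simp: inner_commute)
      ultimately show ?thesis unfolding F_def fst_conv snd_conv by (rule has_derivative_Pair)
    qed
    ultimately have D: "(\<lambda>e. D1 F (x, N x) (0, e)) = (\<lambda>e. (\<chi> i. e \<bullet> fst (a i x), 2 * (N x \<bullet> e)))"
      by (rule has_derivative_unique)
    have lD: "linear (\<lambda>e. D1 F (x, N x) (0, e))"
      unfolding D by (intro linearI) (simp_all add: vec_eq_iff inner_add_left inner_add_right)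
    show "inj (\<lambda>e. D1 F (x, N x) (0, e))"
      unfolding linear_injective_0[OF lD]
    proof (intro allI impI)
      fix e assume "D1 F (x, N x) (0, e) = 0"
      then have e: "e \<bullet> fst (a i x) = 0" "N x \<bullet> e = 0" for i
        using fun_cong[OF D, of e] by (auto simp: zero_prod_def vec_eq_iff)
      have "e \<bullet> fst (D1 \<psi> x u) = 0" for u
      proof -
        have "u = (\<Sum>k\<in>UNIV. u $ k *\<^sub>R axis k 1)"
          using basis_expansion[of u] by (simp add: scalar_mult_eq_scaleR)
        then have "D1 \<psi> x u = (\<Sum>k\<in>UNIV. u $ k *\<^sub>R a k x)"
          unfolding a_def by (metis (no_types, lifting) linear_scale[OF lin] linear_sum[OF lin] sum.cong)
        then show ?thesis using e by (simp add: fst_sum inner_sum_right)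
      qed
      then have "(e, 0) \<in> normal_space \<psi> x" by (simp add: normal_space_def mink_def)
      moreover have "mink (e, 0) (N x, 1) = 0" using e(2) by (simp add: mink_def inner_commute)
      ultimately have "(e, 0 :: real) = snd (e, 0 :: real) *\<^sub>R (N x, 1)"
        using normal_orthogonal_null[OF lin ip[OF x] n[OF x] N(2)[OF x], of "(e, 0)"] by blast
      then show "e = 0" by (simp add: zero_prod_def)
    qed
  qed
qed

text \<open>The derivatives of the equations \<open>\<langle>(N, 1), D\<psi>(u)\<rangle> = 0\<close> and \<open>\<langle>N, N\<rangle> = 1\<close>.\<close>

lemma null_normal_derivative:
  fixes \<psi> :: "real ^ 'n \<Rightarrow> 'n::finite mink"
  assumes V: "open V" "x \<in> V" and \<psi>: "Ck_on 2 \<psi> V" and N: "Ck_on 1 N V" "\<And>x. x \<in> V \<Longrightarrow> norm (N x) = 1"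
    and n: "\<And>x. x \<in> V \<Longrightarrow> (N x, 1) \<in> normal_space \<psi> x"
  shows "D1 N x v \<bullet> fst (D1 \<psi> x u) = - mink (D2 \<psi> x v u) (N x, 1)" "N x \<bullet> D1 N x v = 0"
proof -
  have dN: "(N has_derivative D1 N x) (at x)" by (rule Ck_on_has_derivative[OF N(1) _ V(2)]) simp
  have d\<psi>: "((\<lambda>y. D1 \<psi> y u) has_derivative (\<lambda>v. D2 \<psi> x v u)) (at x)"
    unfolding D2_def using \<psi> V(2) by (intro has_derivative_D1) (auto simp: numeral_2_eq_2)
  have "((\<lambda>y. mink (N y, 1) (D1 \<psi> y u)) has_derivative
      (\<lambda>v. mink (N x, 1) (D2 \<psi> x v u) + mink (D1 N x v, 0) (D1 \<psi> x u))) (at x)"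
    by (rule mk.FDERIV[OF has_derivative_Pair[OF dN has_derivative_const] d\<psi>])
  moreover have "((\<lambda>y. mink (N y, 1) (D1 \<psi> y u)) has_derivative (\<lambda>v. 0)) (at x)"
    by (rule has_derivative_transform_within_open[OF has_derivative_const[of 0] V])
      (use n in \<open>simp add: normal_space_def\<close>)
  ultimately have "(\<lambda>v. mink (N x, 1) (D2 \<psi> x v u) + mink (D1 N x v, 0) (D1 \<psi> x u)) = (\<lambda>v. 0)"
    by (rule has_derivative_unique)
  then have "mink (N x, 1) (D2 \<psi> x v u) + mink (D1 N x v, 0) (D1 \<psi> x u) = 0" by (rule fun_cong)
  then show "D1 N x v \<bullet> fst (D1 \<psi> x u) = - mink (D2 \<psi> x v u) (N x, 1)"
    using mink_commute[of "(N x, 1)" "D2 \<psi> x v u"] mink_def[of "(D1 N x v, 0)" "D1 \<psi> x u"] by simp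
  have "((\<lambda>y. N y \<bullet> N y) has_derivative (\<lambda>v. N x \<bullet> D1 N x v + D1 N x v \<bullet> N x)) (at x)"
    by (rule has_derivative_inner[OF dN dN])
  moreover have "((\<lambda>y. N y \<bullet> N y) has_derivative (\<lambda>v. 0)) (at x)"
    by (rule has_derivative_transform_within_open[OF has_derivative_const[of 1] V])
      (use N(2) in \<open>simp add: dot_square_norm\<close>)
  ultimately have "(\<lambda>v. N x \<bullet> D1 N x v + D1 N x v \<bullet> N x) = (\<lambda>v. 0)" by (rule has_derivative_unique)
  then have "N x \<bullet> D1 N x v + D1 N x v \<bullet> N x = 0" by (rule fun_cong)
  then show "N x \<bullet> D1 N x v = 0" by (simp add: inner_commute)
qed

section \<open>Flat immersions with null second fundamental form\<close>

lemma null_graph_eq: "null_graph \<tau> = (\<lambda>x. ((x, \<tau> x), \<tau> x))"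
  by (auto simp: null_graph_def canon_emb_def normal0_def)

lemma Ck_on_null_graph: "open \<Omega> \<Longrightarrow> Ck_on k \<tau> \<Omega> \<Longrightarrow> Ck_on k (null_graph \<tau>) \<Omega>"
  unfolding null_graph_eq by (intro Ck_on_Pair Ck_on_id)

lemma D1_null_graph:
  assumes "\<tau> differentiable (at x)"
  shows "D1 (null_graph \<tau>) x = (\<lambda>u. ((u, D1 \<tau> x u), D1 \<tau> x u))"
  unfolding null_graph_eq
  by (rule D1_eq) (intro has_derivative_Pair has_derivative_ident has_derivative_D1 assms)

lemma D2_null_graph:
  assumes \<Omega>: "open \<Omega>" "x \<in> \<Omega>" and \<tau>: "Ck_on 2 \<tau> \<Omega>"
  shows "D2 (null_graph \<tau>) x u v = Hess \<tau> x u v *\<^sub>R (normal0, 1)"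
proof -
  have d: "\<tau> differentiable (at y)" "(\<lambda>z. D1 \<tau> z v) differentiable (at y)" if "y \<in> \<Omega>" for y
    using \<tau> that by (auto simp: numeral_2_eq_2)
  have "D1 (\<lambda>y. D1 (null_graph \<tau>) y v) x = D1 (\<lambda>y. ((v, D1 \<tau> y v), D1 \<tau> y v)) x"
    by (rule D1_cong[OF \<Omega>]) (simp add: D1_null_graph d(1))
  also have "\<dots> = (\<lambda>u. ((0, D2 \<tau> x u v), D2 \<tau> x u v))"
    unfolding D2_def
    by (rule D1_eq) (intro has_derivative_Pair has_derivative_const has_derivative_D1 d(2) \<Omega>)
  finally show ?thesis by (simp add: D2_def[of "null_graph \<tau>"] Hess_def normal0_def)
qed

lemma null_graph_metric:
  assumes "\<tau> differentiable (at x)"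
  shows "ind_metric (null_graph \<tau>) x u v = u \<bullet> v"
  by (simp add: ind_metric_def D1_null_graph[OF assms] mink_def)

lemma null_graph_normal:
  assumes "\<tau> differentiable (at x)"
  shows "(normal0, 1) \<in> normal_space (null_graph \<tau>) x"
  by (simp add: normal_space_def D1_null_graph[OF assms] mink_def normal0_def)

theorem null_graph_properties:
  fixes \<tau> :: "real ^ 'n::finite \<Rightarrow> real"
  assumes \<Omega>: "open \<Omega>" and \<tau>: "Ck_on 2 \<tau> \<Omega>"
  shows "immersion 2 \<Omega> (null_graph \<tau>)" "spacelike \<Omega> (null_graph \<tau>)" "flat \<Omega> (null_graph \<tau>)"
    "\<And>x u v. x \<in> \<Omega> \<Longrightarrow> sff (null_graph \<tau>) x u v = Hess \<tau> x u v *\<^sub>R (normal0, 1)"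
    "null_sff \<Omega> (null_graph \<tau>)" "marginally_trapped \<Omega> (null_graph \<tau>)"
proof -
  let ?n = "(normal0, 1) :: 'n mink"
  have d: "\<tau> differentiable (at x)" if "x \<in> \<Omega>" for x
    using Ck_on_differentiable[OF \<tau> _ that] by simp
  have C2: "Ck_on 2 (null_graph \<tau>) \<Omega>" by (rule Ck_on_null_graph[OF \<Omega> \<tau>])
  show "immersion 2 \<Omega> (null_graph \<tau>)"
    unfolding immersion_def using C2 by (auto simp: D1_null_graph d intro!: injI)
  show sp: "spacelike \<Omega> (null_graph \<tau>)"
    by (simp add: spacelike_def null_graph_metric d)
  show "flat \<Omega> (null_graph \<tau>)"
    unfolding flat_def
  proof (intro ballI exI conjI allI)
    show "Ck_on 1 (\<lambda>x :: real ^ 'n. x) \<Omega>" by (rule Ck_on_id)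
  qed (use \<Omega> in \<open>simp_all add: null_graph_metric d\<close>)
  have lin: "linear (D1 (null_graph \<tau>) x)" if "x \<in> \<Omega>" for x
    by (rule linear_frechet_derivative[OF Ck_on_differentiable[OF C2 _ that]]) simp
  have ip: "inner_product (ind_metric (null_graph \<tau>) x)" if "x \<in> \<Omega>" for x
    by (rule spacelike_inner_product[OF sp that Ck_on_differentiable[OF C2 _ that]]) simp
  have nn: "?n \<in> normal_space (null_graph \<tau>) x" if "x \<in> \<Omega>" for x
    by (rule null_graph_normal[OF d[OF that]])
  show sff: "sff (null_graph \<tau>) x u v = Hess \<tau> x u v *\<^sub>R ?n" if "x \<in> \<Omega>" for x u v
    unfolding sff_def D2_null_graph[OF \<Omega> that \<tau>]
    by (rule normal_proj_ident[OF lin ip])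
      (rule that that subspace_scale[OF subspace_normal_space[OF lin ip] nn])+
  have null0: "mink ?n ?n = 0" by (simp add: mink_def normal0_def)
  show "null_sff \<Omega> (null_graph \<tau>)"
  proof -
    have "null_normal_field \<Omega> (null_graph \<tau>) (\<lambda>_. ?n)"
      using nn null0 by (auto simp: null_normal_field_def null_normal_def zero_prod_def)
    moreover have "\<forall>y\<in>\<Omega>. \<forall>u v. \<exists>b. sff (null_graph \<tau>) y u v = b *\<^sub>R ?n"
      using sff by blast
    ultimately show ?thesis unfolding null_sff_def using \<Omega> by blast
  qed
  show "marginally_trapped \<Omega> (null_graph \<tau>)"
    unfolding marginally_trapped_def
  proof (intro conjI ballI)
    show "nondegenerate_metric \<Omega> (null_graph \<tau>)" by (rule spacelike_nondegenerate[OF sp])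
    fix x assume x: "x \<in> \<Omega>"
    define s where "s = (\<Sum>i\<in>UNIV. \<Sum>j\<in>UNIV. matrix_inv (gram (null_graph \<tau>) x) $ i $ j * Hess \<tau> x (axis i 1) (axis j 1))"
    have "mean_curv_vec (null_graph \<tau>) x = (1 / real CARD('n) * s) *\<^sub>R ?n"
      unfolding mean_curv_vec_def sff[OF x] s_def scaleR_scaleR[symmetric]
      by (simp only: scaleR_sum_left scaleR_scaleR)
    then show "mink (mean_curv_vec (null_graph \<tau>) x) (mean_curv_vec (null_graph \<tau>) x) = 0"
      by (simp only: mk.scaleR_left mk.scaleR_right null0) simp
  qed
qed

subsection \<open>Isometries\<close>

lemma mink_nondegenerate: "(\<And>b. mink a b = 0) \<Longrightarrow> a = 0"
proof -
  assume a: "\<And>b. mink a b = 0"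
  have "fst a \<bullet> fst a = 0" using a[of "(fst a, 0)"] by (simp add: mink_def)
  moreover have "snd a = 0" using a[of "(0, 1)"] by (simp add: mink_def)
  ultimately show ?thesis by (simp add: prod_eq_iff)
qed

lemma mink_isometry_affine:
  fixes L :: "'n::finite mink \<Rightarrow> 'n mink"
  assumes L: "linear L" and iso: "\<And>a b. mink (L a) (L b) = mink a b"
  shows "mink_isometry (\<lambda>w. L w + p)"
proof -
  have inj: "inj L"
    unfolding linear_injective_0[OF L]
  proof (intro allI impI)
    fix a assume "L a = 0"
    then have "mink a b = 0" for b using iso[of a b] by (simp add: mk.zero_left)
    then show "a = 0" by (rule mink_nondegenerate)
  qed
  obtain M where M: "linear M" "M \<circ> L = id" "L \<circ> M = id"
    using linear_injective_isomorphism[OF L inj] by (auto simp: fun_eq_iff)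
  have inv_simps: "M (L a) = a" "L (M a) = a" for a
    using fun_cong[OF M(2), of a] fun_cong[OF M(3), of a] by simp_all
  have bl: "bounded_linear L" "bounded_linear M" using L M(1) by (simp_all add: linear_conv_bounded_linear)
  have invF: "inv (\<lambda>w. L w + p) = (\<lambda>w. M (w - p))"
    by (rule inv_unique_comp) (auto simp: fun_eq_iff inv_simps)
  have bij: "bij (\<lambda>w. L w + p)"
    by (rule o_bij[of "\<lambda>w. M (w - p)"]) (auto simp: fun_eq_iff inv_simps)
  have CF: "Ck_on k (\<lambda>w. L w + p) UNIV" for k
    by (intro Ck_on_add Ck_on_const Ck_on_bounded_linear bl) simp
  have "Ck_on k (\<lambda>w. M w - M p) UNIV" for k
    by (intro Ck_on_diff Ck_on_const Ck_on_bounded_linear bl) simp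
  then have CM: "Ck_on k (\<lambda>w. M (w - p)) UNIV" for k
    by (simp add: linear_diff[OF M(1)])
  have "D1 (\<lambda>w. L w + p) x = L" for x
    by (rule D1_eq) (auto intro!: derivative_eq_intros bounded_linear_imp_has_derivative bl)
  then show ?thesis unfolding mink_isometry_def invF using bij CF CM iso by simp
qed

lemma exists_reflection:
  fixes N M :: "'a::euclidean_space"
  assumes "norm N = 1" "norm M = 1"
  shows "\<exists>R. linear R \<and> (\<forall>a b. R a \<bullet> R b = a \<bullet> b) \<and> R N = M"
proof -
  define w where "w = N - M"
  \<comment> \<open>If \<open>N = M\<close> then \<open>w = 0\<close>, and this is the identity.\<close>
  define R where "R = (\<lambda>v. v - (2 * (v \<bullet> w) / (w \<bullet> w)) *\<^sub>R w)"
  have NM: "N \<bullet> N = 1" "M \<bullet> M = 1" using assms by (simp_all add: dot_square_norm)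
  have "linear R"
    by (intro linearI) (simp_all add: R_def inner_add_left algebra_simps add_divide_distrib)
  moreover have "R a \<bullet> R b = a \<bullet> b" for a b
  proof (cases "w = 0")
    case False
    then have "w \<bullet> w \<noteq> 0" by simp
    then show ?thesis
      by (simp add: R_def inner_diff_left inner_diff_right inner_commute[of w b] field_simps)
  qed (simp add: R_def)
  moreover have "R N = M"
  proof (cases "w = 0")
    case False
    then have "w \<bullet> w \<noteq> 0" by simp
    moreover have "w \<bullet> w = 2 * (N \<bullet> w)"
      using NM by (simp add: w_def inner_diff_left inner_diff_right inner_commute)
    ultimately have c: "2 * (N \<bullet> w) / (w \<bullet> w) = 1" by (metis divide_self)
    show ?thesis unfolding R_def c by (simp add: w_def)
  qed (simp add: R_def w_def)
  ultimately show ?thesis by blast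
qed

text \<open>The null normal direction is constant: its derivative is normal, because the second
  fundamental form has no component paired with it, and orthogonal to it. So the submanifold lies
  in a degenerate hyperplane, over which it is a graph.\<close>

theorem null_sff_locally_null_graph:
  fixes \<psi> :: "real ^ 'n \<Rightarrow> 'n::finite mink"
  assumes \<Omega>: "open \<Omega>" "x0 \<in> \<Omega>" and imm: "immersion 2 \<Omega> \<psi>" and sp: "spacelike \<Omega> \<psi>" and null: "null_sff \<Omega> \<psi>"
  shows "\<exists>V F. open V \<and> x0 \<in> V \<and> V \<subseteq> \<Omega> \<and> mink_isometry F \<and> F ` \<psi> ` V \<in> null_graph_images"
proof -
  have C2: "Ck_on 2 \<psi> \<Omega>" using imm by (simp add: immersion_def)
  have d\<psi>: "\<psi> differentiable (at x)" if "x \<in> \<Omega>" for x using Ck_on_differentiable[OF C2 _ that] by simp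
  have lin: "linear (D1 \<psi> x)" if "x \<in> \<Omega>" for x by (rule linear_frechet_derivative[OF d\<psi>[OF that]])
  have ip: "inner_product (ind_metric \<psi> x)" if "x \<in> \<Omega>" for x
    by (rule spacelike_inner_product[OF sp that d\<psi>[OF that]])
  obtain V0 \<xi> where V0: "open V0" "x0 \<in> V0" "V0 \<subseteq> \<Omega>" "null_normal_field V0 \<psi> \<xi>"
    "\<forall>y\<in>V0. \<forall>u v. \<exists>b. sff \<psi> y u v = b *\<^sub>R \<xi> y"
    using bspec[OF null[unfolded null_sff_def] \<Omega>(2)] by blast
  obtain e where e: "e > 0" "ball x0 e \<subseteq> V0" using V0(1,2) open_contains_ball by blast
  define B where "B = ball x0 e"
  have B: "open B" "x0 \<in> B" "B \<subseteq> V0" "B \<subseteq> \<Omega>" "convex B" using e V0(3) by (auto simp: B_def)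
  have nn: "null_normal \<psi> x (\<xi> x)" if "x \<in> B" for x using V0(4) B(3) that by (auto simp: null_normal_field_def)
  define N where "N = (\<lambda>x. (1 / snd (\<xi> x)) *\<^sub>R fst (\<xi> x))"
  have Nn: "(N x, 1) \<in> normal_space \<psi> x" and N1: "norm (N x) = 1" and \<xi>: "\<xi> x = snd (\<xi> x) *\<^sub>R (N x, 1)"
    if "x \<in> B" for x
    using null_normal_normalise[OF nn[OF that]] unfolding N_def by blast+
  have c\<xi>: "continuous_on B \<xi>" using V0(4) B(3) continuous_on_subset by (auto simp: null_normal_field_def)
  have cN: "continuous_on B N"
    unfolding N_def by (intro continuous_intros c\<xi>) (use null_normal_snd_nonzero[OF nn] in auto)
  have C2B: "Ck_on 2 \<psi> B" by (rule Ck_on_subset[OF C2 B(4)])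
  have C1N: "Ck_on 1 N B"
    by (rule Ck_on_null_normal[OF B(1) _ _ cN N1 Nn]) (use C2B ip B(4) in \<open>auto simp: numeral_2_eq_2 simp del: Ck_on.simps\<close>)
  have dN0: "D1 N x v = 0" if x: "x \<in> B" for x v
  proof -
    have x\<Omega>: "x \<in> \<Omega>" using x B(4) by blast
    have N0: "mink (N x, 1) (N x, 1) = 0" using N1[OF x] by (simp add: mink_def dot_square_norm)
    have h0: "mink (D2 \<psi> x u v) (N x, 1) = 0" for u v
    proof -
      obtain b where "sff \<psi> x u v = b *\<^sub>R \<xi> x" using V0(5) x B(3) by blast
      then have "sff \<psi> x u v = b *\<^sub>R (snd (\<xi> x) *\<^sub>R (N x, 1))" using \<xi>[OF x] by simp
      then have "mink (sff \<psi> x u v) (N x, 1) = 0" by (simp only: mk.scaleR_left N0) simp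
      then show ?thesis by (simp add: mink_sff[OF lin[OF x\<Omega>] ip[OF x\<Omega>] Nn[OF x]])
    qed
    note der = null_normal_derivative[OF B(1) x C2B C1N N1 Nn]
    have "D1 N x v \<bullet> fst (D1 \<psi> x u) = 0" for u using der(1)[of v u] h0 by simp
    then have "(D1 N x v, 0) \<in> normal_space \<psi> x" by (simp add: normal_space_def mink_def)
    moreover have "mink (D1 N x v, 0) (N x, 1) = 0" using der(2)[of v] by (simp add: mink_def inner_commute)
    ultimately have "(D1 N x v, 0 :: real) = snd (D1 N x v, 0 :: real) *\<^sub>R (N x, 1)"
      using normal_orthogonal_null[OF lin[OF x\<Omega>] ip[OF x\<Omega>] Nn[OF x] N1[OF x], of "(D1 N x v, 0)"] by blast
    then show ?thesis by (simp add: zero_prod_def)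
  qed
  have "(N has_derivative (\<lambda>h. 0)) (at x within B)" if "x \<in> B" for x
  proof -
    have "(N has_derivative D1 N x) (at x)" by (rule Ck_on_has_derivative[OF C1N _ that]) simp
    then show ?thesis using dN0[OF that] has_derivative_at_withinI by (metis (no_types, lifting) ext)
  qed
  then have "\<exists>c. \<forall>x\<in>B. N x = c" by (rule has_derivative_zero_constant[OF B(5)])
  then obtain N0 where N0: "\<And>x. x \<in> B \<Longrightarrow> N x = N0" by blast
  have N01: "norm N0 = 1" using N0 N1 B(2) by metis
  have "((\<lambda>y. mink (\<psi> y) (N0, 1)) has_derivative (\<lambda>h. 0)) (at x within B)" if x: "x \<in> B" for x
  proof -
    have "((\<lambda>y. mink (\<psi> y) (N0, 1)) has_derivative (\<lambda>h. mink (D1 \<psi> x h) (N0, 1))) (at x)"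
      using x B(4)
      by (intro bounded_linear.has_derivative[OF mk.bounded_linear_left] has_derivative_D1 d\<psi>) auto
    moreover have "mink (D1 \<psi> x h) (N0, 1) = 0" for h
      using Nn[OF x] N0[OF x] mink_commute[of "(N0, 1)"] by (simp add: normal_space_def)
    ultimately show ?thesis using has_derivative_at_withinI by simp
  qed
  then have "\<exists>c. \<forall>x\<in>B. mink (\<psi> x) (N0, 1) = c" by (rule has_derivative_zero_constant[OF B(5)])
  then obtain c where c: "\<And>x. x \<in> B \<Longrightarrow> mink (\<psi> x) (N0, 1) = c" by blast
  obtain R where R: "linear R" "\<And>a b. R a \<bullet> R b = a \<bullet> b" "R N0 = (normal0 :: (real ^ 'n) \<times> real)"
    using exists_reflection[OF N01, of normal0] by (auto simp: normal0_def norm_Pair)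
  define L where "L = (\<lambda>w :: 'n mink. (R (fst w), snd w))"
  have linL: "linear L"
    by (intro linearI) (simp_all add: L_def linear_add[OF R(1)] linear_scale[OF R(1)])
  have isoL: "mink (L a) (L b) = mink a b" for a b by (simp add: L_def mink_def R(2))
  \<comment> \<open>The linear part takes the null normal to \<open>(normal0, 1)\<close>, and the translation moves the
    hyperplane to one through the origin.\<close>
  define p :: "'n mink" where "p = ((0, - c), 0)"
  define F where "F = (\<lambda>w. L w + p)"
  have F: "mink_isometry F" unfolding F_def by (rule mink_isometry_affine[OF linL isoL])
  have nR: "snd (R a) = N0 \<bullet> a" for a
  proof -
    have "snd (R a) = normal0 \<bullet> R a" by (simp add: normal0_def inner_prod_def)
    also have "\<dots> = R N0 \<bullet> R a" by (simp add: R(3))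
    finally show ?thesis by (simp add: R(2))
  qed
  have hyper: "snd (fst (F (\<psi> y))) = snd (F (\<psi> y))" if "y \<in> B" for y
    using c[OF that] by (simp add: F_def L_def p_def nR mink_def inner_commute)
  have CF: "Ck_on 2 (\<lambda>y. F (\<psi> y)) B"
    unfolding F_def
    by (intro Ck_on_add B(1) Ck_on_const Ck_on_compose_bounded_linear[OF B(1) _ C2B])
      (use linL in \<open>simp add: linear_conv_bounded_linear\<close>)
  define pr where "pr = (\<lambda>y. fst (fst (F (\<psi> y))))"
  have Cpr: "Ck_on 2 pr B" unfolding pr_def by (intro Ck_on_fst B(1) CF)
  have Dpr: "D1 pr x0 u = fst (R (fst (D1 \<psi> x0 u)))" for u
  proof -
    have "bounded_linear (\<lambda>w. fst (R (fst w)))"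
      using bounded_linear_compose[OF bounded_linear_fst bounded_linear_compose[OF _ bounded_linear_fst], of R] R(1)
      by (simp add: linear_conv_bounded_linear)
    from bounded_linear.has_derivative[OF this has_derivative_D1[OF d\<psi>[OF \<Omega>(2)]]]
    have "(pr has_derivative (\<lambda>u. fst (R (fst (D1 \<psi> x0 u))))) (at x0)"
      by (simp add: pr_def F_def L_def p_def)
    then show ?thesis by (simp add: D1_eq)
  qed
  have injpr: "inj (D1 pr x0)"
  proof -
    have l: "linear (D1 pr x0)" by (rule linear_frechet_derivative[OF Ck_on_differentiable[OF Cpr _ B(2)]]) simp
    show ?thesis
      unfolding linear_injective_0[OF l]
    proof (intro allI impI)
      fix u assume "D1 pr x0 u = 0"
      then have f0: "fst (R (fst (D1 \<psi> x0 u))) = 0" by (simp add: Dpr)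
      have "snd (R (fst (D1 \<psi> x0 u))) = snd (D1 \<psi> x0 u)"
        using Nn[OF B(2)] N0[OF B(2)] by (simp add: nR normal_space_def mink_def)
      then have "R (fst (D1 \<psi> x0 u)) = (0, snd (D1 \<psi> x0 u))" using f0 by (simp add: prod_eq_iff)
      then have "mink (L (D1 \<psi> x0 u)) (L (D1 \<psi> x0 u)) = 0" by (simp add: L_def mink_def)
      then have "ind_metric \<psi> x0 u u = 0" by (simp add: isoL ind_metric_def)
      then show "u = 0" using inner_product_pos[OF ip[OF \<Omega>(2)], of u] by force
    qed
  qed
  obtain U V g where UV: "open U" "x0 \<in> U" "U \<subseteq> B" "open V" "pr x0 \<in> V" "homeomorphism U V pr g" "Ck_on 2 g V"
    by (rule Ck_inverse_function[OF B(1,2) Cpr _ injpr]) simp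
  \<comment> \<open>A ball, because the model graphs have connected domains.\<close>
  obtain r where r: "r > 0" "ball (pr x0) r \<subseteq> V" using UV(4,5) open_contains_ball by blast
  define W where "W = ball (pr x0) r"
  have W: "open W" "connected W" "W \<subseteq> V" "pr x0 \<in> W" using r by (auto simp: W_def)
  have gW: "pr (g z) = z" "g z \<in> U" if "z \<in> W" for z
    using UV(6) W(3) that by (auto simp: homeomorphism_def)
  have gim: "g ` W = U \<inter> pr -` W"
  proof
    show "g ` W \<subseteq> U \<inter> pr -` W" using gW by auto
    show "U \<inter> pr -` W \<subseteq> g ` W"
    proof
      fix x assume x: "x \<in> U \<inter> pr -` W"
      then have "x = g (pr x)" using UV(6) by (simp add: homeomorphism_def)
      then show "x \<in> g ` W" using x by blast
    qed
  qed
  have open_gW: "open (g ` W)"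
    unfolding gim by (rule continuous_open_preimage[OF _ UV(1) W(1)]) (use UV(6) in \<open>simp add: homeomorphism_def\<close>)
  define \<tau> where "\<tau> = (\<lambda>z. snd (F (\<psi> (g z))))"
  have "Ck_on 2 (\<lambda>z. F (\<psi> (g z))) W"
    by (rule Ck_on_comp[OF W(1) B(1) Ck_on_subset[OF UV(7) W(3)] CF]) (use gW(2) UV(3) in auto)
  then have C\<tau>: "Ck_on 2 \<tau> W" unfolding \<tau>_def by (intro Ck_on_snd W(1))
  have "F (\<psi> (g z)) = null_graph \<tau> z" if z: "z \<in> W" for z
  proof -
    have "g z \<in> B" using gW(2)[OF z] UV(3) by blast
    then show ?thesis
      using hyper[of "g z"] gW(1)[OF z] by (simp add: null_graph_eq \<tau>_def pr_def prod_eq_iff)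
  qed
  then have "F ` \<psi> ` g ` W = null_graph \<tau> ` W" by (simp add: image_image)
  then have "F ` \<psi> ` g ` W \<in> null_graph_images"
    unfolding null_graph_images_def using W(1,2) C\<tau> by blast
  moreover have "x0 \<in> g ` W" unfolding gim using UV(2) W(4) by simp
  moreover have "g ` W \<subseteq> \<Omega>" using gim UV(3) B(4) by blast
  ultimately show ?thesis using open_gW F by blast
qed

section \<open>Charts\<close>

lemma manifold_chart:
  assumes M: "manifold k X A" and Uc: "(U, c) \<in> A"
  shows "open (c ` U)" "U \<subseteq> topspace X" "\<And>x. x \<in> U \<Longrightarrow> inv_into U c (c x) = x"
    "\<And>V. open V \<Longrightarrow> V \<subseteq> c ` U \<Longrightarrow> openin X (inv_into U c ` V)"
proof -
  have U: "openin X U" "open (c ` U)" "homeomorphic_map (subtopology X U) (top_of_set (c ` U)) c"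
    using M Uc unfolding manifold_def by auto
  show "open (c ` U)" by fact
  show sub: "U \<subseteq> topspace X" using openin_subset[OF U(1)] .
  have ts: "topspace (subtopology X U) = U" using sub by (simp add: topspace_subtopology Int_absorb1)
  have inj: "inj_on c U" using homeomorphic_imp_injective_map[OF U(3)] ts by simp
  show inv: "inv_into U c (c x) = x" if "x \<in> U" for x using inv_into_f_f[OF inj that] .
  fix V assume V: "open V" "V \<subseteq> c ` U"
  have eq: "inv_into U c ` V = {x \<in> U. c x \<in> V}"
  proof
    show "inv_into U c ` V \<subseteq> {x \<in> U. c x \<in> V}"
      using V(2) by (auto intro: inv_into_into simp: f_inv_into_f subset_iff)
    show "{x \<in> U. c x \<in> V} \<subseteq> inv_into U c ` V" using inv by force
  qed
  have "openin (top_of_set (c ` U)) V" using V by (simp add: openin_open_eq[OF U(2)])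
  then have "openin (subtopology X U) {x \<in> U. c x \<in> V}"
    using openin_continuous_map_preimage[OF homeomorphic_imp_continuous_map[OF U(3)]] ts by metis
  then show "openin X (inv_into U c ` V)"
    unfolding eq using openin_trans_full[OF _ U(1)] by blast
qed

lemma manifold_chart_exists: "manifold k X A \<Longrightarrow> x \<in> topspace X \<Longrightarrow> \<exists>(U, c)\<in>A. x \<in> U"
  unfolding manifold_def by blast

lemma locally_congruent_chart:
  assumes M: "manifold k X A" and Uc: "(U, c) \<in> A" "x \<in> U"
    and ex: "\<exists>V F. open V \<and> c x \<in> V \<and> V \<subseteq> c ` U \<and> mink_isometry F \<and> F ` (\<psi> \<circ> inv_into U c) ` V \<in> \<S>"
  shows "locally_congruent_at X \<psi> x \<S>"
proof -
  note ch = manifold_chart[OF M Uc(1)]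
  obtain V F where V: "open V" "c x \<in> V" "V \<subseteq> c ` U" "mink_isometry F" "F ` (\<psi> \<circ> inv_into U c) ` V \<in> \<S>"
    using ex by blast
  have "openin X (inv_into U c ` V)" by (rule ch(4)[OF V(1,3)])
  moreover have "x \<in> inv_into U c ` V" using V(2) ch(3)[OF Uc(2)] by force
  moreover have "F ` \<psi> ` inv_into U c ` V \<in> \<S>" using V(5) by (simp add: image_comp)
  ultimately show ?thesis unfolding locally_congruent_at_def using V(4) by blast
qed

theorem null_sff_locally_congruent:
  assumes M: "manifold 2 X A"
    and ch: "on_charts A (\<lambda>\<Omega> r. immersion 2 \<Omega> (\<psi> \<circ> r) \<and> spacelike \<Omega> (\<psi> \<circ> r) \<and> null_sff \<Omega> (\<psi> \<circ> r))"
    and x: "x \<in> topspace X"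
  shows "locally_congruent_at X \<psi> x null_graph_images"
proof -
  obtain U c where Uc: "(U, c) \<in> A" "x \<in> U" using manifold_chart_exists[OF M x] by blast
  have "immersion 2 (c ` U) (\<psi> \<circ> inv_into U c)" "spacelike (c ` U) (\<psi> \<circ> inv_into U c)" "null_sff (c ` U) (\<psi> \<circ> inv_into U c)"
    using ch Uc(1) by (auto simp: on_charts_def)
  then show ?thesis
    using null_sff_locally_null_graph[OF manifold_chart(1)[OF M Uc(1)], of "c x" "\<psi> \<circ> inv_into U c"] Uc
    by (intro locally_congruent_chart[OF M Uc]) auto
qed

section \<open>Hypersurfaces of Euclidean space and their lifts\<close>

definition first_form :: "('a::euclidean_space \<Rightarrow> 'b::euclidean_space) \<Rightarrow> 'a \<Rightarrow> 'a \<Rightarrow> 'a \<Rightarrow> real" where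
  "first_form \<phi> x u v = D1 \<phi> x u \<bullet> D1 \<phi> x v"

text \<open>A hypersurface is a submanifold of a time slice, and its unit normal \<open>\<nu>\<close> gives the null
  normal \<open>(\<nu>, 1)\<close>.\<close>

definition slice :: "('a \<Rightarrow> (real ^ 'n::finite) \<times> real) \<Rightarrow> 'a \<Rightarrow> 'n mink" where
  "slice \<phi> x = (\<phi> x, 0)"

lemma D1_slice:
  assumes "\<phi> differentiable (at x)"
  shows "D1 (slice \<phi>) x = (\<lambda>u. (D1 \<phi> x u, 0))"
  unfolding slice_def[abs_def]
  by (rule D1_eq) (intro has_derivative_Pair has_derivative_const has_derivative_D1 assms)

lemma ind_metric_slice:
  "\<phi> differentiable (at x) \<Longrightarrow> ind_metric (slice \<phi>) x = first_form \<phi> x"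
  by (intro ext) (simp add: ind_metric_def D1_slice mink_def first_form_def)

lemma Ck_on_slice: "open \<Omega> \<Longrightarrow> Ck_on k \<phi> \<Omega> \<Longrightarrow> Ck_on k (slice \<phi>) \<Omega>"
  unfolding slice_def[abs_def] by (intro Ck_on_Pair Ck_on_const)

lemma first_form_inner_product:
  fixes \<phi> :: "'a::euclidean_space \<Rightarrow> 'b::euclidean_space"
  assumes "\<phi> differentiable (at x)" "inj (D1 \<phi> x)"
  shows "inner_product (first_form \<phi> x)"
proof -
  have l: "linear (D1 \<phi> x)" by (rule linear_frechet_derivative[OF assms(1)])
  have "D1 \<phi> x u \<noteq> 0" if "u \<noteq> 0" for u
    using assms(2) that linear_injective_0[OF l] by blast
  then show ?thesis
    by (auto simp: inner_product_def first_form_def linear_add[OF l] linear_scale[OF l] inner_add_right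
        intro!: linearI intro: inner_commute)
qed

context
  fixes \<phi> \<nu> :: "real ^ 'n \<Rightarrow> (real ^ 'n::finite) \<times> real" and \<Omega> k
  assumes \<Omega>: "open \<Omega>" and C: "Ck_on (Suc (Suc k)) \<phi> \<Omega>" and inj: "\<And>x. x \<in> \<Omega> \<Longrightarrow> inj (D1 \<phi> x)"
    and gm: "gauss_map \<Omega> \<phi> \<nu>"
begin

lemma hyp_differentiable: "x \<in> \<Omega> \<Longrightarrow> \<phi> differentiable (at x)"
  using Ck_on_differentiable[OF C] by simp

lemma hyp_linear: "x \<in> \<Omega> \<Longrightarrow> linear (D1 \<phi> x)"
  by (rule linear_frechet_derivative[OF hyp_differentiable])

lemma hyp_inner_product: "x \<in> \<Omega> \<Longrightarrow> inner_product (first_form \<phi> x)"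
  by (rule first_form_inner_product[OF hyp_differentiable inj])

lemma hyp_normal: "x \<in> \<Omega> \<Longrightarrow> (\<nu> x, 1) \<in> normal_space (slice \<phi>) x" "x \<in> \<Omega> \<Longrightarrow> norm (\<nu> x) = 1"
  using gm by (auto simp: gauss_map_def normal_space_def D1_slice hyp_differentiable mink_def)

text \<open>The Gauss map is one derivative less regular than the hypersurface although it is only
  assumed continuous, since \<open>(\<nu>, 1)\<close> is a null normal field.\<close>

lemma Ck_on_gauss: "Ck_on (Suc k) \<nu> \<Omega>"
proof (rule Ck_on_null_normal[OF \<Omega> Ck_on_slice[OF \<Omega> C]])
  show "continuous_on \<Omega> \<nu>" using gm by (simp add: gauss_map_def)
qed (simp_all add: ind_metric_slice hyp_differentiable hyp_inner_product hyp_normal)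

lemma gauss_differentiable: "x \<in> \<Omega> \<Longrightarrow> \<nu> differentiable (at x)"
  using Ck_on_differentiable[OF Ck_on_gauss] by simp

lemma gauss_derivative:
  assumes "x \<in> \<Omega>"
  shows "D1 \<nu> x v \<bullet> D1 \<phi> x u = - mink (D2 (slice \<phi>) x v u) (\<nu> x, 1)" "\<nu> x \<bullet> D1 \<nu> x v = 0"
proof -
  have a: "Ck_on 2 (slice \<phi>) \<Omega>" "Ck_on 1 \<nu> \<Omega>"
    using Ck_on_le[OF Ck_on_slice[OF \<Omega> C], of 2] Ck_on_le[OF Ck_on_gauss, of 1] by auto
  note der = null_normal_derivative[OF \<Omega> assms a hyp_normal(2,1)]
  show "D1 \<nu> x v \<bullet> D1 \<phi> x u = - mink (D2 (slice \<phi>) x v u) (\<nu> x, 1)"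
    using der(1)[of v u] by (simp add: D1_slice hyp_differentiable assms)
  show "\<nu> x \<bullet> D1 \<nu> x v = 0" using der(2) .
qed

text \<open>The vector \<open>d\<nu>(u)\<close> is tangent, because the normal part of \<open>(d\<nu>(u), 0)\<close> is horizontal and
  orthogonal to the null normal \<open>(\<nu>, 1)\<close>; so the definite description has a value.\<close>

lemma shape_op: 
  assumes x: "x \<in> \<Omega>"
  shows "D1 \<phi> x (shape_op \<phi> \<nu> x u) = - D1 \<nu> x u"
proof -
  have lin: "linear (D1 (slice \<phi>) x)"
    by (rule linear_frechet_derivative[OF Ck_on_differentiable[OF Ck_on_slice[OF \<Omega> C] _ x]]) simp
  have ip: "inner_product (ind_metric (slice \<phi>) x)"
    by (simp add: ind_metric_slice hyp_differentiable x hyp_inner_product)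
  define z :: "'n mink" where "z = (- D1 \<nu> x u, 0)"
  define w where "w = tangent_part (slice \<phi>) x z"
  define y where "y = normal_proj (slice \<phi>) x z"
  have y: "y = (- D1 \<nu> x u - D1 \<phi> x w, 0)"
    unfolding y_def normal_proj_eq[OF lin ip] by (simp add: z_def w_def D1_slice hyp_differentiable x)
  have "mink y (\<nu> x, 1) = 0"
  proof -
    have "\<nu> x \<bullet> D1 \<phi> x w = 0" using gm x by (simp add: gauss_map_def)
    then have "\<nu> x \<bullet> (- D1 \<nu> x u - D1 \<phi> x w) = 0"
      using gauss_derivative(2)[OF x, of u] by (simp add: inner_diff_right)
    then show ?thesis by (simp add: y mink_def inner_commute)
  qed
  moreover have "y \<in> normal_space (slice \<phi>) x" unfolding y_def by (rule normal_proj_normal[OF lin ip])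
  ultimately have "y = snd y *\<^sub>R (\<nu> x, 1)"
    using normal_orthogonal_null[OF lin ip hyp_normal[OF x]] by blast
  then have "- D1 \<nu> x u - D1 \<phi> x w = 0" unfolding y by (simp add: zero_prod_def)
  then have "D1 \<phi> x w = - D1 \<nu> x u" by simp
  then have "\<exists>!w. D1 \<phi> x w = - D1 \<nu> x u" using inj[OF x] by (metis injD)
  from theI'[OF this] show ?thesis by (simp add: shape_op_def)
qed

lemma shape_op_unique: "x \<in> \<Omega> \<Longrightarrow> D1 \<phi> x w = - D1 \<nu> x u \<Longrightarrow> shape_op \<phi> \<nu> x u = w"
  using shape_op inj by (metis injD)

lemma shape_op_linear:
  assumes x: "x \<in> \<Omega>"
  shows "linear (shape_op \<phi> \<nu> x)"
proof -
  have l: "linear (D1 \<nu> x)" by (rule linear_frechet_derivative[OF gauss_differentiable[OF x]])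
  show ?thesis
    by (intro linearI; rule shape_op_unique[OF x])
      (simp_all add: linear_add[OF hyp_linear[OF x]] linear_scale[OF hyp_linear[OF x]] shape_op[OF x]
         linear_add[OF l] linear_scale[OF l])
qed

lemma shape_op_self_adjoint:
  assumes x: "x \<in> \<Omega>"
  shows "first_form \<phi> x (shape_op \<phi> \<nu> x u) v = first_form \<phi> x u (shape_op \<phi> \<nu> x v)"
proof -
  have "Ck_on 2 (slice \<phi>) \<Omega>" using Ck_on_le[OF Ck_on_slice[OF \<Omega> C], of 2] by simp
  from D2_symmetric[OF \<Omega> x this, of u v] show ?thesis
    using gauss_derivative(1)[OF x, of u v] gauss_derivative(1)[OF x, of v u]
      inner_commute[of "D1 \<phi> x u" "D1 \<nu> x v"]
    by (simp add: first_form_def shape_op[OF x])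
qed

lemma shape_op_eigenframe:
  assumes x: "x \<in> \<Omega>"
  shows "\<exists>f d. eigenframe (first_form \<phi> x) (shape_op \<phi> \<nu> x) f d"
proof (rule spectral_theorem[OF hyp_inner_product[OF x] shape_op_linear[OF x]])
  show "first_form \<phi> x (shape_op \<phi> \<nu> x u) v = first_form \<phi> x u (shape_op \<phi> \<nu> x v)" for u v
    by (rule shape_op_self_adjoint[OF x])
qed

lemma Ck_on_shape_op: "Ck_on k (\<lambda>x. shape_op \<phi> \<nu> x u) \<Omega>"
proof (rule Ck_on_linear_solution[OF \<Omega>, where L = "\<lambda>x. D1 \<phi> x" and b = "\<lambda>x. - D1 \<nu> x u"])
  show "Ck_on k (\<lambda>x. D1 \<phi> x e) \<Omega>" for e by (rule Ck_on_Suc_D[OF Ck_on_D1[OF C]])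
  show "Ck_on k (\<lambda>x. - D1 \<nu> x u) \<Omega>" by (rule Ck_on_minus[OF \<Omega> Ck_on_D1[OF Ck_on_gauss]])
qed (simp_all add: hyp_linear inj shape_op)

lemma has_derivative_lift:
  assumes x: "x \<in> \<Omega>" and \<tau>: "\<tau> differentiable (at x)"
  shows "(lift \<phi> \<nu> \<tau> has_derivative
     (\<lambda>u. (D1 \<phi> x u + (\<tau> x *\<^sub>R D1 \<nu> x u + D1 \<tau> x u *\<^sub>R \<nu> x), D1 \<tau> x u))) (at x)"
  unfolding lift_def[abs_def]
  by (intro has_derivative_Pair has_derivative_add has_derivative_scaleR has_derivative_D1 \<tau>
        hyp_differentiable gauss_differentiable x)

lemma D1_lift:
  assumes x: "x \<in> \<Omega>" and \<tau>: "\<tau> differentiable (at x)"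
  shows "D1 (lift \<phi> \<nu> \<tau>) x u =
    (D1 \<phi> x (u - \<tau> x *\<^sub>R shape_op \<phi> \<nu> x u) + D1 \<tau> x u *\<^sub>R \<nu> x, D1 \<tau> x u)"
proof -
  have "D1 (lift \<phi> \<nu> \<tau>) x u = (D1 \<phi> x u + (\<tau> x *\<^sub>R D1 \<nu> x u + D1 \<tau> x u *\<^sub>R \<nu> x), D1 \<tau> x u)"
    using D1_eq[OF has_derivative_lift[OF x \<tau>]] by simp
  moreover have "D1 \<nu> x u = - D1 \<phi> x (shape_op \<phi> \<nu> x u)" by (simp add: shape_op[OF x])
  ultimately show ?thesis
    by (simp add: linear_diff[OF hyp_linear[OF x]] linear_scale[OF hyp_linear[OF x]])
qed

text \<open>The derivative of \<open>\<tau>\<close> enters only through a multiple of \<open>(\<nu>, 1)\<close>, which is null and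
  orthogonal to the rest.\<close>

lemma lift_metric:
  assumes x: "x \<in> \<Omega>" and \<tau>: "\<tau> differentiable (at x)"
  shows "ind_metric (lift \<phi> \<nu> \<tau>) x u v =
    first_form \<phi> x (u - \<tau> x *\<^sub>R shape_op \<phi> \<nu> x u) (v - \<tau> x *\<^sub>R shape_op \<phi> \<nu> x v)"
proof -
  have n: "\<nu> x \<bullet> \<nu> x = 1" "\<nu> x \<bullet> D1 \<phi> x w = 0" "D1 \<phi> x w \<bullet> \<nu> x = 0" for w
    using gm x by (auto simp: gauss_map_def dot_square_norm inner_commute)
  show ?thesis
    by (simp add: ind_metric_def D1_lift[OF x \<tau>] mink_def first_form_def inner_add_left inner_add_right n)
qed

lemma lift_normal:
  assumes x: "x \<in> \<Omega>" and \<tau>: "\<tau> differentiable (at x)"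
  shows "(\<nu> x, 1) \<in> normal_space (lift \<phi> \<nu> \<tau>) x"
proof -
  have "\<nu> x \<bullet> \<nu> x = 1" "\<nu> x \<bullet> D1 \<phi> x w = 0" for w
    using gm x by (auto simp: gauss_map_def dot_square_norm)
  then show ?thesis by (simp add: normal_space_def D1_lift[OF x \<tau>] mink_def inner_add_right)
qed

lemma lift_operator_eigen:
  assumes x: "x \<in> \<Omega>" and ef: "eigenframe (first_form \<phi> x) (shape_op \<phi> \<nu> x) f d"
  shows "inj (\<lambda>u. u - t *\<^sub>R shape_op \<phi> \<nu> x u) \<longleftrightarrow> (\<forall>i. 1 - t * d i \<noteq> 0)"
  by (rule eigenframe_resolvent_inj[OF hyp_inner_product[OF x] shape_op_linear[OF x] ef])

lemma lift_positive_and_immersive: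
  assumes x: "x \<in> \<Omega>" and \<tau>: "\<tau> differentiable (at x)"
    and inj': "inj (\<lambda>u. u - \<tau> x *\<^sub>R shape_op \<phi> \<nu> x u)"
  shows "u \<noteq> 0 \<Longrightarrow> 0 < ind_metric (lift \<phi> \<nu> \<tau>) x u u" "inj (D1 (lift \<phi> \<nu> \<tau>) x)"
proof -
  show pos: "0 < ind_metric (lift \<phi> \<nu> \<tau>) x u u" if "u \<noteq> 0" for u
  proof -
    have "u - \<tau> x *\<^sub>R shape_op \<phi> \<nu> x u \<noteq> 0"
    proof
      assume "u - \<tau> x *\<^sub>R shape_op \<phi> \<nu> x u = 0"
      then have "u = 0" using injD[OF inj', of u 0] by (simp add: linear_0[OF shape_op_linear[OF x]])
      then show False using that by simp
    qed
    then show ?thesis unfolding lift_metric[OF x \<tau>] by (rule inner_product_pos[OF hyp_inner_product[OF x]])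
  qed
  have l: "linear (D1 (lift \<phi> \<nu> \<tau>) x)"
    using has_derivative_linear[OF has_derivative_lift[OF x \<tau>]] D1_eq[OF has_derivative_lift[OF x \<tau>]] by simp
  show "inj (D1 (lift \<phi> \<nu> \<tau>) x)"
    unfolding linear_injective_0[OF l]
  proof (intro allI impI)
    fix u assume "D1 (lift \<phi> \<nu> \<tau>) x u = 0"
    then have "ind_metric (lift \<phi> \<nu> \<tau>) x u u = 0" by (simp add: ind_metric_def mk.zero_left)
    then show "u = 0" using pos[of u] by force
  qed
qed

text \<open>In a basis of principal directions the shape operator of the lift along the null normal
  \<open>(\<nu>, 1)\<close> has the eigenvalues \<open>d i / (1 - \<tau> d i)\<close>, the inverses of the shifted radii of
  curvature.\<close>

lemma trace_lift_null_shape: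
  assumes x: "x \<in> \<Omega>" and \<tau>: "Ck_on 2 \<tau> \<Omega>" and k: "1 \<le> k"
    and inj': "inj (\<lambda>u. u - \<tau> x *\<^sub>R shape_op \<phi> \<nu> x u)"
    and ef: "eigenframe (first_form \<phi> x) (shape_op \<phi> \<nu> x) f d"
  shows "trace (matrix (null_shape (lift \<phi> \<nu> \<tau>) x (\<nu> x, 1))) = (\<Sum>i\<in>UNIV. d i / (1 - \<tau> x * d i))"
proof -
  let ?A = "shape_op \<phi> \<nu> x" and ?\<psi> = "lift \<phi> \<nu> \<tau>"
  note lA = shape_op_linear[OF x] and g = hyp_inner_product[OF x]
  have \<nu>2: "Ck_on 2 \<nu> \<Omega>" using Ck_on_le[OF Ck_on_gauss, of 2] k by simp
  have \<phi>2: "Ck_on 2 \<phi> \<Omega>" using Ck_on_le[OF C, of 2] by simp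
  have d\<tau>: "\<tau> differentiable (at y)" if "y \<in> \<Omega>" for y using Ck_on_differentiable[OF \<tau> _ that] by simp
  have C2: "Ck_on 2 ?\<psi> \<Omega>"
    unfolding lift_def[abs_def] by (intro Ck_on_Pair Ck_on_add Ck_on_scaleR \<Omega> \<tau> \<nu>2 \<phi>2)
  have ip: "inner_product (ind_metric ?\<psi> x)"
    by (rule ind_metric_inner_product[OF Ck_on_differentiable[OF C2 _ x] lift_positive_and_immersive(1)[OF x d\<tau>[OF x] inj']]) simp
  have "Ck_on 1 \<nu> \<Omega>" using Ck_on_le[OF \<nu>2, of 1] by simp
  note der = null_normal_derivative[OF \<Omega> x C2 this hyp_normal(2) lift_normal[OF _ d\<tau>]]
  have pair: "mink (D2 ?\<psi> x u v) (\<nu> x, 1) = first_form \<phi> x (?A u) (v - \<tau> x *\<^sub>R ?A v)" for u v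
  proof -
    have "mink (D2 ?\<psi> x u v) (\<nu> x, 1) = - (D1 \<nu> x u \<bullet> fst (D1 ?\<psi> x v))"
      using der(1)[of u v] by simp
    also have "\<dots> = - (D1 \<nu> x u) \<bullet> D1 \<phi> x (v - \<tau> x *\<^sub>R ?A v)"
      using der(2)[of u] by (simp add: D1_lift[OF x d\<tau>[OF x]] inner_add_right inner_commute)
    finally show ?thesis by (simp add: first_form_def shape_op[OF x])
  qed
  have ne: "1 - \<tau> x * d i \<noteq> 0" for i using inj' lift_operator_eigen[OF x ef] by blast
  have "null_shape ?\<psi> x (\<nu> x, 1) (f i) = (d i / (1 - \<tau> x * d i)) *\<^sub>R f i" for i
  proof (rule null_shape_unique[OF \<Omega> x C2 ip])
    fix v
    have "f i - \<tau> x *\<^sub>R ?A (f i) = (1 - \<tau> x * d i) *\<^sub>R f i"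
      by (simp add: eigenframe_eigen[OF g lA ef] algebra_simps)
    then show "ind_metric ?\<psi> x ((d i / (1 - \<tau> x * d i)) *\<^sub>R f i) v = mink (D2 ?\<psi> x (f i) v) (\<nu> x, 1)"
      unfolding inner_product_simps(5)[OF ip] unfolding lift_metric[OF x d\<tau>[OF x]] pair
      using ne[of i] by (simp add: inner_product_simps(5)[OF g] eigenframe_eigen[OF g lA ef])
  qed
  then have "eigenframe (first_form \<phi> x) (null_shape ?\<psi> x (\<nu> x, 1)) f (\<lambda>i. d i / (1 - \<tau> x * d i))"
    using ef by (simp add: eigenframe_def)
  from eigenframe_trace[OF g null_shape_linear[OF \<Omega> x C2 ip] this] show ?thesis .
qed

lemma lift_trapped:
  assumes \<tau>: "Ck_on 2 \<tau> \<Omega>" and k: "1 \<le> k"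
    and inj': "\<And>x. x \<in> \<Omega> \<Longrightarrow> inj (\<lambda>u. u - \<tau> x *\<^sub>R shape_op \<phi> \<nu> x u)"
  shows "immersion 2 \<Omega> (lift \<phi> \<nu> \<tau>)" "spacelike \<Omega> (lift \<phi> \<nu> \<tau>)"
    "\<And>x f d. x \<in> \<Omega> \<Longrightarrow> eigenframe (first_form \<phi> x) (shape_op \<phi> \<nu> x) f d \<Longrightarrow>
       (\<Sum>i\<in>UNIV. d i / (1 - \<tau> x * d i)) = 0 \<longleftrightarrow> (\<exists>b. mean_curv_vec (lift \<phi> \<nu> \<tau>) x = b *\<^sub>R (\<nu> x, 1))"
proof -
  have \<nu>2: "Ck_on 2 \<nu> \<Omega>" using Ck_on_le[OF Ck_on_gauss, of 2] k by simp
  have \<phi>2: "Ck_on 2 \<phi> \<Omega>" using Ck_on_le[OF C, of 2] by simp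
  have d\<tau>: "\<tau> differentiable (at y)" if "y \<in> \<Omega>" for y using Ck_on_differentiable[OF \<tau> _ that] by simp
  have C2: "Ck_on 2 (lift \<phi> \<nu> \<tau>) \<Omega>"
    unfolding lift_def[abs_def] by (intro Ck_on_Pair Ck_on_add Ck_on_scaleR \<Omega> \<tau> \<nu>2 \<phi>2)
  note im = lift_positive_and_immersive[OF _ d\<tau> inj']
  show "immersion 2 \<Omega> (lift \<phi> \<nu> \<tau>)" unfolding immersion_def using C2 im(2) by blast
  show "spacelike \<Omega> (lift \<phi> \<nu> \<tau>)" unfolding spacelike_def using im(1) by blast
  fix x f d assume x: "x \<in> \<Omega>" and ef: "eigenframe (first_form \<phi> x) (shape_op \<phi> \<nu> x) f d"
  have ip: "inner_product (ind_metric (lift \<phi> \<nu> \<tau>) x)"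
    by (rule ind_metric_inner_product[OF Ck_on_differentiable[OF C2 _ x] im(1)]) (use x in simp_all)
  show "(\<Sum>i\<in>UNIV. d i / (1 - \<tau> x * d i)) = 0 \<longleftrightarrow> (\<exists>b. mean_curv_vec (lift \<phi> \<nu> \<tau>) x = b *\<^sub>R (\<nu> x, 1))"
    unfolding trace_lift_null_shape[OF x \<tau> k inj'[OF x] ef, symmetric]
    by (rule mean_curv_null_iff_trace[OF \<Omega> x C2 ip lift_normal[OF x d\<tau>[OF x]] hyp_normal(2)[OF x]])
qed

end

lemma marginally_trappedI:
  assumes "spacelike \<Omega> \<psi>" "\<And>x. x \<in> \<Omega> \<Longrightarrow> norm (N x) = 1" "\<And>x. x \<in> \<Omega> \<Longrightarrow> \<exists>b. mean_curv_vec \<psi> x = b *\<^sub>R (N x, 1)"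
  shows "marginally_trapped \<Omega> \<psi>"
  unfolding marginally_trapped_def
proof (intro conjI ballI spacelike_nondegenerate[OF assms(1)])
  fix x assume x: "x \<in> \<Omega>"
  have "mink (N x, 1) (N x, 1) = 0" using assms(2)[OF x] by (simp add: mink_def dot_square_norm)
  then show "mink (mean_curv_vec \<psi> x) (mean_curv_vec \<psi> x) = 0"
    using assms(3)[OF x] by (elim exE) (simp only: mk.scaleR_left mk.scaleR_right, simp)
qed

section \<open>The roots of the curvature polynomial\<close>

context
  fixes p :: nat and k :: "nat \<Rightarrow> real" and m :: "nat \<Rightarrow> nat"
  assumes p: "2 \<le> p" and k: "inj_on k {1..p}" and k0: "\<And>i. i \<in> {1..p} \<Longrightarrow> k i \<noteq> 0"
    and m: "\<And>i. i \<in> {1..p} \<Longrightarrow> 0 < m i"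
begin

lemma poly_curv_poly:
  "poly (curv_poly p k m) t = (\<Sum>i\<in>{1..p}. real (m i) * (\<Prod>j\<in>{1..p} - {i}. inverse (k j) - t))"
proof -
  have lin: "poly [:c, -1:] t = c - t" for c :: real by simp
  show ?thesis unfolding curv_poly_def poly_sum poly_smult poly_prod lin by (rule refl)
qed

lemma inj_on_radii: "inj_on (\<lambda>i. inverse (k i)) {1..p}"
proof (rule inj_onI)
  fix i j assume ij: "i \<in> {1..p}" "j \<in> {1..p}" "inverse (k i) = inverse (k j)"
  then have "k i = k j" by simp
  then show "i = j" by (rule inj_onD[OF k _ ij(1,2)])
qed

text \<open>Every other summand contains the factor that vanishes at this radius of curvature.\<close>

lemma poly_curv_poly_at_radius:
  assumes a: "a \<in> {1..p}"
  shows "poly (curv_poly p k m) (inverse (k a)) =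
    real (m a) * (\<Prod>j\<in>{1..p} - {a}. inverse (k j) - inverse (k a))"
proof -
  have "real (m i) * (\<Prod>j\<in>{1..p} - {i}. inverse (k j) - inverse (k a)) = 0" if "i \<in> {1..p} - {a}" for i
  proof -
    have "(\<Prod>j\<in>{1..p} - {i}. inverse (k j) - inverse (k a)) = 0"
      by (rule prod_zero) (use a that in auto)
    then show ?thesis by simp
  qed
  then have "(\<Sum>i\<in>{1..p} - {a}. real (m i) * (\<Prod>j\<in>{1..p} - {i}. inverse (k j) - inverse (k a))) = 0"
    by (intro sum.neutral ballI)
  then show ?thesis unfolding poly_curv_poly by (subst sum.remove[OF _ a]) simp_all
qed

lemma curv_poly_at_radius_nonzero:
  assumes a: "a \<in> {1..p}"
  shows "poly (curv_poly p k m) (inverse (k a)) \<noteq> 0"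
proof -
  have "inverse (k j) - inverse (k a) \<noteq> 0" if "j \<in> {1..p} - {a}" for j
    using inj_onD[OF inj_on_radii, of j a] a that by auto
  then have "(\<Prod>j\<in>{1..p} - {a}. inverse (k j) - inverse (k a)) \<noteq> 0" by simp
  then show ?thesis using m[OF a] by (simp add: poly_curv_poly_at_radius[OF a])
qed

text \<open>Away from the radii of curvature the sum is the polynomial divided by the product of all
  \<open>(k j)\<^sup>-\<^sup>1 - t\<close>; at a radius of curvature the polynomial does not vanish.\<close>

lemma curv_poly_root_iff:
  "poly (curv_poly p k m) t = 0 \<longleftrightarrow>
    (\<forall>i\<in>{1..p}. 1 - t * k i \<noteq> 0) \<and> (\<Sum>i\<in>{1..p}. real (m i) * (k i / (1 - t * k i))) = 0"
proof (cases "\<forall>i\<in>{1..p}. 1 - t * k i \<noteq> 0")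
  case True
  have ne: "inverse (k i) - t \<noteq> 0" and eq: "k i / (1 - t * k i) = 1 / (inverse (k i) - t)" if "i \<in> {1..p}" for i
    using True k0[OF that] that by (auto simp: field_simps)
  have "real (m i) * (\<Prod>j\<in>{1..p} - {i}. inverse (k j) - t)
      = (\<Prod>j\<in>{1..p}. inverse (k j) - t) * (real (m i) * (k i / (1 - t * k i)))" if i: "i \<in> {1..p}" for i
    using prod.remove[of "{1..p}" i "\<lambda>j. inverse (k j) - t"] i ne[OF i] by (simp add: eq[OF i])
  then have "poly (curv_poly p k m) t
      = (\<Prod>j\<in>{1..p}. inverse (k j) - t) * (\<Sum>i\<in>{1..p}. real (m i) * (k i / (1 - t * k i)))"
    unfolding poly_curv_poly sum_distrib_left by (intro sum.cong refl) blast
  moreover have "(\<Prod>j\<in>{1..p}. inverse (k j) - t) \<noteq> 0" using ne by simp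
  ultimately show ?thesis using True by simp
next
  case False
  then obtain a where a: "a \<in> {1..p}" "1 - t * k a = 0" by auto
  then have "t = inverse (k a)" using k0[OF a(1)] by (simp add: field_simps)
  then show ?thesis using False curv_poly_at_radius_nonzero[OF a(1)] by auto
qed

lemma curv_poly_nonzero: "curv_poly p k m \<noteq> 0"
  using curv_poly_at_radius_nonzero[of 1] p by force

lemma degree_curv_poly: "degree (curv_poly p k m) \<le> p - 1"
  unfolding curv_poly_def
proof (rule degree_sum_le)
  fix i assume i: "i \<in> {1..p}"
  have "degree (\<Prod>j\<in>{1..p} - {i}. [:inverse (k j), -1:]) \<le> (\<Sum>j\<in>{1..p} - {i}. degree [:inverse (k j), -1:])"
    using degree_prod_sum_le[of "{1..p} - {i}" "\<lambda>j. [:inverse (k j), -1:]"] by (simp add: o_def)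
  also have "\<dots> = p - 1" using i by simp
  finally show "degree (smult (real (m i)) (\<Prod>j\<in>{1..p} - {i}. [:inverse (k j), -1:])) \<le> p - 1"
    using degree_smult_le order_trans by blast
qed simp

text \<open>At two consecutive radii of curvature the polynomial has opposite signs.\<close>

lemma curv_poly_root_between:
  assumes il: "i \<in> {1..p}" "l \<in> {1..p}" and lt: "inverse (k i) < inverse (k l)"
    and gap: "\<And>j. j \<in> {1..p} \<Longrightarrow> \<not> (inverse (k i) < inverse (k j) \<and> inverse (k j) < inverse (k l))"
  shows "\<exists>t. inverse (k i) < t \<and> t < inverse (k l) \<and> poly (curv_poly p k m) t = 0"
proof -
  define a where "a = inverse (k i)"
  define b where "b = inverse (k l)"
  define J where "J = {1..p} - {i} - {l}"
  have ne: "i \<noteq> l" using lt by auto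
  have l': "l \<in> {1..p} - {i}" "i \<in> {1..p} - {l}" "{1..p} - {l} - {i} = J" using il ne by (auto simp: J_def)
  have Pa: "poly (curv_poly p k m) a = real (m i) * ((b - a) * (\<Prod>j\<in>J. inverse (k j) - a))"
    unfolding a_def poly_curv_poly_at_radius[OF il(1)]
    using prod.remove[OF _ l'(1), of "\<lambda>j. inverse (k j) - inverse (k i)"] by (simp add: J_def b_def)
  have Pb: "poly (curv_poly p k m) b = real (m l) * ((a - b) * (\<Prod>j\<in>J. inverse (k j) - b))"
    unfolding b_def poly_curv_poly_at_radius[OF il(2)]
    using prod.remove[OF _ l'(2), of "\<lambda>j. inverse (k j) - inverse (k l)"] l'(3) by (simp add: a_def)
  have pos: "(\<Prod>j\<in>J. (inverse (k j) - a) * (inverse (k j) - b)) > 0"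
  proof (rule prod_pos)
    fix j assume j: "j \<in> J"
    then have "inverse (k j) \<noteq> a" "inverse (k j) \<noteq> b"
      using inj_onD[OF inj_on_radii, of j i] inj_onD[OF inj_on_radii, of j l] il
      unfolding J_def a_def b_def by blast+
    moreover have "\<not> (a < inverse (k j) \<and> inverse (k j) < b)"
      using gap[of j] j by (simp add: J_def a_def b_def)
    ultimately consider "inverse (k j) < a" | "inverse (k j) > b" by linarith
    then show "0 < (inverse (k j) - a) * (inverse (k j) - b)"
      using lt by cases (auto simp: a_def b_def intro: mult_pos_pos mult_neg_neg)
  qed
  have "poly (curv_poly p k m) a * poly (curv_poly p k m) b
      = - (real (m i) * real (m l) * (b - a)\<^sup>2 * (\<Prod>j\<in>J. (inverse (k j) - a) * (inverse (k j) - b)))"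
    unfolding Pa Pb prod.distrib by (simp add: power2_eq_square algebra_simps)
  also have "\<dots> < 0"
  proof -
    have "0 < real (m i) * real (m l) * (b - a)\<^sup>2"
    proof -
      have "a < b" using lt unfolding a_def b_def .
      then have "0 < (b - a)\<^sup>2" by simp
      then show ?thesis using m[OF il(1)] m[OF il(2)] by (intro mult_pos_pos) auto
    qed
    from mult_pos_pos[OF this pos] show ?thesis by simp
  qed
  finally have "poly (curv_poly p k m) a * poly (curv_poly p k m) b < 0" .
  then show ?thesis using poly_IVT[of a b "curv_poly p k m"] lt by (auto simp: a_def b_def)
qed

text \<open>There is a root between any two consecutive radii of curvature, and the degree is at most
  \<open>p - 1\<close>.\<close>

theorem card_curv_poly_roots: "card {t. poly (curv_poly p k m) t = 0} = p - 1"
proof -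
  define R where "R = (\<lambda>i. inverse (k i)) ` {1..p}"
  have R: "finite R" "card R = p" "R \<noteq> {}"
    using card_image[OF inj_on_radii] p by (auto simp: R_def)
  \<comment> \<open>The radii of curvature that are followed by another one.\<close>
  define S where "S = R - {Max R}"
  have "\<exists>t. a < t \<and> poly (curv_poly p k m) t = 0 \<and> (\<forall>b\<in>R. a < b \<longrightarrow> t < b)" if a: "a \<in> S" for a
  proof -
    define N where "N = {b \<in> R. a < b}"
    have "a < Max R" using a R by (simp add: S_def order_less_le)
    then have "Max R \<in> N" using Max_in[OF R(1,3)] by (simp add: N_def)
    then have N: "finite N" "N \<noteq> {}" using R(1) by (auto simp: N_def)
    obtain i where i: "i \<in> {1..p}" "a = inverse (k i)" using a by (auto simp: S_def R_def)
    obtain l where l: "l \<in> {1..p}" "Min N = inverse (k l)" using Min_in[OF N] by (auto simp: N_def R_def)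
    have "a < Min N" using Min_in[OF N] by (simp add: N_def)
    moreover have "\<not> (a < inverse (k j) \<and> inverse (k j) < Min N)" if "j \<in> {1..p}" for j
    proof
      assume j: "a < inverse (k j) \<and> inverse (k j) < Min N"
      then have "inverse (k j) \<in> N" using that by (simp add: N_def R_def)
      then show False using Min_le[OF N(1), of "inverse (k j)"] j by linarith
    qed
    ultimately obtain t where t: "a < t" "t < Min N" "poly (curv_poly p k m) t = 0"
      using curv_poly_root_between[OF i(1) l(1)] unfolding i(2) l(2) by blast
    have "t < b" if "b \<in> R" "a < b" for b
      using t(2) Min_le[OF N(1), of b] that by (simp add: N_def)
    then show ?thesis using t by blast
  qed
  then obtain r where r: "\<And>a. a \<in> S \<Longrightarrow> a < r a" "\<And>a. a \<in> S \<Longrightarrow> poly (curv_poly p k m) (r a) = 0"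
    "\<And>a b. a \<in> S \<Longrightarrow> b \<in> R \<Longrightarrow> a < b \<Longrightarrow> r a < b" by metis
  have mono: "r a < r b" if "a \<in> S" "b \<in> S" "a < b" for a b
    using r(3)[of a b] r(1)[of b] that by (force simp: S_def)
  have "inj_on r S"
  proof (rule inj_onI)
    fix a b assume "a \<in> S" "b \<in> S" "r a = r b"
    then show "a = b" using mono[of a b] mono[of b a] by (cases a b rule: linorder_cases) auto
  qed
  then have cS: "card (r ` S) = p - 1"
    using R Max_in[of R] by (simp add: card_image S_def)
  have fin: "finite {t. poly (curv_poly p k m) t = 0}" by (rule poly_roots_finite[OF curv_poly_nonzero])
  have "card (r ` S) \<le> card {t. poly (curv_poly p k m) t = 0}"
    by (rule card_mono[OF fin]) (use r(2) in auto)
  moreover have "card {t. poly (curv_poly p k m) t = 0} \<le> p - 1"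
    using card_poly_roots_bound[OF curv_poly_nonzero] degree_curv_poly by linarith
  ultimately show ?thesis using cS by linarith
qed

end

section \<open>Continuity of sorted roots\<close>

text \<open>Each step raises \<open>f\<close> by at least 1, so \<open>f\<close> cannot fall behind \<open>i\<close> when counted from 1,
  nor get ahead of it when counted down from \<open>q\<close>.\<close>

lemma strict_mono_self_map:
  fixes f :: "nat \<Rightarrow> nat"
  assumes f: "\<And>i. i \<in> {1..q} \<Longrightarrow> f i \<in> {1..q}"
    and mono: "\<And>i j. i \<in> {1..q} \<Longrightarrow> j \<in> {1..q} \<Longrightarrow> i < j \<Longrightarrow> f i < f j" and i: "i \<in> {1..q}"
  shows "f i = i"
proof -
  have step: "f a + b \<le> f (a + b)" if "1 \<le> a" "a + b \<le> q" for a b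
    using that(2)
  proof (induction b)
    case (Suc b)
    have "f (a + b) < f (a + Suc b)" using Suc.prems that(1) by (intro mono) auto
    then show ?case using Suc by simp
  qed simp
  have "f 1 + (i - 1) \<le> f i" using step[of 1 "i - 1"] i by simp
  moreover have "1 \<le> f 1" using f[of 1] i by simp
  moreover have "f i + (q - i) \<le> f q" using step[of i "q - i"] i by simp
  moreover have "f q \<le> q" using f[of q] i by simp
  ultimately show ?thesis using i by simp
qed

text \<open>If every root at \<open>x0\<close> has a root at \<open>x\<close> near it and the number of roots is constant,
  then the sorted roots at \<open>x\<close> are near those at \<open>x0\<close> in the given order.\<close>

lemma isCont_sorted_roots:
  fixes \<tau> :: "nat \<Rightarrow> 'a::t2_space \<Rightarrow> real"
  assumes \<Omega>: "open \<Omega>" "x0 \<in> \<Omega>"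
    and sorted: "\<And>x. x \<in> \<Omega> \<Longrightarrow> strict_mono_on {1..q} (\<lambda>i. \<tau> i x)"
    and roots: "\<And>x. x \<in> \<Omega> \<Longrightarrow> (\<lambda>i. \<tau> i x) ` {1..q} = R x"
    and near: "\<And>i \<epsilon>. i \<in> {1..q} \<Longrightarrow> \<epsilon> > 0 \<Longrightarrow> \<forall>\<^sub>F x in nhds x0. \<exists>t\<in>R x. \<bar>t - \<tau> i x0\<bar> < \<epsilon>"
    and i: "i \<in> {1..q}"
  shows "isCont (\<tau> i) x0"
proof -
  have "\<forall>\<^sub>F x in nhds x0. \<bar>\<tau> i x - \<tau> i x0\<bar> < \<epsilon>" if e: "\<epsilon> > 0" for \<epsilon>
  proof -
    define D where "D = insert \<epsilon> ((\<lambda>(i, j). (\<tau> j x0 - \<tau> i x0) / 2) ` {(i, j). i \<in> {1..q} \<and> j \<in> {1..q} \<and> i < j})"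
    have "finite {(i, j). i \<in> {1..q} \<and> j \<in> {1..q} \<and> i < j}"
      by (rule finite_subset[of _ "{1..q} \<times> {1..q}"]) auto
    then have D: "finite D" "D \<noteq> {}" by (auto simp: D_def)
    \<comment> \<open>With \<open>\<eta>\<close> at most half of every gap, roots near distinct roots at \<open>x0\<close> keep their order.\<close>
    define \<eta> where "\<eta> = Min D"
    have lt0: "\<tau> a x0 < \<tau> b x0" if "a \<in> {1..q}" "b \<in> {1..q}" "a < b" for a b
      using strict_mono_onD[OF sorted[OF \<Omega>(2)] that] by simp
    have "\<forall>c\<in>D. 0 < c" using e lt0 by (auto simp: D_def)
    then have "\<eta> > 0" unfolding \<eta>_def using Min_in[OF D] by blast
    have \<eta>e: "\<eta> \<le> \<epsilon>" unfolding \<eta>_def by (rule Min_le[OF D(1)]) (simp add: D_def)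
    have gap: "2 * \<eta> \<le> \<tau> b x0 - \<tau> a x0" if "a \<in> {1..q}" "b \<in> {1..q}" "a < b" for a b
    proof -
      have "(\<tau> b x0 - \<tau> a x0) / 2 \<in> D" using that unfolding D_def by (intro insertI2 image_eqI[of _ _ "(a, b)"]) auto
      from Min_le[OF D(1) this] show ?thesis by (simp add: \<eta>_def)
    qed
    have "\<forall>\<^sub>F x in nhds x0. \<forall>i\<in>{1..q}. \<exists>t\<in>R x. \<bar>t - \<tau> i x0\<bar> < \<eta>"
      using near[OF _ \<open>\<eta> > 0\<close>] by (intro eventually_ball_finite) auto
    moreover have "\<forall>\<^sub>F x in nhds x0. x \<in> \<Omega>" by (rule eventually_nhds_in_open[OF \<Omega>])
    ultimately show ?thesis
    proof eventually_elim
      case (elim x)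
      then have "\<forall>i\<in>{1..q}. \<exists>j\<in>{1..q}. \<bar>\<tau> j x - \<tau> i x0\<bar> < \<eta>"
        using roots[OF elim(2)] by (metis (no_types, lifting) imageE)
      then obtain f where f: "\<And>i. i \<in> {1..q} \<Longrightarrow> f i \<in> {1..q}" "\<And>i. i \<in> {1..q} \<Longrightarrow> \<bar>\<tau> (f i) x - \<tau> i x0\<bar> < \<eta>"
        by metis
      have mono: "f a < f b" if ab: "a \<in> {1..q}" "b \<in> {1..q}" "a < b" for a b
      proof (rule ccontr)
        assume "\<not> f a < f b"
        then have "\<tau> (f b) x \<le> \<tau> (f a) x"
          using strict_mono_onD[OF sorted[OF elim(2)], of "f b" "f a"] f(1) ab by (cases "f a = f b") auto
        moreover have "\<bar>\<tau> (f a) x - \<tau> a x0\<bar> < \<eta>" "\<bar>\<tau> (f b) x - \<tau> b x0\<bar> < \<eta>" using f(2) ab by auto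
        moreover have "2 * \<eta> \<le> \<tau> b x0 - \<tau> a x0" using gap ab by blast
        ultimately show False by (simp add: abs_if split: if_splits)
      qed
      have "f i = i" by (rule strict_mono_self_map[of q f, OF f(1) mono i])
      then show ?case using f(2)[OF i] \<eta>e by simp
    qed
  qed
  then have "(\<tau> i \<longlongrightarrow> \<tau> i x0) (nhds x0)" by (simp add: tendsto_iff dist_real_def)
  then show ?thesis unfolding isCont_def tendsto_at_iff_tendsto_nhds .
qed

section \<open>Roots of the trace of the resolvent\<close>

text \<open>For a self-adjoint operator \<open>S\<close> with eigenvalues \<open>d i\<close>, the operator \<open>(1 - t S)\<^sup>-\<^sup>1 S\<close>
  has the eigenvalues \<open>d i / (1 - t d i)\<close>. Its trace is strictly increasing in \<open>t\<close> on every
  interval where it is defined, unless \<open>S = 0\<close>, and depends on \<open>t\<close> and on a parameter as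
  smoothly as \<open>S\<close> does, although the individual eigenvalues need not even be differentiable. So
  the implicit function theorem applies to the zeros of the trace.\<close>

definition resolvent :: "('p \<Rightarrow> 'a::real_vector \<Rightarrow> 'a) \<Rightarrow> 'p \<times> real \<Rightarrow> 'a \<Rightarrow> 'a" where
  "resolvent A q u = (THE w. w - snd q *\<^sub>R A (fst q) w = A (fst q) u)"

definition resolvent_trace :: "('p \<Rightarrow> real ^ 'n \<Rightarrow> real ^ 'n::finite) \<Rightarrow> 'p \<times> real \<Rightarrow> real" where
  "resolvent_trace A q = trace (matrix (resolvent A q))"

definition resolvent_set :: "'p set \<Rightarrow> ('p \<Rightarrow> 'a::real_vector \<Rightarrow> 'a) \<Rightarrow> ('p \<times> real) set" where
  "resolvent_set \<Omega> A = {q. fst q \<in> \<Omega> \<and> inj (\<lambda>w. w - snd q *\<^sub>R A (fst q) w)}"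

context
  fixes \<Omega> :: "'p::euclidean_space set" and A :: "'p \<Rightarrow> real ^ 'n \<Rightarrow> real ^ 'n::finite"
    and g :: "'p \<Rightarrow> real ^ 'n \<Rightarrow> real ^ 'n \<Rightarrow> real" and k :: nat
  assumes \<Omega>: "open \<Omega>" and A: "\<And>u. Ck_on k (\<lambda>x. A x u) \<Omega>" "\<And>x. x \<in> \<Omega> \<Longrightarrow> linear (A x)"
    and g: "\<And>x. x \<in> \<Omega> \<Longrightarrow> inner_product (g x)"
    and ef: "\<And>x. x \<in> \<Omega> \<Longrightarrow> \<exists>f d. eigenframe (g x) (A x) f d"
begin

lemma resolvent_linear:
  assumes "fst q \<in> \<Omega>"
  shows "linear (\<lambda>w. w - snd q *\<^sub>R A (fst q) w)"
  by (intro linearI) (simp_all add: linear_add[OF A(2)[OF assms]] linear_scale[OF A(2)[OF assms]] algebra_simps)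

lemma resolvent_works:
  assumes "q \<in> resolvent_set \<Omega> A"
  shows "resolvent A q u - snd q *\<^sub>R A (fst q) (resolvent A q u) = A (fst q) u"
proof -
  have q: "fst q \<in> \<Omega>" "inj (\<lambda>w. w - snd q *\<^sub>R A (fst q) w)" using assms by (auto simp: resolvent_set_def)
  have "surj (\<lambda>w. w - snd q *\<^sub>R A (fst q) w)"
    using linear_injective_imp_surjective[OF resolvent_linear[OF q(1)] q(2)] by blast
  then obtain w where w: "A (fst q) u = w - snd q *\<^sub>R A (fst q) w" by (rule surjE)
  have "\<exists>!w. w - snd q *\<^sub>R A (fst q) w = A (fst q) u"
  proof (rule ex1I)
    show "w - snd q *\<^sub>R A (fst q) w = A (fst q) u" using w by simp
    show "w' = w" if "w' - snd q *\<^sub>R A (fst q) w' = A (fst q) u" for w'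
      using injD[OF q(2), of w' w] that w by simp
  qed
  from theI'[OF this] show ?thesis by (simp add: resolvent_def)
qed

lemma resolvent_unique:
  assumes "q \<in> resolvent_set \<Omega> A" "w - snd q *\<^sub>R A (fst q) w = A (fst q) u"
  shows "resolvent A q u = w"
proof -
  have "inj (\<lambda>w. w - snd q *\<^sub>R A (fst q) w)" using assms(1) by (simp add: resolvent_set_def)
  from injD[OF this, of "resolvent A q u" w] show ?thesis using resolvent_works[OF assms(1), of u] assms(2) by simp
qed

lemma Ck_on_resolvent_matrix:
  assumes "open W" "W \<subseteq> \<Omega> \<times> UNIV"
  shows "Ck_on k (\<lambda>q. A (fst q) e) W" "Ck_on k (\<lambda>q. e - snd q *\<^sub>R A (fst q) e) W"
proof -
  show a: "Ck_on k (\<lambda>q. A (fst q) e) W"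
    by (rule Ck_on_comp[OF assms(1) \<Omega> Ck_on_fst[OF assms(1) Ck_on_id] A(1)]) (use assms(2) in auto)
  show "Ck_on k (\<lambda>q. e - snd q *\<^sub>R A (fst q) e) W"
    by (intro Ck_on_diff Ck_on_scaleR Ck_on_const Ck_on_snd Ck_on_id a assms(1))
qed

lemma open_resolvent_set: "open (resolvent_set \<Omega> A)"
proof (subst open_subopen, intro ballI)
  fix q assume q: "q \<in> resolvent_set \<Omega> A"
  define T where "T = \<Omega> \<times> (UNIV :: real set)"
  have T: "open T" "q \<in> T" using \<Omega> q by (auto simp: T_def open_Times resolvent_set_def mem_Times_iff)
  have T': "T \<subseteq> \<Omega> \<times> UNIV" by (simp add: T_def)
  have evT: "\<forall>\<^sub>F q in nhds q. q \<in> T" by (rule eventually_nhds_in_open[OF T])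
  have "\<forall>\<^sub>F q in nhds q. inj (\<lambda>w. w - snd q *\<^sub>R A (fst q) w)"
  proof (rule eventually_linear_inj)
    show "\<forall>\<^sub>F q in nhds q. linear (\<lambda>w. w - snd q *\<^sub>R A (fst q) w)"
      using evT by (rule eventually_mono) (auto simp: T_def intro: resolvent_linear)
    show "inj (\<lambda>w. w - snd q *\<^sub>R A (fst q) w)" using q by (simp add: resolvent_set_def)
    show "isCont (\<lambda>q. e - snd q *\<^sub>R A (fst q) e) q" for e
      using Ck_on_continuous[OF Ck_on_resolvent_matrix(2)[OF T(1) T', of e]] T
      by (simp add: continuous_on_eq_continuous_at)
  qed
  with evT have "\<forall>\<^sub>F q in nhds q. q \<in> resolvent_set \<Omega> A"
    by eventually_elim (auto simp: T_def resolvent_set_def)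
  then show "\<exists>T. open T \<and> q \<in> T \<and> T \<subseteq> resolvent_set \<Omega> A" by (auto simp: eventually_nhds subset_iff)
qed

lemma resolvent_set_subset: "resolvent_set \<Omega> A \<subseteq> \<Omega> \<times> UNIV"
  by (auto simp: resolvent_set_def)

lemma Ck_on_resolvent_trace: "Ck_on k (resolvent_trace A) (resolvent_set \<Omega> A)"
proof -
  note W = open_resolvent_set resolvent_set_subset
  have "Ck_on k (\<lambda>q. resolvent A q u) (resolvent_set \<Omega> A)" for u
  proof (rule Ck_on_linear_solution[OF W(1), where L = "\<lambda>q w. w - snd q *\<^sub>R A (fst q) w" and b = "\<lambda>q. A (fst q) u"])
    show "Ck_on k (\<lambda>q. e - snd q *\<^sub>R A (fst q) e) (resolvent_set \<Omega> A)" for e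
      by (rule Ck_on_resolvent_matrix(2)[OF W])
    show "Ck_on k (\<lambda>q. A (fst q) u) (resolvent_set \<Omega> A)" by (rule Ck_on_resolvent_matrix(1)[OF W])
  qed (auto simp: resolvent_set_def intro: resolvent_linear resolvent_works)
  then have "Ck_on k (\<lambda>q. \<Sum>i\<in>UNIV. resolvent A q (axis i 1) \<bullet> axis i 1) (resolvent_set \<Omega> A)"
    by (intro Ck_on_sum Ck_on_inner Ck_on_const W(1))
  then show ?thesis
    by (simp add: resolvent_trace_def[abs_def] trace_def matrix_def inner_axis)
qed

lemma resolvent_set_iff:
  assumes "x \<in> \<Omega>" "eigenframe (g x) (A x) f d"
  shows "(x, t) \<in> resolvent_set \<Omega> A \<longleftrightarrow> (\<forall>i. 1 - t * d i \<noteq> 0)"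
  using eigenframe_resolvent_inj[OF g[OF assms(1)] A(2)[OF assms(1)] assms(2), of t] assms(1)
  by (simp add: resolvent_set_def)

lemma resolvent_trace_eq:
  assumes x: "x \<in> \<Omega>" and f: "eigenframe (g x) (A x) f d" and W: "(x, t) \<in> resolvent_set \<Omega> A"
  shows "resolvent_trace A (x, t) = (\<Sum>i\<in>UNIV. d i / (1 - t * d i))"
proof -
  note lA = A(2)[OF x]
  have ne: "1 - t * d i \<noteq> 0" for i using W resolvent_set_iff[OF x f] by blast
  have "resolvent A (x, t) (f i) = (d i / (1 - t * d i)) *\<^sub>R f i" for i
  proof (rule resolvent_unique[OF W])
    have "(d i / (1 - t * d i)) *\<^sub>R f i - t *\<^sub>R A x ((d i / (1 - t * d i)) *\<^sub>R f i)
        = ((d i / (1 - t * d i)) * (1 - t * d i)) *\<^sub>R f i"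
      by (simp only: linear_scale[OF lA] eigenframe_eigen[OF g[OF x] lA f] right_diff_distrib scaleR_diff_left
          scaleR_scaleR mult_1_right mult.assoc mult.left_commute[of t] mult.commute[of t])
    also have "\<dots> = A x (f i)" using ne[of i] by (simp add: eigenframe_eigen[OF g[OF x] lA f])
    finally show "(d i / (1 - t * d i)) *\<^sub>R f i - snd (x, t) *\<^sub>R A (fst (x, t)) ((d i / (1 - t * d i)) *\<^sub>R f i)
        = A (fst (x, t)) (f i)" by simp
  qed
  then have e: "eigenframe (g x) (resolvent A (x, t)) f (\<lambda>i. d i / (1 - t * d i))"
    using f by (simp add: eigenframe_def)
  have "linear (resolvent A (x, t))"
  proof (intro linearI; rule resolvent_unique[OF W])
    fix u v and c :: real
    define ru where "ru = resolvent A (x, t) u"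
    define rv where "rv = resolvent A (x, t) v"
    have w: "ru - t *\<^sub>R A x ru = A x u" "rv - t *\<^sub>R A x rv = A x v"
      using resolvent_works[OF W, of u] resolvent_works[OF W, of v] by (simp_all add: ru_def rv_def)
    have "(ru + rv) - t *\<^sub>R A x (ru + rv) = (ru - t *\<^sub>R A x ru) + (rv - t *\<^sub>R A x rv)"
      by (simp add: linear_add[OF lA] algebra_simps)
    also have "\<dots> = A x (u + v)" unfolding w by (simp add: linear_add[OF lA])
    finally show "(resolvent A (x, t) u + resolvent A (x, t) v) - snd (x, t) *\<^sub>R A (fst (x, t)) (resolvent A (x, t) u + resolvent A (x, t) v)
        = A (fst (x, t)) (u + v)" by (simp add: ru_def rv_def)
    have "c *\<^sub>R ru - t *\<^sub>R A x (c *\<^sub>R ru) = c *\<^sub>R (ru - t *\<^sub>R A x ru)"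
      by (simp add: linear_scale[OF lA] algebra_simps)
    also have "\<dots> = A x (c *\<^sub>R u)" unfolding w by (simp add: linear_scale[OF lA])
    finally show "c *\<^sub>R resolvent A (x, t) u - snd (x, t) *\<^sub>R A (fst (x, t)) (c *\<^sub>R resolvent A (x, t) u)
        = A (fst (x, t)) (c *\<^sub>R u)" by (simp add: ru_def)
  qed
  from eigenframe_trace[OF g[OF x] this e] show ?thesis by (simp add: resolvent_trace_def)
qed

lemma resolvent_trace_derivative:
  assumes x: "x \<in> \<Omega>" and f: "eigenframe (g x) (A x) f d" and W: "(x, t) \<in> resolvent_set \<Omega> A"
  shows "((\<lambda>s. resolvent_trace A (x, s)) has_real_derivative (\<Sum>i\<in>UNIV. (d i / (1 - t * d i))\<^sup>2)) (at t)"
proof -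
  have ne: "1 - t * d i \<noteq> 0" for i using W resolvent_set_iff[OF x f] by blast
  have "((\<lambda>s. d i / (1 - s * d i)) has_real_derivative (d i / (1 - t * d i))\<^sup>2) (at t)" for i
    using ne[of i] by (auto intro!: derivative_eq_intros simp: power2_eq_square)
  then have D: "((\<lambda>s. \<Sum>i\<in>UNIV. d i / (1 - s * d i)) has_real_derivative (\<Sum>i\<in>UNIV. (d i / (1 - t * d i))\<^sup>2)) (at t)"
    by (rule DERIV_sum)
  have "open ((\<lambda>s. (x, s)) -` resolvent_set \<Omega> A)"
    by (rule open_vimage[OF open_resolvent_set]) (intro continuous_intros)
  from has_field_derivative_transform_within_open[OF D this] show ?thesis
    using W resolvent_trace_eq[OF x f] by simp
qed

lemma resolvent_trace_derivative_pos:
  assumes x: "x \<in> \<Omega>" and f: "eigenframe (g x) (A x) f d" and W: "(x, t) \<in> resolvent_set \<Omega> A" and ne: "d i \<noteq> 0"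
  shows "0 < (\<Sum>i\<in>UNIV. (d i / (1 - t * d i))\<^sup>2)"
proof (rule sum_pos2[of _ i])
  have "1 - t * d i \<noteq> 0" using W resolvent_set_iff[OF x f] by blast
  then show "0 < (d i / (1 - t * d i))\<^sup>2" using ne by simp
qed auto

text \<open>The derivative of the trace in \<open>t\<close> is a sum of squares, not all of which vanish.\<close>

theorem Ck_on_resolvent_root:
  assumes k: "0 < k" and \<tau>: "continuous_on \<Omega> \<tau>"
    and W: "\<And>x. x \<in> \<Omega> \<Longrightarrow> (x, \<tau> x) \<in> resolvent_set \<Omega> A" and root: "\<And>x. x \<in> \<Omega> \<Longrightarrow> resolvent_trace A (x, \<tau> x) = 0"
    and ne: "\<And>x f d. x \<in> \<Omega> \<Longrightarrow> eigenframe (g x) (A x) f d \<Longrightarrow> \<exists>i. d i \<noteq> 0"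
  shows "Ck_on k \<tau> \<Omega>"
proof (rule Ck_on_implicit[OF \<Omega> open_resolvent_set Ck_on_resolvent_trace k \<tau> W root])
  fix x assume x: "x \<in> \<Omega>"
  obtain f d where f: "eigenframe (g x) (A x) f d" using ef[OF x] by blast
  obtain i where i: "d i \<noteq> 0" using ne[OF x f] by blast
  define c where "c = (\<Sum>i\<in>UNIV. (d i / (1 - \<tau> x * d i))\<^sup>2)"
  have c: "c > 0" unfolding c_def by (rule resolvent_trace_derivative_pos[OF x f W[OF x] i])
  have "((\<lambda>s. resolvent_trace A (x, s)) has_derivative (\<lambda>e. c * e)) (at (\<tau> x))"
    using resolvent_trace_derivative[OF x f W[OF x]] unfolding has_field_derivative_def c_def .
  moreover have "((\<lambda>s. resolvent_trace A (x, s)) has_derivative (\<lambda>e. D1 (resolvent_trace A) (x, \<tau> x) (0, e))) (at (\<tau> x))"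
    by (rule has_derivative_compose[where f = "\<lambda>s. (x, s)", OF _ Ck_on_has_derivative[OF Ck_on_resolvent_trace k W[OF x]]])
      (intro has_derivative_Pair has_derivative_const has_derivative_ident)
  ultimately have "(\<lambda>e. D1 (resolvent_trace A) (x, \<tau> x) (0, e)) = (\<lambda>e. c * e)" by (rule has_derivative_unique[symmetric])
  then show "inj (\<lambda>e. D1 (resolvent_trace A) (x, \<tau> x) (0, e))" using c by (simp add: inj_on_def)
qed

text \<open>The trace changes its sign at \<open>t0\<close> from negative to positive, and so it does near \<open>t0\<close>
  for nearby parameters.\<close>

theorem resolvent_root_persists:
  assumes x0: "x0 \<in> \<Omega>" and W0: "(x0, t0) \<in> resolvent_set \<Omega> A" and root: "resolvent_trace A (x0, t0) = 0"
    and ne: "\<And>f d. eigenframe (g x0) (A x0) f d \<Longrightarrow> \<exists>i. d i \<noteq> 0" and e: "\<epsilon> > 0"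
  shows "\<forall>\<^sub>F x in nhds x0. \<exists>t. \<bar>t - t0\<bar> < \<epsilon> \<and> (x, t) \<in> resolvent_set \<Omega> A \<and> resolvent_trace A (x, t) = 0"
proof -
  let ?W = "resolvent_set \<Omega> A" and ?F = "resolvent_trace A"
  obtain f d where f: "eigenframe (g x0) (A x0) f d" using ef[OF x0] by blast
  obtain i where i: "d i \<noteq> 0" using ne[OF f] by blast
  note der = resolvent_trace_derivative[OF x0 f W0] and pos = resolvent_trace_derivative_pos[OF x0 f W0 i]
  obtain d1 where d1: "d1 > 0" "\<And>h. 0 < h \<Longrightarrow> h < d1 \<Longrightarrow> ?F (x0, t0) < ?F (x0, t0 + h)"
    using DERIV_pos_inc_right[OF der pos] by blast
  obtain d2 where d2: "d2 > 0" "\<And>h. 0 < h \<Longrightarrow> h < d2 \<Longrightarrow> ?F (x0, t0 - h) < ?F (x0, t0)"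
    using DERIV_pos_inc_left[OF der pos] by blast
  obtain U T where UT: "open U" "open T" "(x0, t0) \<in> U \<times> T" "U \<times> T \<subseteq> ?W"
    using open_prod_elim[OF open_resolvent_set W0] by metis
  obtain d3 where d3: "d3 > 0" "ball t0 d3 \<subseteq> T" using UT(2,3) open_contains_ball by (metis mem_Sigma_iff)
  define h where "h = Min {d1, d2, d3, \<epsilon>} / 2"
  have h: "h > 0" "h < d1" "h < d2" "h < d3" "h < \<epsilon>"
    using d1(1) d2(1) d3(1) e by (auto simp: h_def min_def)
  have inT: "s \<in> T" if "t0 - h \<le> s" "s \<le> t0 + h" for s
  proof -
    have "s \<in> ball t0 d3" using that h(4) by (simp add: dist_real_def abs_less_iff)
    then show ?thesis using d3(2) by blast
  qed
  have contF: "continuous_on ?W ?F" by (rule Ck_on_continuous[OF Ck_on_resolvent_trace])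
  have contx: "isCont (\<lambda>x. ?F (x, s)) x0" if "t0 - h \<le> s" "s \<le> t0 + h" for s
  proof -
    have "continuous_on U (\<lambda>x. ?F (x, s))"
      by (rule continuous_on_compose2[OF contF]) (use inT[OF that] UT(4) in \<open>auto intro!: continuous_intros\<close>)
    then show ?thesis using UT(1,3) by (simp add: continuous_on_eq_continuous_at)
  qed
  have "\<forall>\<^sub>F x in nhds x0. ?F (x, t0 - h) < 0"
    using order_tendstoD(2)[OF isCont_nhds[OF contx[of "t0 - h"]], of 0] d2(2)[of h] h root by simp
  moreover have "\<forall>\<^sub>F x in nhds x0. 0 < ?F (x, t0 + h)"
    using order_tendstoD(1)[OF isCont_nhds[OF contx[of "t0 + h"]], of 0] d1(2)[of h] h root by simp
  moreover have "\<forall>\<^sub>F x in nhds x0. x \<in> U" by (rule eventually_nhds_in_open) (use UT in auto)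
  ultimately show ?thesis
  proof eventually_elim
    case (elim x)
    have "continuous_on {t0 - h..t0 + h} (\<lambda>s. ?F (x, s))"
      by (rule continuous_on_compose2[OF contF]) (use inT elim(3) UT(4) in \<open>auto intro!: continuous_intros\<close>)
    then have "\<exists>s\<ge>t0 - h. s \<le> t0 + h \<and> ?F (x, s) = 0"
      using elim h by (intro IVT') auto
    then obtain s where s: "t0 - h \<le> s" "s \<le> t0 + h" "?F (x, s) = 0" by blast
    have "\<bar>s - t0\<bar> < \<epsilon>" using s h(5) by (simp add: abs_less_iff)
    moreover have "(x, s) \<in> ?W" using inT[OF s(1,2)] elim(3) UT(4) by blast
    ultimately show ?case using s(3) by blast
  qed
qed

end

section \<open>Marginally trapped lifts of hypersurfaces\<close>

lemma sum_over_eigenvalues: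
  fixes d :: "'n::finite \<Rightarrow> real" and h :: "real \<Rightarrow> real"
  assumes inj: "inj_on k I" and fin: "finite I" and r: "range d = k ` I" and m: "\<And>i. i \<in> I \<Longrightarrow> card {j. d j = k i} = m i"
  shows "(\<Sum>i\<in>I. real (m i) * h (k i)) = (\<Sum>j\<in>UNIV. h (d j))"
proof -
  have "(\<Sum>j\<in>UNIV. h (d j)) = (\<Sum>y\<in>range d. \<Sum>j\<in>{j \<in> UNIV. d j = y}. h (d j))"
    by (rule sum.image_gen) simp
  also have "\<dots> = (\<Sum>y\<in>k ` I. real (card {j. d j = y}) * h y)"
    unfolding r by (intro sum.cong refl) simp
  also have "\<dots> = (\<Sum>i\<in>I. real (m i) * h (k i))"
    by (subst sum.reindex[OF inj]) (simp add: m)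
  finally show ?thesis by simp
qed

context
  fixes \<phi> \<nu> :: "real ^ 'n \<Rightarrow> (real ^ 'n::finite) \<times> real" and \<Omega>
  assumes \<Omega>: "open \<Omega>" and imm: "immersion 4 \<Omega> \<phi>" and gm: "gauss_map \<Omega> \<phi> \<nu>"
begin

lemma hyp4: "Ck_on (Suc (Suc 2)) \<phi> \<Omega>" "x \<in> \<Omega> \<Longrightarrow> inj (D1 \<phi> x)"
  using imm by (simp_all add: immersion_def numeral_eq_Suc)

lemma principal_curvatures_eigenframe:
  assumes x: "x \<in> \<Omega>" and f: "eigenframe (first_form \<phi> x) (shape_op \<phi> \<nu> x) f d"
  shows "principal_curvatures \<phi> \<nu> x = range d" "dim {u. shape_op \<phi> \<nu> x u = k *\<^sub>R u} = card {i. d i = k}"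
proof -
  note e = hyp_inner_product[OF \<Omega> hyp4 gm x] shape_op_linear[OF \<Omega> hyp4 gm x] f
  show "principal_curvatures \<phi> \<nu> x = range d"
    unfolding principal_curvatures_def by (rule eigenframe_eigenvalues[OF e])
  show "dim {u. shape_op \<phi> \<nu> x u = k *\<^sub>R u} = card {i. d i = k}"
    by (rule eigenframe_dim_eigenspace[OF e])
qed

lemma eigenframe_hyp: "x \<in> \<Omega> \<Longrightarrow> \<exists>f d. eigenframe (first_form \<phi> x) (shape_op \<phi> \<nu> x) f d"
  by (rule shape_op_eigenframe[OF \<Omega> hyp4 gm])

lemma lift_trapped_sum:
  assumes \<tau>: "Ck_on 2 \<tau> \<Omega>"
    and ne: "\<And>x f d i. x \<in> \<Omega> \<Longrightarrow> eigenframe (first_form \<phi> x) (shape_op \<phi> \<nu> x) f d \<Longrightarrow> 1 - \<tau> x * d i \<noteq> 0"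
    and sum: "\<And>x f d. x \<in> \<Omega> \<Longrightarrow> eigenframe (first_form \<phi> x) (shape_op \<phi> \<nu> x) f d \<Longrightarrow>
       (\<Sum>i\<in>UNIV. d i / (1 - \<tau> x * d i)) = 0"
  shows "immersion 2 \<Omega> (lift \<phi> \<nu> \<tau>) \<and> spacelike \<Omega> (lift \<phi> \<nu> \<tau>) \<and> marginally_trapped \<Omega> (lift \<phi> \<nu> \<tau>)"
proof -
  have inj: "inj (\<lambda>u. u - \<tau> x *\<^sub>R shape_op \<phi> \<nu> x u)" if x: "x \<in> \<Omega>" for x
  proof -
    obtain f d where f: "eigenframe (first_form \<phi> x) (shape_op \<phi> \<nu> x) f d" using eigenframe_hyp[OF x] by blast
    show ?thesis using lift_operator_eigen[OF \<Omega> hyp4 gm x f, of "\<tau> x"] ne[OF x f] by blast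
  qed
  note L = lift_trapped[OF \<Omega> hyp4 gm \<tau> _ inj]
  have sp: "spacelike \<Omega> (lift \<phi> \<nu> \<tau>)" and im: "immersion 2 \<Omega> (lift \<phi> \<nu> \<tau>)" by (rule L; simp)+
  have "marginally_trapped \<Omega> (lift \<phi> \<nu> \<tau>)"
  proof (rule marginally_trappedI[OF sp])
    fix x assume x: "x \<in> \<Omega>"
    show "norm (\<nu> x) = 1" using gm x by (simp add: gauss_map_def)
    obtain f d where f: "eigenframe (first_form \<phi> x) (shape_op \<phi> \<nu> x) f d" using eigenframe_hyp[OF x] by blast
    have "(\<Sum>i\<in>UNIV. d i / (1 - \<tau> x * d i)) = 0 \<longleftrightarrow> (\<exists>b. mean_curv_vec (lift \<phi> \<nu> \<tau>) x = b *\<^sub>R (\<nu> x, 1))"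
      by (rule L(3)[OF _ _ _ x f]) auto
    then show "\<exists>b. mean_curv_vec (lift \<phi> \<nu> \<tau>) x = b *\<^sub>R (\<nu> x, 1)"
      using sum[OF x f] by blast
  qed
  then show ?thesis using sp im by blast
qed

context
  fixes p \<kappa> m
  assumes p: "2 \<le> p" and hp: "has_principal_curvatures \<Omega> \<phi> \<nu> p \<kappa> m" and \<kappa>0: "\<And>i x. i \<in> {1..p} \<Longrightarrow> x \<in> \<Omega> \<Longrightarrow> \<kappa> i x \<noteq> 0"
begin

lemma principal_multiplicities:
  assumes x: "x \<in> \<Omega>" and f: "eigenframe (first_form \<phi> x) (shape_op \<phi> \<nu> x) f d"
  shows "inj_on (\<lambda>i. \<kappa> i x) {1..p}" "range d = (\<lambda>i. \<kappa> i x) ` {1..p}"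
    "i \<in> {1..p} \<Longrightarrow> card {j. d j = \<kappa> i x} = m i" "i \<in> {1..p} \<Longrightarrow> 0 < m i"
proof -
  have h: "inj_on (\<lambda>i. \<kappa> i x) {1..p}" "principal_curvatures \<phi> \<nu> x = (\<lambda>i. \<kappa> i x) ` {1..p}"
    "\<And>i. i \<in> {1..p} \<Longrightarrow> dim {u. shape_op \<phi> \<nu> x u = \<kappa> i x *\<^sub>R u} = m i"
    using hp x unfolding has_principal_curvatures_def by blast+
  show "inj_on (\<lambda>i. \<kappa> i x) {1..p}" by (rule h(1))
  show r: "range d = (\<lambda>i. \<kappa> i x) ` {1..p}" using h(2) principal_curvatures_eigenframe(1)[OF x f] by simp
  show c: "card {j. d j = \<kappa> i x} = m i" if "i \<in> {1..p}" for i
    using h(3)[OF that] principal_curvatures_eigenframe(2)[OF x f] by simp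
  show "0 < m i" if i: "i \<in> {1..p}"
  proof -
    have "\<kappa> i x \<in> range d" using r i by blast
    then have "{j. d j = \<kappa> i x} \<noteq> {}" by auto
    then have "0 < card {j. d j = \<kappa> i x}" by (simp add: card_gt_0_iff)
    then show ?thesis using c[OF i] by simp
  qed
qed

lemma multiplicity_pos: "x \<in> \<Omega> \<Longrightarrow> i \<in> {1..p} \<Longrightarrow> 0 < m i"
  using eigenframe_hyp principal_multiplicities(4) by metis

lemma card_radius_roots:
  assumes x: "x \<in> \<Omega>"
  shows "card {t. poly (curv_poly p (\<lambda>i. \<kappa> i x) m) t = 0} = p - 1"
proof -
  obtain f d where f: "eigenframe (first_form \<phi> x) (shape_op \<phi> \<nu> x) f d" using eigenframe_hyp[OF x] by blast
  show ?thesis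
    by (rule card_curv_poly_roots[OF p principal_multiplicities(1)[OF x f]]) (use \<kappa>0 x multiplicity_pos in auto)
qed

lemma radius_root_iff:
  assumes x: "x \<in> \<Omega>" and f: "eigenframe (first_form \<phi> x) (shape_op \<phi> \<nu> x) f d"
  shows "poly (curv_poly p (\<lambda>i. \<kappa> i x) m) t = 0 \<longleftrightarrow>
    (\<forall>i. 1 - t * d i \<noteq> 0) \<and> (\<Sum>i\<in>UNIV. d i / (1 - t * d i)) = 0"
proof -
  note pm = principal_multiplicities[OF x f]
  have "poly (curv_poly p (\<lambda>i. \<kappa> i x) m) t = 0 \<longleftrightarrow>
      (\<forall>i\<in>{1..p}. 1 - t * \<kappa> i x \<noteq> 0) \<and> (\<Sum>i\<in>{1..p}. real (m i) * (\<kappa> i x / (1 - t * \<kappa> i x))) = 0"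
    by (rule curv_poly_root_iff[OF p pm(1)]) (use \<kappa>0 x multiplicity_pos in auto)
  also have "(\<Sum>i\<in>{1..p}. real (m i) * (\<kappa> i x / (1 - t * \<kappa> i x))) = (\<Sum>i\<in>UNIV. d i / (1 - t * d i))"
    by (rule sum_over_eigenvalues[OF pm(1) _ pm(2,3), of "\<lambda>c. c / (1 - t * c)"]) auto
  also have "(\<forall>i\<in>{1..p}. 1 - t * \<kappa> i x \<noteq> 0) \<longleftrightarrow> (\<forall>c\<in>range d. 1 - t * c \<noteq> 0)"
    unfolding pm(2) by blast
  finally show ?thesis by simp
qed

lemma radius_root_resolvent:
  assumes x: "x \<in> \<Omega>"
  shows "poly (curv_poly p (\<lambda>i. \<kappa> i x) m) t = 0 \<longleftrightarrow>
    (x, t) \<in> resolvent_set \<Omega> (shape_op \<phi> \<nu>) \<and> resolvent_trace (shape_op \<phi> \<nu>) (x, t) = 0"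
proof -
  obtain f d where f: "eigenframe (first_form \<phi> x) (shape_op \<phi> \<nu> x) f d" using eigenframe_hyp[OF x] by blast
  note R = \<Omega> Ck_on_shape_op[OF \<Omega> hyp4 gm] shape_op_linear[OF \<Omega> hyp4 gm] hyp_inner_product[OF \<Omega> hyp4 gm]
    eigenframe_hyp
  show ?thesis
    unfolding radius_root_iff[OF x f]
    using resolvent_set_iff[OF R x f, of t] resolvent_trace_eq[OF R x f, of t] by auto
qed

text \<open>Each root persists nearby and their number is constant, so the sorted roots are continuous;
  then the implicit function theorem for the trace of the resolvent makes them as regular as the
  shape operator.\<close>

theorem Ck_on_root_function:
  assumes rf: "root_functions \<Omega> p \<kappa> m \<tau>" and i: "i \<in> {1..p - 1}"
  shows "Ck_on 2 (\<tau> i) \<Omega>"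
proof -
  note R = \<Omega> Ck_on_shape_op[OF \<Omega> hyp4 gm] shape_op_linear[OF \<Omega> hyp4 gm] hyp_inner_product[OF \<Omega> hyp4 gm]
    eigenframe_hyp
  have ne: "\<exists>i. d i \<noteq> 0" if x: "x \<in> \<Omega>" and f: "eigenframe (first_form \<phi> x) (shape_op \<phi> \<nu> x) f d" for x f d
  proof -
    have "\<kappa> 1 x \<in> range d" using principal_multiplicities(2)[OF x f] p by simp
    moreover have "\<kappa> 1 x \<noteq> 0" using \<kappa>0[of 1 x] p x by simp
    ultimately show ?thesis by (metis rangeE)
  qed
  have sorted: "strict_mono_on {1..p - 1} (\<lambda>i. \<tau> i x)"
    and roots: "(\<lambda>i. \<tau> i x) ` {1..p - 1} = {t. poly (curv_poly p (\<lambda>i. \<kappa> i x) m) t = 0}" if "x \<in> \<Omega>" for x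
    using rf that by (auto simp: root_functions_def)
  have root: "(x, \<tau> i x) \<in> resolvent_set \<Omega> (shape_op \<phi> \<nu>)" "resolvent_trace (shape_op \<phi> \<nu>) (x, \<tau> i x) = 0"
    if "i \<in> {1..p - 1}" "x \<in> \<Omega>" for i x
    using roots[OF that(2)] that radius_root_resolvent[OF that(2), of "\<tau> i x"] by blast+
  have "isCont (\<tau> i) x0" if x0: "x0 \<in> \<Omega>" for x0
  proof (rule isCont_sorted_roots[OF \<Omega> x0 sorted roots _ i])
    fix j and \<epsilon> :: real assume j: "j \<in> {1..p - 1}" and e: "\<epsilon> > 0"
    have "\<forall>\<^sub>F x in nhds x0. \<exists>t. \<bar>t - \<tau> j x0\<bar> < \<epsilon> \<and> (x, t) \<in> resolvent_set \<Omega> (shape_op \<phi> \<nu>) \<and>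
        resolvent_trace (shape_op \<phi> \<nu>) (x, t) = 0"
      by (rule resolvent_root_persists[OF R x0 root[OF j x0] ne[OF x0] e])
    moreover have "\<forall>\<^sub>F x in nhds x0. x \<in> \<Omega>" by (rule eventually_nhds_in_open[OF \<Omega> x0])
    ultimately show "\<forall>\<^sub>F x in nhds x0. \<exists>t\<in>{t. poly (curv_poly p (\<lambda>i. \<kappa> i x) m) t = 0}. \<bar>t - \<tau> j x0\<bar> < \<epsilon>"
    proof eventually_elim
      case (elim x)
      then show ?case using radius_root_resolvent[OF elim(2)] by blast
    qed
  qed
  then have "continuous_on \<Omega> (\<tau> i)" by (simp add: continuous_at_imp_continuous_on)
  from Ck_on_resolvent_root[OF R _ this root[OF i] ne] show ?thesis by simp
qed

theorem root_lift_trapped: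
  assumes rf: "root_functions \<Omega> p \<kappa> m \<tau>" and i: "i \<in> {1..p - 1}"
  shows "immersion 2 \<Omega> (lift \<phi> \<nu> (\<tau> i)) \<and> spacelike \<Omega> (lift \<phi> \<nu> (\<tau> i)) \<and> marginally_trapped \<Omega> (lift \<phi> \<nu> (\<tau> i))"
proof (rule lift_trapped_sum[OF Ck_on_root_function[OF rf i]])
  fix x f d assume x: "x \<in> \<Omega>" and f: "eigenframe (first_form \<phi> x) (shape_op \<phi> \<nu> x) f d"
  have "poly (curv_poly p (\<lambda>i. \<kappa> i x) m) (\<tau> i x) = 0"
  proof -
    have "\<tau> i x \<in> (\<lambda>i. \<tau> i x) ` {1..p - 1}" using i by blast
    then show ?thesis using rf x unfolding root_functions_def by blast
  qed
  then have r: "(\<forall>j. 1 - \<tau> i x * d j \<noteq> 0) \<and> (\<Sum>j\<in>UNIV. d j / (1 - \<tau> i x * d j)) = 0"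
    using radius_root_iff[OF x f] by blast
  show "1 - \<tau> i x * d j \<noteq> 0" for j using r by blast
  show "(\<Sum>j\<in>UNIV. d j / (1 - \<tau> i x * d j)) = 0" using r by blast
qed

end

subsection \<open>Surfaces\<close>

lemma two_principal_curvatures:
  assumes n2: "CARD('n) = 2" and x: "x \<in> \<Omega>" and pc: "principal_curvatures \<phi> \<nu> x = {k1, k2}" and um: "\<not> umbilic \<phi> \<nu> x"
    and f: "eigenframe (first_form \<phi> x) (shape_op \<phi> \<nu> x) f d"
  shows "k1 \<noteq> k2" "card {i. d i = k1} = 1" "card {i. d i = k2} = 1"
proof -
  note e = hyp_inner_product[OF \<Omega> hyp4 gm x] shape_op_linear[OF \<Omega> hyp4 gm x] f
  have r: "range d = {k1, k2}" using principal_curvatures_eigenframe(1)[OF x f] pc by simp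
  show ne: "k1 \<noteq> k2"
  proof
    assume "k1 = k2"
    then have d: "d i = k1" for i using r by (metis insertE rangeI singletonD)
    have "shape_op \<phi> \<nu> x u = k1 *\<^sub>R u" for u
    proof (rule eigenframe_eqI[OF e])
      show "first_form \<phi> x (f i) (shape_op \<phi> \<nu> x u) = first_form \<phi> x (f i) (k1 *\<^sub>R u)" for i
        by (simp add: eigenframe_operator[OF e] d inner_product_simps[OF e(1)])
    qed
    then show False using um by (auto simp: umbilic_def)
  qed
  have "{i. d i = k1} \<union> {i. d i = k2} = UNIV" using r by auto
  then have "card {i. d i = k1} + card {i. d i = k2} = 2"
    using card_Un_disjoint[of "{i. d i = k1}" "{i. d i = k2}"] ne n2 by fastforce
  moreover have "k1 \<in> range d" "k2 \<in> range d" using r by simp_all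
  then have "{i. d i = k1} \<noteq> {}" "{i. d i = k2} \<noteq> {}" by auto
  then have "card {i. d i = k1} > 0" "card {i. d i = k2} > 0" by (simp_all add: card_gt_0_iff)
  ultimately show "card {i. d i = k1} = 1" "card {i. d i = k2} = 1" by linarith+
qed

lemma sum_two_principal_curvatures:
  assumes n2: "CARD('n) = 2" and x: "x \<in> \<Omega>" and pc: "principal_curvatures \<phi> \<nu> x = {k1, k2}" and um: "\<not> umbilic \<phi> \<nu> x"
    and f: "eigenframe (first_form \<phi> x) (shape_op \<phi> \<nu> x) f d"
  shows "(\<Sum>i\<in>UNIV. h (d i)) = h k1 + (h k2 :: real)"
proof -
  note t = two_principal_curvatures[OF n2 x pc um f]
  have r: "range d = {k1, k2}" using principal_curvatures_eigenframe(1)[OF x f] pc by simp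
  have "(\<Sum>k\<in>{k1, k2}. real 1 * h (id k)) = (\<Sum>j\<in>UNIV. h (d j))"
  proof (rule sum_over_eigenvalues[of id "{k1, k2}" d "\<lambda>_. 1" h])
    show "card {j. d j = id i} = 1" if "i \<in> {k1, k2}" for i using that t(2,3) by auto
  qed (simp_all add: r)
  then show ?thesis using t(1) by simp
qed

text \<open>For two simple curvatures \<open>P(t) = \<kappa>\<^sub>1\<^sup>-\<^sup>1 + \<kappa>\<^sub>2\<^sup>-\<^sup>1 - 2 t\<close>, whose root is \<open>H / K\<close>.\<close>

theorem surface_lift_trapped:
  assumes n2: "CARD('n) = 2"
    and pc: "\<And>x. x \<in> \<Omega> \<Longrightarrow> principal_curvatures \<phi> \<nu> x = {k1 x, k2 x}" and um: "\<And>x. x \<in> \<Omega> \<Longrightarrow> \<not> umbilic \<phi> \<nu> x"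
    and HK: "\<And>x. x \<in> \<Omega> \<Longrightarrow> H x = (k1 x + k2 x) / 2 \<and> K x = k1 x * k2 x \<and> K x \<noteq> 0"
  shows "immersion 2 \<Omega> (lift \<phi> \<nu> (\<lambda>x. H x / K x)) \<and> spacelike \<Omega> (lift \<phi> \<nu> (\<lambda>x. H x / K x)) \<and>
     marginally_trapped \<Omega> (lift \<phi> \<nu> (\<lambda>x. H x / K x))"
proof -
  define \<kappa> where "\<kappa> = (\<lambda>i :: nat. if i = 1 then k1 else k2)"
  have I2: "{1..2} = {1, 2 :: nat}" by auto
  have \<kappa>0: "\<kappa> i x \<noteq> 0" if "i \<in> {1..2}" "x \<in> \<Omega>" for i x
    using HK[OF that(2)] by (auto simp: \<kappa>_def)
  have hp: "has_principal_curvatures \<Omega> \<phi> \<nu> 2 \<kappa> (\<lambda>_. 1)"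
    unfolding has_principal_curvatures_def
  proof (intro ballI conjI)
    fix x assume x: "x \<in> \<Omega>"
    obtain f d where f: "eigenframe (first_form \<phi> x) (shape_op \<phi> \<nu> x) f d" using eigenframe_hyp[OF x] by blast
    note t = two_principal_curvatures[OF n2 x pc[OF x] um[OF x] f]
    show "inj_on (\<lambda>i. \<kappa> i x) {1..2}" unfolding I2 using t(1) by (simp add: \<kappa>_def)
    show "principal_curvatures \<phi> \<nu> x = (\<lambda>i. \<kappa> i x) ` {1..2}" unfolding I2 using pc[OF x] by (simp add: \<kappa>_def)
    show "dim {u. shape_op \<phi> \<nu> x u = \<kappa> i x *\<^sub>R u} = 1" if "i \<in> {1..2}" for i
      unfolding principal_curvatures_eigenframe(2)[OF x f] using t(2,3) by (simp add: \<kappa>_def)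
  qed
  have rf: "root_functions \<Omega> 2 \<kappa> (\<lambda>_. 1) (\<lambda>i x. H x / K x)"
    unfolding root_functions_def
  proof (intro ballI conjI)
    fix x assume x: "x \<in> \<Omega>"
    have k: "k1 x \<noteq> 0" "k2 x \<noteq> 0" using HK[OF x] by auto
    have "poly (curv_poly 2 (\<lambda>i. \<kappa> i x) (\<lambda>_. 1)) t = (inverse (k2 x) - t) + (inverse (k1 x) - t)" for t
    proof -
      have "{1, 2} - {1} = {2 :: nat}" "{1, 2} - {2} = {1 :: nat}" by auto
      then show ?thesis unfolding curv_poly_def I2 by (simp add: \<kappa>_def)
    qed
    moreover have "(inverse (k2 x) - t) + (inverse (k1 x) - t) = 0 \<longleftrightarrow> t = H x / K x" for t
      using HK[OF x] k by (auto simp: field_simps)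
    moreover have "{1..2 - 1} = {1 :: nat}" by simp
    ultimately show "(\<lambda>i :: nat. H x / K x) ` {1..2 - 1} = {t. poly (curv_poly 2 (\<lambda>i. \<kappa> i x) (\<lambda>_. 1)) t = 0}" by auto
  qed (auto intro!: strict_mono_onI)
  show ?thesis using root_lift_trapped[OF _ hp \<kappa>0 rf, of 1] by simp
qed

text \<open>The lift with constant \<open>\<tau>\<close> is a parallel surface in a time slice. There a null mean
  curvature vector vanishes, and so \<open>\<tau>\<close> has to be the root of \<open>P\<close>.\<close>

theorem surface_parallel_trapped_iff:
  assumes n2: "CARD('n) = 2"
    and pc: "\<And>x. x \<in> \<Omega> \<Longrightarrow> principal_curvatures \<phi> \<nu> x = {k1 x, k2 x}" and um: "\<And>x. x \<in> \<Omega> \<Longrightarrow> \<not> umbilic \<phi> \<nu> x"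
    and HK: "\<And>x. x \<in> \<Omega> \<Longrightarrow> H x = (k1 x + k2 x) / 2 \<and> K x = k1 x * k2 x \<and> K x \<noteq> 0"
    and im: "immersion 2 \<Omega> (lift \<phi> \<nu> (\<lambda>_. c))"
  shows "marginally_trapped \<Omega> (lift \<phi> \<nu> (\<lambda>_. c)) \<longleftrightarrow> (\<forall>x\<in>\<Omega>. H x / K x = c)"
proof -
  let ?\<psi> = "lift \<phi> \<nu> (\<lambda>_. c)"
  have C2: "Ck_on 2 ?\<psi> \<Omega>" using im by (simp add: immersion_def)
  have dc: "(\<lambda>_. c) differentiable (at x)" for x :: "real ^ 'n" by simp
  have D1c: "D1 ?\<psi> x u = (D1 \<phi> x (u - c *\<^sub>R shape_op \<phi> \<nu> x u), 0)" if "x \<in> \<Omega>" for x u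
    using D1_lift[OF \<Omega> hyp4 gm that dc] by simp
  have inj: "inj (\<lambda>u. u - c *\<^sub>R shape_op \<phi> \<nu> x u)" if x: "x \<in> \<Omega>" for x
  proof (rule injI)
    fix u v assume "u - c *\<^sub>R shape_op \<phi> \<nu> x u = v - c *\<^sub>R shape_op \<phi> \<nu> x v"
    then have "D1 ?\<psi> x u = D1 ?\<psi> x v" by (simp add: D1c[OF x])
    moreover have "inj (D1 ?\<psi> x)" using im x by (simp add: immersion_def)
    ultimately show "u = v" by (simp add: inj_eq)
  qed
  note L = lift_trapped[OF \<Omega> hyp4 gm Ck_on_const _ inj]
  have sp: "spacelike \<Omega> ?\<psi>" by (rule L(2)) simp_all
  have key: "(\<exists>b. mean_curv_vec ?\<psi> x = b *\<^sub>R (\<nu> x, 1)) \<longleftrightarrow> H x / K x = c" if x: "x \<in> \<Omega>" for x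
  proof -
    obtain f d where f: "eigenframe (first_form \<phi> x) (shape_op \<phi> \<nu> x) f d" using eigenframe_hyp[OF x] by blast
    have r: "range d = {k1 x, k2 x}" using principal_curvatures_eigenframe(1)[OF x f] pc[OF x] by simp
    have "1 - c * d i \<noteq> 0" for i
      using lift_operator_eigen[OF \<Omega> hyp4 gm x f, of c] inj[OF x] by blast
    then have ne: "1 - c * k1 x \<noteq> 0" "1 - c * k2 x \<noteq> 0" using r by (metis insertI1 insert_commute rangeE)+
    have k: "k1 x \<noteq> 0" "k2 x \<noteq> 0" using HK[OF x] by auto
    have "(\<exists>b. mean_curv_vec ?\<psi> x = b *\<^sub>R (\<nu> x, 1)) \<longleftrightarrow> (\<Sum>i\<in>UNIV. d i / (1 - c * d i)) = 0"
      by (rule L(3)[OF _ _ _ x f, symmetric]) auto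
    also have "(\<Sum>i\<in>UNIV. d i / (1 - c * d i)) = k1 x / (1 - c * k1 x) + k2 x / (1 - c * k2 x)"
      by (rule sum_two_principal_curvatures[OF n2 x pc[OF x] um[OF x] f, of "\<lambda>k. k / (1 - c * k)"])
    also have "\<dots> = (k1 x + k2 x - 2 * c * (k1 x * k2 x)) / ((1 - c * k1 x) * (1 - c * k2 x))"
      unfolding add_frac_eq[OF ne] by (simp add: algebra_simps)
    also have "\<dots> = 0 \<longleftrightarrow> k1 x + k2 x = 2 * c * (k1 x * k2 x)"
      using ne by simp
    also have "\<dots> \<longleftrightarrow> H x / K x = c" using HK[OF x] k by (auto simp: field_simps)
    finally show ?thesis .
  qed
  show ?thesis
  proof
    assume "\<forall>x\<in>\<Omega>. H x / K x = c"
    then show "marginally_trapped \<Omega> ?\<psi>"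
      using key gm by (intro marginally_trappedI[OF sp, of \<nu>]) (auto simp: gauss_map_def)
  next
    assume mt: "marginally_trapped \<Omega> ?\<psi>"
    show "\<forall>x\<in>\<Omega>. H x / K x = c"
    proof
      fix x assume x: "x \<in> \<Omega>"
      have d: "?\<psi> differentiable (at x)" by (rule Ck_on_differentiable[OF C2 _ x]) simp
      have lin: "linear (D1 ?\<psi> x)" by (rule linear_frechet_derivative[OF d])
      have ip: "inner_product (ind_metric ?\<psi> x)" by (rule spacelike_inner_product[OF sp x d])
      \<comment> \<open>The lift lies in a time slice, so its mean curvature vector is horizontal; a horizontal
        null vector vanishes.\<close>
      have s2: "snd (D2 ?\<psi> x u v) = 0" for u v
      proof -
        have "snd (D2 ?\<psi> x u v) = D2 (\<lambda>y. snd (?\<psi> y)) x u v"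
          by (rule D2_compose_bounded_linear[OF bounded_linear_snd \<Omega> x C2, symmetric])
        also have "\<dots> = 0" by (simp add: lift_def D2_def)
        finally show ?thesis .
      qed
      have "snd (sff ?\<psi> x u v) = 0" for u v
        unfolding sff_def normal_proj_eq[OF lin ip] by (simp add: s2 D1c[OF x])
      then have s0: "snd (mean_curv_vec ?\<psi> x) = 0" by (simp add: mean_curv_vec_def snd_sum)
      have "mink (mean_curv_vec ?\<psi> x) (mean_curv_vec ?\<psi> x) = 0"
        using mt x by (simp add: marginally_trapped_def)
      then have "fst (mean_curv_vec ?\<psi> x) = 0" using s0 by (simp add: mink_def)
      then have "mean_curv_vec ?\<psi> x = 0 *\<^sub>R (\<nu> x, 1)" using s0 by (simp add: prod_eq_iff)
      then show "H x / K x = c" using key[OF x] by blast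
    qed
  qed
qed

end

lemma lift_comp: "lift \<phi> \<nu> \<tau> \<circ> r = lift (\<phi> \<circ> r) (\<nu> \<circ> r) (\<tau> \<circ> r)"
  by (simp add: lift_def fun_eq_iff)

section \<open>Submanifolds with a null field along the mean curvature vector\<close>

context
  fixes \<psi> :: "real ^ 'n \<Rightarrow> 'n::finite mink" and V \<xi>
  assumes V: "open V" and C5: "Ck_on 5 \<psi> V" and sp: "spacelike V \<psi>" and \<xi>: "null_normal_field V \<psi> \<xi>"
begin

definition unit_null :: "real ^ 'n \<Rightarrow> (real ^ 'n) \<times> real" where
  "unit_null x = (1 / snd (\<xi> x)) *\<^sub>R fst (\<xi> x)"

definition unit_shape :: "real ^ 'n \<Rightarrow> real ^ 'n \<Rightarrow> real ^ 'n" where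
  "unit_shape x = null_shape \<psi> x (unit_null x, 1)"

lemma tf_C: "Ck_on (Suc (Suc 3)) \<psi> V" "Ck_on (Suc 4) \<psi> V" "Ck_on 2 \<psi> V"
  using C5 Ck_on_le[OF C5, of 4] Ck_on_le[OF C5, of 2] by (simp_all add: numeral_eq_Suc del: Ck_on.simps)

lemma tf_differentiable: "x \<in> V \<Longrightarrow> \<psi> differentiable (at x)"
  using Ck_on_differentiable[OF C5] by simp

lemma tf_linear: "x \<in> V \<Longrightarrow> linear (D1 \<psi> x)"
  by (rule linear_frechet_derivative[OF tf_differentiable])

lemma tf_ip: "x \<in> V \<Longrightarrow> inner_product (ind_metric \<psi> x)"
  using spacelike_inner_product[OF sp] tf_differentiable by blast

lemma tf_null:
  assumes "x \<in> V"
  shows "(unit_null x, 1) \<in> normal_space \<psi> x" "norm (unit_null x) = 1" "\<xi> x = snd (\<xi> x) *\<^sub>R (unit_null x, 1)"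
    "snd (\<xi> x) \<noteq> 0"
proof -
  have n: "null_normal \<psi> x (\<xi> x)" using \<xi> assms by (simp add: null_normal_field_def)
  show "(unit_null x, 1) \<in> normal_space \<psi> x" "norm (unit_null x) = 1" "\<xi> x = snd (\<xi> x) *\<^sub>R (unit_null x, 1)"
    using null_normal_normalise[OF n] unfolding unit_null_def by blast+
  show "snd (\<xi> x) \<noteq> 0" by (rule null_normal_snd_nonzero[OF n])
qed

lemma Ck_on_unit_null: "Ck_on 4 unit_null V"
proof (rule Ck_on_null_normal[OF V tf_C(2) tf_ip _ tf_null(2) tf_null(1)])
  have "continuous_on V \<xi>" using \<xi> by (simp add: null_normal_field_def)
  then show "continuous_on V unit_null"
    unfolding unit_null_def[abs_def] using tf_null(4) by (intro continuous_intros) auto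
qed

lemma unit_shape: "x \<in> V \<Longrightarrow> ind_metric \<psi> x (unit_shape x u) v = mink (D2 \<psi> x u v) (unit_null x, 1)"
  unfolding unit_shape_def by (rule null_shape[OF V _ tf_C(3) tf_ip])

lemma unit_shape_linear: "x \<in> V \<Longrightarrow> linear (unit_shape x)"
  unfolding unit_shape_def by (rule null_shape_linear[OF V _ tf_C(3) tf_ip])

lemma unit_shape_eigenframe: "x \<in> V \<Longrightarrow> \<exists>f d. eigenframe (ind_metric \<psi> x) (unit_shape x) f d"
  unfolding unit_shape_def by (rule null_shape_eigenframe[OF V _ tf_C(3) tf_ip])

lemma Ck_on_pairing: "Ck_on 3 (\<lambda>x. mink (D2 \<psi> x u v) (unit_null x, 1)) V"
proof -
  have "Ck_on 3 unit_null V" using Ck_on_le[OF Ck_on_unit_null, of 3] by simp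
  then show ?thesis by (intro Ck_on_mink V Ck_on_D2[OF tf_C(1)] Ck_on_Pair Ck_on_const)
qed

lemma pairing_linear:
  assumes x: "x \<in> V"
  shows "linear (\<lambda>v. mink (D2 \<psi> x u v) (unit_null x, 1))"
proof -
  note l = D2_linear_right[OF V x tf_C(3)]
  show ?thesis by (intro linearI) (simp_all add: linear_add[OF l] linear_scale[OF l] mk.add_left mk.scaleR_left)
qed

lemma Ck_on_tf_metric: "Ck_on 3 (\<lambda>x. ind_metric \<psi> x u v) V"
  by (rule Ck_on_ind_metric[OF V]) (rule Ck_on_Suc_D[OF tf_C(1)])

lemma Ck_on_unit_shape: "Ck_on 3 (\<lambda>x. unit_shape x u) V"
  unfolding unit_shape_def null_shape_def
  by (rule Ck_on_riesz[OF V tf_ip Ck_on_tf_metric pairing_linear Ck_on_pairing])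

lemma tf_isCont:
  assumes x: "x \<in> V"
  shows "isCont (\<lambda>x. ind_metric \<psi> x u v) x" "isCont (\<lambda>x. ind_metric \<psi> x (unit_shape x u) v) x"
    "isCont (\<lambda>x. ind_metric \<psi> x (unit_shape x u) (unit_shape x v)) x" "isCont (\<lambda>x. unit_shape x u) x"
proof -
  have c: "isCont h x" if "Ck_on 3 h V" for h :: "real ^ 'n \<Rightarrow> 'b::real_normed_vector"
    using Ck_on_continuous[OF that] V x continuous_on_eq_continuous_at by blast
  show "isCont (\<lambda>x. ind_metric \<psi> x u v) x" by (rule c[OF Ck_on_tf_metric])
  show "isCont (\<lambda>x. unit_shape x u) x"
    using Ck_on_continuous[OF Ck_on_unit_shape] V x continuous_on_eq_continuous_at by blast
  have "Ck_on 3 (\<lambda>x. ind_metric \<psi> x (unit_shape x u) v) V"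
    by (subst Ck_on_cong[OF V unit_shape]) (auto intro: Ck_on_pairing)
  then show "isCont (\<lambda>x. ind_metric \<psi> x (unit_shape x u) v) x" by (rule c)
  have "Ck_on 3 (\<lambda>x. mink (D2 \<psi> x u (unit_shape x v)) (unit_null x, 1)) V"
    by (rule Ck_on_linear_apply[OF V pairing_linear Ck_on_pairing Ck_on_unit_shape])
  then have "Ck_on 3 (\<lambda>x. ind_metric \<psi> x (unit_shape x u) (unit_shape x v)) V"
    by (subst Ck_on_cong[OF V unit_shape]) auto
  then show "isCont (\<lambda>x. ind_metric \<psi> x (unit_shape x u) (unit_shape x v)) x" by (rule c)
qed

lemma unit_shape_clusters:
  assumes x0: "x0 \<in> V" and f0: "eigenframe (ind_metric \<psi> x0) (unit_shape x0) f0 d0"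
  shows "\<forall>\<^sub>F x in nhds x0. \<forall>f d. eigenframe (ind_metric \<psi> x) (unit_shape x) f d \<longrightarrow>
     card (range d0) \<le> card (range d) \<and>
     (card (range d) = card (range d0) \<longrightarrow>
        (\<exists>\<kappa>. inj_on \<kappa> (range d0) \<and> range d = \<kappa> ` range d0 \<and>
           (\<forall>l\<in>range d0. card {i. d i = \<kappa> l} = card {i. d0 i = l})))"
proof (rule eigenvalue_clusters[OF _ _ tf_isCont(1)[OF x0] tf_isCont(2)[OF x0] tf_isCont(3)[OF x0] f0])
  have ev: "\<forall>\<^sub>F x in nhds x0. x \<in> V" by (rule eventually_nhds_in_open[OF V x0])
  show "\<forall>\<^sub>F x in nhds x0. inner_product (ind_metric \<psi> x)" using ev by (rule eventually_mono) (rule tf_ip)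
  show "\<forall>\<^sub>F x in nhds x0. linear (unit_shape x)" using ev by (rule eventually_mono) (rule unit_shape_linear)
qed

lemma null_eigenvalues_eq:
  assumes x: "x \<in> V" and f: "eigenframe (ind_metric \<psi> x) (unit_shape x) f d"
  shows "null_eigenvalues \<psi> \<xi> x = (\<lambda>k. snd (\<xi> x) * k) ` range d"
proof -
  note ip = tf_ip[OF x] and n = tf_null[OF x]
  let ?s = "snd (\<xi> x)"
  have pair: "mink (sff \<psi> x u v) (\<xi> x) = ?s * ind_metric \<psi> x (unit_shape x u) v" for u v
  proof -
    have "mink (sff \<psi> x u v) (\<xi> x) = ?s * mink (sff \<psi> x u v) (unit_null x, 1)"
      by (subst n(3)) (simp only: mk.scaleR_right, simp)
    also have "mink (sff \<psi> x u v) (unit_null x, 1) = ind_metric \<psi> x (unit_shape x u) v"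
      unfolding mink_sff[OF tf_linear[OF x] ip n(1)] unit_shape[OF x] ..
    finally show ?thesis .
  qed
  have "(\<forall>v. mink (sff \<psi> x u v) (\<xi> x) = l * ind_metric \<psi> x u v) \<longleftrightarrow> unit_shape x u = (l / ?s) *\<^sub>R u" for l u
  proof
    assume a: "\<forall>v. mink (sff \<psi> x u v) (\<xi> x) = l * ind_metric \<psi> x u v"
    show "unit_shape x u = (l / ?s) *\<^sub>R u"
    proof (rule inner_product_eqI[OF ip])
      fix v have "?s * ind_metric \<psi> x (unit_shape x u) v = l * ind_metric \<psi> x u v" using a pair by simp
      then show "ind_metric \<psi> x (unit_shape x u) v = ind_metric \<psi> x ((l / ?s) *\<^sub>R u) v"
        using n(4) by (simp add: inner_product_simps(5)[OF ip] field_simps)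
    qed
  next
    assume "unit_shape x u = (l / ?s) *\<^sub>R u"
    then show "\<forall>v. mink (sff \<psi> x u v) (\<xi> x) = l * ind_metric \<psi> x u v"
      using n(4) by (simp add: pair inner_product_simps(5)[OF ip])
  qed
  then have "null_eigenvalues \<psi> \<xi> x = {l. l / ?s \<in> {k. \<exists>u. u \<noteq> 0 \<and> unit_shape x u = k *\<^sub>R u}}"
    unfolding null_eigenvalues_def by simp
  also have "\<dots> = {l. l / ?s \<in> range d}"
    unfolding eigenframe_eigenvalues[OF ip unit_shape_linear[OF x] f] ..
  also have "\<dots> = (\<lambda>k. ?s * k) ` range d"
  proof
    show "{l. l / ?s \<in> range d} \<subseteq> (\<lambda>k. ?s * k) ` range d"
    proof
      fix l assume "l \<in> {l. l / ?s \<in> range d}"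
      moreover have "l = ?s * (l / ?s)" using n(4) by simp
      ultimately show "l \<in> (\<lambda>k. ?s * k) ` range d" by blast
    qed
    show "(\<lambda>k. ?s * k) ` range d \<subseteq> {l. l / ?s \<in> range d}" using n(4) by auto
  qed
  finally show ?thesis .
qed

lemma card_null_eigenvalues:
  assumes x: "x \<in> V" and f: "eigenframe (ind_metric \<psi> x) (unit_shape x) f d"
  shows "card (null_eigenvalues \<psi> \<xi> x) = card (range d)" "0 \<in> null_eigenvalues \<psi> \<xi> x \<longleftrightarrow> 0 \<in> range d"
proof -
  have "inj_on (\<lambda>k. snd (\<xi> x) * k) (range d)" using tf_null(4)[OF x] by (simp add: inj_on_def)
  then show "card (null_eigenvalues \<psi> \<xi> x) = card (range d)"
    unfolding null_eigenvalues_eq[OF assms] by (rule card_image)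
  show "0 \<in> null_eigenvalues \<psi> \<xi> x \<longleftrightarrow> 0 \<in> range d"
    unfolding null_eigenvalues_eq[OF assms] using tf_null(4)[OF x] by force
qed

lemma unit_shape_trace:
  assumes x: "x \<in> V" and f: "eigenframe (ind_metric \<psi> x) (unit_shape x) f d" and H: "mean_curv_vec \<psi> x = b *\<^sub>R \<xi> x"
  shows "(\<Sum>i\<in>UNIV. d i) = 0"
proof -
  have "\<exists>b. mean_curv_vec \<psi> x = b *\<^sub>R (unit_null x, 1)"
    using H tf_null(3)[OF x] by (metis scaleR_scaleR)
  then have "trace (matrix (unit_shape x)) = 0"
    unfolding unit_shape_def using mean_curv_null_iff_trace[OF V x tf_C(3) tf_ip[OF x] tf_null(1,2)[OF x]] by blast
  then show ?thesis using eigenframe_trace[OF tf_ip[OF x] unit_shape_linear[OF x] f] by simp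
qed

text \<open>A trace-free operator with a single eigenvalue is 0, and then the second fundamental form
  takes its values in the null line.\<close>

lemma unit_shape_two_eigenvalues:
  assumes x: "x \<in> V" and f: "eigenframe (ind_metric \<psi> x) (unit_shape x) f d" and H: "mean_curv_vec \<psi> x = b *\<^sub>R \<xi> x"
    and nn: "\<not> null_sff_at \<psi> x"
  shows "2 \<le> card (range d)"
proof (rule ccontr)
  assume "\<not> 2 \<le> card (range d)"
  moreover have "card (range d) \<noteq> 0" by simp
  ultimately have "card (range d) = 1" by linarith
  then obtain k where "range d = {k}" by (auto simp: card_1_singleton_iff)
  then have k: "d i = k" for i by auto
  have "real CARD('n) * k = 0" using unit_shape_trace[OF x f H] by (simp add: k)
  then have d0: "d i = 0" for i using k by simp
  have "unit_shape x u = 0" for u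
    by (rule eigenframe_eqI[OF tf_ip[OF x] unit_shape_linear[OF x] f])
      (simp add: eigenframe_operator[OF tf_ip[OF x] unit_shape_linear[OF x] f] d0 inner_product_simps[OF tf_ip[OF x]])
  then have "mink (sff \<psi> x u v) (unit_null x, 1) = 0" for u v
    unfolding mink_sff[OF tf_linear[OF x] tf_ip[OF x] tf_null(1)[OF x]] unit_shape[OF x, symmetric]
    by (simp add: inner_product_simps[OF tf_ip[OF x]])
  then have "sff \<psi> x u v = snd (sff \<psi> x u v) *\<^sub>R (unit_null x, 1)" for u v
    using normal_orthogonal_null[OF tf_linear[OF x] tf_ip[OF x] tf_null(1,2)[OF x] sff_normal[OF tf_linear[OF x] tf_ip[OF x]]]
    by blast
  moreover have "null_normal \<psi> x (unit_null x, 1)" by (rule null_normal_unit[OF tf_null(1,2)[OF x]])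
  ultimately have "null_sff_at \<psi> x" unfolding null_sff_at_def by blast
  then show False using nn by blast
qed

subsection \<open>The underlying hypersurface\<close>

text \<open>Moving from each point of the submanifold along its null normal to a fixed time slice gives a
  hypersurface with unit normal \<open>unit_null\<close>, wherever \<open>1 + t S\<close> is invertible; here \<open>t\<close> is the
  height above the slice and \<open>S\<close> the shape operator of the null normal. An eigenvalue \<open>d\<close> of \<open>S\<close>
  becomes the principal curvature \<open>d / (1 + t d)\<close>.\<close>

context
  fixes s :: real
begin

definition height :: "real ^ 'n \<Rightarrow> real" where
  "height x = snd (\<psi> x) - s"

definition projected :: "real ^ 'n \<Rightarrow> (real ^ 'n) \<times> real" where
  "projected x = fst (\<psi> x) - height x *\<^sub>R unit_null x"

lemma lift_projected: "lift projected unit_null height x = \<psi> x + (0, - s)"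
  by (simp add: lift_def projected_def height_def prod_eq_iff)

lemma Ck_on_height: "Ck_on 5 height V"
  unfolding height_def[abs_def] by (intro Ck_on_diff Ck_on_snd Ck_on_const V C5)

lemma Ck_on_projected: "Ck_on 4 projected V"
proof -
  have "Ck_on 4 \<psi> V" "Ck_on 4 height V" using Ck_on_le[OF C5, of 4] Ck_on_le[OF Ck_on_height, of 4] by simp_all
  then show ?thesis
    unfolding projected_def[abs_def] by (intro Ck_on_diff Ck_on_fst Ck_on_scaleR V Ck_on_unit_null)
qed

text \<open>The representative with last component 0 of a tangent vector modulo the null normal
  \<open>(N, 1)\<close>. Because \<open>(N, 1)\<close> is orthogonal to the tangent space, passing to it changes no
  inner products.\<close>

definition screen :: "real ^ 'n \<Rightarrow> real ^ 'n \<Rightarrow> (real ^ 'n) \<times> real" where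
  "screen x w = fst (D1 \<psi> x w) - snd (D1 \<psi> x w) *\<^sub>R unit_null x"

lemma screen_linear:
  assumes "x \<in> V"
  shows "linear (screen x)"
  by (intro linearI) (simp_all add: screen_def linear_add[OF tf_linear[OF assms]] linear_scale[OF tf_linear[OF assms]] algebra_simps)

lemma screen_normal:
  assumes x: "x \<in> V"
  shows "unit_null x \<bullet> screen x w = 0"
proof -
  have "unit_null x \<bullet> unit_null x = 1" using tf_null(2)[OF x] by (simp add: dot_square_norm)
  moreover have "unit_null x \<bullet> fst (D1 \<psi> x w) = snd (D1 \<psi> x w)"
    using tf_null(1)[OF x] by (simp add: normal_space_def mink_def)
  ultimately show ?thesis by (simp add: screen_def inner_diff_right)
qed

lemma screen_inj:
  assumes x: "x \<in> V"
  shows "inj (screen x)"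
  unfolding linear_injective_0[OF screen_linear[OF x]]
proof (intro allI impI)
  fix w assume "screen x w = 0"
  then have e: "fst (D1 \<psi> x w) = snd (D1 \<psi> x w) *\<^sub>R unit_null x" by (simp add: screen_def)
  have "unit_null x \<bullet> unit_null x = 1" using tf_null(2)[OF x] by (simp add: dot_square_norm)
  then have "ind_metric \<psi> x w w = 0" by (simp add: ind_metric_def mink_def e)
  then show "w = 0" using inner_product_pos[OF tf_ip[OF x], of w] by force
qed

text \<open>The vector \<open>(dN(u), 0) + D\<psi>(S u)\<close> is normal and orthogonal to \<open>(N, 1)\<close>, hence a multiple
  of it.\<close>

lemma D1_unit_null:
  assumes x: "x \<in> V"
  shows "D1 unit_null x u = - screen x (unit_shape x u)"
proof -
  have C1: "Ck_on 1 unit_null V" using Ck_on_le[OF Ck_on_unit_null, of 1] by simp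
  note der = null_normal_derivative[OF V x tf_C(3) C1 tf_null(2) tf_null(1)]
  define z where "z = (D1 unit_null x u, 0) + D1 \<psi> x (unit_shape x u)"
  have "mink z (D1 \<psi> x v) = 0" for v
    using der(1)[of u v] unit_shape[OF x, of u v] by (simp add: z_def mk.add_left ind_metric_def mink_def inner_add_left)
  then have "z \<in> normal_space \<psi> x" by (simp add: normal_space_def)
  moreover have "mink z (unit_null x, 1) = 0"
  proof -
    have "mink (D1 \<psi> x (unit_shape x u)) (unit_null x, 1) = 0"
      using tf_null(1)[OF x] mink_commute[of "(unit_null x, 1)"] by (simp add: normal_space_def)
    then show ?thesis using der(2)[of u] by (simp add: z_def mk.add_left mink_def inner_commute inner_add_right)
  qed
  ultimately have z: "z = snd z *\<^sub>R (unit_null x, 1)"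
    by (rule normal_orthogonal_null[OF tf_linear[OF x] tf_ip[OF x] tf_null(1,2)[OF x]])
  have "snd z = snd (D1 \<psi> x (unit_shape x u))" by (simp add: z_def)
  moreover have "fst z = D1 unit_null x u + fst (D1 \<psi> x (unit_shape x u))" by (simp add: z_def)
  moreover have "fst z = snd z *\<^sub>R unit_null x" using arg_cong[OF z, of fst] by simp
  ultimately have "D1 unit_null x u + fst (D1 \<psi> x (unit_shape x u)) = snd (D1 \<psi> x (unit_shape x u)) *\<^sub>R unit_null x"
    by simp
  then show ?thesis by (simp add: screen_def algebra_simps)
qed

lemma D1_projected:
  assumes x: "x \<in> V"
  shows "D1 projected x u = screen x (u + height x *\<^sub>R unit_shape x u)"
proof -
  have d\<psi>: "(\<psi> has_derivative D1 \<psi> x) (at x)" by (rule has_derivative_D1[OF tf_differentiable[OF x]])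
  have dh: "(height has_derivative (\<lambda>u. snd (D1 \<psi> x u))) (at x)"
    unfolding height_def[abs_def] using has_derivative_diff[OF has_derivative_snd[OF d\<psi>] has_derivative_const[of s]] by simp
  have dN: "(unit_null has_derivative D1 unit_null x) (at x)"
    by (rule Ck_on_has_derivative[OF Ck_on_unit_null _ x]) simp
  have "(projected has_derivative (\<lambda>u. fst (D1 \<psi> x u) - (height x *\<^sub>R D1 unit_null x u + snd (D1 \<psi> x u) *\<^sub>R unit_null x))) (at x)"
    unfolding projected_def[abs_def] by (intro has_derivative_diff has_derivative_fst d\<psi> has_derivative_scaleR dh dN)
  then have "D1 projected x u = fst (D1 \<psi> x u) - (height x *\<^sub>R D1 unit_null x u + snd (D1 \<psi> x u) *\<^sub>R unit_null x)"
    by (simp add: D1_eq)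
  also have "\<dots> = screen x u + height x *\<^sub>R screen x (unit_shape x u)"
    unfolding D1_unit_null[OF x] by (simp add: screen_def[of x u])
  finally show ?thesis by (simp add: linear_add[OF screen_linear[OF x]] linear_scale[OF screen_linear[OF x]])
qed

lemma projected_hypersurface:
  assumes W: "W \<subseteq> V" and inj: "\<And>x. x \<in> W \<Longrightarrow> inj (\<lambda>u. u + height x *\<^sub>R unit_shape x u)"
  shows "immersion 4 W projected" "gauss_map W projected unit_null"
proof -
  show "immersion 4 W projected"
    unfolding immersion_def
  proof (intro conjI ballI)
    show "Ck_on 4 projected W" by (rule Ck_on_subset[OF Ck_on_projected W])
    fix x assume x: "x \<in> W"
    then have xV: "x \<in> V" using W by blast
    have eq: "D1 projected x = screen x \<circ> (\<lambda>u. u + height x *\<^sub>R unit_shape x u)"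
      using D1_projected[OF xV] by (simp add: fun_eq_iff)
    show "inj (D1 projected x)" unfolding eq by (rule inj_compose[OF screen_inj[OF xV] inj[OF x]])
  qed
  show "gauss_map W projected unit_null"
    unfolding gauss_map_def
  proof (intro conjI ballI allI)
    show "continuous_on W unit_null" by (rule continuous_on_subset[OF Ck_on_continuous[OF Ck_on_unit_null] W])
    fix x u assume "x \<in> W"
    then have xV: "x \<in> V" using W by blast
    show "norm (unit_null x) = 1" by (rule tf_null(2)[OF xV])
    show "unit_null x \<bullet> D1 projected x u = 0" unfolding D1_projected[OF xV] by (rule screen_normal[OF xV])
  qed
qed

lemma projected_shape:
  assumes W: "open W" "W \<subseteq> V" and inj: "\<And>x. x \<in> W \<Longrightarrow> inj (\<lambda>u. u + height x *\<^sub>R unit_shape x u)"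
    and x: "x \<in> W" and f: "eigenframe (ind_metric \<psi> x) (unit_shape x) f d"
  shows "1 + height x * d i \<noteq> 0"
    "eigenframe (ind_metric \<psi> x) (shape_op projected unit_null x) f (\<lambda>i. d i / (1 + height x * d i))"
    "linear (shape_op projected unit_null x)"
proof -
  have xV: "x \<in> V" using x W by blast
  note hyp = projected_hypersurface[OF W(2) inj]
  have C4: "Ck_on (Suc (Suc 2)) projected W" "\<And>x. x \<in> W \<Longrightarrow> inj (D1 projected x)"
    using hyp(1) by (simp_all add: immersion_def numeral_eq_Suc)
  show ne: "1 + height x * d i \<noteq> 0" for i
    using eigenframe_resolvent_inj[OF tf_ip[OF xV] unit_shape_linear[OF xV] f, of "- height x"] inj[OF x] by simp
  have "shape_op projected unit_null x (f i) = (d i / (1 + height x * d i)) *\<^sub>R f i" for i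
  proof (rule shape_op_unique[OF W(1) C4 hyp(2) x])
    have e: "unit_shape x (f i) = d i *\<^sub>R f i" by (rule eigenframe_eigen[OF tf_ip[OF xV] unit_shape_linear[OF xV] f])
    define c where "c = d i / (1 + height x * d i)"
    have c: "c * (1 + height x * d i) = d i" using ne[of i] by (simp add: c_def)
    have "c *\<^sub>R f i + height x *\<^sub>R unit_shape x (c *\<^sub>R f i) = (c * (1 + height x * d i)) *\<^sub>R f i"
      unfolding linear_scale[OF unit_shape_linear[OF xV]] e by (simp add: algebra_simps)
    then have "D1 projected x (c *\<^sub>R f i) = screen x (unit_shape x (f i))"
      unfolding D1_projected[OF xV] c e by simp
    then show "D1 projected x ((d i / (1 + height x * d i)) *\<^sub>R f i) = - D1 unit_null x (f i)"
      by (simp add: D1_unit_null[OF xV] c_def)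
  qed
  then show "eigenframe (ind_metric \<psi> x) (shape_op projected unit_null x) f (\<lambda>i. d i / (1 + height x * d i))"
    using f by (simp add: eigenframe_def)
  show "linear (shape_op projected unit_null x)" by (rule shape_op_linear[OF W(1) C4 hyp(2) x])
qed

end

end

section \<open>Local description of marginally trapped submanifolds\<close>

text \<open>With the time slice through the given point the height is 0 there, so \<open>1 + t S\<close> is
  invertible nearby and the projection along the null normal is a hypersurface. Its principal
  curvatures \<open>k = d / (1 + t d)\<close> satisfy \<open>k / (1 - t k) = d\<close>, so the sum over them is the
  trace of \<open>S\<close>, which vanishes. The eigenvalues \<open>d\<close> have constant multiplicities because their
  number is constant.\<close>

theorem trapping_field_local_lift:
  fixes \<psi> :: "real ^ 'n \<Rightarrow> 'n::finite mink"
  assumes V: "open V" and C5: "Ck_on 5 \<psi> V" and sp: "spacelike V \<psi>" and tf: "trapping_field V \<psi> \<xi>"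
    and x0: "x0 \<in> V" and nn: "\<not> null_sff_at \<psi> x0"
  shows "\<exists>W \<phi> \<nu> t p \<kappa> m. open W \<and> x0 \<in> W \<and> W \<subseteq> V \<and> immersion 4 W \<phi> \<and> gauss_map W \<phi> \<nu> \<and> Ck_on 2 t W \<and>
    2 \<le> p \<and> has_principal_curvatures W \<phi> \<nu> p \<kappa> m \<and> (\<forall>y\<in>W. lift \<phi> \<nu> t y = \<psi> y + (0, - snd (\<psi> x0))) \<and>
    (\<forall>y\<in>W. (\<forall>i\<in>{1..p}. 1 - t y * \<kappa> i y \<noteq> 0) \<and> (\<Sum>i\<in>{1..p}. real (m i) * (\<kappa> i y / (1 - t y * \<kappa> i y))) = 0) \<and>
    (0 \<notin> null_eigenvalues \<psi> \<xi> x0 \<longrightarrow> (\<forall>i\<in>{1..p}. \<forall>y\<in>W. \<kappa> i y \<noteq> 0))"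
proof -
  have \<xi>: "null_normal_field V \<psi> \<xi>" and H: "\<And>x. x \<in> V \<Longrightarrow> \<exists>b. mean_curv_vec \<psi> x = b *\<^sub>R \<xi> x"
    and card: "\<exists>q. \<forall>x\<in>V. card (null_eigenvalues \<psi> \<xi> x) = q"
    using tf by (auto simp: trapping_field_def)
  note A = V C5 sp \<xi>
  let ?S = "unit_shape \<psi> \<xi>" and ?\<nu> = "unit_null \<xi>" and ?t = "height \<psi> (snd (\<psi> x0))"
    and ?\<phi> = "projected \<psi> \<xi> (snd (\<psi> x0))"
  obtain q where q: "\<And>x. x \<in> V \<Longrightarrow> card (null_eigenvalues \<psi> \<xi> x) = q" using card by blast
  obtain f0 d0 where f0: "eigenframe (ind_metric \<psi> x0) (?S x0) f0 d0" using unit_shape_eigenframe[OF A x0] by blast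
  define p where "p = card (range d0)"
  have p: "2 \<le> p"
    unfolding p_def using unit_shape_two_eigenvalues[OF A x0 f0 _ nn] H[OF x0] by blast
  obtain e where e: "bij_betw e {1..p} (range d0)"
    unfolding p_def using ex_bij_betw_nat_finite_1[of "range d0"] by auto
  define m where "m = (\<lambda>i. card {j. d0 j = e i})"
  define N0 where "N0 = (0 \<notin> null_eigenvalues \<psi> \<xi> x0)"
  have evV: "\<forall>\<^sub>F y in nhds x0. y \<in> V" by (rule eventually_nhds_in_open[OF V x0])
  have evt: "\<forall>\<^sub>F y in nhds x0. inj (\<lambda>u. u + ?t y *\<^sub>R ?S y u)"
  proof (rule eventually_linear_inj)
    show "\<forall>\<^sub>F y in nhds x0. linear (\<lambda>u. u + ?t y *\<^sub>R ?S y u)"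
      using evV
    proof (rule eventually_mono)
      fix y assume "y \<in> V"
      note l = unit_shape_linear[OF A this]
      show "linear (\<lambda>u. u + ?t y *\<^sub>R ?S y u)"
        by (intro linearI) (simp_all add: linear_add[OF l] linear_scale[OF l] algebra_simps)
    qed
    show "inj (\<lambda>u. u + ?t x0 *\<^sub>R ?S x0 u)" by (simp add: height_def[OF A])
    have "isCont ?t x0"
      using Ck_on_continuous[OF Ck_on_height[OF A]] V x0 continuous_on_eq_continuous_at by blast
    then show "isCont (\<lambda>y. u + ?t y *\<^sub>R ?S y u) x0" for u
      by (intro continuous_intros tf_isCont(4)[OF A x0])
  qed
  have evS: "\<forall>\<^sub>F y in nhds x0. N0 \<longrightarrow> inj (?S y)"
  proof (cases N0)
    case True
    have "inj (?S x0)"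
      unfolding linear_injective_0[OF unit_shape_linear[OF A x0]]
    proof (intro allI impI, rule ccontr)
      fix u assume "?S x0 u = 0" "u \<noteq> 0"
      then have "0 \<in> {k. \<exists>u. u \<noteq> 0 \<and> ?S x0 u = k *\<^sub>R u}" by auto
      then show False
        using True card_null_eigenvalues(2)[OF A x0 f0]
        unfolding N0_def eigenframe_eigenvalues[OF tf_ip[OF A x0] unit_shape_linear[OF A x0] f0] by blast
    qed
    then have "\<forall>\<^sub>F y in nhds x0. inj (?S y)"
    proof (intro eventually_linear_inj[where L = ?S])
      show "\<forall>\<^sub>F y in nhds x0. linear (?S y)" using evV by (rule eventually_mono) (rule unit_shape_linear[OF A])
      show "isCont (\<lambda>y. ?S y u) x0" for u by (rule tf_isCont(4)[OF A x0])
    qed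
    then show ?thesis by (rule eventually_mono) simp
  qed simp
  define Q where "Q = (\<lambda>y. \<forall>f d. eigenframe (ind_metric \<psi> y) (?S y) f d \<longrightarrow>
     card (range d0) \<le> card (range d) \<and>
     (card (range d) = card (range d0) \<longrightarrow>
        (\<exists>\<kappa>. inj_on \<kappa> (range d0) \<and> range d = \<kappa> ` range d0 \<and>
           (\<forall>l\<in>range d0. card {i. d i = \<kappa> l} = card {i. d0 i = l}))))"
  have evQ: "\<forall>\<^sub>F y in nhds x0. Q y" unfolding Q_def by (rule unit_shape_clusters[OF A x0 f0])
  have "\<forall>\<^sub>F y in nhds x0. y \<in> V \<and> inj (\<lambda>u. u + ?t y *\<^sub>R ?S y u) \<and> (N0 \<longrightarrow> inj (?S y)) \<and> Q y"
    by (intro eventually_conj evV evt evS evQ)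
  then obtain W where W: "open W" "x0 \<in> W"
    and Wp: "\<And>y. y \<in> W \<Longrightarrow> y \<in> V \<and> inj (\<lambda>u. u + ?t y *\<^sub>R ?S y u) \<and> (N0 \<longrightarrow> inj (?S y)) \<and> Q y"
    unfolding eventually_nhds by blast
  have WV: "W \<subseteq> V" using Wp by blast
  have injW: "inj (\<lambda>u. u + ?t y *\<^sub>R ?S y u)" if "y \<in> W" for y using Wp that by blast
  note hyp = projected_hypersurface[OF A WV injW]
  define good where "good = (\<lambda>y k. inj_on k {1..p} \<and> principal_curvatures ?\<phi> ?\<nu> y = k ` {1..p} \<and>
     (\<forall>i\<in>{1..p}. dim {u. shape_op ?\<phi> ?\<nu> y u = k i *\<^sub>R u} = m i) \<and>
     (\<forall>i\<in>{1..p}. 1 - ?t y * k i \<noteq> 0) \<and> (\<Sum>i\<in>{1..p}. real (m i) * (k i / (1 - ?t y * k i))) = 0 \<and>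
     (N0 \<longrightarrow> (\<forall>i\<in>{1..p}. k i \<noteq> 0)))"
  have ex: "\<exists>k. good y k" if y: "y \<in> W" for y
  proof -
    have yV: "y \<in> V" using y WV by blast
    obtain f d where f: "eigenframe (ind_metric \<psi> y) (?S y) f d" using unit_shape_eigenframe[OF A yV] by blast
    have "card (range d) = card (range d0)"
      using card_null_eigenvalues(1)[OF A yV f] card_null_eigenvalues(1)[OF A x0 f0] q[OF yV] q[OF x0] by simp
    then obtain c where c: "inj_on c (range d0)" "range d = c ` range d0"
        "\<And>l. l \<in> range d0 \<Longrightarrow> card {i. d i = c l} = card {i. d0 i = l}"
    proof -
      have "Q y" using Wp[OF y] by blast
      from this[unfolded Q_def, rule_format, OF f] \<open>card (range d) = card (range d0)\<close> that show thesis by blast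
    qed
    \<comment> \<open>The passage from eigenvalues of \<open>S\<close> to principal curvatures; its inverse is
      \<open>k / (1 - t k)\<close>.\<close>
    define h where "h = (\<lambda>l. l / (1 + ?t y * l))"
    note ps = projected_shape[OF A W(1) WV injW y f]
    have ne: "1 + ?t y * l \<noteq> 0" if "l \<in> range d" for l using ps(1) that by blast
    have inv: "1 - ?t y * h l = 1 / (1 + ?t y * l)" if "l \<in> range d" for l
      using ne[OF that] by (simp add: h_def field_simps)
    have ne': "1 - ?t y * h l \<noteq> 0" and ret: "h l / (1 - ?t y * h l) = l" if "l \<in> range d" for l
    proof -
      show "1 - ?t y * h l \<noteq> 0" using inv[OF that] ne[OF that] by simp
      show "h l / (1 - ?t y * h l) = l" unfolding inv[OF that] using ne[OF that] by (simp add: h_def)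
    qed
    have hinj: "inj_on h (range d)" by (rule inj_on_inverseI[of _ "\<lambda>k. k / (1 - ?t y * k)"]) (rule ret)
    have eR: "e i \<in> range d0" if "i \<in> {1..p}" for i using e that by (auto simp: bij_betw_def)
    have cR: "c (e i) \<in> range d" if "i \<in> {1..p}" for i using eR[OF that] c(2) by blast
    have ceinj: "inj_on (\<lambda>i. c (e i)) {1..p}"
      using comp_inj_on[of e "{1..p}" c] e c(1) by (simp add: bij_betw_def o_def)
    have ceim: "(\<lambda>i. c (e i)) ` {1..p} = range d"
    proof -
      have "(\<lambda>i. c (e i)) ` {1..p} = c ` (e ` {1..p})" by (simp only: image_image)
      then show ?thesis using e c(2) by (simp add: bij_betw_def)
    qed
    define k where "k = (\<lambda>i. h (c (e i)))"
    note ev = tf_ip[OF A yV] ps(3,2)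
    have kinj: "inj_on k {1..p}"
      using comp_inj_on[of "\<lambda>i. c (e i)" "{1..p}" h] ceinj hinj ceim by (simp add: k_def o_def)
    moreover have "principal_curvatures ?\<phi> ?\<nu> y = k ` {1..p}"
    proof -
      have "principal_curvatures ?\<phi> ?\<nu> y = range (\<lambda>j. d j / (1 + ?t y * d j))"
        unfolding principal_curvatures_def by (rule eigenframe_eigenvalues[OF ev])
      also have "\<dots> = h ` range d" unfolding h_def by (simp only: image_image)
      also have "\<dots> = k ` {1..p}" unfolding ceim[symmetric] k_def by (simp only: image_image)
      finally show ?thesis .
    qed
    moreover have "dim {u. shape_op ?\<phi> ?\<nu> y u = k i *\<^sub>R u} = m i" if i: "i \<in> {1..p}" for i
    proof -
      have "dim {u. shape_op ?\<phi> ?\<nu> y u = k i *\<^sub>R u} = card {j. h (d j) = k i}"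
        unfolding h_def by (rule eigenframe_dim_eigenspace[OF ev])
      also have "{j. h (d j) = k i} = {j. d j = c (e i)}"
        unfolding k_def using inj_on_eq_iff[OF hinj] cR[OF i] by auto
      finally show ?thesis using c(3)[OF eR[OF i]] by (simp add: m_def)
    qed
    moreover have "1 - ?t y * k i \<noteq> 0" if "i \<in> {1..p}" for i
      unfolding k_def by (rule ne'[OF cR[OF that]])
    moreover have "(\<Sum>i\<in>{1..p}. real (m i) * (k i / (1 - ?t y * k i))) = 0"
    proof -
      have "(\<Sum>i\<in>{1..p}. real (m i) * (k i / (1 - ?t y * k i))) = (\<Sum>i\<in>{1..p}. real (m i) * c (e i))"
        unfolding k_def using ret[OF cR] by (intro sum.cong refl) simp
      also have "\<dots> = (\<Sum>j\<in>UNIV. d j)"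
      proof (rule sum_over_eigenvalues[of "\<lambda>i. c (e i)" "{1..p}" d m "\<lambda>a. a"])
        show "card {j. d j = c (e i)} = m i" if "i \<in> {1..p}" for i
          using c(3)[OF eR[OF that]] by (simp add: m_def)
      qed (use ceinj ceim in auto)
      also have "\<dots> = 0"
      proof -
        obtain b where "mean_curv_vec \<psi> y = b *\<^sub>R \<xi> y" using H[OF yV] by blast
        then show ?thesis by (rule unit_shape_trace[OF A yV f])
      qed
      finally show ?thesis .
    qed
    moreover have "k i \<noteq> 0" if n0: N0 and ii: "i \<in> {1..p}" for i
    proof
      assume "k i = 0"
      then have "c (e i) = 0" using ne[OF cR[OF ii]] by (simp add: k_def h_def)
      then obtain j where "d j = 0" using cR[OF ii] by auto
      then have "?S y (f j) = ?S y 0"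
        using eigenframe_eigen[OF tf_ip[OF A yV] unit_shape_linear[OF A yV] f, of j] linear_0[OF unit_shape_linear[OF A yV]] by simp
      moreover have "inj (?S y)" using Wp[OF y] n0 by blast
      ultimately have "f j = 0" by (simp add: inj_eq)
      then show False using eigenframe_nonzero[OF tf_ip[OF A yV] unit_shape_linear[OF A yV] f] by blast
    qed
    ultimately have "good y k" unfolding good_def by blast
    then show ?thesis by blast
  qed
  have "\<exists>K. \<forall>y\<in>W. good y (K y)" by (rule bchoice) (use ex in blast)
  then obtain K where K: "\<forall>y\<in>W. good y (K y)" by blast
  define \<kappa> where "\<kappa> = (\<lambda>i y. K y i)"
  show ?thesis
  proof (intro exI conjI)
    show "open W" "x0 \<in> W" "W \<subseteq> V" by (fact W WV)+
    show "immersion 4 W ?\<phi>" by (rule hyp(1))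
    show "gauss_map W ?\<phi> ?\<nu>" by (rule hyp(2))
    show "Ck_on 2 ?t W" using Ck_on_subset[OF Ck_on_le[OF Ck_on_height[OF A], of 2] WV] by simp
    show "2 \<le> p" by (fact p)
    show "has_principal_curvatures W ?\<phi> ?\<nu> p \<kappa> m"
      unfolding has_principal_curvatures_def \<kappa>_def
    proof
      fix y assume "y \<in> W"
      then have "good y (K y)" using K by blast
      then show "inj_on (K y) {1..p} \<and> principal_curvatures ?\<phi> ?\<nu> y = K y ` {1..p} \<and>
          (\<forall>i\<in>{1..p}. dim {u. shape_op ?\<phi> ?\<nu> y u = K y i *\<^sub>R u} = m i)"
        unfolding good_def by blast
    qed
    show "\<forall>y\<in>W. lift ?\<phi> ?\<nu> ?t y = \<psi> y + (0, - snd (\<psi> x0))" using lift_projected[OF A] by blast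
    show "\<forall>y\<in>W. (\<forall>i\<in>{1..p}. 1 - ?t y * \<kappa> i y \<noteq> 0) \<and> (\<Sum>i\<in>{1..p}. real (m i) * (\<kappa> i y / (1 - ?t y * \<kappa> i y))) = 0"
    proof
      fix y assume "y \<in> W"
      then have "good y (K y)" using K by blast
      then show "(\<forall>i\<in>{1..p}. 1 - ?t y * \<kappa> i y \<noteq> 0) \<and> (\<Sum>i\<in>{1..p}. real (m i) * (\<kappa> i y / (1 - ?t y * \<kappa> i y))) = 0"
        unfolding good_def \<kappa>_def by blast
    qed
    show "0 \<notin> null_eigenvalues \<psi> \<xi> x0 \<longrightarrow> (\<forall>i\<in>{1..p}. \<forall>y\<in>W. \<kappa> i y \<noteq> 0)"
    proof (intro impI ballI)
      fix i y assume "0 \<notin> null_eigenvalues \<psi> \<xi> x0" "i \<in> {1..p}" "y \<in> W"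
      moreover from this have "good y (K y)" using K by blast
      ultimately show "\<kappa> i y \<noteq> 0" unfolding good_def \<kappa>_def N0_def by blast
    qed
  qed
qed

lemma mink_isometry_translation: "mink_isometry (\<lambda>w :: 'n::finite mink. w + p)"
  by (rule mink_isometry_affine[of "\<lambda>w. w"]) (auto intro: linearI)

text \<open>The equation defining the extended family is the vanishing of the trace, multiplied by all
  denominators.\<close>

theorem regular_trapped_ext:
  fixes \<psi> :: "real ^ 'n \<Rightarrow> 'n::finite mink"
  assumes "open V" "Ck_on 5 \<psi> V" "spacelike V \<psi>" "trapping_field V \<psi> \<xi>" "x0 \<in> V" "\<not> null_sff_at \<psi> x0"
  shows "\<exists>W F. open W \<and> x0 \<in> W \<and> W \<subseteq> V \<and> mink_isometry F \<and> F ` \<psi> ` W \<in> trapped_images_ext"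
proof -
  obtain W \<phi> \<nu> t p \<kappa> m where L: "open W" "x0 \<in> W" "W \<subseteq> V" "immersion 4 W \<phi>" "gauss_map W \<phi> \<nu>" "Ck_on 2 t W"
    "2 \<le> p" "has_principal_curvatures W \<phi> \<nu> p \<kappa> m" "\<forall>y\<in>W. lift \<phi> \<nu> t y = \<psi> y + (0, - snd (\<psi> x0))"
    "\<forall>y\<in>W. (\<forall>i\<in>{1..p}. 1 - t y * \<kappa> i y \<noteq> 0) \<and> (\<Sum>i\<in>{1..p}. real (m i) * (\<kappa> i y / (1 - t y * \<kappa> i y))) = 0"
    using trapping_field_local_lift[OF assms] by blast
  have "(\<Sum>i\<in>{1..p}. real (m i) * \<kappa> i y * (\<Prod>j\<in>{1..p} - {i}. 1 - \<kappa> j y * t y)) = 0" if y: "y \<in> W" for y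
  proof -
    define D where "D = (\<Prod>j\<in>{1..p}. 1 - t y * \<kappa> j y)"
    have ne: "1 - t y * \<kappa> i y \<noteq> 0" if "i \<in> {1..p}" for i using L(10) y that by blast
    have "real (m i) * \<kappa> i y * (\<Prod>j\<in>{1..p} - {i}. 1 - \<kappa> j y * t y) = D * (real (m i) * (\<kappa> i y / (1 - t y * \<kappa> i y)))"
      if i: "i \<in> {1..p}" for i
    proof -
      have "D = (1 - t y * \<kappa> i y) * (\<Prod>j\<in>{1..p} - {i}. 1 - \<kappa> j y * t y)"
        unfolding D_def by (subst prod.remove[OF _ i]) (simp_all add: mult.commute)
      then show ?thesis using ne[OF i] by simp
    qed
    then have "(\<Sum>i\<in>{1..p}. real (m i) * \<kappa> i y * (\<Prod>j\<in>{1..p} - {i}. 1 - \<kappa> j y * t y))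
        = D * (\<Sum>i\<in>{1..p}. real (m i) * (\<kappa> i y / (1 - t y * \<kappa> i y)))"
      unfolding sum_distrib_left by (intro sum.cong refl) blast
    then show ?thesis using L(10) y by simp
  qed
  then have "lift \<phi> \<nu> t ` W \<in> trapped_images_ext"
    unfolding trapped_images_ext_def using L by blast
  moreover have "lift \<phi> \<nu> t ` W = (\<lambda>w. w + (0, - snd (\<psi> x0))) ` \<psi> ` W"
    unfolding image_image using L(9) by (intro image_cong refl) blast
  ultimately show ?thesis using L(1-3) mink_isometry_translation by metis
qed

lemma sorted_enumeration:
  fixes R :: "real set"
  assumes "finite R" "card R = q"
  shows "\<exists>f. strict_mono_on {1..q} f \<and> f ` {1..q} = R"
proof -
  define l where "l = sorted_list_of_set R"
  have l: "sorted_wrt (<) l" "set l = R" "length l = q"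
    using assms by (simp_all add: l_def)
  define f where "f = (\<lambda>i. l ! (i - 1))"
  have "strict_mono_on {1..q} f"
  proof (rule strict_mono_onI)
    fix a b :: nat assume "a \<in> {1..q}" "b \<in> {1..q}" "a < b"
    then have "a - 1 < b - 1" "b - 1 < length l" using l(3) by auto
    then show "f a < f b" unfolding f_def by (rule sorted_wrt_nth_less[OF l(1)])
  qed
  moreover have "f ` {1..q} = R"
  proof -
    have "f ` {1..q} = (!) l ` {..<q}"
    proof -
      have "(\<lambda>i. i - 1) ` {1..q} = {..<q}"
      proof
        show "{..<q} \<subseteq> (\<lambda>i. i - 1) ` {1..q}"
        proof
          fix j assume "j \<in> {..<q}"
          then show "j \<in> (\<lambda>i. i - 1) ` {1..q}" by (intro image_eqI[of _ _ "Suc j"]) auto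
        qed
      qed auto
      then show ?thesis unfolding f_def by (metis (no_types, lifting) image_cong image_image)
    qed
    also have "\<dots> = R" using l(2,3) by (auto simp: set_conv_nth)
    finally show ?thesis .
  qed
  ultimately show ?thesis by blast
qed

text \<open>The height is a root of the curvature polynomial at every point; by continuity its position
  among the sorted roots is locally constant.\<close>

theorem nondegenerate_trapped:
  fixes \<psi> :: "real ^ 'n \<Rightarrow> 'n::finite mink"
  assumes tf: "open V" "Ck_on 5 \<psi> V" "spacelike V \<psi>" "trapping_field V \<psi> \<xi>" "x0 \<in> V" "\<not> null_sff_at \<psi> x0"
    and nd: "0 \<notin> null_eigenvalues \<psi> \<xi> x0"
  shows "\<exists>W F. open W \<and> x0 \<in> W \<and> W \<subseteq> V \<and> mink_isometry F \<and> F ` \<psi> ` W \<in> trapped_images"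
proof -
  obtain W \<phi> \<nu> t p \<kappa> m where L: "open W" "x0 \<in> W" "W \<subseteq> V" "immersion 4 W \<phi>" "gauss_map W \<phi> \<nu>" "Ck_on 2 t W"
    "2 \<le> p" "has_principal_curvatures W \<phi> \<nu> p \<kappa> m" "\<forall>y\<in>W. lift \<phi> \<nu> t y = \<psi> y + (0, - snd (\<psi> x0))"
    "\<forall>y\<in>W. (\<forall>i\<in>{1..p}. 1 - t y * \<kappa> i y \<noteq> 0) \<and> (\<Sum>i\<in>{1..p}. real (m i) * (\<kappa> i y / (1 - t y * \<kappa> i y))) = 0"
    "\<forall>i\<in>{1..p}. \<forall>y\<in>W. \<kappa> i y \<noteq> 0"
    using trapping_field_local_lift[OF tf] nd by blast
  have \<kappa>0: "\<kappa> i y \<noteq> 0" if "i \<in> {1..p}" "y \<in> W" for i y using L(11) that by blast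
  note H = L(1,4,5,7,8) \<kappa>0
  define R where "R = (\<lambda>y. {s. poly (curv_poly p (\<lambda>i. \<kappa> i y) m) s = 0})"
  have "\<exists>f. strict_mono_on {1..p - 1} f \<and> f ` {1..p - 1} = R y" if y: "y \<in> W" for y
  proof (rule sorted_enumeration)
    show c: "card (R y) = p - 1" unfolding R_def by (rule card_radius_roots[OF H y])
    show "finite (R y)" by (rule ccontr) (use c L(7) in auto)
  qed
  then obtain f where f: "\<And>y. y \<in> W \<Longrightarrow> strict_mono_on {1..p - 1} (f y) \<and> f y ` {1..p - 1} = R y" by metis
  define \<tau> where "\<tau> = (\<lambda>i y. f y i)"
  have rf: "root_functions W p \<kappa> m \<tau>"
    unfolding root_functions_def \<tau>_def using f unfolding R_def by blast
  have tR: "t y \<in> R y" if y: "y \<in> W" for y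
  proof -
    have "inj_on (\<lambda>i. \<kappa> i y) {1..p}" using L(8) y by (simp add: has_principal_curvatures_def)
    then have "poly (curv_poly p (\<lambda>i. \<kappa> i y) m) (t y) = 0 \<longleftrightarrow> (\<forall>i\<in>{1..p}. 1 - t y * \<kappa> i y \<noteq> 0) \<and>
        (\<Sum>i\<in>{1..p}. real (m i) * (\<kappa> i y / (1 - t y * \<kappa> i y))) = 0"
      by (rule curv_poly_root_iff[OF L(7)]) (use \<kappa>0 y multiplicity_pos[OF H y] in auto)
    then show ?thesis unfolding R_def using L(10) y by blast
  qed
  have "t x0 \<in> f x0 ` {1..p - 1}" using tR[OF L(2)] f[OF L(2)] by blast
  then obtain i where i: "i \<in> {1..p - 1}" "\<tau> i x0 = t x0" unfolding \<tau>_def by (metis imageE)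
  have cont: "isCont (\<tau> j) x0" if "j \<in> {1..p - 1}" for j
    using Ck_on_continuous[OF Ck_on_root_function[OF H rf that]] L(1,2) continuous_on_eq_continuous_at by blast
  have ct: "isCont t x0"
    using Ck_on_continuous[OF L(6)] L(1,2) continuous_on_eq_continuous_at by blast
  \<comment> \<open>The other roots differ from \<open>t\<close> at \<open>x0\<close>, hence nearby; so \<open>t\<close> remains the root with
    index \<open>i\<close>.\<close>
  have "\<forall>\<^sub>F y in nhds x0. \<forall>j\<in>{1..p - 1} - {i}. \<tau> j y \<noteq> t y"
  proof (rule eventually_ball_finite)
    show "\<forall>j\<in>{1..p - 1} - {i}. \<forall>\<^sub>F y in nhds x0. \<tau> j y \<noteq> t y"
    proof
      fix j assume j: "j \<in> {1..p - 1} - {i}"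
      have "inj_on (\<lambda>i. \<tau> i x0) {1..p - 1}"
        using f[OF L(2)] strict_mono_on_imp_inj_on unfolding \<tau>_def by blast
      then have "\<tau> j x0 \<noteq> \<tau> i x0" using j i(1) by (auto dest: inj_onD)
      then have ne: "\<tau> j x0 - t x0 \<noteq> 0" using i(2) by simp
      have "((\<lambda>y. \<tau> j y - t y) \<longlongrightarrow> \<tau> j x0 - t x0) (nhds x0)"
        by (rule tendsto_diff[OF isCont_nhds[OF cont] isCont_nhds[OF ct]]) (use j in simp)
      from tendsto_imp_eventually_ne[OF this ne] show "\<forall>\<^sub>F y in nhds x0. \<tau> j y \<noteq> t y" by (rule eventually_mono) simp
    qed
  qed simp
  then have "\<forall>\<^sub>F y in nhds x0. y \<in> W \<and> (\<forall>j\<in>{1..p - 1} - {i}. \<tau> j y \<noteq> t y)"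
    by (intro eventually_conj eventually_nhds_in_open L(1,2))
  then obtain U where U: "open U" "x0 \<in> U" "\<And>y. y \<in> U \<Longrightarrow> y \<in> W \<and> (\<forall>j\<in>{1..p - 1} - {i}. \<tau> j y \<noteq> t y)"
    unfolding eventually_nhds by blast
  have UW: "U \<subseteq> W" using U(3) by blast
  have eq: "\<tau> i y = t y" if y: "y \<in> U" for y
  proof -
    have "y \<in> W" using UW y by blast
    then obtain j where j: "j \<in> {1..p - 1}" "\<tau> j y = t y"
      using tR f by (metis (no_types, lifting) \<tau>_def imageE)
    then have "j = i" using U(3)[OF y] by blast
    then show ?thesis using j(2) by simp
  qed
  have "immersion 4 U \<phi>" using L(4) UW Ck_on_subset unfolding immersion_def by blast
  moreover have "gauss_map U \<phi> \<nu>" using L(5) UW continuous_on_subset unfolding gauss_map_def by blast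
  moreover have "has_principal_curvatures U \<phi> \<nu> p \<kappa> m" using L(8) UW unfolding has_principal_curvatures_def by blast
  moreover have "root_functions U p \<kappa> m \<tau>" using rf UW unfolding root_functions_def by blast
  moreover have "\<forall>j\<in>{1..p}. \<forall>x\<in>U. \<kappa> j x \<noteq> 0" using L(11) UW by blast
  ultimately have "lift \<phi> \<nu> (\<tau> i) ` U \<in> trapped_images"
    unfolding trapped_images_def using U(1) L(7) i(1) by blast
  moreover have "lift \<phi> \<nu> (\<tau> i) ` U = (\<lambda>w. w + (0, - snd (\<psi> x0))) ` \<psi> ` U"
    unfolding image_image
  proof (intro image_cong refl)
    fix y assume y: "y \<in> U"
    have "lift \<phi> \<nu> (\<tau> i) y = lift \<phi> \<nu> t y" by (simp add: lift_def eq[OF y])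
    then show "lift \<phi> \<nu> (\<tau> i) y = \<psi> y + (0, - snd (\<psi> x0))" using L(9) UW y by auto
  qed
  ultimately have "(\<lambda>w. w + (0, - snd (\<psi> x0))) ` \<psi> ` U \<in> trapped_images" by simp
  moreover have "U \<subseteq> V" using UW L(3) by blast
  ultimately show ?thesis
    using U(1,2) mink_isometry_translation
    by (intro exI[of _ U] exI[of _ "\<lambda>w. w + (0, - snd (\<psi> x0))"]) blast
qed

text \<open>On a surface the shape operator is trace-free and not zero, so it is invertible.\<close>

lemma surface_nondegenerate:
  fixes \<psi> :: "real ^ 'n \<Rightarrow> 'n::finite mink"
  assumes n2: "CARD('n) = 2"
    and V: "open V" "Ck_on 5 \<psi> V" "spacelike V \<psi>" and tf: "trapping_field V \<psi> \<xi>" and x: "x \<in> V" and nn: "\<not> null_sff_at \<psi> x"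
  shows "0 \<notin> null_eigenvalues \<psi> \<xi> x"
proof -
  have \<xi>: "null_normal_field V \<psi> \<xi>" and "\<exists>b. mean_curv_vec \<psi> x = b *\<^sub>R \<xi> x"
    using tf x by (auto simp: trapping_field_def)
  then obtain b where b: "mean_curv_vec \<psi> x = b *\<^sub>R \<xi> x" by blast
  note A = V \<xi>
  obtain f d where f: "eigenframe (ind_metric \<psi> x) (unit_shape \<psi> \<xi> x) f d" using unit_shape_eigenframe[OF A x] by blast
  have tr: "(\<Sum>i\<in>UNIV. d i) = 0" by (rule unit_shape_trace[OF A x f b])
  have two: "2 \<le> card (range d)" by (rule unit_shape_two_eigenvalues[OF A x f b nn])
  obtain a c where ac: "(UNIV :: 'n set) = {a, c}" "a \<noteq> c" using n2 by (auto simp: card_2_iff)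
  have s: "d a + d c = 0" using tr ac(2) unfolding ac(1) by simp
  have "range d = {d a, d c}" unfolding ac(1) by simp
  moreover from this have "d a \<noteq> d c" using two by auto
  ultimately have "0 \<notin> range d" using s by auto
  then show ?thesis using card_null_eigenvalues(2)[OF A x f] by blast
qed

section \<open>Regular points are dense\<close>

lemma Ck_on_normal_proj:
  fixes \<psi> :: "real ^ 'n \<Rightarrow> 'n::finite mink"
  assumes V: "open V" and \<psi>: "Ck_on (Suc k) \<psi> V" and ip: "\<And>x. x \<in> V \<Longrightarrow> inner_product (ind_metric \<psi> x)"
    and w: "Ck_on k w V"
  shows "Ck_on k (\<lambda>x. normal_proj \<psi> x (w x)) V"
proof -
  have lin: "linear (D1 \<psi> x)" if "x \<in> V" for x
    by (rule linear_frechet_derivative[OF Ck_on_differentiable[OF \<psi> _ that]]) simp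
  have "Ck_on k (\<lambda>x. riesz (ind_metric \<psi> x) (\<lambda>v. mink (w x) (D1 \<psi> x v))) V"
  proof (rule Ck_on_riesz[OF V ip Ck_on_ind_metric[OF V \<psi>]])
    show "linear (\<lambda>v. mink (w x) (D1 \<psi> x v))" if "x \<in> V" for x
      by (intro linearI) (simp_all add: linear_add[OF lin[OF that]] linear_scale[OF lin[OF that]] mk.add_right mk.scaleR_right)
    show "Ck_on k (\<lambda>x. mink (w x) (D1 \<psi> x v)) V" for v by (intro Ck_on_mink V w Ck_on_D1[OF \<psi>])
  qed
  then have "Ck_on k (\<lambda>x. w x - D1 \<psi> x (riesz (ind_metric \<psi> x) (\<lambda>v. mink (w x) (D1 \<psi> x v)))) V"
    by (intro Ck_on_diff V w Ck_on_D1_apply[OF V \<psi>])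
  moreover have "normal_proj \<psi> x (w x) = w x - D1 \<psi> x (riesz (ind_metric \<psi> x) (\<lambda>v. mink (w x) (D1 \<psi> x v)))"
    if x: "x \<in> V" for x
    by (simp only: normal_proj_eq[OF lin[OF x] ip[OF x]] tangent_part_def[OF lin[OF x] ip[OF x]])
  ultimately show ?thesis by (subst Ck_on_cong[OF V]) auto
qed

lemma continuous_mean_curv:
  fixes \<psi> :: "real ^ 'n \<Rightarrow> 'n::finite mink"
  assumes V: "open V" and \<psi>: "Ck_on 2 \<psi> V" and ip: "\<And>x. x \<in> V \<Longrightarrow> inner_product (ind_metric \<psi> x)"
  shows "continuous_on V (mean_curv_vec \<psi>)"
proof -
  have \<psi>1: "Ck_on (Suc 0) \<psi> V" and \<psi>2: "Ck_on (Suc (Suc 0)) \<psi> V"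
    using \<psi> Ck_on_le[OF \<psi>, of 1] by (simp_all add: numeral_2_eq_2 del: Ck_on.simps)
  have gr: "gram \<psi> x = (\<chi> i j. ind_metric \<psi> x (axis i 1) (axis j 1))" for x by (simp add: gram_def)
  have inv: "Ck_on 0 (\<lambda>x. matrix_inv (gram \<psi> x) *v axis j 1) V" for j
  proof (rule Ck_on_linear_solution[OF V, where L = "\<lambda>x. (*v) (gram \<psi> x)" and b = "\<lambda>x. axis j 1"])
    fix x assume x: "x \<in> V"
    show inj: "inj ((*v) (gram \<psi> x))" unfolding gr by (rule gram_inj[OF ip[OF x]])
    have "gram \<psi> x ** matrix_inv (gram \<psi> x) = mat 1"
      using matrix_inv_left[OF inj] matrix_left_right_inverse by blast
    then show "gram \<psi> x *v (matrix_inv (gram \<psi> x) *v axis j 1) = axis j 1"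
      by (simp add: matrix_vector_mul_assoc)
  next
    fix u
    have "Ck_on 0 (\<lambda>x. \<chi> i. ind_metric \<psi> x (axis i 1) u) V"
      by (intro Ck_on_vec_lambda V Ck_on_ind_metric[OF V \<psi>1])
    moreover have "gram \<psi> x *v u = (\<chi> i. ind_metric \<psi> x (axis i 1) u)" if "x \<in> V" for x
      unfolding gr using gram_vector[OF ip[OF that], of u] by (simp add: vec_eq_iff)
    ultimately show "Ck_on 0 (\<lambda>x. gram \<psi> x *v u) V" by (subst Ck_on_cong[OF V]) auto
  qed (auto intro: Ck_on_const)
  have entry: "(matrix_inv G *v axis j 1) \<bullet> axis i 1 = matrix_inv G $ i $ j" for G :: "real ^ 'n ^ 'n" and i j
  proof -
    have "matrix_inv G *v axis j 1 = column j (matrix_inv G)" by (rule matrix_vector_mult_basis)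
    then show ?thesis by (simp add: inner_axis column_def)
  qed
  have "Ck_on 0 (\<lambda>x. (matrix_inv (gram \<psi> x) *v axis j 1) \<bullet> axis i 1) V" for i j
    by (intro Ck_on_inner V inv Ck_on_const)
  then have e: "Ck_on 0 (\<lambda>x. matrix_inv (gram \<psi> x) $ i $ j) V" for i j by (simp only: entry)
  have s: "Ck_on 0 (\<lambda>x. sff \<psi> x u v) V" for u v
    unfolding sff_def by (rule Ck_on_normal_proj[OF V \<psi>1 ip Ck_on_D2[OF \<psi>2]])
  have "Ck_on 0 (mean_curv_vec \<psi>) V"
    unfolding mean_curv_vec_def[abs_def]
    by (intro Ck_on_scaleR Ck_on_sum Ck_on_const V e s)
  then show ?thesis by simp
qed

text \<open>In the normal plane spanned by the normal parts of a Euclidean normal vector and of the time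
  axis, which are spacelike and timelike, a null combination is found by solving a quadratic
  equation.\<close>

lemma exists_null_normal_field:
  fixes \<psi> :: "real ^ 'n \<Rightarrow> 'n::finite mink"
  assumes V: "open V" "x0 \<in> V" and \<psi>: "Ck_on 1 \<psi> V" and ip: "\<And>x. x \<in> V \<Longrightarrow> inner_product (ind_metric \<psi> x)"
  shows "\<exists>W \<xi>. open W \<and> x0 \<in> W \<and> W \<subseteq> V \<and> null_normal_field W \<psi> \<xi>"
proof -
  have \<psi>1: "Ck_on (Suc 0) \<psi> V" using \<psi> by simp
  have lin: "linear (D1 \<psi> x)" if "x \<in> V" for x
    by (rule linear_frechet_derivative[OF Ck_on_differentiable[OF \<psi> _ that]]) simp
  have "dim (range (\<lambda>u. fst (D1 \<psi> x0 u))) < DIM((real ^ 'n) \<times> real)"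
  proof -
    have "linear (\<lambda>u. fst (D1 \<psi> x0 u))"
      using linear_compose[OF lin[OF V(2)] linear_fst] by (simp add: o_def)
    from dim_image_le[OF this, of UNIV] show ?thesis by simp
  qed
  then obtain e where e: "e \<noteq> 0" "\<And>y. y \<in> span (range (\<lambda>u. fst (D1 \<psi> x0 u))) \<Longrightarrow> orthogonal e y"
    using orthogonal_to_subspace_exists by blast
  have eN: "(e, 0) \<in> normal_space \<psi> x0"
  proof -
    have "orthogonal e (fst (D1 \<psi> x0 u))" for u by (rule e(2)[OF span_base[OF rangeI]])
    then show ?thesis by (simp add: normal_space_def mink_def orthogonal_def)
  qed
  define Z where "Z = (\<lambda>x. normal_proj \<psi> x (e, 0))"
  define T where "T = (\<lambda>x. normal_proj \<psi> x (0, 1))"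
  define a where "a = (\<lambda>x. mink (Z x) (Z x))"
  define b where "b = (\<lambda>x. mink (Z x) (T x))"
  define c where "c = (\<lambda>x. mink (T x) (T x))"
  have CZ: "Ck_on 0 Z V" and CT: "Ck_on 0 T V"
    unfolding Z_def T_def by (intro Ck_on_normal_proj[OF V(1) \<psi>1 ip] Ck_on_const; assumption)+
  have Cabc: "Ck_on 0 a V" "Ck_on 0 b V" "Ck_on 0 c V"
    unfolding a_def b_def c_def by (intro Ck_on_mink V CZ CT)+
  have cneg: "c x < 0" if x: "x \<in> V" for x
  proof -
    define u where "u = tangent_part \<psi> x (0, 1)"
    have T: "T x = (0, 1) - D1 \<psi> x u" unfolding T_def u_def by (rule normal_proj_eq[OF lin[OF x] ip[OF x]])
    have Tn: "T x \<in> normal_space \<psi> x" unfolding T_def by (rule normal_proj_normal[OF lin[OF x] ip[OF x]])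
    then have Tu: "mink (T x) (D1 \<psi> x u) = 0" by (simp add: normal_space_def)
    have dec: "(0, 1) = T x + D1 \<psi> x u" by (simp add: T)
    have "- 1 = mink (0 :: (real ^ 'n) \<times> real, 1) (0, 1)" by (simp add: mink_def)
    also have "\<dots> = mink (T x + D1 \<psi> x u) (T x + D1 \<psi> x u)" by (simp only: dec[symmetric])
    also have "\<dots> = c x + ind_metric \<psi> x u u"
      using Tu mink_commute[of "D1 \<psi> x u" "T x"] by (simp add: mk.add_left mk.add_right c_def ind_metric_def)
    finally show ?thesis using inner_product_nonneg[OF ip[OF x], of u] by linarith
  qed
  define W where "W = {x \<in> V. a x > 0}"
  have "open W"
  proof -
    have "continuous_on V a" using Cabc(1) by simp
    from continuous_open_preimage[OF this V(1), of "{0<..}"] have "open (V \<inter> a -` {0<..})" by simp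
    moreover have "V \<inter> a -` {0<..} = W" by (auto simp: W_def)
    ultimately show ?thesis by simp
  qed
  moreover have "x0 \<in> W"
  proof -
    have "Z x0 = (e, 0)" unfolding Z_def by (rule normal_proj_ident[OF lin[OF V(2)] ip[OF V(2)] eN])
    then show ?thesis using e(1) V(2) by (simp add: W_def a_def mink_def)
  qed
  moreover have WV: "W \<subseteq> V" by (auto simp: W_def)
  \<comment> \<open>A root of \<open>a + 2 s b + s\<^sup>2 c\<close>, the squared length of \<open>Z + s T\<close>; the discriminant is
    positive as \<open>a\<close> and \<open>c\<close> have opposite signs.\<close>
  define s where "s = (\<lambda>x. (- b x - sqrt ((b x)\<^sup>2 - a x * c x)) / c x)"
  define \<xi> where "\<xi> = (\<lambda>x. Z x + s x *\<^sub>R T x)"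
  have "null_normal_field W \<psi> \<xi>"
    unfolding null_normal_field_def
  proof (intro conjI ballI)
    have cont: "continuous_on W a" "continuous_on W b" "continuous_on W c" "continuous_on W Z" "continuous_on W T"
      using Cabc CZ CT continuous_on_subset[OF _ WV] by simp_all
    show "continuous_on W \<xi>"
      unfolding \<xi>_def s_def by (intro continuous_intros cont) (use cneg WV in force)
    fix x assume x: "x \<in> W"
    then have xV: "x \<in> V" and ax: "a x > 0" by (auto simp: W_def)
    have cx: "c x < 0" by (rule cneg[OF xV])
    define r where "r = sqrt ((b x)\<^sup>2 - a x * c x)"
    have "a x * c x < 0" using ax cx by (simp add: mult_pos_neg)
    then have "(b x)\<^sup>2 - a x * c x \<ge> 0" using zero_le_power2[of "b x"] by linarith
    then have r2: "r * r = (b x)\<^sup>2 - a x * c x" unfolding r_def by simp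
    have sc: "s x * c x = - b x - r" using cx by (simp add: s_def r_def)
    have "mink (\<xi> x) (\<xi> x) = a x + 2 * s x * b x + s x * s x * c x"
      using mink_commute[of "T x" "Z x"]
      by (simp add: \<xi>_def mk.add_left mk.add_right mk.scaleR_left mk.scaleR_right a_def b_def c_def algebra_simps)
    moreover have "c x * (a x + 2 * s x * b x + s x * s x * c x) = 0"
    proof -
      have "c x * (a x + 2 * s x * b x + s x * s x * c x) = a x * c x + 2 * (s x * c x) * b x + (s x * c x) * (s x * c x)"
        by (simp add: algebra_simps)
      also have "\<dots> = 0" unfolding sc using r2 by (simp add: algebra_simps power2_eq_square)
      finally show ?thesis .
    qed
    ultimately have null: "mink (\<xi> x) (\<xi> x) = 0" using cx by simp
    have "\<xi> x \<noteq> 0"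
    proof
      assume "\<xi> x = 0"
      then have Zx: "Z x = (- s x) *\<^sub>R T x" by (simp add: \<xi>_def eq_neg_iff_add_eq_0)
      have "a x = mink ((- s x) *\<^sub>R T x) ((- s x) *\<^sub>R T x)" by (simp only: a_def Zx)
      also have "\<dots> = (- s x) * ((- s x) * c x)" by (simp only: mk.scaleR_left mk.scaleR_right c_def real_scaleR_def)
      finally have "a x = s x * s x * c x" by simp
      moreover have "s x * s x * c x \<le> 0" using cx by (intro mult_nonneg_nonpos) auto
      ultimately show False using ax by simp
    qed
    moreover have "\<xi> x \<in> normal_space \<psi> x"
      unfolding \<xi>_def Z_def T_def
      by (intro subspace_add subspace_scale subspace_normal_space[OF lin[OF xV] ip[OF xV]] normal_proj_normal[OF lin[OF xV] ip[OF xV]])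
    ultimately show "null_normal \<psi> x (\<xi> x)" using null by (simp add: null_normal_def)
  qed
  ultimately show ?thesis using WV by (intro exI[of _ W] exI[of _ \<xi>] conjI)
qed

text \<open>Where the mean curvature vector is not zero it is itself a null normal field; where it
  vanishes on an open set, any null normal field will do. The number of distinct eigenvalues can
  only increase under small perturbations, so it is constant near a point where it is maximal.\<close>

theorem regular_points_dense:
  fixes \<psi> :: "real ^ 'n \<Rightarrow> 'n::finite mink"
  assumes V: "open V" "x0 \<in> V" and C5: "Ck_on 5 \<psi> V" and sp: "spacelike V \<psi>" and mt: "marginally_trapped V \<psi>"
  shows "\<exists>y\<in>V. regular_at V \<psi> y"
proof -
  have d: "\<psi> differentiable (at x)" if "x \<in> V" for x using Ck_on_differentiable[OF C5 _ that] by simp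
  have lin: "linear (D1 \<psi> x)" if "x \<in> V" for x by (rule linear_frechet_derivative[OF d[OF that]])
  have ip: "inner_product (ind_metric \<psi> x)" if "x \<in> V" for x by (rule spacelike_inner_product[OF sp that d[OF that]])
  have C2: "Ck_on 2 \<psi> V" and C1: "Ck_on 1 \<psi> V" using Ck_on_le[OF C5, of 2] Ck_on_le[OF C5, of 1] by simp_all
  have cH: "continuous_on V (mean_curv_vec \<psi>)" by (rule continuous_mean_curv[OF V(1) C2 ip])
  obtain W \<xi> where W: "open W" "W \<noteq> {}" "W \<subseteq> V" "null_normal_field W \<psi> \<xi>"
    "\<And>x. x \<in> W \<Longrightarrow> \<exists>b. mean_curv_vec \<psi> x = b *\<^sub>R \<xi> x"
  proof (cases "\<exists>y\<in>V. mean_curv_vec \<psi> y \<noteq> 0")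
    case True
    define U where "U = {y \<in> V. mean_curv_vec \<psi> y \<noteq> 0}"
    have "U = V \<inter> mean_curv_vec \<psi> -` (- {0})" by (auto simp: U_def)
    then have "open U" using continuous_open_preimage[OF cH V(1) open_Compl[OF closed_singleton]] by (simp only:)
    moreover have "null_normal_field U \<psi> (mean_curv_vec \<psi>)"
      unfolding null_normal_field_def
    proof (intro conjI ballI)
      show "continuous_on U (mean_curv_vec \<psi>)" by (rule continuous_on_subset[OF cH]) (auto simp: U_def)
      fix x assume "x \<in> U"
      then have x: "x \<in> V" "mean_curv_vec \<psi> x \<noteq> 0" by (auto simp: U_def)
      then show "null_normal \<psi> x (mean_curv_vec \<psi> x)"
        using mean_curv_normal[OF lin[OF x(1)] ip[OF x(1)]] mt by (simp add: null_normal_def marginally_trapped_def)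
    qed
    moreover have "\<exists>b. mean_curv_vec \<psi> x = b *\<^sub>R mean_curv_vec \<psi> x" for x by (rule exI[of _ 1]) simp
    moreover have "U \<noteq> {}" "U \<subseteq> V" using True by (auto simp: U_def)
    ultimately show thesis using that by blast
  next
    case False
    obtain U \<xi> where U: "open U" "x0 \<in> U" "U \<subseteq> V" "null_normal_field U \<psi> \<xi>"
      using exists_null_normal_field[OF V C1 ip] by blast
    have "mean_curv_vec \<psi> x = 0 *\<^sub>R \<xi> x" if "x \<in> U" for x using False U(3) that by auto
    then show thesis using that[of U \<xi>] U by blast
  qed
  have spW: "spacelike W \<psi>" using sp W(3) unfolding spacelike_def by blast
  note A = W(1) Ck_on_subset[OF C5 W(3)] spW W(4)
  define N where "N = (\<lambda>x. card (null_eigenvalues \<psi> \<xi> x))"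
  have Nle: "N x \<le> CARD('n)" if x: "x \<in> W" for x
  proof -
    obtain f d where f: "eigenframe (ind_metric \<psi> x) (unit_shape \<psi> \<xi> x) f d" using unit_shape_eigenframe[OF A x] by blast
    show ?thesis unfolding N_def card_null_eigenvalues(1)[OF A x f] by (rule card_image_le) simp
  qed
  obtain w where w: "w \<in> W" using W(2) by blast
  have "\<exists>y. y \<in> W \<and> (\<forall>z. z \<in> W \<longrightarrow> N z \<le> N y)"
    using ex_has_greatest_nat[of "\<lambda>x. x \<in> W" w N "Suc CARD('n)"] w Nle less_Suc_eq_le by blast
  then obtain y where y: "y \<in> W" "\<And>z. z \<in> W \<Longrightarrow> N z \<le> N y" by blast
  obtain f0 d0 where f0: "eigenframe (ind_metric \<psi> y) (unit_shape \<psi> \<xi> y) f0 d0" using unit_shape_eigenframe[OF A y(1)] by blast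
  have "\<forall>\<^sub>F z in nhds y. z \<in> W" by (rule eventually_nhds_in_open[OF W(1) y(1)])
  with unit_shape_clusters[OF A y(1) f0] have "\<forall>\<^sub>F z in nhds y. z \<in> W \<and> N z = N y"
  proof eventually_elim
    case (elim z)
    obtain f d where f: "eigenframe (ind_metric \<psi> z) (unit_shape \<psi> \<xi> z) f d" using unit_shape_eigenframe[OF A elim(2)] by blast
    have "card (range d0) \<le> card (range d)" using elim(1) f by blast
    then have "N y \<le> N z"
      unfolding N_def card_null_eigenvalues(1)[OF A y(1) f0] card_null_eigenvalues(1)[OF A elim(2) f] .
    then show ?case using y(2)[OF elim(2)] elim(2) by simp
  qed
  then obtain U where U: "open U" "y \<in> U" "\<And>z. z \<in> U \<Longrightarrow> z \<in> W \<and> N z = N y"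
    unfolding eventually_nhds by blast
  have UW: "U \<subseteq> W" using U(3) by blast
  have "trapping_field U \<psi> \<xi>"
    unfolding trapping_field_def
  proof (intro conjI)
    show "null_normal_field U \<psi> \<xi>" using W(4) UW continuous_on_subset unfolding null_normal_field_def by blast
    show "\<forall>x\<in>U. \<exists>b. mean_curv_vec \<psi> x = b *\<^sub>R \<xi> x" using W(5) UW by blast
    show "\<exists>q. \<forall>x\<in>U. card (null_eigenvalues \<psi> \<xi> x) = q" using U(3) unfolding N_def by blast
  qed
  then have "regular_at V \<psi> y" unfolding regular_at_def using U(1,2) UW W(3) by blast
  then show ?thesis using y(1) W(3) by blast
qed

section \<open>Submanifolds given by an atlas\<close>

text \<open>A neighbourhood that makes a point regular does so for each of its points, hence \<open>R\<close> is
  open. It is dense because the existence of regular points applies to the chart image of any open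
  set.\<close>

theorem trapped_submanifold:
  fixes X :: "'m topology" and A :: "('m, 'n::finite) atlas" and \<psi> :: "'m \<Rightarrow> 'n mink"
  assumes M: "manifold 5 X A"
    and ch: "on_charts A (\<lambda>\<Omega> r. immersion 5 \<Omega> (\<psi> \<circ> r) \<and> spacelike \<Omega> (\<psi> \<circ> r) \<and>
          marginally_trapped \<Omega> (\<psi> \<circ> r) \<and> (\<forall>y\<in>\<Omega>. \<not> null_sff_at (\<psi> \<circ> r) y))"
  defines "R \<equiv> {x \<in> topspace X. in_chart_at A x (\<lambda>\<Omega> r. regular_at \<Omega> (\<psi> \<circ> r))}"
  shows "openin X R" "X closure_of R = topspace X"
    "\<forall>x\<in>R. locally_congruent_at X \<psi> x trapped_images_ext"
    "\<forall>x\<in>R. CARD('n) = 2 \<or> in_chart_at A x (\<lambda>\<Omega> r. nondegenerate_at \<Omega> (\<psi> \<circ> r)) \<longrightarrow>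
       locally_congruent_at X \<psi> x trapped_images"
proof -
  have C: "Ck_on 5 (\<psi> \<circ> inv_into U c) (c ` U)" "spacelike (c ` U) (\<psi> \<circ> inv_into U c)"
    "marginally_trapped (c ` U) (\<psi> \<circ> inv_into U c)" "\<And>y. y \<in> c ` U \<Longrightarrow> \<not> null_sff_at (\<psi> \<circ> inv_into U c) y"
    if "(U, c) \<in> A" for U c
    using ch that unfolding on_charts_def immersion_def by blast+
  have sub: "Ck_on 5 (\<psi> \<circ> inv_into U c) V" "spacelike V (\<psi> \<circ> inv_into U c)"
    if "(U, c) \<in> A" "V \<subseteq> c ` U" for U c V
    using Ck_on_subset[OF C(1)[OF that(1)] that(2)] C(2)[OF that(1)] that(2) unfolding spacelike_def by blast+
  have reg_open: "\<exists>T. openin X T \<and> inv_into U c y \<in> T \<and> T \<subseteq> R"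
    if Uc: "(U, c) \<in> A" and y: "regular_at (c ` U) (\<psi> \<circ> inv_into U c) y" for U c y
  proof -
    note ct = manifold_chart[OF M Uc]
    obtain V \<xi> where V: "open V" "y \<in> V" "V \<subseteq> c ` U" "trapping_field V (\<psi> \<circ> inv_into U c) \<xi>"
      using y unfolding regular_at_def by blast
    have "inv_into U c ` V \<subseteq> R"
    proof
      fix x assume "x \<in> inv_into U c ` V"
      then obtain z where z: "z \<in> V" "x = inv_into U c z" by blast
      have zU: "z \<in> c ` U" using z(1) V(3) by blast
      have xU: "x \<in> U" unfolding z(2) by (rule inv_into_into[OF zU])
      have "c x = z" unfolding z(2) by (rule f_inv_into_f[OF zU])
      then have "regular_at (c ` U) (\<psi> \<circ> inv_into U c) (c x)"
        unfolding regular_at_def using V z(1) by blast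
      then have "in_chart_at A x (\<lambda>\<Omega> r. regular_at \<Omega> (\<psi> \<circ> r))"
        unfolding in_chart_at_def using Uc xU by blast
      then show "x \<in> R" unfolding R_def using ct(2) xU by blast
    qed
    then show ?thesis using ct(4)[OF V(1,3)] V(2) by blast
  qed
  have R_chart: "\<exists>U c. (U, c) \<in> A \<and> x \<in> U \<and> regular_at (c ` U) (\<psi> \<circ> inv_into U c) (c x)" if "x \<in> R" for x
    using that unfolding R_def in_chart_at_def by blast
  show "openin X R"
  proof (subst openin_subopen, intro ballI)
    fix x assume "x \<in> R"
    then obtain U c where Uc: "(U, c) \<in> A" "x \<in> U" "regular_at (c ` U) (\<psi> \<circ> inv_into U c) (c x)" using R_chart by blast
    show "\<exists>T. openin X T \<and> x \<in> T \<and> T \<subseteq> R"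
      using reg_open[OF Uc(1,3)] manifold_chart(3)[OF M Uc(1,2)] by simp
  qed
  show "X closure_of R = topspace X"
  proof
    show "X closure_of R \<subseteq> topspace X" by (rule closure_of_subset_topspace)
    show "topspace X \<subseteq> X closure_of R"
    proof
      fix x assume x: "x \<in> topspace X"
      have "\<exists>y. y \<in> R \<and> y \<in> T" if T: "x \<in> T" "openin X T" for T
      proof -
        obtain U c where Uc: "(U, c) \<in> A" "x \<in> U" using manifold_chart_exists[OF M x] by blast
        have hom: "homeomorphic_map (subtopology X U) (top_of_set (c ` U)) c" "openin X U" "open (c ` U)"
          using M Uc(1) unfolding manifold_def by auto
        have ts: "topspace (subtopology X U) = U" using openin_subset[OF hom(2)] by (simp add: topspace_subtopology Int_absorb1)
        have "openin (subtopology X U) (U \<inter> T)" using T(2) by (auto simp: openin_subtopology)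
        then have "openin (top_of_set (c ` U)) (c ` (U \<inter> T))"
          using homeomorphic_map_openness_eq[OF hom(1), of "U \<inter> T"] by blast
        then have V: "open (c ` (U \<inter> T))" using openin_open_trans[OF _ hom(3)] by blast
        have Vs: "c ` (U \<inter> T) \<subseteq> c ` U" by blast
        have "c x \<in> c ` (U \<inter> T)" using Uc(2) T(1) by blast
        moreover have "marginally_trapped (c ` (U \<inter> T)) (\<psi> \<circ> inv_into U c)"
          using C(3)[OF Uc(1)] Vs unfolding marginally_trapped_def nondegenerate_metric_def by blast
        ultimately obtain y where y: "y \<in> c ` (U \<inter> T)" "regular_at (c ` (U \<inter> T)) (\<psi> \<circ> inv_into U c) y"
          using regular_points_dense[OF V _ sub[OF Uc(1) Vs]] by blast
        have "regular_at (c ` U) (\<psi> \<circ> inv_into U c) y"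
          using y(2) Vs unfolding regular_at_def by (meson subset_trans)
        then have "inv_into U c y \<in> R" using reg_open[OF Uc(1)] by blast
        moreover have "inv_into U c y \<in> T"
        proof -
          obtain z where z: "z \<in> U" "z \<in> T" "y = c z" using y(1) by blast
          then show ?thesis using manifold_chart(3)[OF M Uc(1) z(1)] by simp
        qed
        ultimately show ?thesis by blast
      qed
      then show "x \<in> X closure_of R" using x by (simp add: in_closure_of)
    qed
  qed
  show "\<forall>x\<in>R. locally_congruent_at X \<psi> x trapped_images_ext"
  proof
    fix x assume "x \<in> R"
    then obtain U c where Uc: "(U, c) \<in> A" "x \<in> U" "regular_at (c ` U) (\<psi> \<circ> inv_into U c) (c x)" using R_chart by blast
    obtain V \<xi> where V: "open V" "c x \<in> V" "V \<subseteq> c ` U" "trapping_field V (\<psi> \<circ> inv_into U c) \<xi>"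
      using Uc(3) unfolding regular_at_def by blast
    have nn: "\<not> null_sff_at (\<psi> \<circ> inv_into U c) (c x)" using C(4)[OF Uc(1)] Uc(2) by blast
    obtain W F where "open W" "c x \<in> W" "W \<subseteq> V" "mink_isometry F" "F ` (\<psi> \<circ> inv_into U c) ` W \<in> trapped_images_ext"
      using regular_trapped_ext[OF V(1) sub[OF Uc(1) V(3)] V(4,2) nn] by blast
    then show "locally_congruent_at X \<psi> x trapped_images_ext"
      using V(3) by (intro locally_congruent_chart[OF M Uc(1,2)]) blast
  qed
  have nondeg: "locally_congruent_at X \<psi> x trapped_images"
    if Uc: "(U, c) \<in> A" "x \<in> U" and V: "open V" "c x \<in> V" "V \<subseteq> c ` U" "trapping_field V (\<psi> \<circ> inv_into U c) \<xi>"
      and nd: "0 \<notin> null_eigenvalues (\<psi> \<circ> inv_into U c) \<xi> (c x)" for x U c V \<xi>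
  proof -
    have nn: "\<not> null_sff_at (\<psi> \<circ> inv_into U c) (c x)" using C(4)[OF Uc(1)] Uc(2) by blast
    obtain W F where "open W" "c x \<in> W" "W \<subseteq> V" "mink_isometry F" "F ` (\<psi> \<circ> inv_into U c) ` W \<in> trapped_images"
      using nondegenerate_trapped[OF V(1) sub[OF Uc(1) V(3)] V(4,2) nn nd] by blast
    then show ?thesis using V(3) by (intro locally_congruent_chart[OF M Uc]) blast
  qed
  show "\<forall>x\<in>R. CARD('n) = 2 \<or> in_chart_at A x (\<lambda>\<Omega> r. nondegenerate_at \<Omega> (\<psi> \<circ> r)) \<longrightarrow>
       locally_congruent_at X \<psi> x trapped_images"
  proof (intro ballI impI)
    fix x assume x: "x \<in> R" and "CARD('n) = 2 \<or> in_chart_at A x (\<lambda>\<Omega> r. nondegenerate_at \<Omega> (\<psi> \<circ> r))"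
    then consider "CARD('n) = 2" | "in_chart_at A x (\<lambda>\<Omega> r. nondegenerate_at \<Omega> (\<psi> \<circ> r))" by blast
    then show "locally_congruent_at X \<psi> x trapped_images"
    proof cases
      case 1
      obtain U c where Uc: "(U, c) \<in> A" "x \<in> U" "regular_at (c ` U) (\<psi> \<circ> inv_into U c) (c x)" using R_chart[OF x] by blast
      obtain V \<xi> where V: "open V" "c x \<in> V" "V \<subseteq> c ` U" "trapping_field V (\<psi> \<circ> inv_into U c) \<xi>"
        using Uc(3) unfolding regular_at_def by blast
      have nn: "\<not> null_sff_at (\<psi> \<circ> inv_into U c) (c x)" using C(4)[OF Uc(1)] Uc(2) by blast
      show ?thesis
        by (rule nondeg[OF Uc(1,2) V surface_nondegenerate[OF 1 V(1) sub[OF Uc(1) V(3)] V(4,2) nn]])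
    next
      case 2
      then obtain U c where Uc: "(U, c) \<in> A" "x \<in> U" "nondegenerate_at (c ` U) (\<psi> \<circ> inv_into U c) (c x)"
        unfolding in_chart_at_def by blast
      then obtain V \<xi> where "open V" "c x \<in> V" "V \<subseteq> c ` U" "trapping_field V (\<psi> \<circ> inv_into U c) \<xi>"
        "0 \<notin> null_eigenvalues (\<psi> \<circ> inv_into U c) \<xi> (c x)"
        unfolding nondegenerate_at_def by blast
      then show ?thesis by (rule nondeg[OF Uc(1,2)])
    qed
  qed
qed

theorem lift_submanifold:
  fixes X :: "'m topology" and A :: "('m, 'n::finite) atlas" and \<phi> :: "'m \<Rightarrow> (real ^ 'n) \<times> real"
  assumes M: "manifold 4 X A" and p: "2 \<le> p"
    and ch: "on_charts A (\<lambda>\<Omega> r. immersion 4 \<Omega> (\<phi> \<circ> r) \<and> gauss_map \<Omega> (\<phi> \<circ> r) (\<nu> \<circ> r) \<and>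
          has_principal_curvatures \<Omega> (\<phi> \<circ> r) (\<nu> \<circ> r) p (\<lambda>i. \<kappa> i \<circ> r) m)"
    and \<kappa>0: "\<And>i x. i \<in> {1..p} \<Longrightarrow> x \<in> topspace X \<Longrightarrow> \<kappa> i x \<noteq> 0"
  shows "\<forall>x\<in>topspace X. card {t. poly (curv_poly p (\<lambda>i. \<kappa> i x) m) t = 0} = p - 1"
    "root_functions (topspace X) p \<kappa> m \<tau> \<Longrightarrow> i \<in> {1..p - 1} \<Longrightarrow> on_charts A (\<lambda>\<Omega> r.
             immersion 2 \<Omega> (lift \<phi> \<nu> (\<tau> i) \<circ> r) \<and> spacelike \<Omega> (lift \<phi> \<nu> (\<tau> i) \<circ> r) \<and>
             marginally_trapped \<Omega> (lift \<phi> \<nu> (\<tau> i) \<circ> r))"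
proof -
  have H: "open (c ` U)" "immersion 4 (c ` U) (\<phi> \<circ> inv_into U c)" "gauss_map (c ` U) (\<phi> \<circ> inv_into U c) (\<nu> \<circ> inv_into U c)"
    "has_principal_curvatures (c ` U) (\<phi> \<circ> inv_into U c) (\<nu> \<circ> inv_into U c) p (\<lambda>i. \<kappa> i \<circ> inv_into U c) m"
    if "(U, c) \<in> A" for U c
    using manifold_chart(1)[OF M that] ch that unfolding on_charts_def by blast+
  have inX: "inv_into U c y \<in> topspace X" if "(U, c) \<in> A" "y \<in> c ` U" for U c y
    using manifold_chart(2)[OF M that(1)] inv_into_into[OF that(2)] by blast
  have k: "(\<kappa> i \<circ> inv_into U c) y \<noteq> 0" if "(U, c) \<in> A" "i \<in> {1..p}" "y \<in> c ` U" for U c i y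
    using \<kappa>0[OF that(2) inX[OF that(1,3)]] by simp
  show "\<forall>x\<in>topspace X. card {t. poly (curv_poly p (\<lambda>i. \<kappa> i x) m) t = 0} = p - 1"
  proof
    fix x assume x: "x \<in> topspace X"
    obtain U c where Uc: "(U, c) \<in> A" "x \<in> U" using manifold_chart_exists[OF M x] by blast
    have "c x \<in> c ` U" using Uc(2) by blast
    from card_radius_roots[OF H(1,2,3)[OF Uc(1)] p H(4)[OF Uc(1)] k[OF Uc(1)] this]
    show "card {t. poly (curv_poly p (\<lambda>i. \<kappa> i x) m) t = 0} = p - 1"
      using manifold_chart(3)[OF M Uc] by simp
  qed
  assume rf: "root_functions (topspace X) p \<kappa> m \<tau>" and i: "i \<in> {1..p - 1}"
  show "on_charts A (\<lambda>\<Omega> r. immersion 2 \<Omega> (lift \<phi> \<nu> (\<tau> i) \<circ> r) \<and> spacelike \<Omega> (lift \<phi> \<nu> (\<tau> i) \<circ> r) \<and>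
             marginally_trapped \<Omega> (lift \<phi> \<nu> (\<tau> i) \<circ> r))"
    unfolding on_charts_def
  proof clarify
    fix U c assume Uc: "(U, c) \<in> A"
    have rf': "root_functions (c ` U) p (\<lambda>i. \<kappa> i \<circ> inv_into U c) m (\<lambda>i. \<tau> i \<circ> inv_into U c)"
      unfolding root_functions_def o_def
    proof
      fix y assume "y \<in> c ` U"
      then have "inv_into U c y \<in> topspace X" by (rule inX[OF Uc])
      then show "strict_mono_on {1..p - 1} (\<lambda>i. \<tau> i (inv_into U c y)) \<and>
         (\<lambda>i. \<tau> i (inv_into U c y)) ` {1..p - 1} = {t. poly (curv_poly p (\<lambda>i. \<kappa> i (inv_into U c y)) m) t = 0}"
        using rf unfolding root_functions_def by blast
    qed
    show "immersion 2 (c ` U) (lift \<phi> \<nu> (\<tau> i) \<circ> inv_into U c) \<and> spacelike (c ` U) (lift \<phi> \<nu> (\<tau> i) \<circ> inv_into U c) \<and>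
             marginally_trapped (c ` U) (lift \<phi> \<nu> (\<tau> i) \<circ> inv_into U c)"
      unfolding lift_comp by (rule root_lift_trapped[OF H(1,2,3)[OF Uc] p H(4)[OF Uc] k[OF Uc] rf' i])
  qed
qed

theorem lift_surface:
  fixes X :: "'m topology" and A :: "('m, 'n::finite) atlas" and \<phi> :: "'m \<Rightarrow> (real ^ 'n) \<times> real"
  assumes n2: "CARD('n) = 2" and M: "manifold 4 X A"
    and ch: "on_charts A (\<lambda>\<Omega> r. immersion 4 \<Omega> (\<phi> \<circ> r) \<and> gauss_map \<Omega> (\<phi> \<circ> r) (\<nu> \<circ> r) \<and>
          (\<forall>y\<in>\<Omega>. principal_curvatures (\<phi> \<circ> r) (\<nu> \<circ> r) y = {k1 (r y), k2 (r y)} \<and>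
                  \<not> umbilic (\<phi> \<circ> r) (\<nu> \<circ> r) y))"
    and HK: "\<forall>x\<in>topspace X. H x = (k1 x + k2 x) / 2 \<and> K x = k1 x * k2 x \<and> K x \<noteq> 0"
  shows "on_charts A (\<lambda>\<Omega> r. immersion 2 \<Omega> (lift \<phi> \<nu> (\<lambda>x. H x / K x) \<circ> r) \<and>
          spacelike \<Omega> (lift \<phi> \<nu> (\<lambda>x. H x / K x) \<circ> r) \<and> marginally_trapped \<Omega> (lift \<phi> \<nu> (\<lambda>x. H x / K x) \<circ> r))"
    "(\<exists>c. lift \<phi> \<nu> (\<lambda>x. H x / K x) ` topspace X \<subseteq> time_slice c) \<longleftrightarrow> (\<exists>c. \<forall>x\<in>topspace X. H x / K x = c)"
    "on_charts A (\<lambda>\<Omega> r. immersion 2 \<Omega> (lift \<phi> \<nu> (\<lambda>_. c) \<circ> r)) \<Longrightarrow>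
       on_charts A (\<lambda>\<Omega> r. marginally_trapped \<Omega> (lift \<phi> \<nu> (\<lambda>_. c) \<circ> r)) \<longleftrightarrow> (\<forall>x\<in>topspace X. H x / K x = c)"
proof -
  have C: "open (d ` U)" "immersion 4 (d ` U) (\<phi> \<circ> inv_into U d)" "gauss_map (d ` U) (\<phi> \<circ> inv_into U d) (\<nu> \<circ> inv_into U d)"
    "\<And>y. y \<in> d ` U \<Longrightarrow> principal_curvatures (\<phi> \<circ> inv_into U d) (\<nu> \<circ> inv_into U d) y = {(k1 \<circ> inv_into U d) y, (k2 \<circ> inv_into U d) y}"
    "\<And>y. y \<in> d ` U \<Longrightarrow> \<not> umbilic (\<phi> \<circ> inv_into U d) (\<nu> \<circ> inv_into U d) y"
    if "(U, d) \<in> A" for U d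
    using manifold_chart(1)[OF M that] ch that unfolding on_charts_def o_def by blast+
  have inX: "inv_into U d y \<in> topspace X" if "(U, d) \<in> A" "y \<in> d ` U" for U d y
    using manifold_chart(2)[OF M that(1)] inv_into_into[OF that(2)] by blast
  have hk: "(H \<circ> inv_into U d) y = ((k1 \<circ> inv_into U d) y + (k2 \<circ> inv_into U d) y) / 2 \<and>
      (K \<circ> inv_into U d) y = (k1 \<circ> inv_into U d) y * (k2 \<circ> inv_into U d) y \<and> (K \<circ> inv_into U d) y \<noteq> 0"
    if "(U, d) \<in> A" "y \<in> d ` U" for U d y
    unfolding o_apply using bspec[OF HK inX[OF that]] .
  show "on_charts A (\<lambda>\<Omega> r. immersion 2 \<Omega> (lift \<phi> \<nu> (\<lambda>x. H x / K x) \<circ> r) \<and>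
          spacelike \<Omega> (lift \<phi> \<nu> (\<lambda>x. H x / K x) \<circ> r) \<and> marginally_trapped \<Omega> (lift \<phi> \<nu> (\<lambda>x. H x / K x) \<circ> r))"
    unfolding on_charts_def
  proof clarify
    fix U d assume Ud: "(U, d) \<in> A"
    have e: "(\<lambda>x. H x / K x) \<circ> inv_into U d = (\<lambda>y. (H \<circ> inv_into U d) y / (K \<circ> inv_into U d) y)" by auto
    show "immersion 2 (d ` U) (lift \<phi> \<nu> (\<lambda>x. H x / K x) \<circ> inv_into U d) \<and>
          spacelike (d ` U) (lift \<phi> \<nu> (\<lambda>x. H x / K x) \<circ> inv_into U d) \<and>
          marginally_trapped (d ` U) (lift \<phi> \<nu> (\<lambda>x. H x / K x) \<circ> inv_into U d)"
      unfolding lift_comp e by (rule surface_lift_trapped[OF C(1,2,3)[OF Ud] n2 C(4,5)[OF Ud] hk[OF Ud]])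
  qed
  show "(\<exists>c. lift \<phi> \<nu> (\<lambda>x. H x / K x) ` topspace X \<subseteq> time_slice c) \<longleftrightarrow> (\<exists>c. \<forall>x\<in>topspace X. H x / K x = c)"
  proof -
    have "lift \<phi> \<nu> (\<lambda>x. H x / K x) ` topspace X \<subseteq> time_slice c \<longleftrightarrow> (\<forall>x\<in>topspace X. H x / K x = c)" for c
      unfolding image_subset_iff lift_def time_slice_def mem_Collect_eq snd_conv ..
    then show ?thesis by blast
  qed
  assume im: "on_charts A (\<lambda>\<Omega> r. immersion 2 \<Omega> (lift \<phi> \<nu> (\<lambda>_. c) \<circ> r))"
  have e: "(\<lambda>_. c) \<circ> r = (\<lambda>_. c)" for r :: "real ^ 'n \<Rightarrow> 'm" by auto
  have iff: "marginally_trapped (d ` U) (lift \<phi> \<nu> (\<lambda>_. c) \<circ> inv_into U d) \<longleftrightarrow>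
      (\<forall>y\<in>d ` U. (H \<circ> inv_into U d) y / (K \<circ> inv_into U d) y = c)" if Ud: "(U, d) \<in> A" for U d
  proof -
    have "immersion 2 (d ` U) (lift (\<phi> \<circ> inv_into U d) (\<nu> \<circ> inv_into U d) (\<lambda>_. c))"
      using im Ud unfolding on_charts_def lift_comp e by blast
    from surface_parallel_trapped_iff[OF C(1,2,3)[OF Ud] n2 C(4,5)[OF Ud] hk[OF Ud] this]
    show ?thesis unfolding lift_comp e .
  qed
  show "on_charts A (\<lambda>\<Omega> r. marginally_trapped \<Omega> (lift \<phi> \<nu> (\<lambda>_. c) \<circ> r)) \<longleftrightarrow> (\<forall>x\<in>topspace X. H x / K x = c)"
  proof
    assume mt: "on_charts A (\<lambda>\<Omega> r. marginally_trapped \<Omega> (lift \<phi> \<nu> (\<lambda>_. c) \<circ> r))"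
    show "\<forall>x\<in>topspace X. H x / K x = c"
    proof
      fix x assume x: "x \<in> topspace X"
      obtain U d where Ud: "(U, d) \<in> A" "x \<in> U" using manifold_chart_exists[OF M x] by blast
      have "marginally_trapped (d ` U) (lift \<phi> \<nu> (\<lambda>_. c) \<circ> inv_into U d)"
        using mt Ud(1) unfolding on_charts_def by blast
      then have "(H \<circ> inv_into U d) (d x) / (K \<circ> inv_into U d) (d x) = c" using iff[OF Ud(1)] Ud(2) by blast
      then show "H x / K x = c" using manifold_chart(3)[OF M Ud] by simp
    qed
  next
    assume a: "\<forall>x\<in>topspace X. H x / K x = c"
    show "on_charts A (\<lambda>\<Omega> r. marginally_trapped \<Omega> (lift \<phi> \<nu> (\<lambda>_. c) \<circ> r))"
      unfolding on_charts_def
    proof clarify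
      fix U d assume Ud: "(U, d) \<in> A"
      show "marginally_trapped (d ` U) (lift \<phi> \<nu> (\<lambda>_. c) \<circ> inv_into U d)"
        unfolding iff[OF Ud] using a inX[OF Ud] by simp
    qed
  qed
qed

theorem theorem1:
  fixes X :: "'m topology" and A :: "('m, 'n::finite) atlas"
  shows
    "(\<forall>\<Omega> (\<tau> :: real ^ 'n \<Rightarrow> real). open \<Omega> \<and> Ck_on 2 \<tau> \<Omega> \<longrightarrow>
        immersion 2 \<Omega> (null_graph \<tau>) \<and> spacelike \<Omega> (null_graph \<tau>) \<and>
        flat \<Omega> (null_graph \<tau>) \<and>
        (\<forall>x\<in>\<Omega>. \<forall>u v. sff (null_graph \<tau>) x u v = Hess \<tau> x u v *\<^sub>R (normal0, 1)) \<and>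
        null_sff \<Omega> (null_graph \<tau>) \<and>
        marginally_trapped \<Omega> (null_graph \<tau>))
   \<and> (\<forall>\<psi> :: 'm \<Rightarrow> 'n mink.
        manifold 2 X A \<and>
        on_charts A (\<lambda>\<Omega> r. immersion 2 \<Omega> (\<psi> \<circ> r) \<and> spacelike \<Omega> (\<psi> \<circ> r) \<and> null_sff \<Omega> (\<psi> \<circ> r)) \<longrightarrow>
        (\<forall>x\<in>topspace X. locally_congruent_at X \<psi> x null_graph_images))
   \<and>
     (\<forall>(\<phi> :: 'm \<Rightarrow> (real ^ 'n) \<times> real) \<nu> p \<kappa> m.
        manifold 4 X A \<and> 2 \<le> p \<and>
        on_charts A (\<lambda>\<Omega> r. immersion 4 \<Omega> (\<phi> \<circ> r) \<and> gauss_map \<Omega> (\<phi> \<circ> r) (\<nu> \<circ> r) \<and>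
          has_principal_curvatures \<Omega> (\<phi> \<circ> r) (\<nu> \<circ> r) p (\<lambda>i. \<kappa> i \<circ> r) m) \<and>
        (\<forall>i\<in>{1..p}. \<forall>x\<in>topspace X. \<kappa> i x \<noteq> 0) \<longrightarrow>
        (\<forall>x\<in>topspace X. card {t. poly (curv_poly p (\<lambda>i. \<kappa> i x) m) t = 0} = p - 1) \<and>
        (\<forall>\<tau>. root_functions (topspace X) p \<kappa> m \<tau> \<longrightarrow>
          (\<forall>i\<in>{1..p - 1}. on_charts A (\<lambda>\<Omega> r.
             immersion 2 \<Omega> (lift \<phi> \<nu> (\<tau> i) \<circ> r) \<and> spacelike \<Omega> (lift \<phi> \<nu> (\<tau> i) \<circ> r) \<and>
             marginally_trapped \<Omega> (lift \<phi> \<nu> (\<tau> i) \<circ> r)))))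
   \<and> (\<forall>\<psi> :: 'm \<Rightarrow> 'n mink.
        manifold 5 X A \<and>
        on_charts A (\<lambda>\<Omega> r. immersion 5 \<Omega> (\<psi> \<circ> r) \<and> spacelike \<Omega> (\<psi> \<circ> r) \<and>
          marginally_trapped \<Omega> (\<psi> \<circ> r) \<and> (\<forall>y\<in>\<Omega>. \<not> null_sff_at (\<psi> \<circ> r) y)) \<longrightarrow>
        (let R = {x \<in> topspace X. in_chart_at A x (\<lambda>\<Omega> r. regular_at \<Omega> (\<psi> \<circ> r))} in
          openin X R \<and> X closure_of R = topspace X \<and>
          (\<forall>x\<in>R. locally_congruent_at X \<psi> x trapped_images_ext) \<and>
          (\<forall>x\<in>R. CARD('n) = 2 \<or> in_chart_at A x (\<lambda>\<Omega> r. nondegenerate_at \<Omega> (\<psi> \<circ> r)) \<longrightarrow>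
             locally_congruent_at X \<psi> x trapped_images)))
   \<and>
     (\<forall>(\<phi> :: 'm \<Rightarrow> (real ^ 'n) \<times> real) \<nu> \<kappa>\<^sub>1 \<kappa>\<^sub>2 H K.
        CARD('n) = 2 \<and> manifold 4 X A \<and>
        on_charts A (\<lambda>\<Omega> r. immersion 4 \<Omega> (\<phi> \<circ> r) \<and> gauss_map \<Omega> (\<phi> \<circ> r) (\<nu> \<circ> r) \<and>
          (\<forall>y\<in>\<Omega>. principal_curvatures (\<phi> \<circ> r) (\<nu> \<circ> r) y = {\<kappa>\<^sub>1 (r y), \<kappa>\<^sub>2 (r y)} \<and>
                  \<not> umbilic (\<phi> \<circ> r) (\<nu> \<circ> r) y)) \<and>
        (\<forall>x\<in>topspace X. H x = (\<kappa>\<^sub>1 x + \<kappa>\<^sub>2 x) / 2 \<and> K x = \<kappa>\<^sub>1 x * \<kappa>\<^sub>2 x \<and> K x \<noteq> 0) \<longrightarrow>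
        on_charts A (\<lambda>\<Omega> r.
          immersion 2 \<Omega> (lift \<phi> \<nu> (\<lambda>x. H x / K x) \<circ> r) \<and>
          spacelike \<Omega> (lift \<phi> \<nu> (\<lambda>x. H x / K x) \<circ> r) \<and>
          marginally_trapped \<Omega> (lift \<phi> \<nu> (\<lambda>x. H x / K x) \<circ> r)) \<and>
        ((\<exists>c. lift \<phi> \<nu> (\<lambda>x. H x / K x) ` topspace X \<subseteq> time_slice c) \<longleftrightarrow>
           (\<exists>c. \<forall>x\<in>topspace X. H x / K x = c)) \<and>
        (\<forall>c. on_charts A (\<lambda>\<Omega> r. immersion 2 \<Omega> (lift \<phi> \<nu> (\<lambda>_. c) \<circ> r)) \<longrightarrow>
           (on_charts A (\<lambda>\<Omega> r. marginally_trapped \<Omega> (lift \<phi> \<nu> (\<lambda>_. c) \<circ> r)) \<longleftrightarrow>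
              (\<forall>x\<in>topspace X. H x / K x = c))))"
proof (intro conjI)
  show "\<forall>\<Omega> (\<tau> :: real ^ 'n \<Rightarrow> real). open \<Omega> \<and> Ck_on 2 \<tau> \<Omega> \<longrightarrow>
        immersion 2 \<Omega> (null_graph \<tau>) \<and> spacelike \<Omega> (null_graph \<tau>) \<and> flat \<Omega> (null_graph \<tau>) \<and>
        (\<forall>x\<in>\<Omega>. \<forall>u v. sff (null_graph \<tau>) x u v = Hess \<tau> x u v *\<^sub>R (normal0, 1)) \<and>
        null_sff \<Omega> (null_graph \<tau>) \<and> marginally_trapped \<Omega> (null_graph \<tau>)"
    by (intro allI impI conjI ballI; elim conjE; rule null_graph_properties; assumption)
next
  show "\<forall>\<psi> :: 'm \<Rightarrow> 'n mink. manifold 2 X A \<and>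
        on_charts A (\<lambda>\<Omega> r. immersion 2 \<Omega> (\<psi> \<circ> r) \<and> spacelike \<Omega> (\<psi> \<circ> r) \<and> null_sff \<Omega> (\<psi> \<circ> r)) \<longrightarrow>
        (\<forall>x\<in>topspace X. locally_congruent_at X \<psi> x null_graph_images)"
    by (intro allI impI ballI; elim conjE; rule null_sff_locally_congruent; assumption)
next
  show "\<forall>(\<phi> :: 'm \<Rightarrow> (real ^ 'n) \<times> real) \<nu> p \<kappa> m.
        manifold 4 X A \<and> 2 \<le> p \<and>
        on_charts A (\<lambda>\<Omega> r. immersion 4 \<Omega> (\<phi> \<circ> r) \<and> gauss_map \<Omega> (\<phi> \<circ> r) (\<nu> \<circ> r) \<and>
          has_principal_curvatures \<Omega> (\<phi> \<circ> r) (\<nu> \<circ> r) p (\<lambda>i. \<kappa> i \<circ> r) m) \<and>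
        (\<forall>i\<in>{1..p}. \<forall>x\<in>topspace X. \<kappa> i x \<noteq> 0) \<longrightarrow>
        (\<forall>x\<in>topspace X. card {t. poly (curv_poly p (\<lambda>i. \<kappa> i x) m) t = 0} = p - 1) \<and>
        (\<forall>\<tau>. root_functions (topspace X) p \<kappa> m \<tau> \<longrightarrow>
          (\<forall>i\<in>{1..p - 1}. on_charts A (\<lambda>\<Omega> r.
             immersion 2 \<Omega> (lift \<phi> \<nu> (\<tau> i) \<circ> r) \<and> spacelike \<Omega> (lift \<phi> \<nu> (\<tau> i) \<circ> r) \<and>
             marginally_trapped \<Omega> (lift \<phi> \<nu> (\<tau> i) \<circ> r))))"
  proof (intro allI impI, elim conjE)
    fix \<phi> :: "'m \<Rightarrow> (real ^ 'n) \<times> real" and \<nu> p \<kappa> m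
    assume M: "manifold 4 X A" "2 \<le> p"
      "on_charts A (\<lambda>\<Omega> r. immersion 4 \<Omega> (\<phi> \<circ> r) \<and> gauss_map \<Omega> (\<phi> \<circ> r) (\<nu> \<circ> r) \<and>
          has_principal_curvatures \<Omega> (\<phi> \<circ> r) (\<nu> \<circ> r) p (\<lambda>i. \<kappa> i \<circ> r) m)"
      and "\<forall>i\<in>{1..p}. \<forall>x\<in>topspace X. \<kappa> i x \<noteq> 0"
    then have k: "\<And>i x. i \<in> {1..p} \<Longrightarrow> x \<in> topspace X \<Longrightarrow> \<kappa> i x \<noteq> 0" by blast
    show "(\<forall>x\<in>topspace X. card {t. poly (curv_poly p (\<lambda>i. \<kappa> i x) m) t = 0} = p - 1) \<and>
        (\<forall>\<tau>. root_functions (topspace X) p \<kappa> m \<tau> \<longrightarrow>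
          (\<forall>i\<in>{1..p - 1}. on_charts A (\<lambda>\<Omega> r.
             immersion 2 \<Omega> (lift \<phi> \<nu> (\<tau> i) \<circ> r) \<and> spacelike \<Omega> (lift \<phi> \<nu> (\<tau> i) \<circ> r) \<and>
             marginally_trapped \<Omega> (lift \<phi> \<nu> (\<tau> i) \<circ> r))))"
    proof (intro conjI allI impI ballI)
      fix x assume "x \<in> topspace X"
      then show "card {t. poly (curv_poly p (\<lambda>i. \<kappa> i x) m) t = 0} = p - 1"
        using lift_submanifold(1)[OF M k] by blast
    next
      fix \<tau> i assume "root_functions (topspace X) p \<kappa> m \<tau>" "i \<in> {1..p - 1}"
      from lift_submanifold(2)[OF M k this]
      show "on_charts A (\<lambda>\<Omega> r. immersion 2 \<Omega> (lift \<phi> \<nu> (\<tau> i) \<circ> r) \<and> spacelike \<Omega> (lift \<phi> \<nu> (\<tau> i) \<circ> r) \<and>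
             marginally_trapped \<Omega> (lift \<phi> \<nu> (\<tau> i) \<circ> r))" .
    qed
  qed
next
  show "\<forall>\<psi> :: 'm \<Rightarrow> 'n mink.
        manifold 5 X A \<and>
        on_charts A (\<lambda>\<Omega> r. immersion 5 \<Omega> (\<psi> \<circ> r) \<and> spacelike \<Omega> (\<psi> \<circ> r) \<and>
          marginally_trapped \<Omega> (\<psi> \<circ> r) \<and> (\<forall>y\<in>\<Omega>. \<not> null_sff_at (\<psi> \<circ> r) y)) \<longrightarrow>
        (let R = {x \<in> topspace X. in_chart_at A x (\<lambda>\<Omega> r. regular_at \<Omega> (\<psi> \<circ> r))} in
          openin X R \<and> X closure_of R = topspace X \<and>
          (\<forall>x\<in>R. locally_congruent_at X \<psi> x trapped_images_ext) \<and>
          (\<forall>x\<in>R. CARD('n) = 2 \<or> in_chart_at A x (\<lambda>\<Omega> r. nondegenerate_at \<Omega> (\<psi> \<circ> r)) \<longrightarrow>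
             locally_congruent_at X \<psi> x trapped_images))"
    unfolding Let_def by (intro allI impI conjI; elim conjE; rule trapped_submanifold; assumption)
next
  show "\<forall>(\<phi> :: 'm \<Rightarrow> (real ^ 'n) \<times> real) \<nu> \<kappa>\<^sub>1 \<kappa>\<^sub>2 H K.
        CARD('n) = 2 \<and> manifold 4 X A \<and>
        on_charts A (\<lambda>\<Omega> r. immersion 4 \<Omega> (\<phi> \<circ> r) \<and> gauss_map \<Omega> (\<phi> \<circ> r) (\<nu> \<circ> r) \<and>
          (\<forall>y\<in>\<Omega>. principal_curvatures (\<phi> \<circ> r) (\<nu> \<circ> r) y = {\<kappa>\<^sub>1 (r y), \<kappa>\<^sub>2 (r y)} \<and>
                  \<not> umbilic (\<phi> \<circ> r) (\<nu> \<circ> r) y)) \<and>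
        (\<forall>x\<in>topspace X. H x = (\<kappa>\<^sub>1 x + \<kappa>\<^sub>2 x) / 2 \<and> K x = \<kappa>\<^sub>1 x * \<kappa>\<^sub>2 x \<and> K x \<noteq> 0) \<longrightarrow>
        on_charts A (\<lambda>\<Omega> r.
          immersion 2 \<Omega> (lift \<phi> \<nu> (\<lambda>x. H x / K x) \<circ> r) \<and>
          spacelike \<Omega> (lift \<phi> \<nu> (\<lambda>x. H x / K x) \<circ> r) \<and>
          marginally_trapped \<Omega> (lift \<phi> \<nu> (\<lambda>x. H x / K x) \<circ> r)) \<and>
        ((\<exists>c. lift \<phi> \<nu> (\<lambda>x. H x / K x) ` topspace X \<subseteq> time_slice c) \<longleftrightarrow>
           (\<exists>c. \<forall>x\<in>topspace X. H x / K x = c)) \<and>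
        (\<forall>c. on_charts A (\<lambda>\<Omega> r. immersion 2 \<Omega> (lift \<phi> \<nu> (\<lambda>_. c) \<circ> r)) \<longrightarrow>
           (on_charts A (\<lambda>\<Omega> r. marginally_trapped \<Omega> (lift \<phi> \<nu> (\<lambda>_. c) \<circ> r)) \<longleftrightarrow>
              (\<forall>x\<in>topspace X. H x / K x = c)))"
    by (intro allI impI, elim conjE, intro conjI allI impI; rule lift_surface; assumption)
qed

end
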